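(* For $P_d$-Matching with $d$ being part of the input, there is a computable function $f$ such that (1) one can compute, in time $n^{O(1)}$, a kernel of size $f(d)\cdot k^{O(1)}$, and (2) one can compute, in time $f(d)\cdot n^{O(1)}$, a kernel of size $k^{O(1)}$. Here the constants in the $O(1)$ exponents do not depend on $d$.
   Context: $P_d$ denotes the simple path with $d$ edges. $P_d$-Matching (with $d$ part of the input): given a graph $G$ on $n$ vertices and integers $d$ and $k$, decide whether $G$ contains $k$ pairwise vertex-disjoint subgraphs each isomorphic to $P_d$; $k$ is the parameter. A kernel is an algorithm mapping an instance to an equivalent instance of the same problem (yes iff yes) whose size is bounded as stated. *)

theory Defs
  imports Main
begin

section \<open>Graphs and path matchings\<close>

type_synonym 'a ugraph = "'a set \<times> 'a set set"

definition simple_graph :: "'a ugraph \<Rightarrow> bool" where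
  "simple_graph G \<longleftrightarrow> finite (fst G) \<and> (\<forall>e \<in> snd G. e \<subseteq> fst G \<and> card e = 2)"

definition is_subgraph :: "'a ugraph \<Rightarrow> 'a ugraph \<Rightarrow> bool" where
  "is_subgraph H G \<longleftrightarrow> simple_graph H \<and> fst H \<subseteq> fst G \<and> snd H \<subseteq> snd G"

definition isomorphic :: "'a ugraph \<Rightarrow> 'b ugraph \<Rightarrow> bool" where
  "isomorphic G H \<longleftrightarrow> (\<exists>\<phi>. bij_betw \<phi> (fst G) (fst H) \<and> snd H = (\<lambda>e. \<phi> ` e) ` snd G)"

text \<open>\<open>path_graph d\<close> has \<open>d\<close> edges, hence \<open>d + 1\<close> vertices.\<close>

definition path_graph :: "nat \<Rightarrow> nat ugraph" where
  "path_graph d = ({0..d}, {{i, Suc i} | i. i < d})"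

definition has_path_matching :: "'a ugraph \<Rightarrow> nat \<Rightarrow> nat \<Rightarrow> bool" where
  "has_path_matching G d k \<longleftrightarrow>
     (\<exists>H :: nat \<Rightarrow> 'a ugraph.
        (\<forall>i<k. is_subgraph (H i) G \<and> isomorphic (H i) (path_graph d)) \<and>
        (\<forall>i<k. \<forall>j<k. i \<noteq> j \<longrightarrow> fst (H i) \<inter> fst (H j) = {}))"


section \<open>Machine model\<close>

text \<open>
  Structured programs over finitely many stacks of bits, where every push, pop and test of a
  top symbol takes one time unit. A stack is a one-ended tape and two stacks simulate a
  two-way tape with constant overhead, so computability and running time agree with those
  of multi-tape Turing machines up to constant factors (depending on the machine).

  A test asks whether the top of a stack lies in a given set, where \<open>None\<close> stands for the
  empty stack. Popping the empty stack has no effect.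
\<close>

datatype prog =
    Skip
  | Push nat bool
  | Pop nat
  | Seq prog prog
  | IfTop nat "bool option set" prog prog
  | WhileTop nat "bool option set" prog

type_synonym stacks = "nat \<Rightarrow> bool list"

fun top_of :: "bool list \<Rightarrow> bool option" where
  "top_of [] = None"
| "top_of (b # bs) = Some b"

text \<open>\<open>exec p s t s'\<close>: started on \<open>s\<close>, the program \<open>p\<close> halts in \<open>s'\<close> after exactly \<open>t\<close> steps.\<close>

inductive exec :: "prog \<Rightarrow> stacks \<Rightarrow> nat \<Rightarrow> stacks \<Rightarrow> bool" where
  Skip: "exec Skip s 1 s"
| Push: "exec (Push r b) s 1 (s(r := b # s r))"
| Pop: "exec (Pop r) s 1 (s(r := tl (s r)))"
| Seq: "exec p s t s' \<Longrightarrow> exec q s' u s'' \<Longrightarrow> exec (Seq p q) s (t + u) s''"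
| IfTrue: "top_of (s r) \<in> X \<Longrightarrow> exec p s t s' \<Longrightarrow> exec (IfTop r X p q) s (Suc t) s'"
| IfFalse: "top_of (s r) \<notin> X \<Longrightarrow> exec q s t s' \<Longrightarrow> exec (IfTop r X p q) s (Suc t) s'"
| WhileTrue: "top_of (s r) \<in> X \<Longrightarrow> exec p s t s' \<Longrightarrow> exec (WhileTop r X p) s' u s'' \<Longrightarrow>
    exec (WhileTop r X p) s (Suc (t + u)) s''"
| WhileFalse: "top_of (s r) \<notin> X \<Longrightarrow> exec (WhileTop r X p) s 1 s"

inductive_cases exec_elims:
  "exec Skip s t s'" "exec (Push r b) s t s'" "exec (Pop r) s t s'" "exec (Seq p q) s t s'"
  "exec (IfTop r X p q) s t s'" "exec (WhileTop r X p) s t s'"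

lemma exec_deterministic:
  "exec p s t s' \<Longrightarrow> exec p s u s'' \<Longrightarrow> t = u \<and> s' = s''"
proof (induction arbitrary: u s'' rule: exec.induct)
  case (Skip s)
  then show ?case by (elim exec_elims) simp
next
  case (Push r b s)
  then show ?case by (elim exec_elims) simp
next
  case (Pop r s)
  then show ?case by (elim exec_elims) simp
next
  case (Seq p s t s' q u s1)
  from Seq.prems show ?case by (rule exec_elims(4)) (use Seq.IH in blast)
next
  case (IfTrue s r X p t s' q)
  from IfTrue.prems show ?case by (rule exec_elims(5)) (use IfTrue.IH IfTrue.hyps in blast)+
next
  case (IfFalse s r X q t s' p)
  from IfFalse.prems show ?case by (rule exec_elims(5)) (use IfFalse.IH IfFalse.hyps in blast)+
next
  case (WhileTrue s r X p t s' v s1)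
  from WhileTrue.prems show ?case
    by (rule exec_elims(6)) (use WhileTrue.IH WhileTrue.hyps in blast)+
next
  case (WhileFalse s r X p)
  from WhileFalse.prems show ?case by (rule exec_elims(6)) (use WhileFalse.hyps in simp_all)
qed

text \<open>
  The inputs are placed on the first stacks, all other stacks being empty, and the outputs
  are read off the stacks that follow the input stacks. Thus neither reading the inputs
  completely nor erasing them is required.
\<close>

definition input_stacks :: "bool list list \<Rightarrow> stacks" where
  "input_stacks xs = (\<lambda>r. if r < length xs then xs ! r else [])"

definition outputs_in :: "prog \<Rightarrow> bool list list \<Rightarrow> nat \<Rightarrow> bool list list \<Rightarrow> bool" where
  "outputs_in p xs t ys \<longleftrightarrow>
     (\<exists>s'. exec p (input_stacks xs) t s' \<and> (\<forall>i<length ys. s' (length xs + i) = ys ! i))"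

text \<open>Binary representation, least significant bit on top, without leading zeros.\<close>

fun bin :: "nat \<Rightarrow> bool list" where
  "bin 0 = []"
| "bin (Suc n) = odd (Suc n) # bin (Suc n div 2)"

definition computable :: "(nat \<Rightarrow> nat) \<Rightarrow> bool" where
  "computable f \<longleftrightarrow> (\<exists>p. \<forall>x. \<exists>t. outputs_in p [bin x] t [bin (f x)])"


section \<open>Kernels\<close>

text \<open>An instance is \<open>(G, d, k)\<close>, where \<open>G\<close> has the vertices \<open>0, \<dots>, n - 1\<close>.\<close>

type_synonym pm_instance = "nat ugraph \<times> nat \<times> nat"

definition valid_instance :: "pm_instance \<Rightarrow> bool" where
  "valid_instance = (\<lambda>(G, d, k). simple_graph G \<and> fst G = {..<card (fst G)})"

definition yes_instance :: "pm_instance \<Rightarrow> bool" where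
  "yes_instance = (\<lambda>(G, d, k). has_path_matching G d k)"

text \<open>The number of vertices in unary, followed by the adjacency matrix.\<close>

definition encode_graph :: "nat ugraph \<Rightarrow> bool list" where
  "encode_graph G = (let n = card (fst G) in
     replicate n True @ False # concat (map (\<lambda>u. map (\<lambda>v. {u, v} \<in> snd G) [0..<n]) [0..<n]))"

definition encode :: "pm_instance \<Rightarrow> bool list list" where
  "encode = (\<lambda>(G, d, k). [encode_graph G, bin d, bin k])"

definition instance_size :: "pm_instance \<Rightarrow> nat" where
  "instance_size I = sum_list (map length (encode I))"

text \<open>
  \<open>kernelization p T S\<close>: on every instance \<open>(G, d, k)\<close> with \<open>n\<close> vertices, \<open>p\<close> produces an
  equivalent instance of size at most \<open>S d k\<close> within \<open>T d n\<close> steps. The integers \<open>d\<close>, \<open>k\<close>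
  of the instance produced need not be the given ones.
\<close>

definition kernelization :: "prog \<Rightarrow> (nat \<Rightarrow> nat \<Rightarrow> nat) \<Rightarrow> (nat \<Rightarrow> nat \<Rightarrow> nat) \<Rightarrow> bool" where
  "kernelization p T S \<longleftrightarrow>
     (\<forall>G d k. valid_instance (G, d, k) \<longrightarrow>
        (\<exists>I t. valid_instance I \<and>
               outputs_in p (encode (G, d, k)) t (encode I) \<and>
               t \<le> T d (card (fst G)) \<and>
               (yes_instance I \<longleftrightarrow> yes_instance (G, d, k)) \<and>
               instance_size I \<le> S d k))"

text \<open>
  A bound of the form \<open>x\<^sup>O\<^sup>(\<^sup>1\<^sup>)\<close>. The offset makes the base at least 2, so that constant
  factors are absorbed by the exponent and \<open>x = 0\<close> and \<open>x = 1\<close> are covered.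
\<close>

definition polybound :: "nat \<Rightarrow> nat \<Rightarrow> nat" where
  "polybound c x = (x + 2) ^ c"

end

theory Submission
  imports Defs Complex_Main
begin

text \<open>
  Let \<open>D = d + 1\<close> and let \<open>S\<close> be the vertex set of a greedy packing of paths with \<open>D\<close> vertices.
  Unless the packing has \<open>k\<close> paths, \<open>S\<close> has fewer than \<open>k * D\<close> vertices and \<open>G - S\<close> has
  no such path, hence an elimination forest of depth less than \<open>D\<close>. A solution meets \<open>G - S\<close> in
  segments, each inside one subtree of the forest. Colour coding describes segments by a
  modulus \<open>O(D\<^sup>4 log n)\<close> and their residues. Thus there are \<open>O(D\<^sup>4 log n)\<^sup>D\<^sup>+\<^sup>1\<close> codes, which is at
  most \<open>f(d) * n\<close>, and a code with distinct residues admits only paths, so that its walks are found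
  by dynamic programming. Segment types that occur in many disjoint subtrees can always be rerouted.
  The roots of the others form a set \<open>H\<close>. A vertex outside \<open>S\<close> and \<open>H\<close> is irrelevant if
  every coded segment in its region, that is, between the same vertices of \<open>H\<close>, can avoid it. Some
  solution then avoids it and it is deleted. When no irrelevant vertex is left, \<open>n\<close> is bounded
  polynomially in \<open>k\<close> and the number of codes, and since that number grows only
  polylogarithmically in \<open>n\<close> for fixed \<open>d\<close>, \<open>n \<le> f(d) * k\<^sup>1\<^sup>8\<close>.

  If there are too many codes for polynomial time, then \<open>n * n\<close> is at most \<open>f(d) * n\<close> and the
  instance is already small. This is the first kernel. For the second, if the reduced instance
  is not polynomial in \<open>k\<close>, then \<open>k \<le> f(d)\<close> and exhaustive search takes time depending on \<open>d\<close> only.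

  The algorithms are written as commands over natural numbers bounded by a budget held in
  variable 0, with conditions in first-order logic with counting, so that the compiled programs
  run in time polynomial in the final budget.
\<close>

text \<open>An exchange that frees the irrelevant vertex \<open>v\<close> must miss the rest of the
  solution, about which a code says nothing. The way out is that only few vertices matter. Segments
  with many disjoint copies are taken out and put back later. Any other segment has its topmost
  vertex in \<open>H\<close>, and if it meets the region of \<open>v\<close>, then this vertex is an
  ancestor of \<open>v\<close>. Since \<open>v\<close> has fewer than \<open>D\<close> ancestors and
  a segment has at most \<open>D\<close> vertices, the remaining segments use at most
  \<open>D * D\<close> vertices of the region. If the modulus is injective on these, a walk in the
  region with the residues of the old segment cannot hit any other of them. So one logarithmic
  modulus replaces random colours; it exists because the least common multiple of an initial
  interval of numbers grows exponentially.

  Two obstacles come from the machine. The time of the first kernel may depend on \<open>n\<close>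
  alone although \<open>d\<close> and \<open>k\<close> are given in binary with any number of
  digits, so overlong ones have to be recognised without being read. And \<open>f\<close> itself
  must be computed, so it is chosen as a power of two obtained by repeated doubling.\<close>

definition run :: "prog \<Rightarrow> stacks \<Rightarrow> nat \<Rightarrow> stacks \<Rightarrow> bool" where
  "run p s T s' \<longleftrightarrow> (\<exists>t\<le>T. exec p s t s')"

lemma run_weaken: "run p s T s' \<Longrightarrow> s' = s'' \<Longrightarrow> T \<le> U \<Longrightarrow> run p s U s''"
  unfolding run_def by (meson order_trans)

lemma run_Skip: "run Skip s 1 s"
  unfolding run_def using exec.Skip by blast

lemma run_Push: "run (Push r b) s 1 (s(r := b # s r))"
  unfolding run_def using exec.Push by blast

lemma run_Pop: "run (Pop r) s 1 (s(r := tl (s r)))"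
  unfolding run_def using exec.Pop by blast

lemma run_Seq: "run p s T s' \<Longrightarrow> run q s' U s'' \<Longrightarrow> run (Seq p q) s (T + U) s''"
  unfolding run_def by (meson add_mono exec.Seq)

lemma run_IfTrue: "top_of (s r) \<in> X \<Longrightarrow> run p s T s' \<Longrightarrow> run (IfTop r X p q) s (Suc T) s'"
  unfolding run_def by (meson exec.IfTrue Suc_le_mono)

lemma run_IfFalse: "top_of (s r) \<notin> X \<Longrightarrow> run q s T s' \<Longrightarrow> run (IfTop r X p q) s (Suc T) s'"
  unfolding run_def by (meson exec.IfFalse Suc_le_mono)

lemma run_If:
  assumes "top_of (s r) \<in> X \<Longrightarrow> run p s T s'" "top_of (s r) \<notin> X \<Longrightarrow> run q s T s'"
  shows "run (IfTop r X p q) s (Suc T) s'"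
  using run_IfTrue[of s r X p T s' q] run_IfFalse[of s r X q T s' p] assms by blast

lemma run_WhileTrue:
  "top_of (s r) \<in> X \<Longrightarrow> run p s T s' \<Longrightarrow> run (WhileTop r X p) s' U s'' \<Longrightarrow>
    run (WhileTop r X p) s (Suc (T + U)) s''"
  unfolding run_def by (meson add_mono exec.WhileTrue Suc_le_mono)

lemma run_WhileFalse: "top_of (s r) \<notin> X \<Longrightarrow> run (WhileTop r X p) s 1 s"
  unfolding run_def using exec.WhileFalse[of s r X p] by blast

text \<open>All intermediate states are prescribed by \<open>\<sigma>\<close>, so a loop is reduced
  to a single pass of its body. The induction counts the passes still to come, because the loop rule
  unfolds at the front.\<close>

lemma run_While:
  assumes "\<And>i. i < m \<Longrightarrow> top_of (\<sigma> i r) \<in> X"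
    and "\<And>i. i < m \<Longrightarrow> run p (\<sigma> i) C (\<sigma> (Suc i))"
    and "top_of (\<sigma> m r) \<notin> X" "s = \<sigma> 0" "s' = \<sigma> m"
  shows "run (WhileTop r X p) s (m * (C + 1) + 1) s'"
proof -
  have "run (WhileTop r X p) (\<sigma> (m - j)) (j * (C + 1) + 1) (\<sigma> m)" if "j \<le> m" for j
    using that
  proof (induction j)
    case 0
    then show ?case unfolding run_def using exec.WhileFalse[of "\<sigma> m" r X p] assms(3) by auto
  next
    case (Suc j)
    then obtain t where t: "t \<le> j * (C + 1) + 1" "exec (WhileTop r X p) (\<sigma> (m - j)) t (\<sigma> m)"
      unfolding run_def by auto
    have m: "m - Suc j < m" "Suc (m - Suc j) = m - j" using Suc.prems by auto
    obtain u where u: "u \<le> C" "exec p (\<sigma> (m - Suc j)) u (\<sigma> (m - j))"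
      using assms(2)[OF m(1)] unfolding m(2) run_def by auto
    have "exec (WhileTop r X p) (\<sigma> (m - Suc j)) (Suc (u + t)) (\<sigma> m)"
      by (rule exec.WhileTrue[OF assms(1)[OF m(1)] u(2) t(2)])
    moreover have "Suc (u + t) \<le> Suc j * (C + 1) + 1" using t u by simp
    ultimately show ?case unfolding run_def by blast
  qed
  from this[of m] show ?thesis using assms(4,5) by simp
qed

abbreviation seq (infixr \<open>;;\<close> 60) where "p ;; q \<equiv> Seq p q"

section \<open>Polynomial time bounds\<close>

definition polyb :: "(nat \<Rightarrow> nat) \<Rightarrow> bool" where
  "polyb f \<longleftrightarrow> (\<exists>c. \<forall>W. f W \<le> (W + 2) ^ c)"

lemma polybI: "(\<And>W. f W \<le> (W + 2) ^ c) \<Longrightarrow> polyb f"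
  unfolding polyb_def by blast

lemma polyb_mono: "polyb g \<Longrightarrow> (\<And>W. f W \<le> g W) \<Longrightarrow> polyb f"
  unfolding polyb_def by (meson order_trans)

lemma polyb_const: "polyb (\<lambda>W. n)"
proof (rule polybI)
  fix W :: nat
  have "n \<le> 2 ^ n" using less_exp[of n] by simp
  also have "\<dots> \<le> (W + 2) ^ n" by (rule power_mono) auto
  finally show "n \<le> (W + 2) ^ n" .
qed

lemma polyb_id: "polyb (\<lambda>W. W)"
  by (rule polybI[of _ 1]) simp

lemma polyb_add: assumes "polyb f" "polyb g" shows "polyb (\<lambda>W. f W + g W)"
proof -
  obtain a b where ab: "f W \<le> (W + 2) ^ a" "g W \<le> (W + 2) ^ b" for W
    using assms unfolding polyb_def by metis
  show ?thesis
  proof (rule polybI)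
    fix W :: nat
    have "(W + 2) ^ a \<le> (W + 2) ^ (a + b)" "(W + 2) ^ b \<le> (W + 2) ^ (a + b)"
      by (rule power_increasing; simp)+
    then have "f W + g W \<le> 2 * (W + 2) ^ (a + b)" using ab[of W] by linarith
    also have "\<dots> \<le> (W + 2) ^ Suc (a + b)" by simp
    finally show "f W + g W \<le> (W + 2) ^ Suc (a + b)" .
  qed
qed

lemma polyb_mult: assumes "polyb f" "polyb g" shows "polyb (\<lambda>W. f W * g W)"
proof -
  obtain a b where ab: "f W \<le> (W + 2) ^ a" "g W \<le> (W + 2) ^ b" for W
    using assms unfolding polyb_def by metis
  show ?thesis
    by (rule polybI[of _ "a + b"]) (use ab in \<open>simp add: power_add mult_mono\<close>)
qed

lemma polyb_Suc: "polyb f \<Longrightarrow> polyb (\<lambda>W. Suc (f W))"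
  using polyb_add[of f "\<lambda>_. 1"] polyb_const by simp

lemma polyb_power: "polyb f \<Longrightarrow> polyb (\<lambda>W. f W ^ n)"
  by (induction n) (auto intro: polyb_const polyb_mult)

lemma polyb_comp: assumes "polyb f" "polyb g" shows "polyb (\<lambda>W. f (g W))"
proof -
  obtain a where a: "f W \<le> (W + 2) ^ a" for W using assms(1) unfolding polyb_def by metis
  have "polyb (\<lambda>W. (g W + 2) ^ a)"
    by (intro polyb_power polyb_add polyb_const assms(2))
  then show ?thesis by (rule polyb_mono) (rule a)
qed

lemmas polyb_intros = polyb_const polyb_id polyb_add polyb_mult polyb_Suc polyb_power

section \<open>Stacks read as variables and relations\<close>

definition lead :: "bool list \<Rightarrow> nat" where "lead xs = length (takeWhile id xs)"
definition trail :: "bool list \<Rightarrow> bool list" where "trail xs = dropWhile id xs"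

lemma lead_trail: "xs = replicate (lead xs) True @ trail xs"
proof -
  have "takeWhile id xs = replicate (lead xs) True"
    unfolding lead_def by (rule replicate_eqI[symmetric, THEN sym]) (auto dest: set_takeWhileD)
  then show ?thesis unfolding trail_def by (metis takeWhile_dropWhile_id)
qed

lemma top_trail: "top_of (trail xs) \<noteq> Some True"
  unfolding trail_def by (induction xs) auto

lemma lead_simps [simp]:
  "lead [] = 0" "lead (False # xs) = 0" "lead (True # xs) = Suc (lead xs)"
  "lead (replicate m True @ xs) = m + lead xs"
  by (simp_all add: lead_def takeWhile_append)

lemma lead_0: "top_of xs \<noteq> Some True \<Longrightarrow> lead xs = 0"
  by (cases xs) auto

text \<open>Stacks 0 to 5 are the three inputs and the three outputs and serve directly as
  relations. Stacks 6 to 12 are for work: 6 for numbers, 7 for truth values, 8 for loop counters, 9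
  to 11 for scratch, 12 for a table under construction. From 20 on, even stacks hold variables and
  odd ones hold further relations.\<close>

definition vst :: "nat \<Rightarrow> nat" where "vst x = 2 * x + 20"
definition rst :: "nat \<Rightarrow> nat" where "rst R = (if R < 6 then R else 2 * R + 21)"

lemma vst_rst_simps [simp]:
  "vst x = vst y \<longleftrightarrow> x = y" "rst R = rst R' \<longleftrightarrow> R = R'" "vst x \<noteq> rst R" "rst R \<noteq> vst x"
  "n < 20 \<Longrightarrow> vst x \<noteq> n" "n < 20 \<Longrightarrow> n \<noteq> vst x"
  "6 \<le> n \<Longrightarrow> n < 20 \<Longrightarrow> rst R \<noteq> n" "6 \<le> n \<Longrightarrow> n < 20 \<Longrightarrow> n \<noteq> rst R"
  by (auto simp: vst_def rst_def; presburger)+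

type_synonym env = "nat \<Rightarrow> nat"
type_synonym rels = "nat \<Rightarrow> bool list"

text \<open>Only the leading \<open>True\<close> bits count. Pushing \<open>False\<close> and then a
  new value rebinds a variable, and popping both restores the old value; this implements bound
  variables.\<close>

definition env_of :: "stacks \<Rightarrow> env" where "env_of s x = lead (s (vst x))"
definition rels_of :: "stacks \<Rightarrow> rels" where "rels_of s R = s (rst R)"

section \<open>Terms and formulas with counting\<close>

datatype tm = Var nat | Num nat | Add tm tm | Mul tm tm

fun val :: "env \<Rightarrow> tm \<Rightarrow> nat" where
  "val e (Var x) = e x"
| "val e (Num n) = n"
| "val e (Add t u) = val e t + val e u"
| "val e (Mul t u) = val e t * val e u"

text \<open>Counting is built in because the threshold in \<open>freq\<close> and the size of the
  packing are cardinalities. \<open>Peek\<close> tests one symbol of a list, with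
  \<open>None\<close> beyond its end, so that it also reveals lengths.\<close>

datatype fm = Lt tm tm | Peek nat tm "bool option set" | Neg fm | Conj fm fm | Cnt nat tm fm tm

fun sat :: "rels \<Rightarrow> env \<Rightarrow> fm \<Rightarrow> bool" where
  "sat \<rho> e (Lt t u) \<longleftrightarrow> val e t < val e u"
| "sat \<rho> e (Peek R t X) \<longleftrightarrow> top_of (drop (val e t) (\<rho> R)) \<in> X"
| "sat \<rho> e (Neg p) \<longleftrightarrow> \<not> sat \<rho> e p"
| "sat \<rho> e (Conj p q) \<longleftrightarrow> sat \<rho> e p \<and> sat \<rho> e q"
| "sat \<rho> e (Cnt x t p u) \<longleftrightarrow> val e u \<le> card {a. a < val e t \<and> sat \<rho> (e(x := a)) p}"

definition clean :: "stacks \<Rightarrow> bool" where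
  "clean s \<longleftrightarrow> s 9 = [] \<and> s 10 = [] \<and> s 11 = []"

lemma env_of_upd [simp]: "n < 20 \<Longrightarrow> env_of (s(n := xs)) = env_of s"
  "env_of (s(rst R := xs)) = env_of s" "env_of (s(vst x := xs)) = (env_of s)(x := lead xs)"
  by (auto simp: env_of_def fun_eq_iff)

lemma rels_of_upd [simp]: "6 \<le> n \<Longrightarrow> n < 20 \<Longrightarrow> rels_of (s(n := xs)) = rels_of s"
  "rels_of (s(vst x := xs)) = rels_of s" "rels_of (s(rst R := xs)) = (rels_of s)(R := xs)"
  by (auto simp: rels_of_def fun_eq_iff)

lemma clean_upd [simp]: "n \<notin> {9,10,11} \<Longrightarrow> clean (s(n := xs)) = clean s"
  "clean (s(vst x := xs)) = clean s" "clean (s(rst R := xs)) = clean s"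
  by (auto simp: clean_def)

subsection \<open>Basic programs\<close>

definition mv :: "nat \<Rightarrow> nat \<Rightarrow> prog" where
  "mv a b = WhileTop a {Some True} (Pop a ;; Push b True)"

lemma run_mv:
  assumes "a \<noteq> b" "s a = replicate m True @ r" "top_of r \<noteq> Some True"
  shows "run (mv a b) s (3 * m + 1) (s(a := r, b := replicate m True @ s b))"
proof -
  let ?\<sigma> = "\<lambda>i. s(a := replicate (m - i) True @ r, b := replicate i True @ s b)"
  have "run (mv a b) s (m * (2 + 1) + 1) (?\<sigma> m)" unfolding mv_def
  proof (rule run_While[where \<sigma> = ?\<sigma>])
    fix i assume i: "i < m"
    then obtain j where j: "m - i = Suc j" "m - Suc i = j" by (metis Suc_diff_Suc)
    show "top_of (?\<sigma> i a) \<in> {Some True}" using assms(1) j by simp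
    show "run (Pop a ;; Push b True) (?\<sigma> i) 2 (?\<sigma> (Suc i))"
      by (rule run_weaken[OF run_Seq[OF run_Pop run_Push]]) (use assms(1) j in \<open>auto simp: fun_eq_iff\<close>)
  qed (use assms in auto)
  then show ?thesis by (rule run_weaken) (use assms in \<open>auto simp: fun_eq_iff\<close>)
qed

definition clr :: "nat \<Rightarrow> prog" where
  "clr a = WhileTop a {Some True} (Pop a)"

lemma run_clr:
  assumes "s a = replicate m True @ r" "top_of r \<noteq> Some True"
  shows "run (clr a) s (2 * m + 1) (s(a := r))"
proof -
  let ?\<sigma> = "\<lambda>i. s(a := replicate (m - i) True @ r)"
  have "run (clr a) s (m * (1 + 1) + 1) (?\<sigma> m)" unfolding clr_def
  proof (rule run_While[where \<sigma> = ?\<sigma>])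
    fix i assume i: "i < m"
    then obtain j where j: "m - i = Suc j" "m - Suc i = j" by (metis Suc_diff_Suc)
    show "top_of (?\<sigma> i a) \<in> {Some True}" using j by simp
    show "run (Pop a) (?\<sigma> i) 1 (?\<sigma> (Suc i))"
      by (rule run_weaken[OF run_Pop]) (use j in \<open>auto simp: fun_eq_iff\<close>)
  qed (use assms in auto)
  then show ?thesis by (rule run_weaken) (use assms in \<open>auto simp: fun_eq_iff\<close>)
qed

definition mv2 :: "nat \<Rightarrow> nat \<Rightarrow> nat \<Rightarrow> prog" where
  "mv2 a b c = WhileTop a {Some True} (Pop a ;; Push b True ;; Push c True)"

lemma run_mv2:
  assumes "a \<noteq> b" "a \<noteq> c" "b \<noteq> c" "s a = replicate m True @ r" "top_of r \<noteq> Some True"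
  shows "run (mv2 a b c) s (4 * m + 1)
    (s(a := r, b := replicate m True @ s b, c := replicate m True @ s c))"
proof -
  let ?\<sigma> = "\<lambda>i. s(a := replicate (m - i) True @ r, b := replicate i True @ s b, c := replicate i True @ s c)"
  have "run (mv2 a b c) s (m * (3 + 1) + 1) (?\<sigma> m)" unfolding mv2_def
  proof (rule run_While[where \<sigma> = ?\<sigma>])
    fix i assume i: "i < m"
    then obtain j where j: "m - i = Suc j" "m - Suc i = j" by (metis Suc_diff_Suc)
    show "top_of (?\<sigma> i a) \<in> {Some True}" using assms(1-3) j by simp
    show "run (Pop a ;; Push b True ;; Push c True) (?\<sigma> i) 3 (?\<sigma> (Suc i))"
      by (rule run_weaken[OF run_Seq[OF run_Pop run_Seq[OF run_Push run_Push]]])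
        (use assms(1-3) j in \<open>auto simp: fun_eq_iff\<close>)
  qed (use assms in auto)
  then show ?thesis by (rule run_weaken) (use assms in \<open>auto simp: fun_eq_iff\<close>)
qed

definition mvb1 :: "nat \<Rightarrow> nat \<Rightarrow> prog" where
  "mvb1 a b = IfTop a {Some True} (Pop a ;; Push b True)
     (IfTop a {Some False} (Pop a ;; Push b False) Skip)"

lemma run_mvb1:
  assumes "a \<noteq> b"
  shows "run (mvb1 a b) s 4 (s(a := tl (s a), b := take 1 (s a) @ s b))"
proof (cases "s a")
  case Nil
  have "run (mvb1 a b) s (Suc (Suc 1)) s" unfolding mvb1_def
    by (intro run_IfFalse run_Skip) (auto simp: Nil)
  then show ?thesis by (rule run_weaken) (auto simp: Nil)
next
  case (Cons x xs)
  have 1: "run (Pop a ;; Push b x) s 2 (s(a := tl (s a), b := take 1 (s a) @ s b))"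
    by (rule run_weaken[OF run_Seq[OF run_Pop run_Push]]) (use assms Cons in auto)
  show ?thesis
  proof (cases x)
    case True
    have "run (mvb1 a b) s (Suc 2) (s(a := tl (s a), b := take 1 (s a) @ s b))"
      unfolding mvb1_def by (rule run_IfTrue) (use 1 Cons True in auto)
    then show ?thesis by (rule run_weaken) auto
  next
    case False
    have "run (mvb1 a b) s (Suc (Suc 2)) (s(a := tl (s a), b := take 1 (s a) @ s b))"
      unfolding mvb1_def by (intro run_IfFalse run_IfTrue) (use 1 Cons False in auto)
    then show ?thesis by (rule run_weaken) auto
  qed
qed

definition mvb :: "nat \<Rightarrow> nat \<Rightarrow> prog" where
  "mvb a b = WhileTop a {Some True, Some False} (mvb1 a b)"

lemma top_of_in: "top_of xs \<in> {Some True, Some False} \<longleftrightarrow> xs \<noteq> []"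
  by (cases xs) auto

lemma run_mvb:
  assumes "a \<noteq> b"
  shows "run (mvb a b) s (5 * length (s a) + 1) (s(a := [], b := rev (s a) @ s b))"
proof -
  let ?m = "length (s a)"
  let ?\<sigma> = "\<lambda>i. s(a := drop i (s a), b := rev (take i (s a)) @ s b)"
  have "run (mvb a b) s (?m * (4 + 1) + 1) (?\<sigma> ?m)" unfolding mvb_def
  proof (rule run_While[where \<sigma> = ?\<sigma>])
    fix i assume i: "i < ?m"
    show "top_of (?\<sigma> i a) \<in> {Some True, Some False}" using assms i unfolding top_of_in by simp
    have "take (Suc 0) (drop i (s a)) = [s a ! i]" using i by (simp add: take_Suc hd_drop_conv_nth)
    then show "run (mvb1 a b) (?\<sigma> i) 4 (?\<sigma> (Suc i))"
      by (intro run_weaken[OF run_mvb1[OF assms]])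
        (use assms i in \<open>auto simp: fun_eq_iff take_Suc_conv_app_nth drop_Suc tl_drop\<close>)
  qed (use assms in auto)
  then show ?thesis by (rule run_weaken) (use assms in \<open>auto simp: fun_eq_iff\<close>)
qed

text \<open>Terms are polynomials with natural coefficients. The bound controls both the unary
  evaluation of a term and the length of a loop that the term governs.\<close>

lemma val_bound: "\<exists>V. polyb V \<and> (\<forall>e W. (\<forall>x. e x \<le> W) \<longrightarrow> val e t \<le> V W)"
proof (induction t)
  case (Var x)
  show ?case by (rule exI[of _ "\<lambda>W. W"]) (auto intro: polyb_id)
next
  case (Num n)
  show ?case by (rule exI[of _ "\<lambda>W. n"]) (auto intro: polyb_const)
next
  case (Add t u)
  then obtain V V' where "polyb V" "polyb V'" "\<forall>e W. (\<forall>x. e x \<le> W) \<longrightarrow> val e t \<le> V W"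
    "\<forall>e W. (\<forall>x. e x \<le> W) \<longrightarrow> val e u \<le> V' W" by blast
  then show ?case by (intro exI[of _ "\<lambda>W. V W + V' W"]) (auto intro: polyb_add add_mono)
next
  case (Mul t u)
  then obtain V V' where "polyb V" "polyb V'" "\<forall>e W. (\<forall>x. e x \<le> W) \<longrightarrow> val e t \<le> V W"
    "\<forall>e W. (\<forall>x. e x \<le> W) \<longrightarrow> val e u \<le> V' W" by blast
  then show ?case by (intro exI[of _ "\<lambda>W. V W * V' W"]) (auto intro: polyb_mult mult_mono)
qed

text \<open>The closing \<open>False\<close> lets several unary numbers lie on one stack.\<close>

abbreviation frame :: "nat \<Rightarrow> bool list \<Rightarrow> bool list" where
  "frame v xs \<equiv> replicate v True @ False # xs"

definition ev :: "tm \<Rightarrow> prog \<Rightarrow> (nat \<Rightarrow> nat) \<Rightarrow> bool" where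
  "ev t p T \<longleftrightarrow> polyb T \<and> (\<forall>s W. clean s \<longrightarrow> (\<forall>x. env_of s x \<le> W) \<longrightarrow>
     run p s (T W) (s(6 := frame (val (env_of s) t) (s 6))))"

lemma ev_Var: "\<exists>p T. ev (Var x) p T"
proof -
  let ?p = "Push 6 False ;; mv (vst x) 9 ;; mv2 9 (vst x) 6"
  let ?T = "\<lambda>W. 7 * W + 3"
  have "run ?p s (?T W) (s(6 := frame (val (env_of s) (Var x)) (s 6)))"
    if c: "clean s" and b: "\<forall>x. env_of s x \<le> W" for s W
  proof -
    define m where "m = lead (s (vst x))"
    have mW: "m \<le> W" using b unfolding m_def env_of_def by auto
    have sx: "s (vst x) = replicate m True @ trail (s (vst x))" unfolding m_def by (rule lead_trail)
    define s1 where "s1 = s(6 := False # s 6)"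
    define s2 where "s2 = s1(vst x := trail (s (vst x)), 9 := replicate m True)"
    have 1: "run (Push 6 False) s 1 s1" unfolding s1_def by (rule run_Push)
    have 2: "run (mv (vst x) 9) s1 (3 * m + 1) s2"
      by (rule run_weaken[OF run_mv[where m = m and r = "trail (s (vst x))"]])
        (use sx c in \<open>auto simp: s1_def s2_def top_trail clean_def fun_eq_iff\<close>)
    have 3: "run (mv2 9 (vst x) 6) s2 (4 * m + 1) (s(6 := frame m (s 6)))"
      by (rule run_weaken[OF run_mv2[where m = m and r = "[]"]])
        (use sx c in \<open>auto simp: s1_def s2_def clean_def fun_eq_iff\<close>)
    show ?thesis
      by (rule run_weaken[OF run_Seq[OF 1 run_Seq[OF 2 3]]]) (use mW in \<open>auto simp: m_def env_of_def\<close>)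
  qed
  moreover have "polyb ?T" by (intro polyb_intros)
  ultimately show ?thesis unfolding ev_def by blast
qed

fun pushes :: "nat \<Rightarrow> prog" where
  "pushes 0 = Skip"
| "pushes (Suc n) = Push 6 True ;; pushes n"

lemma run_pushes: "run (pushes n) s (n + 1) (s(6 := replicate n True @ s 6))"
proof (induction n arbitrary: s)
  case 0
  show ?case using run_Skip[of s] by simp
next
  case (Suc n)
  show ?case unfolding pushes.simps
    by (rule run_weaken[OF run_Seq[OF run_Push Suc.IH]]) (auto simp: fun_eq_iff replicate_app_Cons_same)
qed

lemma ev_Num: "\<exists>p T. ev (Num n) p T"
proof -
  have "run (Push 6 False ;; pushes n) s (n + 2) (s(6 := frame n (s 6)))" for s
    by (rule run_weaken[OF run_Seq[OF run_Push run_pushes]]) (auto simp: fun_eq_iff)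
  then show ?thesis unfolding ev_def using polyb_const[of "n + 2"]
    by (intro exI[of _ "Push 6 False ;; pushes n"] exI[of _ "\<lambda>_. n + 2"]) auto
qed

lemma ev_Add:
  assumes "ev t p T" "ev u q U" shows "\<exists>p T. ev (Add t u) p T"
proof -
  obtain V where V: "polyb V" "\<forall>e W. (\<forall>x. e x \<le> W) \<longrightarrow> val e u \<le> V W" using val_bound by blast
  let ?p = "p ;; q ;; mv 6 9 ;; Pop 6 ;; mv 9 6"
  let ?T = "\<lambda>W. T W + U W + 6 * V W + 3"
  have "run ?p s (?T W) (s(6 := frame (val (env_of s) (Add t u)) (s 6)))"
    if c: "clean s" and b: "\<forall>x. env_of s x \<le> W" for s W
  proof -
    define a where "a = val (env_of s) t"
    define v where "v = val (env_of s) u"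
    have vV: "v \<le> V W" using V b unfolding v_def by auto
    define s1 where "s1 = s(6 := frame a (s 6))"
    have 1: "run p s (T W) s1" using assms(1) c b unfolding ev_def s1_def a_def by blast
    have c1: "clean s1" "env_of s1 = env_of s" using c by (auto simp: s1_def)
    have "run q s1 (U W) (s1(6 := frame v (s1 6)))"
      using assms(2) c1 b unfolding ev_def v_def by metis
    then have 2: "run q s1 (U W) (s(6 := frame v (frame a (s 6))))" by (simp add: s1_def)
    have 3: "run (mv 6 9) (s(6 := frame v (frame a (s 6)))) (3 * v + 1)
        (s(6 := False # frame a (s 6), 9 := replicate v True))"
      by (rule run_weaken[OF run_mv[where m = v and r = "False # frame a (s 6)"]])
        (use c in \<open>auto simp: clean_def\<close>)
    have 4: "run (Pop 6) (s(6 := False # frame a (s 6), 9 := replicate v True)) 1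
        (s(6 := frame a (s 6), 9 := replicate v True))"
      by (rule run_weaken[OF run_Pop]) auto
    have 5: "run (mv 9 6) (s(6 := frame a (s 6), 9 := replicate v True)) (3 * v + 1)
        (s(6 := frame (a + v) (s 6)))"
      by (rule run_weaken[OF run_mv[where m = v and r = "[]"]])
        (use c in \<open>auto simp: clean_def fun_eq_iff add.commute[of a v] replicate_add\<close>)
    show ?thesis
      by (rule run_weaken[OF run_Seq[OF 1 run_Seq[OF 2 run_Seq[OF 3 run_Seq[OF 4 5]]]]])
        (use vV in \<open>auto simp: a_def v_def\<close>)
  qed
  moreover have "polyb ?T" using assms V by (auto simp: ev_def intro!: polyb_intros)
  ultimately show ?thesis unfolding ev_def by blast
qed

definition cpy :: "nat \<Rightarrow> nat \<Rightarrow> nat \<Rightarrow> prog" where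
  "cpy a b h = mv a h ;; mv2 h a b"

lemma run_cpy:
  assumes "a \<noteq> b" "a \<noteq> h" "h \<noteq> b" "s a = replicate m True @ r" "top_of r \<noteq> Some True" "s h = []"
  shows "run (cpy a b h) s (7 * m + 2) (s(b := replicate m True @ s b))"
proof -
  have 1: "run (mv a h) s (3 * m + 1) (s(a := r, h := replicate m True))"
    by (rule run_weaken[OF run_mv[where m = m and r = r]]) (use assms in auto)
  have 2: "run (mv2 h a b) (s(a := r, h := replicate m True)) (4 * m + 1) (s(b := replicate m True @ s b))"
    by (rule run_weaken[OF run_mv2[where m = m and r = "[]"]]) (use assms in \<open>auto simp: fun_eq_iff\<close>)
  show ?thesis unfolding cpy_def by (rule run_weaken[OF run_Seq[OF 1 2]]) auto
qed

lemma ev_Mul: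
  assumes "ev t p T" "ev u q U" shows "\<exists>p T. ev (Mul t u) p T"
proof -
  obtain V where V: "polyb V" "\<forall>e W. (\<forall>x. e x \<le> W) \<longrightarrow> val e u \<le> V W" using val_bound by blast
  obtain V' where V': "polyb V'" "\<forall>e W. (\<forall>x. e x \<le> W) \<longrightarrow> val e t \<le> V' W" using val_bound by blast
  let ?l = "WhileTop 10 {Some True} (Pop 10 ;; cpy 9 6 11)"
  let ?p = "p ;; q ;; mv 6 9 ;; Pop 6 ;; mv 6 10 ;; ?l ;; clr 9"
  let ?T = "\<lambda>W. T W + U W + (3 * V W + 1) + 1 + (3 * V' W + 1) + (V' W * (7 * V W + 4) + 1) + (2 * V W + 1)"
  have "run ?p s (?T W) (s(6 := frame (val (env_of s) (Mul t u)) (s 6)))"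
    if c: "clean s" and b: "\<forall>x. env_of s x \<le> W" for s W
  proof -
    define a where "a = val (env_of s) t"
    define v where "v = val (env_of s) u"
    have vV: "v \<le> V W" using V b unfolding v_def by auto
    have aV: "a \<le> V' W" using V' b unfolding a_def by auto
    define s1 where "s1 = s(6 := frame a (s 6))"
    have 1: "run p s (T W) s1" using assms(1) c b unfolding ev_def s1_def a_def by blast
    have c1: "clean s1" "env_of s1 = env_of s" using c by (auto simp: s1_def)
    have "run q s1 (U W) (s1(6 := frame v (s1 6)))"
      using assms(2) c1 b unfolding ev_def v_def by metis
    then have 2: "run q s1 (U W) (s(6 := frame v (frame a (s 6))))" by (simp add: s1_def)
    have 3: "run (mv 6 9) (s(6 := frame v (frame a (s 6)))) (3 * v + 1)
        (s(6 := False # frame a (s 6), 9 := replicate v True))"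
      by (rule run_weaken[OF run_mv[where m = v and r = "False # frame a (s 6)"]])
        (use c in \<open>auto simp: clean_def\<close>)
    have 4: "run (Pop 6) (s(6 := False # frame a (s 6), 9 := replicate v True)) 1
        (s(6 := frame a (s 6), 9 := replicate v True))"
      by (rule run_weaken[OF run_Pop]) auto
    let ?\<sigma> = "\<lambda>i. s(6 := frame (i * v) (s 6), 9 := replicate v True, 10 := replicate (a - i) True)"
    have 5: "run (mv 6 10) (s(6 := frame a (s 6), 9 := replicate v True)) (3 * a + 1) (?\<sigma> 0)"
      by (rule run_weaken[OF run_mv[where m = a and r = "False # s 6"]])
        (use c in \<open>auto simp: clean_def fun_eq_iff\<close>)
    have 6: "run ?l (?\<sigma> 0) (a * ((7 * v + 3) + 1) + 1) (?\<sigma> a)"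
    proof (rule run_While[where \<sigma> = ?\<sigma>])
      fix i assume i: "i < a"
      then obtain j where j: "a - i = Suc j" "a - Suc i = j" by (metis Suc_diff_Suc)
      show "top_of (?\<sigma> i 10) \<in> {Some True}" using j by simp
      have 51: "run (Pop 10) (?\<sigma> i) 1 ((?\<sigma> i)(10 := replicate j True))"
        by (rule run_weaken[OF run_Pop]) (use j in auto)
      have 52: "run (cpy 9 6 11) ((?\<sigma> i)(10 := replicate j True)) (7 * v + 2) (?\<sigma> (Suc i))"
        by (rule run_weaken[OF run_cpy[where m = v and r = "[]"]])
          (use j c in \<open>auto simp: clean_def fun_eq_iff replicate_add\<close>)
      show "run (Pop 10 ;; cpy 9 6 11) (?\<sigma> i) (7 * v + 3) (?\<sigma> (Suc i))"
        by (rule run_weaken[OF run_Seq[OF 51 52]]) auto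
    qed auto
    have 7: "run (clr 9) (?\<sigma> a) (2 * v + 1) (s(6 := frame (a * v) (s 6)))"
      by (rule run_weaken[OF run_clr[where m = v and r = "[]"]])
        (use c in \<open>auto simp: clean_def fun_eq_iff\<close>)
    have "a * ((7 * v + 3) + 1) \<le> V' W * (7 * V W + 4)" using aV vV by (intro mult_mono) auto
    then have "T W + (U W + ((3 * v + 1) + (1 + ((3 * a + 1) + ((a * ((7 * v + 3) + 1) + 1) + (2 * v + 1)))))) \<le> ?T W"
      using aV vV by linarith
    then show ?thesis
      by (intro run_weaken[OF run_Seq[OF 1 run_Seq[OF 2 run_Seq[OF 3 run_Seq[OF 4 run_Seq[OF 5 run_Seq[OF 6 7]]]]]]])
        (auto simp: a_def v_def)
  qed
  moreover have "polyb ?T" using assms V V' by (auto simp: ev_def intro!: polyb_intros)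
  ultimately show ?thesis unfolding ev_def by blast
qed

lemma ev_tm: "\<exists>p T. ev t p T"
  by (induction t) (use ev_Var ev_Num ev_Add ev_Mul in blast)+

subsection \<open>Formulas\<close>

definition fev :: "fm \<Rightarrow> prog \<Rightarrow> (nat \<Rightarrow> nat) \<Rightarrow> bool" where
  "fev f p T \<longleftrightarrow> polyb T \<and> (\<forall>s W. clean s \<longrightarrow> (\<forall>x. env_of s x \<le> W) \<longrightarrow>
     run p s (T W) (s(7 := sat (rels_of s) (env_of s) f # s 7)))"

definition cmp :: prog where
  "cmp = mv 6 9 ;; Pop 6 ;; WhileTop 6 {Some True} (Pop 6 ;; Pop 9) ;; Pop 6 ;;
     IfTop 9 {Some True} (Push 7 True) (Push 7 False) ;; clr 9"

text \<open>Both numbers are popped in step. Popping an empty stack has no effect, so stack 9 ends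
  with the truncated difference \<open>v - a\<close>, which is nonempty iff
  \<open>a < v\<close>.\<close>

lemma run_cmp:
  assumes c: "clean s" and "s 6 = frame v (frame a xs)" "v \<le> V" "a \<le> A"
  shows "run cmp s (5 * V + 3 * A + 8) (s(6 := xs, 7 := (a < v) # s 7))"
proof -
  have 1: "run (mv 6 9) s (3 * v + 1) (s(6 := False # frame a xs, 9 := replicate v True))"
    by (rule run_weaken[OF run_mv[where m = v and r = "False # frame a xs"]])
      (use assms in \<open>auto simp: clean_def\<close>)
  have 2: "run (Pop 6) (s(6 := False # frame a xs, 9 := replicate v True)) 1
      (s(6 := frame a xs, 9 := replicate v True))"
    by (rule run_weaken[OF run_Pop]) auto
  let ?\<sigma> = "\<lambda>i. s(6 := frame (a - i) xs, 9 := replicate (v - i) True)"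
  have 3: "run (WhileTop 6 {Some True} (Pop 6 ;; Pop 9)) (s(6 := frame a xs, 9 := replicate v True))
      (a * (2 + 1) + 1) (?\<sigma> a)"
  proof (rule run_While[where \<sigma> = ?\<sigma>])
    fix i assume i: "i < a"
    then obtain j where j: "a - i = Suc j" "a - Suc i = j" by (metis Suc_diff_Suc)
    show "top_of (?\<sigma> i 6) \<in> {Some True}" using j by simp
    have "tl (replicate (v - i) True) = replicate (v - Suc i) True" by (cases "v - i") auto
    then show "run (Pop 6 ;; Pop 9) (?\<sigma> i) 2 (?\<sigma> (Suc i))"
      by (intro run_weaken[OF run_Seq[OF run_Pop run_Pop]]) (use j in \<open>auto simp: fun_eq_iff\<close>)
  qed (use assms in \<open>auto simp: fun_eq_iff\<close>)
  let ?s4 = "s(6 := xs, 9 := replicate (v - a) True)"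
  have 4: "run (Pop 6) (?\<sigma> a) 1 ?s4" by (rule run_weaken[OF run_Pop]) auto
  let ?s5 = "s(6 := xs, 9 := replicate (v - a) True, 7 := (a < v) # s 7)"
  have 5: "run (IfTop 9 {Some True} (Push 7 True) (Push 7 False)) ?s4 2 ?s5"
  proof (cases "a < v")
    case True
    then obtain j where j: "v - a = Suc j" by (metis Suc_diff_Suc)
    show ?thesis by (rule run_weaken[OF run_IfTrue[OF _ run_Push]]) (use True j in auto)
  next
    case False
    then show ?thesis by (intro run_weaken[OF run_IfFalse[OF _ run_Push]]) auto
  qed
  have 6: "run (clr 9) ?s5 (2 * (v - a) + 1) (s(6 := xs, 7 := (a < v) # s 7))"
    by (rule run_weaken[OF run_clr[where m = "v - a" and r = "[]"]])
      (use c in \<open>auto simp: clean_def fun_eq_iff\<close>)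
  show ?thesis unfolding cmp_def
    by (rule run_weaken[OF run_Seq[OF 1 run_Seq[OF 2 run_Seq[OF 3 run_Seq[OF 4 run_Seq[OF 5 6]]]]]])
      (use assms(3,4) in auto)
qed

lemma fev_Lt: "\<exists>p T. fev (Lt t u) p T"
proof -
  obtain p T where p: "ev t p T" using ev_tm by blast
  obtain q U where q: "ev u q U" using ev_tm by blast
  obtain V where V: "polyb V" "\<forall>e W. (\<forall>x. e x \<le> W) \<longrightarrow> val e u \<le> V W" using val_bound by blast
  obtain V' where V': "polyb V'" "\<forall>e W. (\<forall>x. e x \<le> W) \<longrightarrow> val e t \<le> V' W" using val_bound by blast
  let ?T = "\<lambda>W. T W + U W + (5 * V W + 3 * V' W + 8)"
  have "run (p ;; q ;; cmp) s (?T W) (s(7 := sat (rels_of s) (env_of s) (Lt t u) # s 7))"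
    if c: "clean s" and b: "\<forall>x. env_of s x \<le> W" for s W
  proof -
    define a where "a = val (env_of s) t"
    define v where "v = val (env_of s) u"
    have 1: "run p s (T W) (s(6 := frame a (s 6)))" using p c b unfolding ev_def a_def by blast
    have 2: "run q (s(6 := frame a (s 6))) (U W) (s(6 := frame v (frame a (s 6))))"
      using q[unfolded ev_def, THEN conjunct2, rule_format, of "s(6 := frame a (s 6))" W] c b
      unfolding v_def by simp
    have 3: "run cmp (s(6 := frame v (frame a (s 6)))) (5 * V W + 3 * V' W + 8) (s(7 := (a < v) # s 7))"
      by (rule run_weaken[OF run_cmp[where v = v and a = a and xs = "s 6" and V = "V W" and A = "V' W"]])
        (use c b V(2) V'(2) in \<open>auto simp: a_def v_def fun_eq_iff\<close>)
    show ?thesis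
      by (rule run_weaken[OF run_Seq[OF 1 run_Seq[OF 2 3]]]) (auto simp: a_def v_def)
  qed
  moreover have "polyb ?T" using p q V V' by (auto simp: ev_def intro!: polyb_intros)
  ultimately show ?thesis unfolding fev_def by blast
qed

lemma fev_Peek: "\<exists>p T. fev (Peek R t X) p T"
proof -
  obtain p T where p: "ev t p T" using ev_tm by blast
  obtain V where V: "polyb V" "\<forall>e W. (\<forall>x. e x \<le> W) \<longrightarrow> val e t \<le> V W" using val_bound by blast
  let ?r = "rst R"
  let ?p = "p ;; WhileTop 6 {Some True} (Pop 6 ;; mvb1 ?r 9) ;; Pop 6 ;;
    IfTop ?r X (Push 7 True) (Push 7 False) ;; mvb 9 ?r"
  let ?T = "\<lambda>W. T W + (V W * (5 + 1) + 1) + 1 + 2 + (5 * V W + 1)"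
  have "run ?p s (?T W) (s(7 := sat (rels_of s) (env_of s) (Peek R t X) # s 7))"
    if c: "clean s" and b: "\<forall>x. env_of s x \<le> W" for s W
  proof -
    define a where "a = val (env_of s) t"
    have aV: "a \<le> V W" using V b unfolding a_def by auto
    have 1: "run p s (T W) (s(6 := frame a (s 6)))" using p c b unfolding ev_def a_def by blast
    let ?\<sigma> = "\<lambda>i. s(6 := frame (a - i) (s 6), ?r := drop i (s ?r), 9 := rev (take i (s ?r)))"
    have 2: "run (WhileTop 6 {Some True} (Pop 6 ;; mvb1 ?r 9)) (s(6 := frame a (s 6))) (a * (5 + 1) + 1) (?\<sigma> a)"
    proof (rule run_While[where \<sigma> = ?\<sigma>])
      fix i assume i: "i < a"
      then obtain j where j: "a - i = Suc j" "a - Suc i = j" by (metis Suc_diff_Suc)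
      show "top_of (?\<sigma> i 6) \<in> {Some True}" using j by simp
      have 1: "rev (take (Suc i) (s ?r)) = take 1 (drop i (s ?r)) @ rev (take i (s ?r))"
        by (cases "i < length (s ?r)") (auto simp: take_Suc_conv_app_nth take_Suc hd_drop_conv_nth)
      show "run (Pop 6 ;; mvb1 ?r 9) (?\<sigma> i) 5 (?\<sigma> (Suc i))"
        by (rule run_weaken[OF run_Seq[OF run_Pop run_mvb1]])
          (use j in \<open>auto simp: fun_eq_iff 1 drop_Suc tl_drop\<close>)
    qed (use c in \<open>auto simp: fun_eq_iff clean_def\<close>)
    let ?s3 = "s(?r := drop a (s ?r), 9 := rev (take a (s ?r)))"
    have 3: "run (Pop 6) (?\<sigma> a) 1 ?s3" by (rule run_weaken[OF run_Pop]) (auto simp: fun_eq_iff)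
    let ?b = "top_of (drop a (s ?r)) \<in> X"
    have 4: "run (IfTop ?r X (Push 7 True) (Push 7 False)) ?s3 2 (?s3(7 := ?b # s 7))"
      by (rule run_weaken[OF run_If[where T = 1]]; (rule run_weaken[OF run_Push])?) auto
    have 5: "run (mvb 9 ?r) (?s3(7 := ?b # s 7)) (5 * V W + 1) (s(7 := ?b # s 7))"
      by (rule run_weaken[OF run_mvb]) (use c aV in \<open>auto simp: fun_eq_iff clean_def\<close>)
    show ?thesis
      by (rule run_weaken[OF run_Seq[OF 1 run_Seq[OF 2 run_Seq[OF 3 run_Seq[OF 4 5]]]]])
        (use aV in \<open>auto simp: a_def rels_of_def\<close>)
  qed
  moreover have "polyb ?T" using p V by (auto simp: ev_def intro!: polyb_intros)
  ultimately show ?thesis unfolding fev_def by blast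
qed

definition neg :: prog where
  "neg = IfTop 7 {Some True} (Pop 7 ;; Push 7 False) (Pop 7 ;; Push 7 True)"

lemma run_neg: "run neg (s(7 := b # xs)) 3 (s(7 := (\<not> b) # xs))"
  unfolding neg_def
  by (rule run_weaken[OF run_If[where T = 2]]; (rule run_weaken[OF run_Seq[OF run_Pop run_Push]])?) auto

lemma fev_Neg: assumes "fev f p T" shows "\<exists>p T. fev (Neg f) p T"
proof -
  have "run (p ;; neg) s (T W + 3) (s(7 := sat (rels_of s) (env_of s) (Neg f) # s 7))"
    if "clean s" "\<forall>x. env_of s x \<le> W" for s W
    by (rule run_weaken[OF run_Seq[OF assms[unfolded fev_def, THEN conjunct2, rule_format, OF that(1), of W] run_neg]])
       (use that in auto)
  moreover have "polyb (\<lambda>W. T W + 3)" using assms by (auto simp: fev_def intro!: polyb_intros)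
  ultimately show ?thesis unfolding fev_def by blast
qed

lemma fev_Conj: assumes "fev f p T" "fev g q U" shows "\<exists>p T. fev (Conj f g) p T"
proof -
  let ?q = "IfTop 7 {Some True} (Pop 7) (Pop 7 ;; Pop 7 ;; Push 7 False)"
  have "run (p ;; q ;; ?q) s (T W + U W + 4) (s(7 := sat (rels_of s) (env_of s) (Conj f g) # s 7))"
    if c: "clean s" and b: "\<forall>x. env_of s x \<le> W" for s W
  proof -
    let ?f = "sat (rels_of s) (env_of s) f"
    let ?g = "sat (rels_of s) (env_of s) g"
    have 1: "run p s (T W) (s(7 := ?f # s 7))" using assms(1) c b unfolding fev_def by blast
    have 2: "run q (s(7 := ?f # s 7)) (U W) (s(7 := ?g # ?f # s 7))"
      using assms(2)[unfolded fev_def, THEN conjunct2, rule_format, of "s(7 := ?f # s 7)" W] c b by simp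
    have 3: "run ?q (s(7 := ?g # ?f # s 7)) 4 (s(7 := (?f \<and> ?g) # s 7))"
      by (rule run_weaken[OF run_If[where T = 3]]; (rule run_weaken[OF run_Seq[OF run_Pop run_Seq[OF run_Pop run_Push]]]
          run_weaken[OF run_Pop])?) auto
    show ?thesis by (rule run_weaken[OF run_Seq[OF 1 run_Seq[OF 2 3]]]) auto
  qed
  moreover have "polyb (\<lambda>W. T W + U W + 4)" using assms by (auto simp: fev_def intro!: polyb_intros)
  ultimately show ?thesis unfolding fev_def by blast
qed

text \<open>The loop variable runs downwards; the count is collected in the frame that the separator
  of the range leaves behind.\<close>

definition count_prog :: "nat \<Rightarrow> prog \<Rightarrow> prog \<Rightarrow> prog" where
  "count_prog x p q = p ;; Push (vst x) False ;; mv 6 (vst x) ;;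
     WhileTop (vst x) {Some True} (Pop (vst x) ;; q ;; IfTop 7 {Some True} (Push 6 True) Skip ;; Pop 7) ;;
     Pop (vst x)"

lemma run_count_prog:
  assumes p: "ev t p T" and q: "fev f q U"
  shows "\<exists>T'. polyb T' \<and> (\<forall>s W. clean s \<longrightarrow> (\<forall>x. env_of s x \<le> W) \<longrightarrow>
    run (count_prog x p q) s (T' W)
      (s(6 := frame (card {a. a < val (env_of s) t \<and> sat (rels_of s) ((env_of s)(x := a)) f}) (s 6))))"
proof -
  obtain V where V: "polyb V" "\<forall>e W. (\<forall>x. e x \<le> W) \<longrightarrow> val e t \<le> V W" using val_bound by blast
  \<comment> \<open>Inside the loop the bound variable takes values below \<open>V W\<close>, so the
    body runs under the bound \<open>W + V W\<close>.\<close>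
  let ?U = "\<lambda>W. U (W + V W)"
  let ?T = "\<lambda>W. T W + 1 + (3 * V W + 1) + (V W * ((?U W + 5) + 1) + 1) + 1"
  let ?x = "vst x"
  have "run (count_prog x p q) s (?T W)
      (s(6 := frame (card {a. a < val (env_of s) t \<and> sat (rels_of s) ((env_of s)(x := a)) f}) (s 6)))"
    if c: "clean s" and b: "\<forall>x. env_of s x \<le> W" for s W
  proof -
    define v where "v = val (env_of s) t"
    have vV: "v \<le> V W" using V b unfolding v_def by auto
    let ?P = "\<lambda>a. sat (rels_of s) ((env_of s)(x := a)) f"
    let ?c = "\<lambda>i. card {a. a < v \<and> v - i \<le> a \<and> ?P a}"
    have 1: "run p s (T W) (s(6 := frame v (s 6)))" using p c b unfolding ev_def v_def by blast
    have 2: "run (Push ?x False) (s(6 := frame v (s 6))) 1 (s(6 := frame v (s 6), ?x := False # s ?x))"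
      by (rule run_weaken[OF run_Push]) auto
    let ?\<sigma> = "\<lambda>i. s(6 := frame (?c i) (s 6), ?x := frame (v - i) (s ?x))"
    have 3: "run (mv 6 ?x) (s(6 := frame v (s 6), ?x := False # s ?x)) (3 * v + 1) (?\<sigma> 0)"
      by (rule run_weaken[OF run_mv[where m = v and r = "False # s 6"]])
       (auto simp: fun_eq_iff)
    have 4: "run (WhileTop ?x {Some True} (Pop ?x ;; q ;; IfTop 7 {Some True} (Push 6 True) Skip ;; Pop 7))
      (?\<sigma> 0) (v * ((?U W + 5) + 1) + 1) (?\<sigma> v)"
    proof (rule run_While[where \<sigma> = ?\<sigma>])
      fix i assume i: "i < v"
      then obtain j where j: "v - i = Suc j" "v - Suc i = j" by (metis Suc_diff_Suc)
      have jv: "j < v" using j by linarith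
      show "top_of (?\<sigma> i ?x) \<in> {Some True}" using j by simp
      let ?s1 = "s(6 := frame (?c i) (s 6), ?x := frame j (s ?x))"
      have 1: "run (Pop ?x) (?\<sigma> i) 1 ?s1" by (rule run_weaken[OF run_Pop]) (use j in auto)
      have e1: "env_of ?s1 = (env_of s)(x := j)" "rels_of ?s1 = rels_of s" "clean ?s1" using c by auto
      have "\<forall>y. env_of ?s1 y \<le> W + V W"
        using b jv vV unfolding e1 by (auto intro: trans_le_add1)
      then have 2: "run q ?s1 (?U W) (?s1(7 := ?P j # s 7))"
        using q[unfolded fev_def, THEN conjunct2, rule_format, of ?s1] e1 by auto
      have "{a. a < v \<and> j \<le> a \<and> ?P a} = {a. a < v \<and> Suc j \<le> a \<and> ?P a} \<union> (if ?P j then {j} else {})"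
        using jv by (auto simp: Suc_le_eq order.order_iff_strict)
      then have cS: "card {a. a < v \<and> j \<le> a \<and> ?P a} =
          (if ?P j then Suc (card {a. a < v \<and> Suc j \<le> a \<and> ?P a}) else card {a. a < v \<and> Suc j \<le> a \<and> ?P a})"
        by simp
      have 3: "run (IfTop 7 {Some True} (Push 6 True) Skip) (?s1(7 := ?P j # s 7)) 2 ((?\<sigma> (Suc i))(7 := ?P j # s 7))"
      proof (cases "?P j")
        case True
        show ?thesis
          by (rule run_weaken[OF run_IfTrue[OF _ run_Push]]) (use True in \<open>auto simp: cS j fun_eq_iff\<close>)
      next
        case False
        show ?thesis
          by (rule run_weaken[OF run_IfFalse[OF _ run_Skip]]) (use False in \<open>auto simp: cS j fun_eq_iff\<close>)
      qed
      have 4: "run (Pop 7) ((?\<sigma> (Suc i))(7 := ?P j # s 7)) 1 (?\<sigma> (Suc i))"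
        by (rule run_weaken[OF run_Pop]) (auto simp: fun_eq_iff)
      show "run (Pop ?x ;; q ;; IfTop 7 {Some True} (Push 6 True) Skip ;; Pop 7) (?\<sigma> i) (?U W + 5) (?\<sigma> (Suc i))"
        by (rule run_weaken[OF run_Seq[OF 1 run_Seq[OF 2 run_Seq[OF 3 4]]]]) auto
    qed (auto)
    have 5: "run (Pop ?x) (?\<sigma> v) 1 (s(6 := frame (card {a. a < v \<and> ?P a}) (s 6)))"
      by (rule run_weaken[OF run_Pop]) (auto simp: fun_eq_iff)
    have "v * ((?U W + 5) + 1) \<le> V W * ((?U W + 5) + 1)" using vV by simp
    then show ?thesis unfolding count_prog_def
      by (intro run_weaken[OF run_Seq[OF 1 run_Seq[OF 2 run_Seq[OF 3 run_Seq[OF 4 5]]]]])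
        (use vV in \<open>simp_all add: v_def add_mono\<close>)
  qed
  moreover have "polyb ?T"
  proof -
    have "polyb ?U" using q V by (auto simp: fev_def intro!: polyb_comp[of U] polyb_intros)
    then show ?thesis using p V by (auto simp: ev_def intro!: polyb_intros)
  qed
  ultimately show ?thesis by blast
qed

lemma fev_Cnt: assumes "fev f q U" shows "\<exists>p T. fev (Cnt x t f u) p T"
proof -
  obtain p T where p: "ev t p T" using ev_tm by blast
  obtain r R where r: "ev u r R" using ev_tm by blast
  obtain V where V: "polyb V" "\<forall>e W. (\<forall>x. e x \<le> W) \<longrightarrow> val e u \<le> V W" using val_bound by blast
  obtain V' where V': "polyb V'" "\<forall>e W. (\<forall>x. e x \<le> W) \<longrightarrow> val e t \<le> V' W" using val_bound by blast
  obtain T' where T': "polyb T' \<and> (\<forall>s W. clean s \<longrightarrow> (\<forall>x. env_of s x \<le> W) \<longrightarrow>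
    run (count_prog x p q) s (T' W)
      (s(6 := frame (card {a. a < val (env_of s) t \<and> sat (rels_of s) ((env_of s)(x := a)) f}) (s 6))))"
    using run_count_prog[OF p assms] by (rule exE)
  let ?p = "count_prog x p q ;; r ;; cmp ;; neg"
  let ?T = "\<lambda>W. T' W + R W + (5 * V W + 3 * V' W + 8) + 3"
  have "run ?p s (?T W) (s(7 := sat (rels_of s) (env_of s) (Cnt x t f u) # s 7))"
    if c: "clean s" and b: "\<forall>x. env_of s x \<le> W" for s W
  proof -
    define a where "a = card {a. a < val (env_of s) t \<and> sat (rels_of s) ((env_of s)(x := a)) f}"
    define v where "v = val (env_of s) u"
    have "card {a. a < val (env_of s) t \<and> sat (rels_of s) ((env_of s)(x := a)) f} \<le> card {..<val (env_of s) t}"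
      by (rule card_mono) auto
    then have aV: "a \<le> V' W" using V' b unfolding a_def by (auto intro: order_trans)
    have vV: "v \<le> V W" using V b unfolding v_def by auto
    have 1: "run (count_prog x p q) s (T' W) (s(6 := frame a (s 6)))" using T'[THEN conjunct2, rule_format, OF c, of W] b unfolding a_def by simp
    have 2: "run r (s(6 := frame a (s 6))) (R W) (s(6 := frame v (frame a (s 6))))"
      using r[unfolded ev_def, THEN conjunct2, rule_format, of "s(6 := frame a (s 6))" W] c b
      unfolding v_def by simp
    have 3: "run cmp (s(6 := frame v (frame a (s 6)))) (5 * V W + 3 * V' W + 8) (s(7 := (a < v) # s 7))"
      by (rule run_weaken[OF run_cmp[where v = v and a = a and xs = "s 6"]]) (use c aV vV in \<open>auto simp: fun_eq_iff\<close>)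
    have sat: "sat (rels_of s) (env_of s) (Cnt x t f u) = (\<not> a < v)"
      unfolding a_def v_def by (simp add: not_less)
    show ?thesis
      by (subst sat, rule run_weaken[OF run_Seq[OF 1 run_Seq[OF 2 run_Seq[OF 3 run_neg]]]]) simp_all
  qed
  moreover have "polyb ?T"
    by (intro polyb_intros T'[THEN conjunct1] r[unfolded ev_def, THEN conjunct1] V(1) V'(1))
  ultimately show ?thesis unfolding fev_def by blast
qed

lemma fev_fm: "\<exists>p T. fev f p T"
proof (induction f)
  case (Neg f)
  then show ?case using fev_Neg by metis
next
  case (Conj f g)
  then show ?case using fev_Conj by metis
next
  case (Cnt x t f u)
  then show ?case using fev_Cnt by metis
qed (rule fev_Lt fev_Peek)+

subsection \<open>Commands\<close>

text \<open>\<open>Asg\<close> stores the number of values below the budget that satisfy the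
  formula, so that no assigned value exceeds the budget. In well-formed commands only
  \<open>Grow\<close> changes variable 0, and only upwards.\<close>

datatype cmd = Nop | Asg nat nat fm | Def nat nat tm fm | Grow tm | Sq cmd cmd
  | If fm cmd cmd | Rep tm cmd

fun sem :: "cmd \<Rightarrow> env \<times> rels \<Rightarrow> env \<times> rels" where
  "sem Nop = (\<lambda>(e, \<rho>). (e, \<rho>))"
| "sem (Asg x y f) = (\<lambda>(e, \<rho>). (e(x := card {a. a < e 0 \<and> sat \<rho> (e(y := a)) f}), \<rho>))"
| "sem (Def R x t f) = (\<lambda>(e, \<rho>). (e, \<rho>(R := map (\<lambda>a. sat \<rho> (e(x := a)) f) [0..<val e t])))"
| "sem (Grow t) = (\<lambda>(e, \<rho>). (e(0 := e 0 + val e t), \<rho>))"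
| "sem (Sq c d) = (\<lambda>(e, \<rho>). sem d (sem c (e, \<rho>)))"
| "sem (If f c d) = (\<lambda>(e, \<rho>). if sat \<rho> e f then sem c (e, \<rho>) else sem d (e, \<rho>))"
| "sem (Rep t c) = (\<lambda>(e, \<rho>). (sem c ^^ val e t) (e, \<rho>))"

text \<open>Relations 1 and 2 hold \<open>d\<close> and \<open>k\<close> in binary and may be far
  longer than any polynomial in \<open>n\<close>. A definition first clears the old list, at a cost
  proportional to its length, so these two are never redefined. Variable 0 is never assigned, so
  that the budget cannot shrink.\<close>

fun wf_cmd :: "cmd \<Rightarrow> bool" where
  "wf_cmd (Asg x y f) \<longleftrightarrow> x \<noteq> 0"
| "wf_cmd (Def R x t f) \<longleftrightarrow> R \<noteq> 1 \<and> R \<noteq> 2"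
| "wf_cmd (Sq c d) \<longleftrightarrow> wf_cmd c \<and> wf_cmd d"
| "wf_cmd (If f c d) \<longleftrightarrow> wf_cmd c \<and> wf_cmd d"
| "wf_cmd (Rep t c) \<longleftrightarrow> wf_cmd c"
| "wf_cmd _ \<longleftrightarrow> True"

definition inv_K :: "nat \<Rightarrow> env \<Rightarrow> rels \<Rightarrow> bool" where
  "inv_K K e \<rho> \<longleftrightarrow> (\<forall>x. e x \<le> e 0) \<and> (\<forall>R. R \<noteq> 1 \<longrightarrow> R \<noteq> 2 \<longrightarrow> length (\<rho> R) \<le> (e 0 + 2) ^ K)"

definition inv_st :: "nat \<Rightarrow> stacks \<Rightarrow> bool" where
  "inv_st K s \<longleftrightarrow> clean s \<and> s 12 = [] \<and> inv_K K (env_of s) (rels_of s)"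

text \<open>Time is measured by the budget at the end, which is at least every earlier one. So the
  costs of sequences and loops add up without any knowledge of how far the budget will grow.\<close>

definition cev :: "nat \<Rightarrow> cmd \<Rightarrow> prog \<Rightarrow> nat \<Rightarrow> bool" where
  "cev K c p a \<longleftrightarrow> (\<forall>s. inv_st K s \<longrightarrow> (\<exists>s'. inv_st K s' \<and> env_of s 0 \<le> env_of s' 0 \<and>
     run p s ((env_of s' 0 + 2) ^ a) s' \<and> (env_of s', rels_of s') = sem c (env_of s, rels_of s) \<and>
     s' 6 = s 6 \<and> s' 7 = s 7 \<and> s' 8 = s 8))"

lemma cev_I:
  assumes "polyb T"
    and "\<And>s. inv_st K s \<Longrightarrow> \<exists>s'. inv_st K s' \<and> env_of s 0 \<le> env_of s' 0 \<and>
     run p s (T (env_of s' 0)) s' \<and> (env_of s', rels_of s') = sem c (env_of s, rels_of s) \<and>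
     s' 6 = s 6 \<and> s' 7 = s 7 \<and> s' 8 = s 8"
  shows "\<exists>a. cev K c p a"
proof -
  obtain a where a: "T W \<le> (W + 2) ^ a" for W using assms(1) unfolding polyb_def by metis
  have "cev K c p a" unfolding cev_def
  proof (intro allI impI)
    fix s assume "inv_st K s"
    from assms(2)[OF this] obtain s' where s': "inv_st K s' \<and> env_of s 0 \<le> env_of s' 0 \<and>
     run p s (T (env_of s' 0)) s' \<and> (env_of s', rels_of s') = sem c (env_of s, rels_of s) \<and>
     s' 6 = s 6 \<and> s' 7 = s 7 \<and> s' 8 = s 8" by blast
    then have "run p s ((env_of s' 0 + 2) ^ a) s'" using run_weaken a by blast
    with s' show "\<exists>s'. inv_st K s' \<and> env_of s 0 \<le> env_of s' 0 \<and>
     run p s ((env_of s' 0 + 2) ^ a) s' \<and> (env_of s', rels_of s') = sem c (env_of s, rels_of s) \<and>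
     s' 6 = s 6 \<and> s' 7 = s 7 \<and> s' 8 = s 8" by blast
  qed
  then show ?thesis ..
qed

lemma cev_Nop: "\<exists>a. cev K Nop Skip a"
proof (rule cev_I[of "\<lambda>_. 1"])
  fix s assume "inv_st K s"
  then show "\<exists>s'. inv_st K s' \<and> env_of s 0 \<le> env_of s' 0 \<and>
     run Skip s 1 s' \<and> (env_of s', rels_of s') = sem Nop (env_of s, rels_of s) \<and>
     s' 6 = s 6 \<and> s' 7 = s 7 \<and> s' 8 = s 8"
    by (intro exI[of _ s]) (auto intro: run_Skip[simplified])
qed (rule polyb_const)

lemma cev_Asg:
  assumes "x \<noteq> 0" shows "\<exists>p a. cev K (Asg x y f) p a"
proof -
  obtain p T where p: "ev (Var 0) p T" using ev_tm by blast
  obtain q U where q: "fev f q U" using fev_fm by blast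
  obtain T' where T': "polyb T' \<and> (\<forall>s W. clean s \<longrightarrow> (\<forall>x. env_of s x \<le> W) \<longrightarrow>
    run (count_prog y p q) s (T' W)
      (s(6 := frame (card {a. a < val (env_of s) (Var 0) \<and> sat (rels_of s) ((env_of s)(y := a)) f}) (s 6))))"
    using run_count_prog[OF p q] by (rule exE)
  let ?p = "count_prog y p q ;; clr (vst x) ;; mv 6 (vst x) ;; Pop 6"
  let ?T = "\<lambda>W. T' W + (2 * W + 1) + (3 * W + 1) + 1"
  have "\<exists>a. cev K (Asg x y f) ?p a"
  proof (rule cev_I[of ?T])
    show "polyb ?T" by (intro polyb_intros T'[THEN conjunct1])
    fix s assume i: "inv_st K s"
    define B where "B = env_of s 0"
    define m where "m = card {a. a < B \<and> sat (rels_of s) ((env_of s)(y := a)) f}"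
    have "m \<le> card {..<B}" unfolding m_def by (rule card_mono) auto
    then have mB: "m \<le> B" by simp
    have c: "clean s" and b: "\<And>x. env_of s x \<le> B" using i unfolding inv_st_def inv_K_def B_def by auto
    define l where "l = lead (s (vst x))"
    have lB: "l \<le> B" using b[of x] unfolding l_def env_of_def .
    let ?tr = "trail (s (vst x))"
    have 1: "run (count_prog y p q) s (T' B) (s(6 := frame m (s 6)))"
      using T'[THEN conjunct2, rule_format, OF c, of B] b unfolding m_def B_def by simp
    have 2: "run (clr (vst x)) (s(6 := frame m (s 6))) (2 * l + 1) (s(6 := frame m (s 6), vst x := ?tr))"
      by (rule run_weaken[OF run_clr[where m = l and r = ?tr]])
        (use lead_trail[of "s (vst x)"] in \<open>auto simp: l_def top_trail\<close>)
    let ?s' = "s(vst x := replicate m True @ ?tr)"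
    have 3: "run (mv 6 (vst x)) (s(6 := frame m (s 6), vst x := ?tr)) (3 * m + 1) (?s'(6 := False # s 6))"
      by (rule run_weaken[OF run_mv[where m = m and r = "False # s 6"]]) (auto simp: fun_eq_iff)
    have 4: "run (Pop 6) (?s'(6 := False # s 6)) 1 ?s'"
      by (rule run_weaken[OF run_Pop]) (auto simp: fun_eq_iff)
    have l0: "lead ?tr = 0" by (rule lead_0) (rule top_trail)
    have e: "env_of ?s' = (env_of s)(x := m)" "rels_of ?s' = rels_of s" by (simp_all add: l0)
    have e0: "env_of ?s' 0 = B" unfolding e using assms by (simp add: B_def)
    have 5: "run ?p s (?T (env_of ?s' 0)) ?s'" unfolding e0
      by (rule run_weaken[OF run_Seq[OF 1 run_Seq[OF 2 run_Seq[OF 3 4]]]]) (use mB lB in auto)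
    have "inv_st K ?s'"
      using i mB assms unfolding inv_st_def inv_K_def e by (auto simp: B_def)
    moreover have "(env_of ?s', rels_of ?s') = sem (Asg x y f) (env_of s, rels_of s)"
      unfolding e by (simp add: m_def B_def add.commute)
    ultimately show "\<exists>s'. inv_st K s' \<and> env_of s 0 \<le> env_of s' 0 \<and>
     run ?p s (?T (env_of s' 0)) s' \<and> (env_of s', rels_of s') = sem (Asg x y f) (env_of s, rels_of s) \<and>
     s' 6 = s 6 \<and> s' 7 = s 7 \<and> s' 8 = s 8"
      using 5 e0 B_def by (intro exI[of _ ?s']) auto
  qed
  then show ?thesis by blast
qed

lemma cev_Grow: "\<exists>p a. cev K (Grow t) p a"
proof -
  obtain p T where p: "ev t p T" using ev_tm by blast
  obtain T1 where T1: "T W \<le> (W + 2) ^ T1" for W using p unfolding ev_def polyb_def by metis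
  let ?p = "p ;; mv 6 (vst 0) ;; Pop 6"
  let ?T = "\<lambda>W. (W + 2) ^ T1 + (3 * W + 1) + 1"
  have "\<exists>a. cev K (Grow t) ?p a"
  proof (rule cev_I[of ?T])
    show "polyb ?T" by (intro polyb_intros)
    fix s assume i: "inv_st K s"
    define B where "B = env_of s 0"
    define m where "m = val (env_of s) t"
    have c: "clean s" and b: "\<forall>x. env_of s x \<le> B" using i unfolding inv_st_def inv_K_def B_def by auto
    have 1: "run p s (T B) (s(6 := frame m (s 6)))" using p c b unfolding ev_def m_def by blast
    let ?s' = "s(vst 0 := replicate m True @ s (vst 0))"
    have 3: "run (mv 6 (vst 0)) (s(6 := frame m (s 6))) (3 * m + 1) (?s'(6 := False # s 6))"
      by (rule run_weaken[OF run_mv[where m = m and r = "False # s 6"]]) (auto simp: fun_eq_iff)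
    have 4: "run (Pop 6) (?s'(6 := False # s 6)) 1 ?s'"
      by (rule run_weaken[OF run_Pop]) (auto simp: fun_eq_iff)
    have e: "env_of ?s' = (env_of s)(0 := m + B)" "rels_of ?s' = rels_of s"
      by (simp_all add: B_def env_of_def)
    have e0: "env_of ?s' 0 = m + B" unfolding e by simp
    have "T B \<le> (m + B + 2) ^ T1" by (rule order_trans[OF T1]) (rule power_mono, auto)
    then have 5: "run ?p s (?T (env_of ?s' 0)) ?s'" unfolding e0
      by (intro run_weaken[OF run_Seq[OF 1 run_Seq[OF 3 4]]]) auto
    have "(B + 2) ^ K \<le> (m + B + 2) ^ K" by (rule power_mono) auto
    then have "inv_st K ?s'"
      using i unfolding inv_st_def inv_K_def e by (auto simp: B_def intro: le_trans trans_le_add2)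
    moreover have "(env_of ?s', rels_of ?s') = sem (Grow t) (env_of s, rels_of s)"
      unfolding e by (simp add: m_def B_def add.commute)
    ultimately show "\<exists>s'. inv_st K s' \<and> env_of s 0 \<le> env_of s' 0 \<and>
     run ?p s (?T (env_of s' 0)) s' \<and> (env_of s', rels_of s') = sem (Grow t) (env_of s, rels_of s) \<and>
     s' 6 = s 6 \<and> s' 7 = s 7 \<and> s' 8 = s 8"
      using 5 e0 B_def by (intro exI[of _ ?s']) auto
  qed
  then show ?thesis by blast
qed

definition clrb :: "nat \<Rightarrow> prog" where
  "clrb a = WhileTop a {Some True, Some False} (Pop a)"

lemma run_clrb: "run (clrb a) s (2 * length (s a) + 1) (s(a := []))"
proof -
  let ?m = "length (s a)"
  let ?\<sigma> = "\<lambda>i. s(a := drop i (s a))"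
  have "run (clrb a) s (?m * (1 + 1) + 1) (?\<sigma> ?m)" unfolding clrb_def
  proof (rule run_While[where \<sigma> = ?\<sigma>])
    fix i assume i: "i < ?m"
    show "top_of (?\<sigma> i a) \<in> {Some True, Some False}" using i unfolding top_of_in by simp
    show "run (Pop a) (?\<sigma> i) 1 (?\<sigma> (Suc i))"
      by (rule run_weaken[OF run_Pop]) (auto simp: drop_Suc tl_drop)
  qed auto
  then show ?thesis by (rule run_weaken) auto
qed

text \<open>The formula may mention the relation that is being defined; this is how an iteration
  uses the previous table. The new table is therefore built on stack 12, from the last entry to the
  first, and replaces the old one only at the end. The two moves through stack 9 keep its
  order.\<close>

lemma cev_Def:
  assumes "R \<noteq> 1" "R \<noteq> 2" shows "\<exists>K0. \<forall>K\<ge>K0. \<exists>p a. cev K (Def R x t f) p a"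
proof -
  obtain p T where p: "ev t p T" using ev_tm by blast
  obtain q U where q: "fev f q U" using fev_fm by blast
  obtain V where V: "polyb V" "\<forall>e W. (\<forall>x. e x \<le> W) \<longrightarrow> val e t \<le> V W" using val_bound by blast
  obtain K0 where K0: "V W \<le> (W + 2) ^ K0" for W using V(1) unfolding polyb_def by metis
  have "\<exists>p a. cev K (Def R x t f) p a" if K: "K0 \<le> K" for K
  proof -
    let ?x = "vst x"
    let ?r = "rst R"
    let ?b = "Pop ?x ;; q ;; IfTop 7 {Some True} (Push 12 True) (Push 12 False) ;; Pop 7"
    let ?p = "p ;; Push ?x False ;; mv 6 ?x ;; Pop 6 ;; WhileTop ?x {Some True} ?b ;; Pop ?x ;;
      clrb ?r ;; mvb 12 9 ;; mvb 9 ?r"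
    let ?U = "\<lambda>W. U (W + V W)"
    let ?T = "\<lambda>W. T W + 1 + (3 * V W + 1) + 1 + (V W * ((?U W + 4) + 1) + 1) + 1 + (2 * (W + 2) ^ K + 1) +
      (5 * V W + 1) + (5 * V W + 1)"
    have "\<exists>a. cev K (Def R x t f) ?p a"
    proof (rule cev_I[of ?T])
      have "polyb ?U"
        by (intro polyb_comp[OF q[unfolded fev_def, THEN conjunct1]] polyb_intros V(1))
      then show "polyb ?T" by (intro polyb_intros p[unfolded ev_def, THEN conjunct1] V(1))
      fix s assume i: "inv_st K s"
      define B where "B = env_of s 0"
      define v where "v = val (env_of s) t"
      have c: "clean s" and s12: "s 12 = []" and b: "\<forall>x. env_of s x \<le> B"
        and lenR: "length (s ?r) \<le> (B + 2) ^ K"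
        using i assms unfolding inv_st_def inv_K_def B_def rels_of_def by auto
      have vV: "v \<le> V B" using V b unfolding v_def by auto
      let ?P = "\<lambda>a. sat (rels_of s) ((env_of s)(x := a)) f"
      have 1: "run p s (T B) (s(6 := frame v (s 6)))" using p c b unfolding ev_def v_def by blast
      have 2: "run (Push ?x False) (s(6 := frame v (s 6))) 1 (s(6 := frame v (s 6), ?x := False # s ?x))"
        by (rule run_weaken[OF run_Push]) auto
      have 3: "run (mv 6 ?x) (s(6 := frame v (s 6), ?x := False # s ?x)) (3 * v + 1) (s(6 := False # s 6, ?x := frame v (s ?x)))"
        by (rule run_weaken[OF run_mv[where m = v and r = "False # s 6"]])
         (auto simp: fun_eq_iff)
      let ?\<sigma> = "\<lambda>i. s(?x := frame (v - i) (s ?x), 12 := map ?P [v - i..<v])"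
      have 4: "run (Pop 6) (s(6 := False # s 6, ?x := frame v (s ?x))) 1 (?\<sigma> 0)"
        by (rule run_weaken[OF run_Pop]) (auto simp: fun_eq_iff s12)
      have 5: "run (WhileTop ?x {Some True} ?b) (?\<sigma> 0) (v * ((?U B + 4) + 1) + 1) (?\<sigma> v)"
      proof (rule run_While[where \<sigma> = ?\<sigma>])
        fix i assume i: "i < v"
        then obtain j where j: "v - i = Suc j" "v - Suc i = j" by (metis Suc_diff_Suc)
        have jv: "j < v" using j by linarith
        show "top_of (?\<sigma> i ?x) \<in> {Some True}" using j by simp
        let ?s1 = "s(?x := frame j (s ?x), 12 := map ?P [Suc j..<v])"
        have 1: "run (Pop ?x) (?\<sigma> i) 1 ?s1" by (rule run_weaken[OF run_Pop]) (use j in \<open>auto simp: fun_eq_iff\<close>)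
        have e1: "env_of ?s1 = (env_of s)(x := j)" "rels_of ?s1 = rels_of s" "clean ?s1" using c by auto
        have "\<forall>y. env_of ?s1 y \<le> B + V B"
          using b jv vV unfolding e1 by (auto intro: trans_le_add1)
        then have 2: "run q ?s1 (?U B) (?s1(7 := ?P j # s 7))"
          using q[unfolded fev_def, THEN conjunct2, rule_format, of ?s1] e1 by auto
        have 3: "run (IfTop 7 {Some True} (Push 12 True) (Push 12 False)) (?s1(7 := ?P j # s 7)) 2
          ((?\<sigma> (Suc i))(7 := ?P j # s 7))"
          by (rule run_weaken[OF run_If[where T = 1 and s' = "(?\<sigma> (Suc i))(7 := ?P j # s 7)"]];
              (rule run_weaken[OF run_Push])?)
            (use jv in \<open>auto simp: j fun_eq_iff upt_conv_Cons\<close>)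
        have 4: "run (Pop 7) ((?\<sigma> (Suc i))(7 := ?P j # s 7)) 1 (?\<sigma> (Suc i))"
          by (rule run_weaken[OF run_Pop]) (auto simp: fun_eq_iff)
        show "run ?b (?\<sigma> i) (?U B + 4) (?\<sigma> (Suc i))"
          by (rule run_weaken[OF run_Seq[OF 1 run_Seq[OF 2 run_Seq[OF 3 4]]]]) auto
      qed auto
      let ?L = "map ?P [0..<v]"
      have 6: "run (Pop ?x) (?\<sigma> v) 1 (s(12 := ?L))"
        by (rule run_weaken[OF run_Pop]) (auto simp: fun_eq_iff)
      have 7: "run (clrb ?r) (s(12 := ?L)) (2 * (B + 2) ^ K + 1) (s(12 := ?L, ?r := []))"
        by (rule run_weaken[OF run_clrb]) (use lenR in auto)
      have 8: "run (mvb 12 9) (s(12 := ?L, ?r := [])) (5 * v + 1) (s(?r := [], 9 := rev ?L))"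
        by (rule run_weaken[OF run_mvb]) (use s12 c in \<open>auto simp: fun_eq_iff clean_def\<close>)
      let ?s' = "s(?r := ?L)"
      have 9: "run (mvb 9 ?r) (s(?r := [], 9 := rev ?L)) (5 * v + 1) ?s'"
        by (rule run_weaken[OF run_mvb]) (use c in \<open>auto simp: fun_eq_iff clean_def\<close>)
      have e: "env_of ?s' = env_of s" "rels_of ?s' = (rels_of s)(R := ?L)" by simp_all
      have "v * ((?U B + 4) + 1) \<le> V B * ((?U B + 4) + 1)" using vV by simp
      then have "T B + (1 + (3 * v + 1 + (1 + (v * ((?U B + 4) + 1) + 1 + (1 + (2 * (B + 2) ^ K + 1 + (5 * v + 1 + (5 * v + 1)))))))) \<le> ?T B"
        using vV by linarith
      then have 10: "run ?p s (?T (env_of ?s' 0)) ?s'" unfolding e B_def[symmetric]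
        by (intro run_weaken[OF run_Seq[OF 1 run_Seq[OF 2 run_Seq[OF 3 run_Seq[OF 4 run_Seq[OF 5 run_Seq[OF 6 run_Seq[OF 7 run_Seq[OF 8 9]]]]]]]]])
          (simp_all add: add.assoc)
      have "v \<le> (B + 2) ^ K"
        using vV K0[of B] power_increasing[OF K, of "B + 2"] by linarith
      then have "inv_st K ?s'"
        using i unfolding inv_st_def inv_K_def e by (auto simp: B_def)
      moreover have "(env_of ?s', rels_of ?s') = sem (Def R x t f) (env_of s, rels_of s)"
        unfolding e by (simp add: v_def)
      ultimately show "\<exists>s'. inv_st K s' \<and> env_of s 0 \<le> env_of s' 0 \<and>
       run ?p s (?T (env_of s' 0)) s' \<and> (env_of s', rels_of s') = sem (Def R x t f) (env_of s, rels_of s) \<and>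
       s' 6 = s 6 \<and> s' 7 = s 7 \<and> s' 8 = s 8"
        using 10 e by (intro exI[of _ ?s']) auto
    qed
    then show ?thesis by blast
  qed
  then show ?thesis by blast
qed

lemma cev_Sq:
  assumes "cev K c p a" "cev K d q b" shows "\<exists>p a. cev K (Sq c d) p a"
proof -
  have "\<exists>a. cev K (Sq c d) (p ;; q) a"
  proof (rule cev_I[of "\<lambda>W. (W + 2) ^ a + (W + 2) ^ b"])
    fix s assume "inv_st K s"
    then obtain s1 where s1: "inv_st K s1" "env_of s 0 \<le> env_of s1 0"
       "run p s ((env_of s1 0 + 2) ^ a) s1" "(env_of s1, rels_of s1) = sem c (env_of s, rels_of s)"
       "s1 6 = s 6" "s1 7 = s 7" "s1 8 = s 8" using assms(1) unfolding cev_def by blast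
    obtain s2 where s2: "inv_st K s2" "env_of s1 0 \<le> env_of s2 0"
       "run q s1 ((env_of s2 0 + 2) ^ b) s2" "(env_of s2, rels_of s2) = sem d (env_of s1, rels_of s1)"
       "s2 6 = s1 6" "s2 7 = s1 7" "s2 8 = s1 8" using s1(1) assms(2) unfolding cev_def by blast
    have "run (p ;; q) s ((env_of s2 0 + 2) ^ a + (env_of s2 0 + 2) ^ b) s2"
      by (rule run_weaken[OF run_Seq[OF s1(3) s2(3)]]) (use s2(2) in \<open>auto intro: power_mono\<close>)
    then show "\<exists>s'. inv_st K s' \<and> env_of s 0 \<le> env_of s' 0 \<and>
       run (p ;; q) s ((env_of s' 0 + 2) ^ a + (env_of s' 0 + 2) ^ b) s' \<and>
       (env_of s', rels_of s') = sem (Sq c d) (env_of s, rels_of s) \<and> s' 6 = s 6 \<and> s' 7 = s 7 \<and> s' 8 = s 8"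
      using s1 s2 by (intro exI[of _ s2]) auto
  qed (intro polyb_intros)
  then show ?thesis by blast
qed

lemma cev_If:
  assumes c: "cev K c p a" and d: "cev K d q b" shows "\<exists>p a. cev K (If f c d) p a"
proof -
  obtain r U where r: "fev f r U" using fev_fm by blast
  obtain u where u: "U W \<le> (W + 2) ^ u" for W using r unfolding fev_def polyb_def by metis
  let ?p = "r ;; IfTop 7 {Some True} (Pop 7 ;; p) (Pop 7 ;; q)"
  let ?T = "\<lambda>W. (W + 2) ^ u + 2 + (W + 2) ^ a + (W + 2) ^ b"
  have "\<exists>a. cev K (If f c d) ?p a"
  proof (rule cev_I[of ?T])
    fix s assume i: "inv_st K s"
    define z where "z = sat (rels_of s) (env_of s) f"
    have cl: "clean s" "\<forall>x. env_of s x \<le> env_of s 0" using i unfolding inv_st_def inv_K_def by auto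
    have 1: "run r s (U (env_of s 0)) (s(7 := z # s 7))" using r cl unfolding fev_def z_def by blast
    have pop: "run (Pop 7) (s(7 := z # s 7)) 1 s" by (rule run_weaken[OF run_Pop]) auto
    show "\<exists>s'. inv_st K s' \<and> env_of s 0 \<le> env_of s' 0 \<and>
       run ?p s (?T (env_of s' 0)) s' \<and>
       (env_of s', rels_of s') = sem (If f c d) (env_of s, rels_of s) \<and> s' 6 = s 6 \<and> s' 7 = s 7 \<and> s' 8 = s 8"
    proof (cases z)
      case True
      obtain s1 where s1: "inv_st K s1" "env_of s 0 \<le> env_of s1 0"
       "run p s ((env_of s1 0 + 2) ^ a) s1" "(env_of s1, rels_of s1) = sem c (env_of s, rels_of s)"
       "s1 6 = s 6" "s1 7 = s 7" "s1 8 = s 8" using i c unfolding cev_def by blast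
      have "U (env_of s 0) \<le> (env_of s1 0 + 2) ^ u"
        by (rule order_trans[OF u]) (use s1(2) in \<open>auto intro: power_mono\<close>)
      then have "run ?p s (?T (env_of s1 0)) s1"
        by (intro run_weaken[OF run_Seq[OF 1 run_IfTrue[OF _ run_Seq[OF pop s1(3)]]]]) (use True in auto)
      then show ?thesis using s1 True by (intro exI[of _ s1]) (auto simp: z_def)
    next
      case False
      obtain s1 where s1: "inv_st K s1" "env_of s 0 \<le> env_of s1 0"
       "run q s ((env_of s1 0 + 2) ^ b) s1" "(env_of s1, rels_of s1) = sem d (env_of s, rels_of s)"
       "s1 6 = s 6" "s1 7 = s 7" "s1 8 = s 8" using i d unfolding cev_def by blast
      have "U (env_of s 0) \<le> (env_of s1 0 + 2) ^ u"
        by (rule order_trans[OF u]) (use s1(2) in \<open>auto intro: power_mono\<close>)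
      then have "run ?p s (?T (env_of s1 0)) s1"
        by (intro run_weaken[OF run_Seq[OF 1 run_IfFalse[OF _ run_Seq[OF pop s1(3)]]]]) (use False in auto)
      then show ?thesis using s1 False by (intro exI[of _ s1]) (auto simp: z_def)
    qed
  qed (intro polyb_intros)
  then show ?thesis by blast
qed

lemma cev_Rep:
  assumes c: "cev K c p a" shows "\<exists>p a. cev K (Rep t c) p a"
proof -
  obtain r U where r: "ev t r U" using ev_tm by blast
  obtain V where V: "polyb V" "\<forall>e W. (\<forall>x. e x \<le> W) \<longrightarrow> val e t \<le> V W" using val_bound by blast
  obtain u where u: "U W \<le> (W + 2) ^ u" for W using r unfolding ev_def polyb_def by metis
  obtain k where k: "V W \<le> (W + 2) ^ k" for W using V(1) unfolding polyb_def by metis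
  let ?w = "WhileTop 8 {Some True} (Pop 8 ;; p)"
  have loop: "\<exists>s'. inv_st K s' \<and> env_of s 0 \<le> env_of s' 0 \<and> run ?w s (m * ((env_of s' 0 + 2) ^ a + 2) + 1) s' \<and>
      (env_of s', rels_of s') = (sem c ^^ m) (env_of s, rels_of s) \<and> s' 6 = s 6 \<and> s' 7 = s 7 \<and> s' 8 = False # xs"
    if "inv_st K s" "s 8 = frame m xs" for m s xs
    using that
  proof (induction m arbitrary: s)
    case 0
    then show ?case by (intro exI[of _ s]) (auto intro: run_weaken[OF run_WhileFalse])
  next
    case (Suc m)
    let ?s0 = "s(8 := frame m xs)"
    have i: "inv_st K ?s0" "env_of ?s0 = env_of s" "rels_of ?s0 = rels_of s"
      using Suc.prems by (auto simp: inv_st_def)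
    obtain s1 where s1: "inv_st K s1" "env_of s 0 \<le> env_of s1 0"
       "run p ?s0 ((env_of s1 0 + 2) ^ a) s1" "(env_of s1, rels_of s1) = sem c (env_of s, rels_of s)"
       "s1 6 = s 6" "s1 7 = s 7" "s1 8 = frame m xs" using i c unfolding cev_def by force
    obtain s2 where s2: "inv_st K s2" "env_of s1 0 \<le> env_of s2 0" "run ?w s1 (m * ((env_of s2 0 + 2) ^ a + 2) + 1) s2"
      "(env_of s2, rels_of s2) = (sem c ^^ m) (env_of s1, rels_of s1)" "s2 6 = s1 6" "s2 7 = s1 7" "s2 8 = False # xs"
      using Suc.IH[OF s1(1,7)] by blast
    have 1: "run (Pop 8) s 1 ?s0" by (rule run_weaken[OF run_Pop]) (use Suc.prems in auto)
    have "(env_of s1 0 + 2) ^ a \<le> (env_of s2 0 + 2) ^ a" by (rule power_mono) (use s2(2) in auto)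
    then have "run ?w s (Suc m * ((env_of s2 0 + 2) ^ a + 2) + 1) s2"
      by (intro run_weaken[OF run_WhileTrue[OF _ run_Seq[OF 1 s1(3)] s2(3)]]) (use Suc.prems in auto)
    then show ?case using s1 s2 by (intro exI[of _ s2]) (auto simp: funpow_swap1)
  qed
  let ?p = "r ;; Push 8 False ;; mv 6 8 ;; Pop 6 ;; ?w ;; Pop 8"
  let ?T = "\<lambda>W. (W + 2) ^ u + 1 + (3 * (W + 2) ^ k + 1) + 1 + ((W + 2) ^ k * ((W + 2) ^ a + 2) + 1) + 1"
  have "\<exists>a. cev K (Rep t c) ?p a"
  proof (rule cev_I[of ?T])
    fix s assume i: "inv_st K s"
    define m where "m = val (env_of s) t"
    have cl: "clean s" "\<forall>x. env_of s x \<le> env_of s 0" using i unfolding inv_st_def inv_K_def by auto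
    have mV: "m \<le> (env_of s 0 + 2) ^ k" using V(2) cl k unfolding m_def by (meson order_trans)
    have 1: "run r s (U (env_of s 0)) (s(6 := frame m (s 6)))" using r cl unfolding ev_def m_def by blast
    have 2: "run (Push 8 False) (s(6 := frame m (s 6))) 1 (s(6 := frame m (s 6), 8 := False # s 8))"
      by (rule run_weaken[OF run_Push]) auto
    have 3: "run (mv 6 8) (s(6 := frame m (s 6), 8 := False # s 8)) (3 * m + 1) (s(6 := False # s 6, 8 := frame m (s 8)))"
      by (rule run_weaken[OF run_mv[where m = m and r = "False # s 6"]]) (auto simp: fun_eq_iff)
    let ?s0 = "s(8 := frame m (s 8))"
    have 4: "run (Pop 6) (s(6 := False # s 6, 8 := frame m (s 8))) 1 ?s0"
      by (rule run_weaken[OF run_Pop]) (auto simp: fun_eq_iff)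
    have "inv_st K ?s0" using i by (auto simp: inv_st_def)
    from loop[OF this, of m "s 8"] obtain s1 where s1: "inv_st K s1" "env_of s 0 \<le> env_of s1 0"
      "run ?w ?s0 (m * ((env_of s1 0 + 2) ^ a + 2) + 1) s1"
      "(env_of s1, rels_of s1) = (sem c ^^ m) (env_of s, rels_of s)" "s1 6 = s 6" "s1 7 = s 7" "s1 8 = False # s 8" by auto
    let ?s' = "s1(8 := s 8)"
    have 5: "run (Pop 8) s1 1 ?s'" by (rule run_weaken[OF run_Pop]) (use s1(7) in auto)
    let ?B = "env_of s1 0"
    have b: "U (env_of s 0) \<le> (?B + 2) ^ u"
      by (rule order_trans[OF u]) (use s1(2) in \<open>auto intro: power_mono\<close>)
    have mB: "m \<le> (?B + 2) ^ k"
      by (rule order_trans[OF mV]) (use s1(2) in \<open>auto intro: power_mono\<close>)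
    then have "m * ((?B + 2) ^ a + 2) \<le> (?B + 2) ^ k * ((?B + 2) ^ a + 2)" by (rule mult_le_mono1)
    then have "run ?p s (?T ?B) ?s'"
      by (intro run_weaken[OF run_Seq[OF 1 run_Seq[OF 2 run_Seq[OF 3 run_Seq[OF 4 run_Seq[OF s1(3) 5]]]]]])
        (use b mB in simp_all)
    then show "\<exists>s'. inv_st K s' \<and> env_of s 0 \<le> env_of s' 0 \<and>
       run ?p s (?T (env_of s' 0)) s' \<and>
       (env_of s', rels_of s') = sem (Rep t c) (env_of s, rels_of s) \<and> s' 6 = s 6 \<and> s' 7 = s 7 \<and> s' 8 = s 8"
      using s1 by (intro exI[of _ ?s']) (auto simp: inv_st_def m_def)
  qed (intro polyb_intros)
  then show ?thesis by blast
qed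

text \<open>One exponent \<open>K\<close> has to serve a whole program, since the length invariant
  is handed from command to command. Each definition only asks that \<open>K\<close> be large
  enough, which explains the threshold \<open>K0\<close>.\<close>

theorem cev_cmd: "wf_cmd c \<Longrightarrow> \<exists>K0. \<forall>K\<ge>K0. \<exists>p a. cev K c p a"
proof (induction c)
  case Nop
  show ?case using cev_Nop by metis
next
  case (Asg x y f)
  then show ?case using cev_Asg[of x _ y f] by auto
next
  case (Def R x t f)
  then show ?case using cev_Def[of R x t f] by auto
next
  case (Grow t)
  show ?case using cev_Grow by metis
next
  case (Sq c d)
  then obtain K0 K1 where "\<forall>K\<ge>K0. \<exists>p a. cev K c p a" "\<forall>K\<ge>K1. \<exists>p a. cev K d p a" by auto
  then have "\<forall>K\<ge>max K0 K1. \<exists>p a. cev K (Sq c d) p a" using cev_Sq by (metis max.bounded_iff)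
  then show ?case by blast
next
  case (If f c d)
  then obtain K0 K1 where "\<forall>K\<ge>K0. \<exists>p a. cev K c p a" "\<forall>K\<ge>K1. \<exists>p a. cev K d p a" by auto
  then have "\<forall>K\<ge>max K0 K1. \<exists>p a. cev K (If f c d) p a" using cev_If by (metis max.bounded_iff)
  then show ?case by blast
next
  case (Rep t c)
  then obtain K0 where "\<forall>K\<ge>K0. \<exists>p a. cev K c p a" by auto
  then have "\<forall>K\<ge>K0. \<exists>p a. cev K (Rep t c) p a" using cev_Rep by metis
  then show ?case by blast
qed

subsection \<open>Irrelevant vertices\<close>

definition gr :: "nat \<Rightarrow> (nat \<Rightarrow> nat \<Rightarrow> bool) \<Rightarrow> bool" where
  "gr n E \<longleftrightarrow> (\<forall>u v. E u v \<longrightarrow> u < n \<and> v < n \<and> u \<noteq> v \<and> E v u)"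

definition adjb :: "nat \<Rightarrow> (nat \<Rightarrow> nat \<Rightarrow> bool) \<Rightarrow> nat \<Rightarrow> nat \<Rightarrow> bool" where
  "adjb n E x u \<longleftrightarrow> x = n \<or> E x u"

text \<open>The positions \<open>p < k * D\<close> enumerate the vertices of \<open>k\<close> paths with \<open>D\<close> vertices each.\<close>

definition links :: "(nat \<Rightarrow> nat \<Rightarrow> bool) \<Rightarrow> nat \<Rightarrow> nat \<Rightarrow> (nat \<Rightarrow> nat) \<Rightarrow> bool" where
  "links E D m \<phi> \<longleftrightarrow> (\<forall>p<m. Suc p mod D \<noteq> 0 \<longrightarrow> E (\<phi> p) (\<phi> (Suc p)))"

definition solution :: "nat \<Rightarrow> (nat \<Rightarrow> nat \<Rightarrow> bool) \<Rightarrow> nat \<Rightarrow> nat \<Rightarrow> (nat \<Rightarrow> nat) \<Rightarrow> bool" where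
  "solution n E D m \<phi> \<longleftrightarrow> inj_on \<phi> {..<m} \<and> \<phi> ` {..<m} \<subseteq> {..<n} \<and> links E D m \<phi>"

text \<open>A code \<open>g\<close> of a walk consists of a modulus \<open>g 0\<close> and the residues \<open>g 1, g 2, \<dots>\<close> of its
  vertices. A walk whose code has distinct residues is a path. The vertex \<open>n\<close>, which lies outside
  the graph, stands for the missing neighbour at an end of a path.\<close>

definition okc :: "(nat \<Rightarrow> nat) \<Rightarrow> nat \<Rightarrow> bool" where
  "okc g i \<longleftrightarrow> 1 \<le> g 0 \<and> (\<forall>b\<le>i. \<forall>a<b. g (Suc a) \<noteq> g (Suc b))"

definition walk :: "(nat \<Rightarrow> nat \<Rightarrow> bool) \<Rightarrow> nat set \<Rightarrow> (nat \<Rightarrow> nat) \<Rightarrow> nat \<Rightarrow> (nat \<Rightarrow> nat) \<Rightarrow> bool" where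
  "walk E A g i u \<longleftrightarrow> (\<forall>j\<le>i. u j \<in> A \<and> u j mod g 0 = g (Suc j)) \<and> (\<forall>j<i. E (u j) (u (Suc j)))"

definition Seg :: "nat \<Rightarrow> (nat \<Rightarrow> nat \<Rightarrow> bool) \<Rightarrow> nat set \<Rightarrow> (nat \<Rightarrow> nat) \<Rightarrow> nat \<Rightarrow> nat \<Rightarrow> nat \<Rightarrow> bool" where
  "Seg n E A g x y i \<longleftrightarrow> (\<exists>u. walk E A g i u \<and> adjb n E x (u 0) \<and> adjb n E y (u i))"

definition dg :: "nat \<Rightarrow> nat \<Rightarrow> nat \<Rightarrow> nat" where
  "dg \<beta> c i = c div \<beta> ^ i mod \<beta>"

lemma dg_ex:
  assumes "\<And>j. j < l \<Longrightarrow> g j < \<beta>"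
  shows "\<exists>c<\<beta> ^ l. \<forall>j<l. dg \<beta> c j = g j"
  using assms
proof (induction l arbitrary: g)
  case 0
  show ?case by auto
next
  case (Suc l)
  obtain c where c: "c < \<beta> ^ l" "\<forall>j<l. dg \<beta> c j = g (Suc j)"
    using Suc.IH[of "\<lambda>j. g (Suc j)"] Suc.prems by auto
  have g0: "g 0 < \<beta>" using Suc.prems by auto
  let ?c = "c * \<beta> + g 0"
  have "?c < (c + 1) * \<beta>" using g0 by simp
  also have "\<dots> \<le> \<beta> ^ l * \<beta>" using c(1) by (intro mult_le_mono1) simp
  finally have 1: "?c < \<beta> ^ Suc l" by (simp add: mult.commute)
  have dv: "?c div \<beta> = c" using g0 by simp
  have "dg \<beta> ?c j = g j" if "j < Suc l" for j
  proof (cases j)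
    case 0
    then show ?thesis using g0 by (simp add: dg_def)
  next
    case (Suc i)
    have "?c div \<beta> ^ Suc i = ?c div \<beta> div \<beta> ^ i" by (simp add: div_mult2_eq)
    then show ?thesis using c(2) Suc that by (simp add: dg_def dv)
  qed
  then show ?case using 1 by blast
qed

lemma okc_inj: assumes "okc g i" "walk E A g i u" shows "inj_on u {..i}"
proof (rule inj_onI)
  fix a b assume ab: "a \<in> {..i}" "b \<in> {..i}" "u a = u b"
  then have e: "g (Suc a) = g (Suc b)" using assms(2) unfolding walk_def by (metis atMost_iff)
  show "a = b"
  proof (rule ccontr)
    assume "a \<noteq> b"
    then consider "a < b" | "b < a" by linarith
    then show False
    proof cases
      case 1
      then have "g (Suc a) \<noteq> g (Suc b)" using assms(1) ab unfolding okc_def by auto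
      then show False using e by simp
    next
      case 2
      then have "g (Suc b) \<noteq> g (Suc a)" using assms(1) ab unfolding okc_def by auto
      then show False using e by simp
    qed
  qed
qed

text \<open>The maximal segment \<open>l, \<dots>, r\<close> of positions within one path that satisfy \<open>Q\<close>.\<close>

definition iv :: "nat \<Rightarrow> nat \<Rightarrow> (nat \<Rightarrow> bool) \<Rightarrow> nat \<Rightarrow> nat \<Rightarrow> bool" where
  "iv D m Q l r \<longleftrightarrow> l \<le> r \<and> r < m \<and> (\<forall>p. l \<le> p \<and> p \<le> r \<longrightarrow> Q p) \<and>
     (\<forall>p. l \<le> p \<and> p < r \<longrightarrow> Suc p mod D \<noteq> 0) \<and>
     (0 < l \<longrightarrow> l mod D \<noteq> 0 \<longrightarrow> \<not> Q (l - 1)) \<and> (Suc r mod D \<noteq> 0 \<longrightarrow> \<not> Q (Suc r))"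

lemma iv_ex:
  assumes "p < m" "Q p" "D dvd m" "0 < D"
  shows "\<exists>l r. iv D m Q l r \<and> l \<le> p \<and> p \<le> r"
proof -
  let ?L = "\<lambda>l. l \<le> p \<and> (\<forall>q. l \<le> q \<and> q \<le> p \<longrightarrow> Q q) \<and> (\<forall>q. l \<le> q \<and> q < p \<longrightarrow> Suc q mod D \<noteq> 0)"
  define l where "l = (LEAST l. ?L l)"
  have "?L p" using assms by auto
  then have l: "?L l" unfolding l_def by (rule LeastI)
  have lmin: "\<And>l'. ?L l' \<Longrightarrow> l \<le> l'" unfolding l_def by (rule Least_le)
  let ?R = "\<lambda>r. p \<le> r \<and> r < m \<and> (\<forall>q. p \<le> q \<and> q \<le> r \<longrightarrow> Q q) \<and> (\<forall>q. p \<le> q \<and> q < r \<longrightarrow> Suc q mod D \<noteq> 0)"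
  define r where "r = Max {r. ?R r}"
  have fin: "finite {r. ?R r}" by (rule finite_subset[of _ "{..<m}"]) auto
  have "?R p" using assms by auto
  then have r: "?R r" using Max_in[OF fin] unfolding r_def by blast
  have rmax: "\<And>r'. ?R r' \<Longrightarrow> r' \<le> r" unfolding r_def by (rule Max_ge[OF fin]) blast
  have "\<not> Q (l - 1)" if "0 < l" "l mod D \<noteq> 0"
  proof
    assume q: "Q (l - 1)"
    have "?L (l - 1)"
    proof (intro conjI allI impI)
      show "l - 1 \<le> p" using l by linarith
      fix x assume x: "l - 1 \<le> x \<and> x \<le> p"
      show "Q x" using x l q by (cases "x = l - 1") auto
    next
      fix x assume x: "l - 1 \<le> x \<and> x < p"
      show "Suc x mod D \<noteq> 0" using x l that by (cases "x = l - 1") auto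
    qed
    from lmin[OF this] that show False by linarith
  qed
  moreover have "\<not> Q (Suc r)" if s: "Suc r mod D \<noteq> 0"
  proof
    assume q: "Q (Suc r)"
    have "Suc r \<noteq> m" using s assms(3) by (auto simp: dvd_eq_mod_eq_0)
    then have "?R (Suc r)" using r q s by (auto simp: le_Suc_eq less_Suc_eq)
    from rmax[OF this] show False by simp
  qed
  moreover have "Q q" if "l \<le> q" "q \<le> r" for q
    using l r that by (cases "q \<le> p") auto
  moreover have "Suc q mod D \<noteq> 0" if "l \<le> q" "q < r" for q
    using l r that by (cases "q < p") auto
  moreover have "l \<le> r" "r < m" using l r by auto
  ultimately have "iv D m Q l r" unfolding iv_def by blast
  then show ?thesis using l r by blast
qed

lemma iv_sub:
  assumes "iv D m Q l r" "l \<le> p" "p \<le> r" "l' \<le> p" "p \<le> r'"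
    and "\<And>q. l' \<le> q \<Longrightarrow> q \<le> r' \<Longrightarrow> Q q" "\<And>q. l' \<le> q \<Longrightarrow> q < r' \<Longrightarrow> Suc q mod D \<noteq> 0"
  shows "l \<le> l' \<and> r' \<le> r"
proof (intro conjI)
  show "l \<le> l'"
  proof (rule ccontr)
    assume "\<not> l \<le> l'"
    then have "l' \<le> l - 1" "l - 1 \<le> r'" "l - 1 < r'" "0 < l" using assms(2-5) by linarith+
    then have "Q (l - 1)" "Suc (l - 1) mod D \<noteq> 0" using assms(6,7) by blast+
    then show False using assms(1) \<open>0 < l\<close> unfolding iv_def by simp
  qed
  show "r' \<le> r"
  proof (rule ccontr)
    assume "\<not> r' \<le> r"
    then have "l' \<le> r" "r < r'" "Suc r \<le> r'" "l' \<le> Suc r" using assms(2-5) by linarith+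
    then have "Q (Suc r)" "Suc r mod D \<noteq> 0" using assms(6,7) by blast+
    then show False using assms(1) unfolding iv_def by simp
  qed
qed

lemma iv_unique:
  assumes "iv D m Q l r" "iv D m Q l' r'" "l \<le> p" "p \<le> r" "l' \<le> p" "p \<le> r'"
  shows "l = l' \<and> r = r'"
proof -
  have "l \<le> l' \<and> r' \<le> r"
    by (rule iv_sub[OF assms(1,3-6)]) (use assms(2) in \<open>auto simp: iv_def\<close>)
  moreover have "l' \<le> l \<and> r \<le> r'"
    by (rule iv_sub[OF assms(2,5,6,3,4)]) (use assms(1) in \<open>auto simp: iv_def\<close>)
  ultimately show ?thesis by linarith
qed

lemma iv_length: assumes "iv D m Q l r" "0 < D" shows "r - l < D"
proof (rule ccontr)
  assume a: "\<not> r - l < D"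
  \<comment> \<open>The first multiple of \<open>D\<close> after \<open>l\<close>; an interval of
    more than \<open>D\<close> positions would cross this end of a path.\<close>
  define q where "q = (l div D + 1) * D"
  have "l < q" "q \<le> l + D" unfolding q_def using assms(2) dividend_less_div_times[of D l]
    by (simp_all add: algebra_simps)
  then have "l \<le> q - 1" "q - 1 < r" "Suc (q - 1) = q" using a assms(2) by linarith+
  then have "q mod D \<noteq> 0" using assms(1) unfolding iv_def by metis
  then show False unfolding q_def by simp
qed

text \<open>\<open>anc v\<close> holds the ancestors of \<open>v\<close> in an elimination forest of \<open>G - S\<close>. Separating moduli
  below \<open>\<beta>\<close> exist, so that the digits of a number below \<open>C\<close> in base \<open>\<beta>\<close> give a code.\<close>

locale forest =
  fixes n :: nat and E :: "nat \<Rightarrow> nat \<Rightarrow> bool" and S :: "nat set" and anc :: "nat \<Rightarrow> nat set"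
    and D m \<beta> C :: nat
  assumes gr: "gr n E" and S_n: "S \<subseteq> {..<n}"
    and D0: "0 < D" and D_m: "D dvd m"
    and anc_V: "a \<in> anc v \<Longrightarrow> a < n \<and> a \<notin> S \<and> v < n \<and> v \<notin> S"
    and anc_refl: "v < n \<Longrightarrow> v \<notin> S \<Longrightarrow> v \<in> anc v"
    and anc_trans: "a \<in> anc b \<Longrightarrow> b \<in> anc c \<Longrightarrow> a \<in> anc c"
    and anc_chain: "a \<in> anc c \<Longrightarrow> b \<in> anc c \<Longrightarrow> a \<in> anc b \<or> b \<in> anc a"
    and anc_E: "E u w \<Longrightarrow> u \<notin> S \<Longrightarrow> w \<notin> S \<Longrightarrow> u \<in> anc w \<or> w \<in> anc u"
    and anc_card: "card (anc v) < D"
    and sep: "\<And>Y. Y \<subseteq> {..<n} \<Longrightarrow> card Y \<le> D * D \<Longrightarrow> \<exists>p\<ge>1. p < \<beta> \<and> inj_on (\<lambda>y. y mod p) Y"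
    and C: "C = \<beta> ^ Suc D"
begin

definition T :: "nat \<Rightarrow> nat set" where "T v = {u. v \<in> anc u}"

text \<open>Subtrees at incomparable vertices are disjoint, and a vertex has less than \<open>D\<close> ancestors.
  Hence a segment found in \<open>D * (m + 1)\<close> subtrees has \<open>m + 1\<close> disjoint copies. The vertices \<open>H\<close>
  are the roots of the subtrees that contain some rarer segment.\<close>

definition freq :: "(nat \<Rightarrow> nat) \<Rightarrow> nat \<Rightarrow> nat \<Rightarrow> nat \<Rightarrow> bool" where
  "freq g x y i \<longleftrightarrow> D * (m + 1) \<le> card {v. v < n \<and> Seg n E (T v) g x y i}"

definition H :: "nat set" where
  "H = {v. v < n \<and> v \<notin> S \<and> (\<exists>c<C. \<exists>x\<in>insert n S. \<exists>y\<in>insert n S. \<exists>i<D.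
     okc (dg \<beta> c) i \<and> Seg n E (T v) (dg \<beta> c) x y i \<and> \<not> freq (dg \<beta> c) x y i)}"

text \<open>The region of \<open>v\<close>. By \<open>E_anc_H\<close>, a walk that avoids
  \<open>S\<close> and \<open>H\<close> never leaves its region.\<close>

definition U :: "nat \<Rightarrow> nat set" where
  "U v = {u. u < n \<and> u \<notin> S \<and> u \<notin> H \<and> (\<forall>a\<in>H. a \<in> anc u \<longleftrightarrow> a \<in> anc v)}"

text \<open>The ends \<open>x\<close> and \<open>y\<close> range over \<open>S\<close>,
  \<open>H\<close> and the dummy \<open>n\<close>, because a maximal piece of a path inside a region
  is bounded by such vertices or by an end of the path.\<close>

definition irr :: "nat \<Rightarrow> bool" where
  "irr v \<longleftrightarrow> v < n \<and> v \<notin> S \<and> v \<notin> H \<and>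
     (\<forall>c<C. \<forall>x\<in>insert n (S \<union> H). \<forall>y\<in>insert n (S \<union> H). \<forall>i<D. okc (dg \<beta> c) i \<longrightarrow>
        Seg n E (U v) (dg \<beta> c) x y i \<longrightarrow> Seg n E (U v - {v}) (dg \<beta> c) x y i)"

text \<open>The bound \<open>m + 1\<close> leaves room for all vertices of a solution and one
  further vertex to be avoided. Segments with this property are called soft, the others
  hard.\<close>

definition many :: "nat \<Rightarrow> nat \<Rightarrow> nat \<Rightarrow> bool" where
  "many x y i \<longleftrightarrow> (\<forall>X. finite X \<longrightarrow> card X \<le> m + 1 \<longrightarrow> (\<exists>u. inj_on u {..i} \<and>
     (\<forall>j\<le>i. u j < n \<and> u j \<notin> S \<and> u j \<notin> X) \<and> (\<forall>j<i. E (u j) (u (Suc j))) \<and>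
     adjb n E x (u 0) \<and> adjb n E y (u i)))"

lemma E_D: "E u v \<Longrightarrow> u < n \<and> v < n \<and> u \<noteq> v \<and> E v u"
  using gr unfolding gr_def by blast

lemma finite_anc: "finite (anc v)"
  by (rule finite_subset[of _ "{..<n}"]) (use anc_V in auto)

lemma finite_S: "finite S"
  using S_n finite_subset by blast

lemma finite_H: "finite H"
  by (rule finite_subset[of _ "{..<n}"]) (auto simp: H_def)

lemma Seg_mono: "Seg n E A g x y i \<Longrightarrow> A \<subseteq> B \<Longrightarrow> Seg n E B g x y i"
  unfolding Seg_def walk_def by blast

text \<open>A forbidden vertex spoils only the subtrees at its fewer than \<open>D\<close>
  ancestors. So \<open>m + 1\<close> forbidden vertices spoil at most
  \<open>(m + 1) * (D - 1)\<close> of the \<open>D * (m + 1)\<close> subtrees that contain the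
  segment.\<close>

lemma freq_many: assumes ok: "okc g i" and f: "freq g x y i" shows "many x y i"
  unfolding many_def
proof (intro allI impI)
  fix X :: "nat set" assume X: "finite X" "card X \<le> m + 1"
  let ?bad = "\<Union>(anc ` X)"
  have "card ?bad \<le> (\<Sum>x\<in>X. card (anc x))" by (rule card_UN_le[OF X(1)])
  also have "\<dots> \<le> (\<Sum>x\<in>X. D - 1)"
  proof (rule sum_mono)
    fix x show "card (anc x) \<le> D - 1" using anc_card[of x] by linarith
  qed
  also have "\<dots> = card X * (D - 1)" by simp
  also have "\<dots> \<le> (m + 1) * (D - 1)" using X(2) by (rule mult_le_mono1)
  also have "\<dots> < D * (m + 1)" using D0 by (cases D) auto
  also have "\<dots> \<le> card {v. v < n \<and> Seg n E (T v) g x y i}" using f unfolding freq_def .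
  finally have lt: "card ?bad < card {v. v < n \<and> Seg n E (T v) g x y i}" .
  have "\<not> {v. v < n \<and> Seg n E (T v) g x y i} \<subseteq> ?bad"
  proof
    assume "{v. v < n \<and> Seg n E (T v) g x y i} \<subseteq> ?bad"
    then have "card {v. v < n \<and> Seg n E (T v) g x y i} \<le> card ?bad"
      by (rule card_mono[rotated]) (use X finite_anc in auto)
    then show False using lt by simp
  qed
  then obtain v where v: "Seg n E (T v) g x y i" "v \<notin> ?bad" by blast
  then obtain u where u: "walk E (T v) g i u" "adjb n E x (u 0)" "adjb n E y (u i)" unfolding Seg_def by blast
  have "u j < n \<and> u j \<notin> S \<and> u j \<notin> X" if "j \<le> i" for j
  proof -
    have "v \<in> anc (u j)" using u(1) that unfolding walk_def T_def by auto
    then show ?thesis using anc_V[of v "u j"] v(2) by blast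
  qed
  then show "\<exists>u. inj_on u {..i} \<and>
     (\<forall>j\<le>i. u j < n \<and> u j \<notin> S \<and> u j \<notin> X) \<and> (\<forall>j<i. E (u j) (u (Suc j))) \<and>
     adjb n E x (u 0) \<and> adjb n E y (u i)"
    using okc_inj[OF ok u(1)] u unfolding walk_def by blast
qed

text \<open>Adjacent vertices are comparable and the ancestors of a vertex form a chain. So when a
  walk is prolonged, either the old top stays on top or the new vertex takes over.\<close>

lemma walk_top:
  assumes "\<And>j. j \<le> i \<Longrightarrow> u j < n \<and> u j \<notin> S" "\<And>j. j < i \<Longrightarrow> E (u j) (u (Suc j))"
  shows "\<exists>t\<le>i. \<forall>j\<le>i. u t \<in> anc (u j)"
  using assms
proof (induction i)
  case 0
  then show ?case using anc_refl by auto
next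
  case (Suc i)
  then obtain t where t: "t \<le> i" "\<forall>j\<le>i. u t \<in> anc (u j)" by force
  have r: "u (Suc i) \<in> anc (u (Suc i))" using Suc.prems(1) anc_refl by blast
  have "E (u i) (u (Suc i))" "u i \<notin> S" "u (Suc i) \<notin> S" using Suc.prems by auto
  from anc_E[OF this] consider "u i \<in> anc (u (Suc i))" | "u (Suc i) \<in> anc (u i)" by blast
  then show ?case
  proof cases
    case 1
    then have "u t \<in> anc (u (Suc i))" using t anc_trans by blast
    then show ?thesis using t by (metis le_SucI le_Suc_eq)
  next
    case 2
    from anc_chain[OF this, of "u t"] t consider "u (Suc i) \<in> anc (u t)" | "u t \<in> anc (u (Suc i))" by blast
    then show ?thesis
    proof cases
      case 1
      then have "\<forall>j\<le>Suc i. u (Suc i) \<in> anc (u j)" using t r anc_trans by (metis le_Suc_eq)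
      then show ?thesis by blast
    next
      case 2
      then show ?thesis using t by (metis le_SucI le_Suc_eq)
    qed
  qed
qed

text \<open>The subtree at \<open>v\<close> is contained in the subtree at each ancestor of
  \<open>v\<close>, and so are its rare segments.\<close>

lemma H_anc: assumes "v \<in> H" "a \<in> anc v" shows "a \<in> H"
proof -
  have "T v \<subseteq> T a" unfolding T_def using assms(2) anc_trans by blast
  then show ?thesis using assms anc_V[OF assms(2)] Seg_mono unfolding H_def by blast
qed

text \<open>\<open>Y\<close> may be larger than the path: the modulus also has to tell the path from
  those vertices of the solution that a walk with the same code might hit.\<close>

lemma code_ex:
  assumes "i < D" "\<And>j. j \<le> i \<Longrightarrow> u j \<in> Y" "inj_on u {..i}" "Y \<subseteq> {..<n}" "card Y \<le> D * D"
  shows "\<exists>c<C. okc (dg \<beta> c) i \<and> (\<forall>j\<le>i. u j mod dg \<beta> c 0 = dg \<beta> c (Suc j)) \<and>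
    inj_on (\<lambda>y. y mod dg \<beta> c 0) Y"
proof -
  obtain p where p: "1 \<le> p" "p < \<beta>" "inj_on (\<lambda>y. y mod p) Y" using sep[OF assms(4,5)] by blast
  let ?g = "\<lambda>j. case j of 0 \<Rightarrow> p | Suc j \<Rightarrow> if j \<le> i then u j mod p else 0"
  have "?g j < \<beta>" for j
  proof (cases j)
    case (Suc j')
    have "u j' mod p < p" using p(1) by simp
    then show ?thesis using Suc p(2) by auto
  qed (use p in auto)
  then obtain c where c: "c < C" "\<forall>j<Suc D. dg \<beta> c j = ?g j" using dg_ex[of "Suc D" ?g \<beta>] C by auto
  have c0: "dg \<beta> c 0 = p" using c(2) by auto
  have cj: "dg \<beta> c (Suc j) = u j mod p" if "j \<le> i" for j
  proof -
    have "dg \<beta> c (Suc j) = ?g (Suc j)" using c(2) assms(1) that by (metis Suc_mono le_less_trans)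
    then show ?thesis using that by simp
  qed
  have "u a mod p \<noteq> u b mod p" if "a < b" "b \<le> i" for a b
  proof
    assume "u a mod p = u b mod p"
    then have "u a = u b" using p(3) assms(2) that by (auto simp: inj_on_def)
    then show False using assms(3) that by (auto simp: inj_on_def)
  qed
  then have "okc (dg \<beta> c) i" unfolding okc_def using c0 cj p(1) by auto
  then show ?thesis using c(1) c0 cj p(3) by auto
qed

definition lft :: "(nat \<Rightarrow> nat) \<Rightarrow> nat \<Rightarrow> nat" where
  "lft \<phi> l = (if 0 < l \<and> l mod D \<noteq> 0 then \<phi> (l - 1) else n)"

definition rgt :: "(nat \<Rightarrow> nat) \<Rightarrow> nat \<Rightarrow> nat" where
  "rgt \<phi> r = (if Suc r mod D \<noteq> 0 then \<phi> (Suc r) else n)"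

definition upd :: "(nat \<Rightarrow> nat) \<Rightarrow> nat \<Rightarrow> nat \<Rightarrow> (nat \<Rightarrow> nat) \<Rightarrow> nat \<Rightarrow> nat" where
  "upd \<phi> l r u = (\<lambda>p. if l \<le> p \<and> p \<le> r then u (p - l) else \<phi> p)"

lemma links_upd:
  assumes "links E D m \<phi>" "l \<le> r" "\<phi> ` {..<m} \<subseteq> {..<n}" "r < m"
    and u: "\<forall>j<r - l. E (u j) (u (Suc j))"
    and x: "adjb n E (lft \<phi> l) (u 0)" and y: "adjb n E (rgt \<phi> r) (u (r - l))"
  shows "links E D m (upd \<phi> l r u)"
  unfolding links_def
proof (intro allI impI)
  fix p assume p: "p < m" "Suc p mod D \<noteq> 0"
  have "Suc p \<noteq> m" using p(2) D_m by (auto simp: dvd_eq_mod_eq_0)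
  then have sp: "Suc p < m" using p by simp
  consider "Suc p < l" | "Suc p = l" | "l \<le> p" "p < r" | "p = r" | "r < p" by linarith
  then show "E (upd \<phi> l r u p) (upd \<phi> l r u (Suc p))"
  proof cases
    case 1
    then show ?thesis using assms(1) p unfolding links_def upd_def by auto
  next
    case 2
    have "lft \<phi> l = \<phi> p" unfolding lft_def using 2 p by auto
    moreover have "\<phi> p < n" using assms(3) p by auto
    ultimately have "E (\<phi> p) (u 0)" using x unfolding adjb_def by auto
    then show ?thesis using 2 assms(2) unfolding upd_def by auto
  next
    case 3
    then have "E (u (p - l)) (u (Suc (p - l)))" using u by auto
    then show ?thesis using 3 unfolding upd_def by (simp add: Suc_diff_le)
  next
    case 4
    have "rgt \<phi> r = \<phi> (Suc p)" unfolding rgt_def using 4 p by auto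
    moreover have "\<phi> (Suc p) < n" using assms(3) sp by auto
    ultimately have "E (\<phi> (Suc p)) (u (r - l))" using y unfolding adjb_def by auto
    then have "E (u (r - l)) (\<phi> (Suc p))" using E_D by blast
    then show ?thesis using 4 assms(2) unfolding upd_def by auto
  next
    case 5
    then show ?thesis using assms(1) p unfolding links_def upd_def by auto
  qed
qed

lemma upd_bound:
  assumes "\<phi> ` {..<m} \<subseteq> {..<n}" "\<forall>j\<le>r - l. u j < n"
  shows "upd \<phi> l r u ` {..<m} \<subseteq> {..<n}"
  using assms by (auto simp: upd_def image_subset_iff)

definition cover :: "(nat \<times> nat) set \<Rightarrow> nat set" where
  "cover J = {p. \<exists>(l, r)\<in>J. l \<le> p \<and> p \<le> r}"

text \<open>The soft segments are put back one after another; each has more pairwise disjoint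
  realisations than there are vertices to avoid.\<close>

lemma replace_soft:
  assumes "finite J"
    and "\<And>l r. (l, r) \<in> J \<Longrightarrow> iv D m (\<lambda>p. \<phi> p \<notin> S) l r \<and> many (lft \<phi> l) (rgt \<phi> r) (r - l)"
    and "links E D m \<psi>" "\<psi> ` {..<m} \<subseteq> {..<n}" "\<And>p. p < m \<Longrightarrow> \<phi> p \<in> S \<Longrightarrow> \<psi> p = \<phi> p"
    and "inj_on \<psi> ({..<m} - cover J)" "v \<notin> \<psi> ` ({..<m} - cover J)"
  shows "\<exists>\<psi>'. solution n E D m \<psi>' \<and> v \<notin> \<psi>' ` {..<m}"
  using assms
proof (induction J arbitrary: \<psi> rule: finite_induct)
  case empty
  then show ?case unfolding solution_def cover_def by auto
next
  case (insert x J)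
  obtain l r where x: "x = (l, r)" by (cases x)
  have ivlr: "iv D m (\<lambda>p. \<phi> p \<notin> S) l r" and mny: "many (lft \<phi> l) (rgt \<phi> r) (r - l)"
    using insert.prems(1)[of l r] x by auto
  let ?P = "{..<m} - cover (insert x J)"
  \<comment> \<open>The vertices already in place together with \<open>v\<close> are at most
    \<open>m + 1\<close>, which is what \<open>many\<close> tolerates.\<close>
  let ?X = "insert v (\<psi> ` ?P)"
  have "card (\<psi> ` ?P) \<le> card ?P" by (rule card_image_le) auto
  also have "\<dots> \<le> card {..<m}" by (rule card_mono) auto
  finally have "card ?X \<le> m + 1" by (simp add: card_insert_if)
  moreover have "finite ?X" by auto
  ultimately obtain u where u: "inj_on u {..r - l}" "\<forall>j\<le>r - l. u j < n \<and> u j \<notin> S \<and> u j \<notin> ?X"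
    "\<forall>j<r - l. E (u j) (u (Suc j))" "adjb n E (lft \<phi> l) (u 0)" "adjb n E (rgt \<phi> r) (u (r - l))"
    using mny unfolding many_def by blast
  have lr: "l \<le> r" "r < m" using ivlr unfolding iv_def by auto
  \<comment> \<open>The neighbours of the segment within its path lie in \<open>S\<close>, where
    \<open>\<psi>\<close> agrees with \<open>\<phi>\<close>. So the end conditions are still those
    for which \<open>many\<close> was established.\<close>
  have "lft \<psi> l = lft \<phi> l" unfolding lft_def
    using ivlr lr insert.prems(4)[of "l - 1"] unfolding iv_def by auto
  moreover have "rgt \<psi> r = rgt \<phi> r"
  proof (cases "Suc r mod D = 0")
    case False
    then have "Suc r \<noteq> m" using D_m by (auto simp: dvd_eq_mod_eq_0)
    then show ?thesis using ivlr lr insert.prems(4)[of "Suc r"] False unfolding iv_def rgt_def by auto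
  qed (simp add: rgt_def)
  ultimately have lk: "links E D m (upd \<psi> l r u)"
    using links_upd[OF insert.prems(2) lr(1) insert.prems(3) lr(2) u(3)] u(4,5) by simp
  show ?case
  proof (rule insert.IH[OF _ lk])
    show "iv D m (\<lambda>p. \<phi> p \<notin> S) l r \<and> many (lft \<phi> l) (rgt \<phi> r) (r - l)" if "(l, r) \<in> J" for l r
      using insert.prems(1) that by blast
    show "upd \<psi> l r u ` {..<m} \<subseteq> {..<n}"
      by (rule upd_bound[OF insert.prems(3)]) (use u(2) in auto)
    show "upd \<psi> l r u p = \<phi> p" if "p < m" "\<phi> p \<in> S" for p
      using ivlr insert.prems(4) that unfolding iv_def upd_def by auto
    have sub: "{..<m} - cover J \<subseteq> ?P \<union> {l..r}" unfolding cover_def x by auto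
    have "inj_on (upd \<psi> l r u) (?P \<union> {l..r})"
    proof (rule inj_onI)
      fix a b assume ab: "a \<in> ?P \<union> {l..r}" "b \<in> ?P \<union> {l..r}" "upd \<psi> l r u a = upd \<psi> l r u b"
      show "a = b"
      proof (cases "l \<le> a \<and> a \<le> r")
        case True
        show ?thesis
        proof (cases "l \<le> b \<and> b \<le> r")
          case True
          with \<open>l \<le> a \<and> a \<le> r\<close> have "u (a - l) = u (b - l)" "a - l \<in> {..r - l}" "b - l \<in> {..r - l}"
            using ab(3) unfolding upd_def by auto
          then have "a - l = b - l" using u(1) unfolding inj_on_def by blast
          then show ?thesis using True \<open>l \<le> a \<and> a \<le> r\<close> by linarith
        next
          case False
          then have "u (a - l) = \<psi> b" "b \<in> ?P" using ab True unfolding upd_def by auto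
          moreover have "a - l \<le> r - l" using True by linarith
          ultimately show ?thesis using u(2) by blast
        qed
      next
        case False
        show ?thesis
        proof (cases "l \<le> b \<and> b \<le> r")
          case True
          then have "u (b - l) = \<psi> a" "a \<in> ?P" using ab False unfolding upd_def by auto
          moreover have "b - l \<le> r - l" using True by linarith
          ultimately show ?thesis using u(2) by (metis imageI insertCI)
        next
          case False
          then have "\<psi> a = \<psi> b" "a \<in> ?P" "b \<in> ?P" using \<open>\<not> (l \<le> a \<and> a \<le> r)\<close> ab unfolding upd_def by auto
          then show ?thesis using insert.prems(5) unfolding inj_on_def by blast
        qed
      qed
    qed
    then show "inj_on (upd \<psi> l r u) ({..<m} - cover J)" using sub inj_on_subset by blast
    have "upd \<psi> l r u a \<noteq> v" if "a \<in> ?P \<union> {l..r}" for a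
    proof (cases "l \<le> a \<and> a \<le> r")
      case True
      then have "a - l \<le> r - l" by linarith
      then show ?thesis using u(2) True unfolding upd_def by auto
    next
      case False
      then have "upd \<psi> l r u a = \<psi> a" "a \<in> ?P" using that unfolding upd_def by auto
      then show ?thesis using insert.prems(6) by auto
    qed
    then show "v \<notin> upd \<psi> l r u ` ({..<m} - cover J)" using sub by blast
  qed
qed

text \<open>Let \<open>u\<close> be an ancestor of \<open>w\<close>. An ancestor \<open>a\<close> of
  \<open>w\<close> is comparable with \<open>u\<close>, and \<open>u\<close> above \<open>a\<close>
  would put \<open>u\<close> into \<open>H\<close>, which is closed under ancestors. So
  \<open>a\<close> is above \<open>u\<close>.\<close>

lemma E_anc_H:
  assumes "E u w" "u \<notin> S" "w \<notin> S" "u \<notin> H" "w \<notin> H" "a \<in> H"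
  shows "a \<in> anc u \<longleftrightarrow> a \<in> anc w"
proof -
  have *: "a \<in> anc u \<longleftrightarrow> a \<in> anc w" if "u \<in> anc w" "u \<notin> H" for u w
  proof
    assume "a \<in> anc u" then show "a \<in> anc w" using that anc_trans by blast
  next
    assume "a \<in> anc w"
    then show "a \<in> anc u" using anc_chain[OF _ that(1), of a] H_anc[OF assms(6)] that(2) by blast
  qed
  show ?thesis using anc_E[OF assms(1-3)] *[of u w] *[of w u] assms(4,5) by blast
qed

text \<open>By \<open>walk_top\<close> the segment lies in the subtree at one of its own vertices.
  It has a code with distinct residues, and if it were frequent for this code, then
  \<open>freq_many\<close> would make it soft. So it is rare, and the top vertex is in
  \<open>H\<close>.\<close>

lemma hard_top:
  assumes sol: "solution n E D m \<phi>" and ivlr: "iv D m (\<lambda>p. \<phi> p \<notin> S) l r"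
    and hard: "\<not> many (lft \<phi> l) (rgt \<phi> r) (r - l)"
  shows "\<exists>t. l \<le> t \<and> t \<le> r \<and> \<phi> t \<in> H \<and> (\<forall>p. l \<le> p \<and> p \<le> r \<longrightarrow> \<phi> t \<in> anc (\<phi> p))"
proof -
  have lr: "l \<le> r" "r < m" using ivlr unfolding iv_def by auto
  have iD: "r - l < D" by (rule iv_length[OF ivlr D0])
  let ?u = "\<lambda>j. \<phi> (l + j)"
  have inj: "inj_on \<phi> {..<m}" and im: "\<phi> ` {..<m} \<subseteq> {..<n}" and lk: "links E D m \<phi>"
    using sol unfolding solution_def by auto
  have V: "?u j < n \<and> ?u j \<notin> S" if "j \<le> r - l" for j
  proof -
    have "l + j < m" "l \<le> l + j" "l + j \<le> r" using that lr by auto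
    then have "\<phi> (l + j) < n" using im by auto
    moreover have "\<phi> (l + j) \<notin> S" using ivlr \<open>l \<le> l + j\<close> \<open>l + j \<le> r\<close> unfolding iv_def by simp
    ultimately show ?thesis by simp
  qed
  have Eu: "E (?u j) (?u (Suc j))" if "j < r - l" for j
  proof -
    have "l + j < m" "l \<le> l + j" "l + j < r" using that lr by auto
    then have "Suc (l + j) mod D \<noteq> 0" using ivlr unfolding iv_def by blast
    then show ?thesis using lk \<open>l + j < m\<close> unfolding links_def by simp
  qed
  have "\<exists>t\<le>r - l. \<forall>j\<le>r - l. ?u t \<in> anc (?u j)" by (rule walk_top[of "r - l" ?u]) (erule V, erule Eu)
  then obtain t where t: "t \<le> r - l" "\<forall>j\<le>r - l. ?u t \<in> anc (?u j)" by (elim exE conjE)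
  have inju: "inj_on ?u {..r - l}"
  proof (rule inj_onI)
    fix a b assume h: "a \<in> {..r - l}" "b \<in> {..r - l}" "?u a = ?u b"
    have "l + a = l + b" by (rule inj_onD[OF inj h(3)]) (use h lr in auto)
    then show "a = b" by simp
  qed
  let ?Y = "?u ` {..r - l}"
  have "card ?Y \<le> card {..r - l}" by (rule card_image_le) auto
  also have "\<dots> \<le> D" using iD by simp
  also have "\<dots> \<le> D * D" by simp
  finally have cY: "card ?Y \<le> D * D" .
  have "\<exists>c<C. okc (dg \<beta> c) (r - l) \<and> (\<forall>j\<le>r - l. ?u j mod dg \<beta> c 0 = dg \<beta> c (Suc j)) \<and>
    inj_on (\<lambda>y. y mod dg \<beta> c 0) ?Y"
    by (rule code_ex[OF iD _ inju _ cY]) (use V in auto)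
  then obtain c where c: "c < C" "okc (dg \<beta> c) (r - l)" "\<forall>j\<le>r - l. ?u j mod dg \<beta> c 0 = dg \<beta> c (Suc j)" by blast
  have w: "walk E (T (?u t)) (dg \<beta> c) (r - l) ?u"
    unfolding walk_def T_def using t(2) c(3) Eu by auto
  have ax: "adjb n E (lft \<phi> l) (?u 0)"
  proof (cases "0 < l \<and> l mod D \<noteq> 0")
    case True
    then have "l - 1 < m" "Suc (l - 1) mod D \<noteq> 0" using lr by auto
    then have "E (\<phi> (l - 1)) (\<phi> (Suc (l - 1)))" using lk unfolding links_def by blast
    then show ?thesis using True unfolding lft_def adjb_def by auto
  qed (auto simp: lft_def adjb_def)
  have ay: "adjb n E (rgt \<phi> r) (?u (r - l))"
  proof (cases "Suc r mod D \<noteq> 0")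
    case True
    then have "E (\<phi> r) (\<phi> (Suc r))" using lk lr unfolding links_def by auto
    then show ?thesis using True lr E_D unfolding rgt_def adjb_def by auto
  qed (auto simp: rgt_def adjb_def)
  have sg: "Seg n E (T (?u t)) (dg \<beta> c) (lft \<phi> l) (rgt \<phi> r) (r - l)"
    unfolding Seg_def using w ax ay by auto
  have nf: "\<not> freq (dg \<beta> c) (lft \<phi> l) (rgt \<phi> r) (r - l)" using freq_many[OF c(2)] hard by blast
  have "lft \<phi> l \<in> insert n S" using ivlr unfolding iv_def lft_def by auto
  moreover have "rgt \<phi> r \<in> insert n S" using ivlr unfolding iv_def rgt_def by auto
  ultimately have "\<exists>x\<in>insert n S. \<exists>y\<in>insert n S. \<exists>i<D.
     okc (dg \<beta> c) i \<and> Seg n E (T (?u t)) (dg \<beta> c) x y i \<and> \<not> freq (dg \<beta> c) x y i"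
    using c(2) sg nf iD
    by (intro bexI[of _ "lft \<phi> l"] bexI[of _ "rgt \<phi> r"] exI[of _ "r - l"]) simp_all
  then have "?u t \<in> H" unfolding H_def using V[OF t(1)] c(1) by auto
  moreover have "\<phi> (l + t) \<in> anc (\<phi> p)" if "l \<le> p" "p \<le> r" for p
    using t(2)[rule_format, of "p - l"] that by auto
  ultimately show ?thesis using t(1) lr by (intro exI[of _ "l + t"]) auto
qed

text \<open>Soft segments are left out and restored at the end by \<open>replace_soft\<close>. If
  \<open>v\<close> lies on a hard one, the maximal piece around \<open>v\<close> outside
  \<open>S\<close> and \<open>H\<close> is exchanged for the walk that \<open>irr\<close> provides.
  The point is to choose the code so that this walk misses all other hard segments.\<close>

theorem irr_sound:
  assumes v: "irr v" and sol: "solution n E D m \<phi>"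
  shows "\<exists>\<psi>. solution n E D m \<psi> \<and> v \<notin> \<psi> ` {..<m}"
proof (cases "v \<in> \<phi> ` {..<m}")
  case False
  then show ?thesis using sol by blast
next
  case True
  then obtain p0 where p0: "p0 < m" "\<phi> p0 = v" by auto
  have inj: "inj_on \<phi> {..<m}" and im: "\<phi> ` {..<m} \<subseteq> {..<n}" and lk: "links E D m \<phi>"
    using sol unfolding solution_def by auto
  have vV: "v < n" "v \<notin> S" "v \<notin> H" using v unfolding irr_def by auto
  let ?Q = "\<lambda>p. \<phi> p \<notin> S"
  let ?J = "{(l, r). iv D m ?Q l r \<and> many (lft \<phi> l) (rgt \<phi> r) (r - l)}"
  have finJ: "finite ?J" by (rule finite_subset[of _ "{..<m} \<times> {..<m}"]) (auto simp: iv_def)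
  have hard: "\<exists>l r. iv D m ?Q l r \<and> l \<le> p \<and> p \<le> r \<and> \<not> many (lft \<phi> l) (rgt \<phi> r) (r - l)"
    if p: "p \<in> {..<m} - cover ?J" "\<phi> p \<notin> S" for p
  proof -
    obtain l r where lr: "iv D m ?Q l r" "l \<le> p" "p \<le> r"
      using iv_ex[of p m ?Q D] p(2) D_m D0 DiffD1[OF p(1)] by blast
    have "(l, r) \<notin> ?J" using lr p(1) unfolding cover_def by auto
    then show ?thesis using lr by auto
  qed
  have "\<exists>\<psi>. links E D m \<psi> \<and> \<psi> ` {..<m} \<subseteq> {..<n} \<and> (\<forall>p<m. \<phi> p \<in> S \<longrightarrow> \<psi> p = \<phi> p) \<and>
      inj_on \<psi> ({..<m} - cover ?J) \<and> v \<notin> \<psi> ` ({..<m} - cover ?J)"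
  proof (cases "p0 \<in> cover ?J")
    case True
    have "v \<notin> \<phi> ` ({..<m} - cover ?J)"
    proof
      assume "v \<in> \<phi> ` ({..<m} - cover ?J)"
      then obtain q where "q < m" "q \<notin> cover ?J" "\<phi> q = \<phi> p0" using p0 by auto
      then have "q = p0" using inj p0(1) unfolding inj_on_def by blast
      then show False using True \<open>q \<notin> cover ?J\<close> by blast
    qed
    then show ?thesis using lk im inj_on_subset[OF inj, of "{..<m} - cover ?J"] by blast
  next
    case False
    obtain l0 r0 where lr0: "iv D m ?Q l0 r0" "l0 \<le> p0" "p0 \<le> r0" "\<not> many (lft \<phi> l0) (rgt \<phi> r0) (r0 - l0)"
      using hard[of p0] False p0 vV by auto
    let ?Q2 = "\<lambda>p. \<phi> p \<notin> S \<union> H"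
    obtain l r where lr: "iv D m ?Q2 l r" "l \<le> p0" "p0 \<le> r"
      using iv_ex[of p0 m ?Q2 D] D_m D0 p0 vV by auto
    have lrm: "l \<le> r" "r < m" using lr unfolding iv_def by auto
    have q2: "\<phi> p \<notin> S \<and> \<phi> p \<notin> H" "p < m" "\<phi> p < n" if "l \<le> p" "p \<le> r" for p
    proof -
      show "\<phi> p \<notin> S \<and> \<phi> p \<notin> H" using lr(1) that unfolding iv_def by auto
      show "p < m" using that lrm by linarith
      then show "\<phi> p < n" using im by auto
    qed
    have lkp: "Suc p mod D \<noteq> 0" if "l \<le> p" "p < r" for p using lr(1) that unfolding iv_def by auto
    have sub0: "l0 \<le> l \<and> r \<le> r0"
      by (rule iv_sub[OF lr0(1-3) lr(2,3)]) (use q2 lkp in auto)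
    have Ep: "E (\<phi> p) (\<phi> (Suc p))" if "l \<le> p" "p < r" for p
      using lk lkp[OF that] that lrm unfolding links_def by auto
    have const: "(a \<in> anc (\<phi> p) \<longleftrightarrow> a \<in> anc (\<phi> l))" if "l \<le> p" "p \<le> r" "a \<in> H" for p a
      using that
    proof (induction rule: dec_induct)
      case (step p)
      have "a \<in> anc (\<phi> p) \<longleftrightarrow> a \<in> anc (\<phi> (Suc p))"
        by (rule E_anc_H) (use Ep[of p] q2[of p] q2[of "Suc p"] step in auto)
      then show ?case using step by auto
    qed auto
    have inU: "\<phi> p \<in> U v" if "l \<le> p" "p \<le> r" for p
      unfolding U_def using q2[OF that] const[OF that] const[OF lr(2,3)] p0 by auto
    \<comment> \<open>Positions outside \<open>cover ?J\<close> and \<open>S\<close> are those of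
      the hard segments. As the new walk stays in the region of \<open>v\<close>, it can collide
      only with vertices of \<open>Y\<close>. For a vertex \<open>a\<close>, \<open>?Z a\<close>
      below is the segment through \<open>a\<close>.\<close>
    define Y where "Y = \<phi> ` {p \<in> {..<m} - cover ?J. \<phi> p \<in> U v}"
    let ?Z = "\<lambda>a. \<phi> ` {q. \<exists>l r. iv D m ?Q l r \<and> l \<le> q \<and> q \<le> r \<and> (\<exists>q'. l \<le> q' \<and> q' \<le> r \<and> \<phi> q' = a)}"
    have "card (?Z a) \<le> D" for a
    proof (cases "\<exists>l r q'. iv D m ?Q l r \<and> l \<le> q' \<and> q' \<le> r \<and> \<phi> q' = a")
      case True
      then obtain l r q' where a: "iv D m ?Q l r" "l \<le> q'" "q' \<le> r" "\<phi> q' = a" by blast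
      have "?Z a \<subseteq> \<phi> ` {l..r}"
      proof (rule image_mono, rule subsetI)
        fix q assume "q \<in> {q. \<exists>l r. iv D m ?Q l r \<and> l \<le> q \<and> q \<le> r \<and> (\<exists>q'. l \<le> q' \<and> q' \<le> r \<and> \<phi> q' = a)}"
        then obtain l' r' q'' where b: "iv D m ?Q l' r'" "l' \<le> q" "q \<le> r'" "l' \<le> q''" "q'' \<le> r'" "\<phi> q'' = a" by auto
        have "q'' < m" "q' < m" using a b unfolding iv_def by auto
        then have "q'' = q'" using inj a(4) b(6) unfolding inj_on_def by auto
        then have "l' = l \<and> r' = r" using iv_unique[OF b(1) a(1), of q'] a b by auto
        then show "q \<in> {l..r}" using b by auto
      qed
      then have "card (?Z a) \<le> card (\<phi> ` {l..r})" by (rule card_mono[rotated]) auto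
      also have "\<dots> \<le> card {l..r}" by (rule card_image_le) auto
      also have "\<dots> \<le> D" using iv_length[OF a(1) D0] by auto
      finally show ?thesis .
    next
      case False
      then have "?Z a = {}" by blast
      then show ?thesis by (metis card.empty le0)
    qed note cardZ = this
    \<comment> \<open>A hard segment that meets the region of \<open>v\<close> has its top in
      \<open>H\<close>, hence among the ancestors of \<open>v\<close>, and the top determines the
      segment. So fewer than \<open>D\<close> segments with at most \<open>D\<close> vertices each
      cover \<open>Y\<close>.\<close>
    have "Y \<subseteq> (\<Union>a\<in>anc v. ?Z a)"
    proof
      fix y assume "y \<in> Y"
      then obtain p where p: "p \<in> {..<m} - cover ?J" "\<phi> p \<in> U v" "y = \<phi> p" unfolding Y_def by auto
      then have "\<phi> p \<notin> S" unfolding U_def by auto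
      then obtain l' r' where h: "iv D m ?Q l' r'" "l' \<le> p" "p \<le> r'" "\<not> many (lft \<phi> l') (rgt \<phi> r') (r' - l')"
        using hard[OF p(1)] by blast
      obtain t where t: "l' \<le> t" "t \<le> r'" "\<phi> t \<in> H" "\<forall>p. l' \<le> p \<and> p \<le> r' \<longrightarrow> \<phi> t \<in> anc (\<phi> p)"
        using hard_top[OF sol h(1,4)] by blast
      have "\<phi> t \<in> anc v" using t h p(2) unfolding U_def by auto
      moreover have "y \<in> ?Z (\<phi> t)" using h t p(3) by blast
      ultimately show "y \<in> (\<Union>a\<in>anc v. ?Z a)" by blast
    qed
    moreover have "finite (\<Union>a\<in>anc v. ?Z a)"
    proof -
      have "?Z a \<subseteq> \<phi> ` {..<m}" for a unfolding iv_def by (rule image_mono) auto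
      then show ?thesis by (meson UN_least finite_imageI finite_lessThan finite_subset)
    qed
    ultimately have "card Y \<le> card (\<Union>a\<in>anc v. ?Z a)" by (rule card_mono[rotated])
    also have "\<dots> \<le> (\<Sum>a\<in>anc v. card (?Z a))" by (rule card_UN_le[OF finite_anc])
    also have "\<dots> \<le> (\<Sum>a\<in>anc v. D)" by (rule sum_mono) (rule cardZ)
    also have "\<dots> \<le> D * D" using anc_card[of v] by simp
    finally have cardY: "card Y \<le> D * D" .
    have Yn: "Y \<subseteq> {..<n}" unfolding Y_def U_def by auto
    let ?u = "\<lambda>j. \<phi> (l + j)"
    have uncov: "p \<notin> cover ?J" if "l \<le> p" "p \<le> r" for p
    proof
      assume "p \<in> cover ?J"
      then obtain l' r' where a: "iv D m ?Q l' r'" "many (lft \<phi> l') (rgt \<phi> r') (r' - l')" "l' \<le> p" "p \<le> r'"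
        unfolding cover_def by auto
      then have "l' = l0 \<and> r' = r0" using iv_unique[OF a(1) lr0(1), of p] that sub0 by auto
      then show False using a(2) lr0(4) by auto
    qed
    have uY: "?u j \<in> Y" if "j \<le> r - l" for j
    proof -
      have "l \<le> l + j" "l + j \<le> r" "l + j < m" using that lrm by auto
      then show ?thesis unfolding Y_def using uncov inU by blast
    qed
    have iD: "r - l < D" by (rule iv_length[OF lr(1) D0])
    have inju: "inj_on ?u {..r - l}"
    proof (rule inj_onI)
      fix a b assume h: "a \<in> {..r - l}" "b \<in> {..r - l}" "?u a = ?u b"
      have "l + a = l + b" by (rule inj_onD[OF inj h(3)]) (use h lrm in auto)
      then show "a = b" by simp
    qed
    obtain c where c: "c < C" "okc (dg \<beta> c) (r - l)" "\<forall>j\<le>r - l. ?u j mod dg \<beta> c 0 = dg \<beta> c (Suc j)"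
      "inj_on (\<lambda>y. y mod dg \<beta> c 0) Y"
      using code_ex[OF iD uY inju Yn cardY] by blast
    have "?u j \<in> U v" if "j \<le> r - l" for j
      by (rule inU) (use that lrm in auto)
    then have w: "walk E (U v) (dg \<beta> c) (r - l) ?u"
      unfolding walk_def using c(3) Ep by auto
    have ax: "adjb n E (lft \<phi> l) (?u 0)"
    proof (cases "0 < l \<and> l mod D \<noteq> 0")
      case True
      then have "l - 1 < m" "Suc (l - 1) mod D \<noteq> 0" using lrm by auto
      then have "E (\<phi> (l - 1)) (\<phi> (Suc (l - 1)))" using lk unfolding links_def by blast
      then show ?thesis using True unfolding lft_def adjb_def by auto
    qed (auto simp: lft_def adjb_def)
    have ay: "adjb n E (rgt \<phi> r) (?u (r - l))"
    proof (cases "Suc r mod D \<noteq> 0")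
      case True
      then have "E (\<phi> r) (\<phi> (Suc r))" using lk lrm unfolding links_def by auto
      then show ?thesis using True lrm E_D unfolding rgt_def adjb_def by auto
    qed (auto simp: rgt_def adjb_def)
    have "Seg n E (U v) (dg \<beta> c) (lft \<phi> l) (rgt \<phi> r) (r - l)"
      unfolding Seg_def using w ax ay by auto
    moreover have "lft \<phi> l \<in> insert n (S \<union> H)" using lr(1) unfolding iv_def lft_def by auto
    moreover have "rgt \<phi> r \<in> insert n (S \<union> H)" using lr(1) unfolding iv_def rgt_def by auto
    ultimately have "Seg n E (U v - {v}) (dg \<beta> c) (lft \<phi> l) (rgt \<phi> r) (r - l)"
      using v c(1,2) iD unfolding irr_def by blast
    then obtain u where u: "walk E (U v - {v}) (dg \<beta> c) (r - l) u" "adjb n E (lft \<phi> l) (u 0)"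
      "adjb n E (rgt \<phi> r) (u (r - l))" unfolding Seg_def by blast
    have uU: "u j \<in> U v" "u j \<noteq> v" "u j < n" "u j \<notin> S" "u j mod dg \<beta> c 0 = ?u j mod dg \<beta> c 0" if "j \<le> r - l" for j
      using u(1) c(3) that unfolding walk_def U_def by auto
    let ?\<psi> = "upd \<phi> l r u"
    have "links E D m ?\<psi>"
      by (rule links_upd[OF lk lrm(1) im lrm(2) _ u(2,3)]) (use u(1) in \<open>auto simp: walk_def\<close>)
    moreover have "?\<psi> ` {..<m} \<subseteq> {..<n}" by (rule upd_bound[OF im]) (use uU in auto)
    moreover have "\<forall>p<m. \<phi> p \<in> S \<longrightarrow> ?\<psi> p = \<phi> p" using q2 unfolding upd_def by auto
    \<comment> \<open>In a collision \<open>\<phi> p = u j\<close>, the vertices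
      \<open>\<phi> p\<close> and \<open>\<phi> (l + j)\<close> have the same residue. Both lie in
      \<open>Y\<close>, on which the modulus is injective, so \<open>p = l + j\<close>.\<close>
    moreover have sepu: "\<phi> p \<noteq> u j" if "p \<in> {..<m} - cover ?J" "\<not> (l \<le> p \<and> p \<le> r)" "j \<le> r - l" for p j
    proof
      assume e: "\<phi> p = u j"
      then have "\<phi> p \<in> U v" using uU(1)[OF that(3)] by simp
      then have "\<phi> p \<in> Y" unfolding Y_def using that(1) by blast
      moreover have "\<phi> p mod dg \<beta> c 0 = ?u j mod dg \<beta> c 0" using e uU that by simp
      ultimately have "\<phi> p = ?u j" using c(4) uY[OF that(3)] unfolding inj_on_def by blast
      from inj_onD[OF inj this] have "p = l + j" using that lrm by auto
      then show False using that lrm by auto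
    qed
    have "inj_on ?\<psi> ({..<m} - cover ?J)"
    proof (rule inj_onI)
      fix a b assume ab: "a \<in> {..<m} - cover ?J" "b \<in> {..<m} - cover ?J" "?\<psi> a = ?\<psi> b"
      show "a = b"
      proof (cases "l \<le> a \<and> a \<le> r")
        case True
        then have al: "a - l \<le> r - l" by linarith
        show ?thesis
        proof (cases "l \<le> b \<and> b \<le> r")
          case True
          then have "u (a - l) = u (b - l)" "b - l \<le> r - l" using ab(3) \<open>l \<le> a \<and> a \<le> r\<close> unfolding upd_def by auto
          then have "a - l = b - l" using okc_inj[OF c(2) u(1)] al by (auto simp: inj_on_def)
          then show ?thesis using True \<open>l \<le> a \<and> a \<le> r\<close> by linarith
        next
          case False
          then have "\<phi> b = u (a - l)" using ab(3) True unfolding upd_def by auto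
          then show ?thesis using sepu[OF ab(2) False al] by blast
        qed
      next
        case False
        show ?thesis
        proof (cases "l \<le> b \<and> b \<le> r")
          case True
          then have "\<phi> a = u (b - l)" "b - l \<le> r - l" using ab(3) False unfolding upd_def by auto
          then show ?thesis using sepu[OF ab(1) False] by blast
        next
          case False
          then have "\<phi> a = \<phi> b" using ab(3) \<open>\<not> (l \<le> a \<and> a \<le> r)\<close> unfolding upd_def by auto
          then show ?thesis using inj ab unfolding inj_on_def by blast
        qed
      qed
    qed
    moreover have "v \<notin> ?\<psi> ` ({..<m} - cover ?J)"
    proof
      assume "v \<in> ?\<psi> ` ({..<m} - cover ?J)"
      then obtain q where q: "q < m" "?\<psi> q = v" by auto
      show False
      proof (cases "l \<le> q \<and> q \<le> r")
        case True
        then have "q - l \<le> r - l" "u (q - l) = v" using q(2) unfolding upd_def by auto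
        then show False using uU by blast
      next
        case False
        then have "\<phi> q = \<phi> p0" using q(2) p0 unfolding upd_def by auto
        then have "q = p0" using inj q(1) p0(1) unfolding inj_on_def by blast
        then show False using False lr by auto
      qed
    qed
    ultimately show ?thesis by blast
  qed
  then obtain \<psi> where psi: "links E D m \<psi>" "\<psi> ` {..<m} \<subseteq> {..<n}" "\<forall>p<m. \<phi> p \<in> S \<longrightarrow> \<psi> p = \<phi> p"
      "inj_on \<psi> ({..<m} - cover ?J)" "v \<notin> \<psi> ` ({..<m} - cover ?J)" by blast
  show ?thesis
    by (rule replace_soft[where \<phi> = \<phi>, OF finJ _ psi(1,2) _ psi(4,5)]) (use psi(3) in auto)
qed

text \<open>\<open>H\<close> is covered by the roots belonging to rare choices of a code, a length
  and two ends. By the definition of \<open>freq\<close>, such a choice has fewer than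
  \<open>D * (m + 1)\<close> roots.\<close>

lemma card_H: "card H \<le> C * D * (card S + 1) * (card S + 1) * (D * (m + 1))"
proof -
  let ?I = "{..<C} \<times> {..<D} \<times> insert n S \<times> insert n S"
  let ?V = "\<lambda>(c, i, x, y). {v. v < n \<and> Seg n E (T v) (dg \<beta> c) x y i}"
  let ?J = "{(c, i, x, y) \<in> ?I. \<not> freq (dg \<beta> c) x y i}"
  have fI: "finite ?I" using finite_S by auto
  have fJ: "finite ?J" by (rule finite_subset[OF _ fI]) auto
  have "H \<subseteq> \<Union>(?V ` ?J)"
  proof
    fix v assume "v \<in> H"
    then obtain c x y i where "v < n" "c < C" "x \<in> insert n S" "y \<in> insert n S" "i < D"
      "Seg n E (T v) (dg \<beta> c) x y i" "\<not> freq (dg \<beta> c) x y i" unfolding H_def by blast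
    then have "(c, i, x, y) \<in> ?J" "v \<in> ?V (c, i, x, y)" by auto
    then show "v \<in> \<Union>(?V ` ?J)" by blast
  qed
  moreover have "finite (\<Union>(?V ` ?J))" by (rule finite_subset[of _ "{..<n}"]) auto
  ultimately have "card H \<le> card (\<Union>(?V ` ?J))" by (rule card_mono[rotated])
  also have "\<dots> \<le> (\<Sum>j\<in>?J. card (?V j))" by (rule card_UN_le[OF fJ])
  also have "\<dots> \<le> (\<Sum>j\<in>?J. D * (m + 1))" by (rule sum_mono) (auto simp: freq_def)
  also have "\<dots> = card ?J * (D * (m + 1))" by simp
  also have "\<dots> \<le> card ?I * (D * (m + 1))"
    by (rule mult_le_mono1, rule card_mono[OF fI]) auto
  finally have 1: "card H \<le> card ?I * (D * (m + 1))" .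
  have X: "card (insert n S) \<le> card S + 1" using finite_S by (simp add: card_insert_if)
  have "card ?I = C * D * card (insert n S) * card (insert n S)"
    by (simp only: card_cartesian_product card_lessThan mult.assoc)
  also have "\<dots> \<le> C * D * (card S + 1) * (card S + 1)" by (intro mult_le_mono X order_refl)
  finally show ?thesis using 1 mult_le_mono1 order_trans by blast
qed

text \<open>If \<open>v\<close> is not irrelevant, then for some code, length and ends all matching
  walks in the region pass through \<open>v\<close>. So an arbitrary matching walk contains
  \<open>v\<close>, and one walk for each choice covers the region, with at most \<open>D\<close>
  vertices per walk.\<close>

lemma card_U:
  assumes none: "\<And>v. \<not> irr v"
  shows "card (U w) \<le> C * D * (card S + card H + 1) * (card S + card H + 1) * D"
proof -
  let ?X = "insert n (S \<union> H)"
  let ?I = "{..<C} \<times> {..<D} \<times> ?X \<times> ?X"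
  let ?P = "\<lambda>(c, i, x, y) u. okc (dg \<beta> c) i \<and> walk E (U w) (dg \<beta> c) i u \<and> adjb n E x (u 0) \<and> adjb n E y (u i)"
  let ?Z = "\<lambda>(c, i, x, y). (SOME u. ?P (c, i, x, y) u) ` {..i}"
  have fI: "finite ?I" using finite_S finite_H by auto
  have "U w \<subseteq> \<Union>(?Z ` ?I)"
  proof
    fix v assume v: "v \<in> U w"
    then have Uv: "U v = U w" unfolding U_def by blast
    have "v < n" "v \<notin> S" "v \<notin> H" using v unfolding U_def by auto
    then obtain c x y i where t: "c < C" "x \<in> ?X" "y \<in> ?X" "i < D" "okc (dg \<beta> c) i"
      "Seg n E (U w) (dg \<beta> c) x y i" "\<not> Seg n E (U w - {v}) (dg \<beta> c) x y i"
      using none[of v] unfolding irr_def Uv by blast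
    then have "\<exists>u. ?P (c, i, x, y) u" unfolding Seg_def by auto
    then have P: "?P (c, i, x, y) (SOME u. ?P (c, i, x, y) u)" by (rule someI_ex)
    let ?u = "SOME u. ?P (c, i, x, y) u"
    have "v \<in> ?u ` {..i}"
    proof (rule ccontr)
      assume "v \<notin> ?u ` {..i}"
      then have "walk E (U w - {v}) (dg \<beta> c) i ?u" using P unfolding walk_def by auto
      then show False using P t(7) unfolding Seg_def by auto
    qed
    then have "v \<in> ?Z (c, i, x, y)" by simp
    then show "v \<in> \<Union>(?Z ` ?I)" using t(1-4) by blast
  qed
  moreover have "finite (\<Union>(?Z ` ?I))" using fI by auto
  ultimately have "card (U w) \<le> card (\<Union>(?Z ` ?I))" by (rule card_mono[rotated])
  also have "\<dots> \<le> (\<Sum>j\<in>?I. card (?Z j))" by (rule card_UN_le[OF fI])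
  also have "\<dots> \<le> (\<Sum>j\<in>?I. D)"
  proof (rule sum_mono)
    fix j assume "j \<in> ?I"
    then obtain c i x y where j: "j = (c, i, x, y)" "i < D" by auto
    have "card (?Z j) \<le> card {..i}" unfolding j(1) prod.case by (rule card_image_le) auto
    then show "card (?Z j) \<le> D" using j(2) by simp
  qed
  also have "\<dots> = card ?I * D" by simp
  finally have 1: "card (U w) \<le> card ?I * D" .
  have "card ?X \<le> card S + card H + 1"
    using finite_S finite_H card_Un_le[of S H] by (simp add: card_insert_if)
  then have X: "card ?X \<le> card S + card H + 1" .
  have "card ?I = C * D * card ?X * card ?X"
    by (simp only: card_cartesian_product card_lessThan mult.assoc)
  also have "\<dots> \<le> C * D * (card S + card H + 1) * (card S + card H + 1)" by (intro mult_le_mono X order_refl)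
  finally have "card ?I * D \<le> C * D * (card S + card H + 1) * (card S + card H + 1) * D" by (rule mult_le_mono1)
  then show ?thesis using 1 by (rule order_trans[rotated])
qed

text \<open>The ancestors of a vertex that lie in \<open>H\<close> form a chain closed under
  ancestors. If there are any, they are exactly the ancestors of the lowest one. So there are at
  most \<open>card H + 1\<close> regions, each bounded by \<open>card_U\<close>.\<close>

theorem irr_bound:
  assumes none: "\<And>v. \<not> irr v"
  shows "n \<le> card S + card H +
    (card H + 1) * (C * D * (card S + card H + 1) * (card S + card H + 1) * D)"
proof -
  let ?R = "{..<n} - S - H"
  let ?k = "\<lambda>v. anc v \<inter> H"
  have fR: "finite ?R" by auto
  have "?k ` ?R \<subseteq> insert {} (anc ` H)"
  proof
    fix A assume "A \<in> ?k ` ?R"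
    then obtain v where v: "A = anc v \<inter> H" by blast
    show "A \<in> insert {} (anc ` H)"
    proof (cases "A = {}")
      case False
      have fA: "finite A" using v finite_anc by auto
      \<comment> \<open>The lowest element of the chain is the one with the most ancestors.\<close>
      have "Max ((\<lambda>b. card (anc b)) ` A) \<in> (\<lambda>b. card (anc b)) ` A" using fA False by (intro Max_in) auto
      then obtain a where a: "a \<in> A" "Max ((\<lambda>b. card (anc b)) ` A) = card (anc a)" by blast
      have max: "card (anc b) \<le> card (anc a)" if "b \<in> A" for b
        unfolding a(2)[symmetric] using that fA by (intro Max_ge) auto
      have av: "a \<in> anc v" "a \<in> H" using a(1) v by auto
      have "anc a \<subseteq> A"
      proof
        fix b assume "b \<in> anc a"
        then show "b \<in> A" using anc_trans[of b a v] H_anc[of a b] av v by simp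
      qed
      moreover have "b \<in> anc a" if b: "b \<in> A" for b
      proof (rule ccontr)
        assume nb: "b \<notin> anc a"
        have "b \<in> anc v" using b v by simp
        then have ab: "a \<in> anc b" using anc_chain[OF av(1)] nb by blast
        have "anc a \<subseteq> anc b"
        proof
          fix c assume "c \<in> anc a"
          then show "c \<in> anc b" using anc_trans[OF _ ab] by simp
        qed
        moreover have "b \<in> anc b" using anc_refl[of b] anc_V[OF ab] by simp
        ultimately have "anc a \<subset> anc b" using nb by blast
        then have "card (anc a) < card (anc b)" by (rule psubset_card_mono[OF finite_anc])
        then show False using max[OF b] by simp
      qed
      ultimately have "A = anc a" by blast
      then show ?thesis using av(2) by blast
    qed simp
  qed
  then have "card (?k ` ?R) \<le> card (insert {} (anc ` H))" by (rule card_mono[rotated]) (use finite_H in auto)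
  also have "\<dots> \<le> card H + 1" using finite_H card_image_le[OF finite_H, of anc] by (simp add: card_insert_if)
  finally have ck: "card (?k ` ?R) \<le> card H + 1" .
  let ?G = "C * D * (card S + card H + 1) * (card S + card H + 1) * D"
  have fkR: "finite (?k ` ?R)" using fR by (rule finite_imageI)
  have "?R = (\<Union>A\<in>?k ` ?R. {v\<in>?R. ?k v = A})" by blast
  then have "card ?R = card (\<Union>A\<in>?k ` ?R. {v\<in>?R. ?k v = A})" by (rule arg_cong)
  also have "\<dots> \<le> (\<Sum>A\<in>?k ` ?R. card {v\<in>?R. ?k v = A})" by (rule card_UN_le[OF fkR])
  also have "\<dots> \<le> (\<Sum>A\<in>?k ` ?R. ?G)"
  proof (rule sum_mono)
    fix A assume "A \<in> ?k ` ?R"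
    then obtain w where w: "w \<in> ?R" "A = ?k w" by blast
    have "{v\<in>?R. ?k v = A} \<subseteq> U w" unfolding U_def using w by blast
    then have "card {v\<in>?R. ?k v = A} \<le> card (U w)"
      by (rule card_mono[rotated]) (auto simp: U_def)
    then show "card {v\<in>?R. ?k v = A} \<le> ?G" using card_U[OF none, of w] by linarith
  qed
  also have "\<dots> = card (?k ` ?R) * ?G" by simp
  also have "\<dots> \<le> (card H + 1) * ?G" by (rule mult_le_mono1[OF ck])
  finally have "card ?R \<le> (card H + 1) * ?G" .
  moreover have "n \<le> card ?R + card S + card H"
  proof -
    have "{..<n} \<subseteq> ?R \<union> S \<union> H" by auto
    then have "card {..<n} \<le> card (?R \<union> S \<union> H)" by (rule card_mono[rotated]) (use finite_S finite_H in auto)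
    also have "\<dots> \<le> card (?R \<union> S) + card H" by (rule card_Un_le)
    also have "card (?R \<union> S) \<le> card ?R + card S" by (rule card_Un_le)
    finally show ?thesis by simp
  qed
  ultimately show ?thesis by linarith
qed

end

subsection \<open>Elimination chains\<close>

definition step :: "(nat \<Rightarrow> nat \<Rightarrow> bool) \<Rightarrow> nat set \<Rightarrow> nat \<Rightarrow> nat \<Rightarrow> bool" where
  "step E A x y \<longleftrightarrow> E x y \<and> x \<notin> A \<and> y \<notin> A"

definition nexts :: "nat \<Rightarrow> (nat \<Rightarrow> nat \<Rightarrow> bool) \<Rightarrow> nat set \<Rightarrow> nat list \<Rightarrow> nat \<Rightarrow> nat set" where
  "nexts n E S cs v = {u. v < n \<and> v \<notin> S \<union> set cs \<and> (step E (S \<union> set cs))\<^sup>*\<^sup>* v u \<and> (cs = [] \<or> E (hd cs) u)}"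

text \<open>These are the ancestors of \<open>v\<close> in a depth-first search forest of
  \<open>G - S\<close>, down to depth \<open>t\<close> and deepest first: the next vertex lies in
  the component of \<open>v\<close> that remains and is adjacent to the previous one. So the list is
  at once a path and a set of ancestors, and without a path on \<open>D\<close> vertices the forest
  has depth below \<open>D\<close>. The least choice makes the next vertex depend on the component
  only.\<close>

fun chain :: "nat \<Rightarrow> (nat \<Rightarrow> nat \<Rightarrow> bool) \<Rightarrow> nat set \<Rightarrow> nat \<Rightarrow> nat \<Rightarrow> nat list" where
  "chain n E S 0 v = []"
| "chain n E S (Suc t) v = (let cs = chain n E S t v; N = nexts n E S cs v in
     if N = {} then cs else (LEAST u. u \<in> N) # cs)"

context
  fixes n :: nat and E :: "nat \<Rightarrow> nat \<Rightarrow> bool" and S :: "nat set" assumes gr: "gr n E"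
begin

lemma step_sym: "step E A x y \<Longrightarrow> step E A y x"
  using gr unfolding step_def gr_def by blast

lemma steps_sym: "(step E A)\<^sup>*\<^sup>* x y \<Longrightarrow> (step E A)\<^sup>*\<^sup>* y x"
proof (induction rule: rtranclp_induct)
  case (step y z)
  then show ?case using step_sym converse_rtranclp_into_rtranclp by metis
qed auto

lemma steps_mono: "(step E A)\<^sup>*\<^sup>* x y \<Longrightarrow> B \<subseteq> A \<Longrightarrow> (step E B)\<^sup>*\<^sup>* x y"
  by (erule rtranclp_mono[THEN predicate2D, rotated]) (auto simp: step_def)

lemma steps_in: "(step E A)\<^sup>*\<^sup>* x y \<Longrightarrow> x \<notin> A \<Longrightarrow> x < n \<Longrightarrow> y \<notin> A \<and> y < n"
  by (induction rule: rtranclp_induct) (use gr in \<open>auto simp: step_def gr_def\<close>)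

lemma nexts_in: "u \<in> nexts n E S cs v \<Longrightarrow> u < n \<and> u \<notin> S \<and> u \<notin> set cs \<and> (cs = [] \<or> E (hd cs) u)"
  unfolding nexts_def using steps_in by blast

lemma chain_Suc_cases:
  obtains "nexts n E S (chain n E S t v) v = {}" "chain n E S (Suc t) v = chain n E S t v"
  | u where "u \<in> nexts n E S (chain n E S t v) v" "chain n E S (Suc t) v = u # chain n E S t v"
proof (cases "nexts n E S (chain n E S t v) v = {}")
  case False
  then obtain u where "u \<in> nexts n E S (chain n E S t v) v" by blast
  then have "(LEAST u. u \<in> nexts n E S (chain n E S t v) v) \<in> nexts n E S (chain n E S t v) v" by (rule LeastI)
  then show thesis using that(2) False by (simp add: Let_def)
qed (use that in \<open>simp add: Let_def\<close>)

lemma chain_mono: "s \<le> t \<Longrightarrow> set (chain n E S s v) \<subseteq> set (chain n E S t v)"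
proof (induction rule: dec_induct)
  case (step t)
  then show ?case by (cases rule: chain_Suc_cases[of t v]) auto
qed auto

lemma chain_props:
  "set (chain n E S t v) \<subseteq> {..<n} - S \<and> distinct (chain n E S t v) \<and> length (chain n E S t v) \<le> t \<and>
   (\<forall>i. Suc i < length (chain n E S t v) \<longrightarrow> E (chain n E S t v ! Suc i) (chain n E S t v ! i))"
proof (induction t)
  case (Suc t)
  show ?case
  proof (cases rule: chain_Suc_cases[of t v])
    case 1
    then show ?thesis using Suc by simp
  next
    case (2 u)
    note u = nexts_in[OF 2(1)]
    let ?cs = "chain n E S t v"
    have "E ((u # ?cs) ! Suc i) ((u # ?cs) ! i)" if "Suc i < length (u # ?cs)" for i
    proof (cases i)
      case 0
      then show ?thesis using u that by (auto simp: hd_conv_nth)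
    next
      case (Suc j)
      then show ?thesis using Suc.IH that by auto
    qed
    then show ?thesis unfolding 2(2) using u Suc by auto
  qed
qed auto

lemma chain_outside: "\<not> (v < n \<and> v \<notin> S) \<Longrightarrow> chain n E S t v = []"
  by (induction t) (auto simp: nexts_def Let_def)

lemma nexts_same:
  assumes "v \<notin> S \<union> set cs" "v < n" "(step E (S \<union> set cs))\<^sup>*\<^sup>* v u"
  shows "nexts n E S cs u = nexts n E S cs v"
proof -
  have u: "u \<notin> S \<union> set cs" "u < n" using steps_in[OF assms(3,1,2)] by auto
  have "(step E (S \<union> set cs))\<^sup>*\<^sup>* u w \<longleftrightarrow> (step E (S \<union> set cs))\<^sup>*\<^sup>* v w" for w
    using assms(3) steps_sym[OF assms(3)] rtranclp_trans by metis
  then show ?thesis unfolding nexts_def using u assms(1,2) by auto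
qed

text \<open>Each choice depends only on the component of the vertex, so vertices not yet separated
  have made the same choices.\<close>

lemma chain_same:
  assumes "v < n" "v \<notin> S \<union> set (chain n E S t v)" "(step E (S \<union> set (chain n E S t v)))\<^sup>*\<^sup>* v u"
  shows "chain n E S t u = chain n E S t v"
  using assms
proof (induction t)
  case (Suc t)
  have sub: "set (chain n E S t v) \<subseteq> set (chain n E S (Suc t) v)" by (rule chain_mono) simp
  have st: "(step E (S \<union> set (chain n E S t v)))\<^sup>*\<^sup>* v u"
    by (rule steps_mono[OF Suc.prems(3)]) (use sub in blast)
  have v: "v \<notin> S \<union> set (chain n E S t v)" using Suc.prems(2) sub by blast
  have e: "chain n E S t u = chain n E S t v" by (rule Suc.IH[OF Suc.prems(1) v st])
  have "nexts n E S (chain n E S t v) u = nexts n E S (chain n E S t v) v"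
    by (rule nexts_same[OF v Suc.prems(1) st])
  then show ?case using e by (simp add: Let_def)
qed auto

lemma chain_stop: "v \<in> set (chain n E S s v) \<Longrightarrow> s \<le> t \<Longrightarrow> chain n E S t v = chain n E S s v"
proof (induction t)
  case (Suc t)
  show ?case
  proof (cases "s = Suc t")
    case False
    then have "chain n E S t v = chain n E S s v" using Suc by auto
    then show ?thesis using Suc.prems(1) by (auto simp: nexts_def Let_def)
  qed auto
qed auto

text \<open>When \<open>b\<close> enters the chain of \<open>c\<close>, the two are still in one
  component and share their chain. Now \<open>b\<close> belongs to its own chain, which therefore
  stops there. So the chain of \<open>b\<close> is an earlier stage of that of \<open>c\<close>,
  which gives transitivity and comparability of ancestors.\<close>

lemma chain_stage:
  "b \<in> set (chain n E S t c) \<Longrightarrow> \<exists>s<t. b \<in> set (chain n E S (Suc s) c) \<and> b \<notin> set (chain n E S s c) \<and>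
     (\<forall>t'>s. chain n E S t' b = chain n E S (Suc s) c)"
proof (induction t)
  case (Suc t)
  show ?case
  proof (cases "b \<in> set (chain n E S t c)")
    case True
    then show ?thesis using Suc.IH less_SucI by blast
  next
    case False
    show ?thesis
    proof (cases rule: chain_Suc_cases[of t c])
      case 1
      then show ?thesis using Suc.prems False by simp
    next
      case (2 u)
      then have b: "b = u" using Suc.prems False by auto
      let ?cs = "chain n E S t c"
      have c: "c < n" "c \<notin> S \<union> set ?cs" "(step E (S \<union> set ?cs))\<^sup>*\<^sup>* c b"
        using 2(1) unfolding b nexts_def by auto
      have e: "chain n E S t b = ?cs" by (rule chain_same[OF c])
      have "nexts n E S ?cs b = nexts n E S ?cs c" by (rule nexts_same[OF c(2,1,3)])
      then have e2: "chain n E S (Suc t) b = chain n E S (Suc t) c" using e by (simp add: Let_def)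
      have "\<forall>t'>t. chain n E S t' b = chain n E S (Suc t) c"
        using chain_stop[of b "Suc t"] Suc.prems e2 by (metis Suc_leI)
      then show ?thesis using Suc.prems False by blast
    qed
  qed
qed auto

lemma first_hit:
  assumes "(step E A)\<^sup>*\<^sup>* v w" "v \<noteq> l" "v \<notin> A"
  shows "(w \<noteq> l \<and> (step E (insert l A))\<^sup>*\<^sup>* v w) \<or> (\<exists>u. (step E (insert l A))\<^sup>*\<^sup>* v u \<and> E u l)"
  using assms(1)
proof (induction rule: rtranclp_induct)
  case base
  then show ?case using assms(2) by auto
next
  case (step y z)
  show ?case
  proof (cases "\<exists>u. (step E (insert l A))\<^sup>*\<^sup>* v u \<and> E u l")
    case False
    then have y: "y \<noteq> l" "(step E (insert l A))\<^sup>*\<^sup>* v y" using step.IH by auto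
    then have "z \<noteq> l" using False step.hyps(2) unfolding step_def by blast
    then have "step E (insert l A) y z" using step.hyps(2) y(1) unfolding step_def by auto
    then show ?thesis using y(2) \<open>z \<noteq> l\<close> by (meson rtranclp.rtrancl_into_rtrancl)
  qed auto
qed

lemma chain_last:
  "chain n E S t v = l # cs \<Longrightarrow> l \<in> nexts n E S cs v"
proof (induction t)
  case (Suc t)
  then show ?case by (cases rule: chain_Suc_cases[of t v]) auto
qed auto

text \<open>The walk from \<open>v\<close> to the last chain vertex \<open>l\<close>, cut just
  before its first visit to \<open>l\<close>, ends in a neighbour of \<open>l\<close> in the
  remaining component of \<open>v\<close>. So a chain stops only after it has reached
  \<open>v\<close> itself.\<close>

lemma chain_progress:
  assumes "v < n" "v \<notin> S" "v \<notin> set (chain n E S t v)"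
  shows "nexts n E S (chain n E S t v) v \<noteq> {}"
proof (cases "chain n E S t v")
  case Nil
  then have "v \<in> nexts n E S (chain n E S t v) v" using assms unfolding nexts_def by auto
  then show ?thesis by blast
next
  case (Cons l cs)
  have l: "l \<in> nexts n E S cs v" by (rule chain_last[OF Cons])
  have "(step E (S \<union> set cs))\<^sup>*\<^sup>* v l" "v \<noteq> l" "v \<notin> S \<union> set cs"
    using l assms Cons unfolding nexts_def by auto
  from first_hit[OF this] obtain u where u: "(step E (insert l (S \<union> set cs)))\<^sup>*\<^sup>* v u" "E u l" by blast
  have "E l u" using u(2) gr unfolding gr_def by blast
  then have "u \<in> nexts n E S (chain n E S t v) v" using u(1) assms unfolding Cons nexts_def by simp
  then show ?thesis by blast
qed

lemma chain_refl:
  assumes "v < n" "v \<notin> S" "length (chain n E S D v) < D"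
  shows "v \<in> set (chain n E S D v)"
proof (rule ccontr)
  assume a: "v \<notin> set (chain n E S D v)"
  have "length (chain n E S t v) = t" if "t \<le> D" for t
    using that
  proof (induction t)
    case (Suc t)
    have "v \<notin> set (chain n E S t v)" using a chain_mono[of t D v] Suc.prems by auto
    from chain_progress[OF assms(1,2) this] Suc show ?case by (auto simp: Let_def)
  qed auto
  then show False using assms(3) by auto
qed

text \<open>As long as neither end has been removed, the edge keeps both ends in one component and
  thus gives them equal chains.\<close>

lemma chain_edge:
  assumes "E u w" "u \<notin> S" "w \<notin> S"
  shows "u \<in> set (chain n E S t w) \<or> w \<in> set (chain n E S t u) \<or>
    (chain n E S t u = chain n E S t w \<and> u \<notin> set (chain n E S t u) \<and> w \<notin> set (chain n E S t u))"
proof (induction t)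
  case (Suc t)
  have V: "u < n" "w < n" using assms gr unfolding gr_def by auto
  consider "u \<in> set (chain n E S t w)" | "w \<in> set (chain n E S t u)"
    | "chain n E S t u = chain n E S t w" "u \<notin> set (chain n E S t u)" "w \<notin> set (chain n E S t u)"
    using Suc by blast
  then show ?case
  proof cases
    case 1
    then show ?thesis using chain_mono[of t "Suc t" w] by auto
  next
    case 2
    then show ?thesis using chain_mono[of t "Suc t" u] by auto
  next
    case 3
    have "(step E (S \<union> set (chain n E S t u)))\<^sup>*\<^sup>* u w"
      using assms 3 unfolding step_def by auto
    then have "nexts n E S (chain n E S t u) w = nexts n E S (chain n E S t u) u"
      by (intro nexts_same) (use 3 assms V in auto)
    then have e: "chain n E S (Suc t) u = chain n E S (Suc t) w" using 3(1) by (simp add: Let_def)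
    then show ?thesis by metis
  qed
qed auto

lemma forest_chain:
  assumes short: "\<And>v. length (chain n E S D v) < D" and "S \<subseteq> {..<n}" "0 < D" "D dvd m" "C = \<beta> ^ Suc D"
    and sep: "\<And>Y. Y \<subseteq> {..<n} \<Longrightarrow> card Y \<le> D * D \<Longrightarrow> \<exists>p\<ge>1. p < \<beta> \<and> inj_on (\<lambda>y. y mod p) Y"
  shows "forest n E S (\<lambda>v. set (chain n E S D v)) D m \<beta> C"
proof
  show "gr n E" by (rule gr)
  show "a < n \<and> a \<notin> S \<and> v < n \<and> v \<notin> S" if "a \<in> set (chain n E S D v)" for a v
    using that chain_props[of D v] chain_outside[of v D] by fastforce
  show "v \<in> set (chain n E S D v)" if "v < n" "v \<notin> S" for v
    using chain_refl[OF that short] .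
  show "a \<in> set (chain n E S D c)" if ab: "a \<in> set (chain n E S D b)" "b \<in> set (chain n E S D c)" for a b c
  proof -
    obtain s where s: "s < D" "\<forall>t'>s. chain n E S t' b = chain n E S (Suc s) c"
      using chain_stage[OF ab(2)] by blast
    then show ?thesis using ab(1) chain_mono[of "Suc s" D c] by auto
  qed
  show "a \<in> set (chain n E S D b) \<or> b \<in> set (chain n E S D a)"
    if ab: "a \<in> set (chain n E S D c)" "b \<in> set (chain n E S D c)" for a b c
  proof -
    obtain s where s: "s < D" "a \<in> set (chain n E S (Suc s) c)" "\<forall>t'>s. chain n E S t' a = chain n E S (Suc s) c"
      using chain_stage[OF ab(1)] by blast
    obtain s' where s': "s' < D" "b \<in> set (chain n E S (Suc s') c)" "\<forall>t'>s'. chain n E S t' b = chain n E S (Suc s') c"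
      using chain_stage[OF ab(2)] by blast
    show ?thesis
    proof (cases "s \<le> s'")
      case True
      then show ?thesis using s s' chain_mono[of "Suc s" "Suc s'" c] by auto
    next
      case False
      then show ?thesis using s s' chain_mono[of "Suc s'" "Suc s" c] by auto
    qed
  qed
  show "u \<in> set (chain n E S D w) \<or> w \<in> set (chain n E S D u)" if "E u w" "u \<notin> S" "w \<notin> S" for u w
  proof -
    have "u < n" using that gr unfolding gr_def by auto
    then have "u \<in> set (chain n E S D u)" using chain_refl[OF _ _ short] that by blast
    then show ?thesis using chain_edge[OF that, of D] by blast
  qed
  show "card (set (chain n E S D v)) < D" for v
    using card_length[of "chain n E S D v"] short[of v] by linarith
qed (use assms in auto)

end

section \<open>Greedy packing\<close>

fun pack :: "nat \<Rightarrow> (nat \<Rightarrow> nat \<Rightarrow> bool) \<Rightarrow> nat \<Rightarrow> nat \<Rightarrow> nat set" where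
  "pack n E D 0 = {}"
| "pack n E D (Suc i) = (let S = pack n E D i in
     if \<exists>v<n. D \<le> length (chain n E S D v) then S \<union> set (chain n E S D (LEAST v. v < n \<and> D \<le> length (chain n E S D v)))
     else S)"

text \<open>A chain of length \<open>D\<close> is a path on \<open>D\<close> vertices disjoint from
  the packing, so its vertices are appended as a new block of positions. Once no such chain exists,
  the set no longer changes, which is the second case.\<close>

lemma pack_props:
  assumes gr: "gr n E" and D: "0 < D"
  shows "pack n E D i \<subseteq> {..<n} \<and>
    ((card (pack n E D i) = i * D \<and> (\<exists>\<phi>. solution n E D (i * D) \<phi> \<and> \<phi> ` {..<i * D} = pack n E D i)) \<or>
     (card (pack n E D i) < i * D \<and> (\<forall>v<n. length (chain n E (pack n E D i) D v) < D)))"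
proof (induction i)
  case 0
  show ?case by (auto simp: solution_def links_def)
next
  case (Suc i)
  let ?S = "pack n E D i"
  show ?case
  proof (cases "\<exists>v<n. D \<le> length (chain n E ?S D v)")
    case False
    then have e: "pack n E D (Suc i) = ?S" unfolding pack.simps Let_def by (rule if_not_P)
    have "card ?S < Suc i * D" using Suc D by auto
    then show ?thesis unfolding e using Suc False by (simp add: not_le)
  next
    case True
    define v where "v = (LEAST v. v < n \<and> D \<le> length (chain n E ?S D v))"
    have "v < n \<and> D \<le> length (chain n E ?S D v)" unfolding v_def by (rule LeastI_ex) (use True in blast)
    define cs where "cs = chain n E ?S D v"
    have p: "set cs \<subseteq> {..<n} - ?S" "distinct cs" "length cs = D"
      "\<And>i. Suc i < length cs \<Longrightarrow> E (cs ! Suc i) (cs ! i)"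
      using chain_props[OF gr, of ?S D v] \<open>v < n \<and> D \<le> length (chain n E ?S D v)\<close> unfolding cs_def by auto
    have S': "pack n E D (Suc i) = ?S \<union> set cs" using True by (simp add: Let_def v_def cs_def)
    obtain \<phi> where phi: "solution n E D (i * D) \<phi>" "\<phi> ` {..<i * D} = ?S" and cS: "card ?S = i * D" and Sn: "?S \<subseteq> {..<n}"
      using Suc True by (auto simp: not_less)
    let ?\<psi> = "\<lambda>p. if p < i * D then \<phi> p else cs ! (p - i * D)"
    have split: "{..<Suc i * D} = {..<i * D} \<union> {i * D..<Suc i * D}" by auto
    have im1: "?\<psi> ` {..<i * D} = ?S" using phi(2) by auto
    have im2: "?\<psi> ` {i * D..<Suc i * D} = set cs"
    proof
      show "?\<psi> ` {i * D..<Suc i * D} \<subseteq> set cs" using p(3) by auto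
      show "set cs \<subseteq> ?\<psi> ` {i * D..<Suc i * D}"
      proof
        fix x assume "x \<in> set cs"
        then obtain j where "j < D" "x = cs ! j" using p(3) by (metis in_set_conv_nth)
        then have "x = ?\<psi> (i * D + j)" "i * D + j \<in> {i * D..<Suc i * D}" by auto
        then show "x \<in> ?\<psi> ` {i * D..<Suc i * D}" by blast
      qed
    qed
    have im: "?\<psi> ` {..<Suc i * D} = pack n E D (Suc i)" unfolding split image_Un im1 im2 S' ..
    have dis: "?S \<inter> set cs = {}" using p(1) by blast
    have "card (pack n E D (Suc i)) = card ?S + card (set cs)" unfolding S'
      by (rule card_Un_disjoint) (use Sn dis finite_subset in auto)
    then have card: "card (pack n E D (Suc i)) = Suc i * D" using cS p distinct_card[of cs] by simp
    have "inj_on ?\<psi> {..<Suc i * D}"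
      by (rule eq_card_imp_inj_on) (use im card in auto)
    moreover have "links E D (Suc i * D) ?\<psi>"
      unfolding links_def
    proof (intro allI impI)
      fix q assume q: "q < Suc i * D" "Suc q mod D \<noteq> 0"
      show "E (?\<psi> q) (?\<psi> (Suc q))"
      proof (cases "q < i * D")
        case True
        have "Suc q \<noteq> i * D" using q(2) by auto
        then show ?thesis using True q phi(1) unfolding solution_def links_def by auto
      next
        case False
        have "Suc q \<noteq> Suc i * D" using q(2) by (metis mod_mult_self2_is_0)
        then have "Suc (q - i * D) < length cs" using q(1) False p(3) by auto
        from p(4)[OF this] have "E (cs ! (q - i * D)) (cs ! Suc (q - i * D))" using gr unfolding gr_def by blast
        then show ?thesis using False by (simp add: Suc_diff_le)
      qed
    qed
    moreover have "pack n E D (Suc i) \<subseteq> {..<n}" using S' p(1) Sn by auto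
    ultimately have "solution n E D (Suc i * D) ?\<psi>" unfolding solution_def im by blast
    then show ?thesis using card im \<open>pack n E D (Suc i) \<subseteq> {..<n}\<close> by blast
  qed
qed

subsection \<open>Separating moduli\<close>

text \<open>The reciprocals \<open>1 / (m * (n choose m))\<close> form Leibniz's harmonic triangle, in which
  every entry is a difference of two entries of the previous column.\<close>

lemma leibniz_step:
  assumes "1 \<le> m" "m < n"
  shows "1 / (real (Suc m) * real (n choose Suc m)) =
    1 / (real m * real ((n - 1) choose m)) - 1 / (real m * real (n choose m))"
proof -
  have pos: "0 < real (n choose m)" "0 < real m" "0 < real (n - m)" using assms by auto
  have "Suc m * (n choose Suc m) = n * ((n - 1) choose m)" by (rule binomial_absorption)
  then have 1: "real (Suc m) * real (n choose Suc m) = real n * real ((n - 1) choose m)"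
    by (metis of_nat_mult)
  have "(n - m) * (n choose m) = n * ((n - 1) choose m)" by (rule binomial_absorb_comp)
  then have 2: "real (n - m) * real (n choose m) = real n * real ((n - 1) choose m)" by (metis of_nat_mult)
  have n: "0 < real n" using assms by auto
  have c: "real ((n - 1) choose m) = real (n - m) * real (n choose m) / real n" using 2 n by (simp add: field_simps)
  have "real (n - m) = real n - real m" using assms by (simp add: of_nat_diff)
  then have "1 / (real m * real ((n - 1) choose m)) - 1 / (real m * real (n choose m)) =
    1 / (real (n - m) * real (n choose m))" unfolding c using pos n
    by (simp add: field_simps)
  then show ?thesis unfolding 1 2 ..
qed

text \<open>\<open>P\<close> is a common multiple of \<open>1, ..., n\<close>. The first column of
  the harmonic triangle consists of reciprocals of these numbers, and \<open>leibniz_step\<close>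
  passes from column to column, so \<open>P\<close> times each entry is an integer.\<close>

lemma binomial_dvd:
  assumes "\<And>p. 1 \<le> p \<Longrightarrow> p \<le> n \<Longrightarrow> p dvd P" "1 \<le> m" "m \<le> n"
  shows "m * (n choose m) dvd P"
proof -
  have "real P * (1 / (real m * real (n choose m))) \<in> \<int>"
    using assms(2,3,1)
  proof (induction m arbitrary: n rule: dec_induct)
    case base
    then have "n dvd P" by auto
    then obtain c where "P = n * c" by (auto simp: dvd_def)
    then show ?case using base by simp
  next
    case (step m)
    have "real P * (1 / (real m * real ((n - 1) choose m))) \<in> \<int>"
      by (rule step.IH) (use step in auto)
    moreover have "real P * (1 / (real m * real (n choose m))) \<in> \<int>"
      by (rule step.IH) (use step in auto)
    moreover have "real P * (1 / (real (Suc m) * real (n choose Suc m))) =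
      real P * (1 / (real m * real ((n - 1) choose m))) - real P * (1 / (real m * real (n choose m)))"
      using leibniz_step[of m n] step by (simp only: right_diff_distrib)
    ultimately show ?case by auto
  qed
  then obtain z :: int where z: "real P / real (m * (n choose m)) = of_int z" by (auto elim: Ints_cases)
  have "0 < m * (n choose m)" using assms by auto
  then have "real P = of_int z * real (m * (n choose m))" using z by (simp add: field_simps)
  then have "int P = z * int (m * (n choose m))"
    by (metis of_int_eq_iff of_int_mult of_int_of_nat_eq)
  then have "int (m * (n choose m)) dvd int P" by simp
  then show ?thesis using int_dvd_int_iff by blast
qed

text \<open>If no modulus up to \<open>2 * m\<close> separates \<open>Y\<close>, each of them
  divides a difference of two elements and hence the product \<open>P\<close> of all differences. So
  \<open>m * ((2 * m) choose m)\<close>, which is at least \<open>4 ^ m / 2\<close>, divides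
  \<open>P\<close>. But there are at most \<open>s * s\<close> differences of size at most
  \<open>2 ^ L\<close>, and with \<open>m = L * s * s + 1\<close> this gives
  \<open>P \<le> 2 ^ (m - 1)\<close>.\<close>

lemma separating_modulus:
  assumes Y: "Y \<subseteq> {..<n}" "card Y \<le> s" and n: "n \<le> 2 ^ L"
  shows "\<exists>p\<ge>1. p < 2 * (L * s * s) + 3 \<and> inj_on (\<lambda>y. y mod p) Y"
proof (rule ccontr)
  assume a: "\<not> ?thesis"
  have fY: "finite Y" using Y(1) finite_subset by blast
  define I where "I = {(x, y) \<in> Y \<times> Y. x < y}"
  have fI: "finite I" by (rule finite_subset[of _ "Y \<times> Y"]) (use fY in \<open>auto simp: I_def\<close>)
  define P where "P = (\<Prod>(x, y)\<in>I. y - x)"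
  define m where "m = L * s * s + 1"
  have "p dvd P" if "1 \<le> p" "p \<le> 2 * m" for p
  proof -
    have "\<not> inj_on (\<lambda>y. y mod p) Y" using a that unfolding m_def by auto
    then obtain x y where xy: "x \<in> Y" "y \<in> Y" "x mod p = y mod p" "x \<noteq> y" unfolding inj_on_def by blast
    have "\<exists>x y. x \<in> Y \<and> y \<in> Y \<and> x mod p = y mod p \<and> x < y"
      using xy by (metis linorder_neqE_nat)
    then obtain x y where xy: "x \<in> Y" "y \<in> Y" "x mod p = y mod p" "x < y" by blast
    then have "p dvd y - x" using mod_eq_dvd_iff_nat[of x y p] by auto
    moreover have "(x, y) \<in> I" using xy unfolding I_def by auto
    then have "(case (x, y) of (x, y) \<Rightarrow> y - x) dvd P" unfolding P_def by (rule dvd_prodI[OF fI])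
    ultimately show ?thesis by (metis case_prod_conv dvd_trans)
  qed
  then have "m * ((2 * m) choose m) dvd P" by (rule binomial_dvd) (auto simp: m_def)
  moreover have "0 < P" unfolding P_def I_def by (rule prod_pos) auto
  ultimately have 1: "m * ((2 * m) choose m) \<le> P" using dvd_imp_le by blast
  have "4 ^ m / (2 * real m) \<le> real ((2 * m) choose m)" by (rule central_binomial_lower_bound) (simp add: m_def)
  moreover have "0 < m" by (simp add: m_def)
  then have "0 < real m" by (simp only: of_nat_0_less_iff)
  ultimately have "4 ^ m / 2 \<le> real m * real ((2 * m) choose m)" by (simp add: field_simps)
  also have "\<dots> \<le> real P" using 1 by (metis of_nat_le_iff of_nat_mult)
  finally have 2: "4 ^ m \<le> 2 * real P" by simp
  have "P \<le> (\<Prod>(x, y)\<in>I. 2 ^ L)" unfolding P_def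
  proof (rule prod_mono)
    fix z assume "z \<in> I"
    then obtain x y where z: "z = (x, y)" "y \<in> Y" unfolding I_def by auto
    then have "y < n" using Y(1) by auto
    then have "y - x \<le> 2 ^ L" using n by linarith
    then show "0 \<le> (case z of (x, y) \<Rightarrow> y - x) \<and> (case z of (x, y) \<Rightarrow> y - x) \<le> (case z of (x, y) \<Rightarrow> 2 ^ L)"
      using z by simp
  qed
  also have "\<dots> = (2 ^ L) ^ card I" by (simp add: case_prod_beta)
  also have "\<dots> = 2 ^ (L * card I)" by (simp add: power_mult)
  also have "\<dots> \<le> 2 ^ (L * (s * s))"
  proof -
    have "card I \<le> card (Y \<times> Y)" by (rule card_mono) (use fY in \<open>auto simp: I_def\<close>)
    also have "\<dots> \<le> s * s" using Y(2) by (simp add: card_cartesian_product mult_le_mono)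
    finally show ?thesis by (intro power_increasing mult_le_mono) auto
  qed
  finally have "P \<le> 2 ^ (m - 1)" by (simp add: m_def mult.assoc)
  then have "2 * P \<le> 2 ^ m" by (simp add: m_def)
  then have "2 * real P \<le> 2 ^ m" by (metis of_nat_le_iff of_nat_mult of_nat_numeral of_nat_power)
  with 2 have "(4::real) ^ m \<le> 2 ^ m" by linarith
  moreover have "(2::real) ^ m < 4 ^ m" by (rule power_strict_mono) (auto simp: m_def)
  ultimately show False by linarith
qed

section \<open>Vertex deletion and the size of reduced instances\<close>

definition Lg :: "nat \<Rightarrow> nat" where "Lg n = (LEAST L. n \<le> 2 ^ L)"

lemma Lg_le: "n \<le> 2 ^ Lg n"
  unfolding Lg_def by (rule LeastI[of _ n]) (simp add: less_imp_le)

lemma Lg_less_iff: "2 ^ y < n \<longleftrightarrow> y < Lg n"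
proof
  assume a: "2 ^ y < n"
  show "y < Lg n"
  proof (rule ccontr)
    assume "\<not> y < Lg n"
    then have "(2::nat) ^ Lg n \<le> 2 ^ y" by (intro power_increasing) auto
    then show False using a Lg_le[of n] by linarith
  qed
next
  assume "y < Lg n"
  then show "2 ^ y < n" unfolding Lg_def using not_less_Least by (metis not_le)
qed

text \<open>In this form the logarithm is available to the machine, which assigns numbers by
  counting.\<close>

lemma Lg_card: "card {y. 2 ^ y < n} = Lg n"
  unfolding Lg_less_iff by simp

lemma Lg_upper: "1 \<le> n \<Longrightarrow> 2 ^ (Lg n + 1) \<le> 4 * n"
proof (cases "Lg n")
  case (Suc y)
  then have "2 ^ y < n" using Lg_less_iff by simp
  then show ?thesis using Suc by simp
qed auto

text \<open>The bound of \<open>separating_modulus\<close> for sets of at most \<open>D * D\<close>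
  vertices.\<close>

definition modb :: "nat \<Rightarrow> nat \<Rightarrow> nat" where
  "modb n D = 2 * (Lg n * (D * D) * (D * D)) + 3"

definition anc_of :: "nat \<Rightarrow> (nat \<Rightarrow> nat \<Rightarrow> bool) \<Rightarrow> nat \<Rightarrow> nat \<Rightarrow> nat \<Rightarrow> nat set" where
  "anc_of n E D k v = set (chain n E (pack n E D k) D v)"

definition irrel :: "nat \<Rightarrow> (nat \<Rightarrow> nat \<Rightarrow> bool) \<Rightarrow> nat \<Rightarrow> nat \<Rightarrow> nat \<Rightarrow> bool" where
  "irrel n E D k v = forest.irr n E (pack n E D k) (anc_of n E D k) D (k * D) (modb n D) (modb n D ^ Suc D) v"

text \<open>After the deletion of \<open>v\<close> the vertices are renumbered so as to form an
  initial segment again; \<open>sh v\<close> turns new numbers into old ones.\<close>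

definition sh :: "nat \<Rightarrow> nat \<Rightarrow> nat" where "sh v x = (if x < v then x else Suc x)"
definition del :: "nat \<Rightarrow> (nat \<Rightarrow> nat \<Rightarrow> bool) \<Rightarrow> nat \<Rightarrow> nat \<Rightarrow> bool" where
  "del v E x y \<longleftrightarrow> E (sh v x) (sh v y)"

definition solvable :: "nat \<Rightarrow> (nat \<Rightarrow> nat \<Rightarrow> bool) \<Rightarrow> nat \<Rightarrow> nat \<Rightarrow> bool" where
  "solvable n E D k \<longleftrightarrow> (\<exists>\<phi>. solution n E D (k * D) \<phi>)"

lemma sh_inj: "sh v x = sh v y \<Longrightarrow> x = y"
  unfolding sh_def by (auto split: if_splits)

lemma gr_del: assumes "gr n E" "v < n" shows "gr (n - 1) (del v E)"
proof -
  have "x < n - 1" if "sh v x < n" for x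
    using that assms(2) unfolding sh_def by (auto split: if_splits)
  then show ?thesis using assms(1) unfolding gr_def del_def by metis
qed

lemma pack_yes:
  assumes "gr n E" "0 < D" "k * D \<le> card (pack n E D k)" shows "solvable n E D k"
  using pack_props[OF assms(1,2), of k] assms(3) unfolding solvable_def by auto

context
  fixes n E D k assumes gr: "gr n E" and D: "0 < D" and small: "card (pack n E D k) < k * D"
begin

lemma forest_pack:
  "forest n E (pack n E D k) (anc_of n E D k) D (k * D) (modb n D) (modb n D ^ Suc D)"
  unfolding anc_of_def
proof (rule forest_chain[OF gr])
  show "length (chain n E (pack n E D k) D v) < D" for v
  proof (cases "v < n")
    case True
    then show ?thesis using pack_props[OF gr D, of k] small by auto
  next
    case False
    then show ?thesis using chain_outside[OF gr, of v] D by auto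
  qed
  show "pack n E D k \<subseteq> {..<n}" using pack_props[OF gr D, of k] by blast
  show "\<exists>p\<ge>1. p < modb n D \<and> inj_on (\<lambda>y. y mod p) Y" if "Y \<subseteq> {..<n}" "card Y \<le> D * D" for Y
    using separating_modulus[OF that Lg_le] unfolding modb_def .
qed (use D in auto)

lemma irrel_less: "irrel n E D k v \<Longrightarrow> v < n"
  unfolding irrel_def forest.irr_def[OF forest_pack] by blast

theorem irrel_sound:
  assumes v: "irrel n E D k v"
  shows "solvable n E D k \<longleftrightarrow> solvable (n - 1) (del v E) D k"
proof
  have vn: "v < n" by (rule irrel_less[OF v])
  show "solvable (n - 1) (del v E) D k" if sol: "solvable n E D k"
  proof -
    obtain \<phi> where "solution n E D (k * D) \<phi>" using sol unfolding solvable_def by blast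
    from forest.irr_sound[OF forest_pack v[unfolded irrel_def] this]
    obtain \<psi> where psi: "solution n E D (k * D) \<psi>" "v \<notin> \<psi> ` {..<k * D}" by blast
    let ?u = "\<lambda>x. if x < v then x else x - 1"
    have su: "sh v (?u x) = x" if "x \<noteq> v" for x using that unfolding sh_def by auto
    have ne: "\<psi> p \<noteq> v" if "p < k * D" for p using psi(2) that by auto
    have "solution (n - 1) (del v E) D (k * D) (\<lambda>p. ?u (\<psi> p))"
      unfolding solution_def
    proof (intro conjI)
      show "inj_on (\<lambda>p. ?u (\<psi> p)) {..<k * D}"
      proof (rule inj_onI)
        fix p q assume pq: "p \<in> {..<k * D}" "q \<in> {..<k * D}" "?u (\<psi> p) = ?u (\<psi> q)"
        then have "\<psi> p = \<psi> q" using su[OF ne, of p] su[OF ne, of q] by auto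
        then show "p = q" using psi(1) pq unfolding solution_def inj_on_def by blast
      qed
      have "\<psi> p < n" if "p < k * D" for p using psi(1) that unfolding solution_def by auto
      then show "(\<lambda>p. ?u (\<psi> p)) ` {..<k * D} \<subseteq> {..<n - 1}" using ne vn by fastforce
      show "links (del v E) D (k * D) (\<lambda>p. ?u (\<psi> p))"
        unfolding links_def
      proof (intro allI impI)
        fix p assume p: "p < k * D" "Suc p mod D \<noteq> 0"
        have "Suc p \<noteq> k * D" using p(2) by auto
        then have "sh v (?u (\<psi> p)) = \<psi> p" "sh v (?u (\<psi> (Suc p))) = \<psi> (Suc p)"
          using su[OF ne, of p] su[OF ne, of "Suc p"] p by auto
        moreover have "E (\<psi> p) (\<psi> (Suc p))" using psi(1) p unfolding solution_def links_def by blast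
        ultimately show "del v E (?u (\<psi> p)) (?u (\<psi> (Suc p)))" unfolding del_def by simp
      qed
    qed
    then show ?thesis unfolding solvable_def by blast
  qed
  show "solvable n E D k" if sol: "solvable (n - 1) (del v E) D k"
  proof -
    obtain \<phi> where phi: "solution (n - 1) (del v E) D (k * D) \<phi>" using sol unfolding solvable_def by blast
    have "solution n E D (k * D) (\<lambda>p. sh v (\<phi> p))"
      unfolding solution_def
    proof (intro conjI)
      show "inj_on (\<lambda>p. sh v (\<phi> p)) {..<k * D}"
        using phi sh_inj unfolding solution_def inj_on_def by blast
      have "\<phi> p < n - 1" if "p < k * D" for p using phi that unfolding solution_def by auto
      then show "(\<lambda>p. sh v (\<phi> p)) ` {..<k * D} \<subseteq> {..<n}" unfolding sh_def by fastforce
      show "links E D (k * D) (\<lambda>p. sh v (\<phi> p))"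
        using phi unfolding solution_def links_def del_def by blast
    qed
    then show ?thesis unfolding solvable_def by blast
  qed
qed

text \<open>It bounds both \<open>card H\<close>, by \<open>card_H\<close> with
  \<open>card S \<le> k * D\<close>, and \<open>k * D + 1\<close>.\<close>

definition "hbound = modb n D ^ Suc D * D * D * (k * D + 1) ^ 3"

lemma irrel_bound0:
  assumes none: "\<And>v. \<not> irrel n E D k v" and k: "1 \<le> k"
  shows "n \<le> 10 * (modb n D ^ Suc D * D * D) * hbound ^ 3"
proof -
  interpret F: forest n E "pack n E D k" "anc_of n E D k" D "k * D" "modb n D" "modb n D ^ Suc D"
    by (rule forest_pack)
  define C where "C = modb n D ^ Suc D"
  define m where "m = k * D"
  define s where "s = card (pack n E D k)"
  define h where "h = card F.H"
  define B where "B = C * D * D * (m + 1) ^ 3"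
  have B: "hbound = B" unfolding hbound_def B_def C_def m_def ..
  have C0: "1 \<le> C" unfolding C_def modb_def by simp
  have sm: "s \<le> m" using small unfolding s_def m_def by simp
  have "h \<le> C * D * (s + 1) * (s + 1) * (D * (m + 1))" using F.card_H unfolding h_def s_def C_def m_def .
  also have "\<dots> \<le> C * D * (m + 1) * (m + 1) * (D * (m + 1))" using sm by (intro mult_le_mono order_refl) auto
  also have "\<dots> = B" unfolding B_def power3_eq_cube by (simp only: mult_ac)
  finally have hB: "h \<le> B" .
  have "m + 1 \<le> (m + 1) ^ 3" by (rule self_le_power) auto
  also have "\<dots> \<le> B" unfolding B_def using C0 D by simp
  finally have mB: "m + 1 \<le> B" .
  have X: "s + h + 1 \<le> 2 * B" using sm hB mB by linarith
  have "n \<le> s + h + (h + 1) * (C * D * (s + h + 1) * (s + h + 1) * D)"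
    using F.irr_bound none unfolding irrel_def s_def h_def C_def by blast
  also have "\<dots> \<le> 2 * B + (2 * B) * (C * D * (2 * B) * (2 * B) * D)"
    using X hB mB by (intro add_mono mult_le_mono order_refl) auto
  also have "(2 * B) * (C * D * (2 * B) * (2 * B) * D) = 8 * ((C * D * D) * B ^ 3)"
    by (simp add: power3_eq_cube mult_ac)
  also have "2 * B + \<dots> \<le> 10 * (C * D * D) * B ^ 3"
  proof -
    have "B \<le> B ^ 3" using mB by (intro self_le_power) auto
    also have "\<dots> \<le> (C * D * D) * B ^ 3" using C0 D by simp
    finally show ?thesis by simp
  qed
  finally show ?thesis unfolding B C_def .
qed

end

text \<open>With \<open>C\<close> the number of codes, \<open>irrel_bound0\<close> yields
  \<open>n \<le> 5120 * D ^ 17 * C ^ 4 * k ^ 9\<close>, where \<open>5120 = 10 * 2 ^ 9\<close>.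
  After squaring, \<open>C ^ 8\<close> is at most a function of \<open>D\<close> times
  \<open>4 * n\<close>, and one factor \<open>n\<close> cancels; \<open>Gb D\<close> is what remains
  beside \<open>k ^ 18\<close>.\<close>

definition Gb :: "nat \<Rightarrow> nat" where
  "Gb D = (5120 ^ 2 * D ^ 34) * ((5 * D ^ 4) ^ (8 * Suc D) * (8 * Suc D) ^ (8 * Suc D)) * 4"

text \<open>It absorbs polylogarithmic factors: for \<open>x = Lg n + 1\<close> the right-hand side
  is at most \<open>e ^ e * (4 * n)\<close>. The proof divides \<open>x\<close> by \<open>e\<close>
  and uses \<open>q + 1 \<le> 2 ^ q\<close> for the quotient.\<close>

lemma power_le_exp: assumes "1 \<le> e" shows "(x::nat) ^ e \<le> e ^ e * 2 ^ x"
proof -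
  define q where "q = x div e"
  have "x = q * e + x mod e" unfolding q_def by simp
  moreover have "x mod e < e" using assms by simp
  ultimately have "x \<le> e * (q + 1)" by (simp add: algebra_simps)
  also have "q + 1 \<le> 2 ^ q" by (simp add: Suc_leI)
  finally have "x \<le> e * 2 ^ q" by simp
  then have "x ^ e \<le> (e * 2 ^ q) ^ e" by (rule power_mono) simp
  also have "\<dots> = e ^ e * 2 ^ (q * e)" by (simp add: power_mult_distrib power_mult)
  also have "\<dots> \<le> e ^ e * 2 ^ x" unfolding q_def by (intro mult_le_mono2 power_increasing) auto
  finally show ?thesis .
qed

lemma modb_power:
  assumes "1 \<le> n" "0 < D"
  shows "modb n D ^ (8 * Suc D) \<le> (5 * D ^ 4) ^ (8 * Suc D) * (8 * Suc D) ^ (8 * Suc D) * (4 * n)"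
proof -
  let ?e = "8 * Suc D"
  have "modb n D = 2 * (Lg n * D ^ 4) + 3" unfolding modb_def by (simp add: power4_eq_xxxx mult_ac)
  also have "\<dots> \<le> 5 * D ^ 4 * (Lg n + 1)"
  proof -
    have "1 \<le> D ^ 4" using assms(2) by simp
    then have "3 \<le> 5 * D ^ 4" by linarith
    then show ?thesis by (simp add: algebra_simps)
  qed
  finally have "modb n D ^ ?e \<le> (5 * D ^ 4 * (Lg n + 1)) ^ ?e" by (rule power_mono) simp
  also have "\<dots> = (5 * D ^ 4) ^ ?e * (Lg n + 1) ^ ?e" by (rule power_mult_distrib)
  also have "\<dots> \<le> (5 * D ^ 4) ^ ?e * (?e ^ ?e * 2 ^ (Lg n + 1))"
    by (intro mult_le_mono2 power_le_exp) simp
  also have "\<dots> \<le> (5 * D ^ 4) ^ ?e * (?e ^ ?e * (4 * n))"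
    by (intro mult_le_mono2 Lg_upper assms(1))
  finally show ?thesis by (simp only: mult.assoc)
qed

lemma modb_Gb:
  assumes "1 \<le> n" "0 < D" shows "modb n D ^ Suc D \<le> Gb D * n"
proof -
  have "modb n D ^ Suc D \<le> modb n D ^ (8 * Suc D)" by (rule power_increasing) (auto simp: modb_def)
  also note modb_power[OF assms]
  also have "(5 * D ^ 4) ^ (8 * Suc D) * (8 * Suc D) ^ (8 * Suc D) * (4 * n) \<le>
    (5120 ^ 2 * D ^ 34) * ((5 * D ^ 4) ^ (8 * Suc D) * (8 * Suc D) ^ (8 * Suc D) * (4 * n))"
  proof -
    have "1 \<le> 5120 ^ 2 * D ^ 34" using assms(2) by simp
    from mult_le_mono1[OF this] show ?thesis by simp
  qed
  finally show ?thesis unfolding Gb_def by (simp only: mult_ac)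
qed

theorem irrel_bound:
  assumes gr: "gr n E" and D: "0 < D" and small: "card (pack n E D k) < k * D"
    and none: "\<And>v. \<not> irrel n E D k v" and k: "1 \<le> k"
  shows "n \<le> Gb D * k ^ 18"
proof (cases "n = 0")
  case False
  then have n1: "1 \<le> n" by simp
  define C where "C = modb n D ^ Suc D"
  have "n \<le> 10 * (C * D * D) * (C * D * D * (k * D + 1) ^ 3) ^ 3"
    using irrel_bound0[OF gr D small none k] unfolding hbound_def[OF gr D small] C_def .
  also have "(k * D + 1) ^ 3 \<le> (2 * k * D) ^ 3"
    by (rule power_mono) (use k D in \<open>auto simp: Suc_le_eq\<close>)
  then have "10 * (C * D * D) * (C * D * D * (k * D + 1) ^ 3) ^ 3 \<le>
    10 * (C * D * D) * (C * D * D * (2 * k * D) ^ 3) ^ 3"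
    by (intro mult_le_mono2 power_mono) auto
  also have "\<dots> = 5120 * D ^ 17 * C ^ 4 * k ^ 9"
    by (simp add: power_mult_distrib flip: power_add power_mult) (simp add: power_numeral_reduce mult_ac)
  finally have "n \<le> 5120 * D ^ 17 * C ^ 4 * k ^ 9" .
  then have "n ^ 2 \<le> (5120 * D ^ 17 * C ^ 4 * k ^ 9) ^ 2" by (rule power_mono) simp
  also have "\<dots> = (5120 ^ 2 * D ^ 34) * C ^ 8 * k ^ 18"
    by (simp add: power_mult_distrib flip: power_mult)
  also have "C ^ 8 = modb n D ^ (8 * Suc D)" unfolding C_def by (simp only: mult.commute flip: power_mult)
  also have "(5120 ^ 2 * D ^ 34) * modb n D ^ (8 * Suc D) * k ^ 18 \<le>
    (5120 ^ 2 * D ^ 34) * ((5 * D ^ 4) ^ (8 * Suc D) * (8 * Suc D) ^ (8 * Suc D) * (4 * n)) * k ^ 18"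
    by (intro mult_le_mono1 mult_le_mono2 modb_power n1 D)
  also have "\<dots> = Gb D * k ^ 18 * n" unfolding Gb_def by (simp only: mult_ac)
  finally have "n * n \<le> Gb D * k ^ 18 * n" by (simp add: power2_eq_square)
  then show ?thesis using n1 by simp
qed simp

subsection \<open>Instances as adjacency predicates\<close>

definition adj :: "nat ugraph \<Rightarrow> nat \<Rightarrow> nat \<Rightarrow> bool" where
  "adj G u v \<longleftrightarrow> {u, v} \<in> snd G"

definition graph_of :: "nat \<Rightarrow> (nat \<Rightarrow> nat \<Rightarrow> bool) \<Rightarrow> nat ugraph" where
  "graph_of n E = ({..<n}, {{u, v} | u v. E u v})"

definition enc :: "nat \<Rightarrow> (nat \<Rightarrow> nat \<Rightarrow> bool) \<Rightarrow> bool list" where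
  "enc n E = replicate n True @ False # map (\<lambda>z. E (z div n) (z mod n)) [0..<n * n]"

lemma gr_adj:
  assumes "valid_instance (G, d, k)" shows "gr (card (fst G)) (adj G)"
proof -
  have s: "\<And>e. e \<in> snd G \<Longrightarrow> e \<subseteq> fst G \<and> card e = 2" and V: "fst G = {..<card (fst G)}"
    using assms unfolding valid_instance_def simple_graph_def by auto
  show ?thesis unfolding gr_def adj_def
  proof (intro allI impI)
    fix u v assume e: "{u, v} \<in> snd G"
    have "u \<noteq> v" using s[OF e] by auto
    moreover have "u \<in> {..<card (fst G)}" "v \<in> {..<card (fst G)}" using s[OF e] V by auto
    ultimately show "u < card (fst G) \<and> v < card (fst G) \<and> u \<noteq> v \<and> {v, u} \<in> snd G"
      using e by (auto simp: insert_commute)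
  qed
qed

lemma graph_of_props:
  assumes "gr n E"
  shows "valid_instance (graph_of n E, d, k)" "adj (graph_of n E) = E" "card (fst (graph_of n E)) = n"
proof -
  have "E u v" if "{u, v} = {a, b}" "E a b" for u v a b
    using that assms unfolding gr_def doubleton_eq_iff by metis
  then show "adj (graph_of n E) = E" by (auto simp: fun_eq_iff adj_def graph_of_def)
  show "card (fst (graph_of n E)) = n" by (simp add: graph_of_def)
  have "e \<subseteq> {..<n} \<and> card e = 2" if "e \<in> {{u, v} | u v. E u v}" for e
  proof -
    obtain u v where "e = {u, v}" "E u v" using \<open>e \<in> _\<close> by blast
    moreover have "u < n \<and> v < n \<and> u \<noteq> v" using \<open>E u v\<close> assms unfolding gr_def by blast
    ultimately show ?thesis by auto
  qed
  then show "valid_instance (graph_of n E, d, k)"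
    unfolding valid_instance_def simple_graph_def graph_of_def by auto
qed

lemma concat_map_upt:
  "concat (map (\<lambda>u. map (f u) [0..<n]) [0..<m]) = map (\<lambda>z. f (z div n) (z mod n)) [0..<m * n]"
proof (induction m)
  case (Suc m)
  have "[0..<Suc m * n] = [0..<m * n] @ [m * n..<m * n + n]"
    by (metis add.commute le_add1 mult_Suc upt_add_eq_append zero_le)
  moreover have "map (\<lambda>z. f (z div n) (z mod n)) [m * n..<m * n + n] = map (f m) [0..<n]"
    by (rule nth_equalityI) auto
  ultimately show ?case using Suc by simp
qed auto

lemma encode_graph_enc: "encode_graph G = enc (card (fst G)) (adj G)"
  unfolding encode_graph_def enc_def Let_def adj_def by (simp only: concat_map_upt)

lemma matching_imp_solution:
  assumes "has_path_matching G d k" "fst G = {..<n}"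
  shows "solvable n (adj G) (Suc d) k"
proof -
  obtain H where H: "\<And>i. i < k \<Longrightarrow> is_subgraph (H i) G" "\<And>i. i < k \<Longrightarrow> isomorphic (H i) (path_graph d)"
    "\<And>i j. i < k \<Longrightarrow> j < k \<Longrightarrow> i \<noteq> j \<Longrightarrow> fst (H i) \<inter> fst (H j) = {}"
    using assms(1) unfolding has_path_matching_def by blast
  have "\<exists>g. bij_betw g {0..d} (fst (H i)) \<and> (\<forall>j<d. {g j, g (Suc j)} \<in> snd (H i))" if i: "i < k" for i
  proof -
    obtain f where f: "bij_betw f (fst (H i)) {0..d}" "{{j, Suc j} | j. j < d} = (\<lambda>e. f ` e) ` snd (H i)"
      using H(2)[OF i] unfolding isomorphic_def path_graph_def by auto
    let ?g = "inv_into (fst (H i)) f"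
    have "{?g j, ?g (Suc j)} \<in> snd (H i)" if "j < d" for j
    proof -
      have "{j, Suc j} \<in> (\<lambda>e. f ` e) ` snd (H i)" unfolding f(2)[symmetric] using that by blast
      then obtain e where e: "e \<in> snd (H i)" "{j, Suc j} = f ` e" by blast
      have "e \<subseteq> fst (H i)" using H(1)[OF i] e(1) unfolding is_subgraph_def simple_graph_def by blast
      then have "?g ` (f ` e) = e" using f(1) by (intro inv_into_image_cancel) (auto simp: bij_betw_def)
      then show ?thesis using e by (metis image_empty image_insert)
    qed
    then show ?thesis using bij_betw_inv_into[OF f(1)] by blast
  qed
  then obtain g where g: "\<And>i. i < k \<Longrightarrow> bij_betw (g i) {0..d} (fst (H i))"
    "\<And>i j. i < k \<Longrightarrow> j < d \<Longrightarrow> {g i j, g i (Suc j)} \<in> snd (H i)" by metis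
  let ?D = "Suc d"
  let ?\<phi> = "\<lambda>p. g (p div ?D) (p mod ?D)"
  have div: "p div ?D < k" "p mod ?D \<in> {0..d}" if "p < k * ?D" for p
    using that by (auto simp: less_mult_imp_div_less less_Suc_eq_le[symmetric])
  have mem: "?\<phi> p \<in> fst (H (p div ?D))" if "p < k * ?D" for p
    using g(1)[OF div(1)[OF that]] div(2)[OF that] unfolding bij_betw_def by blast
  have "inj_on ?\<phi> {..<k * ?D}"
  proof (rule inj_onI)
    fix p q assume pq: "p \<in> {..<k * ?D}" "q \<in> {..<k * ?D}" "?\<phi> p = ?\<phi> q"
    then have p: "p < k * ?D" and q: "q < k * ?D" by auto
    have e: "p div ?D = q div ?D"
    proof (rule ccontr)
      assume "p div ?D \<noteq> q div ?D"
      from H(3)[OF div(1)[OF p] div(1)[OF q] this] mem[OF p] mem[OF q] pq(3) show False by auto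
    qed
    have "p mod ?D = q mod ?D"
      using g(1)[OF div(1)[OF p]] div(2)[OF p] div(2)[OF q] pq(3) unfolding e bij_betw_def inj_on_def by blast
    then show "p = q" using e by (metis div_mult_mod_eq)
  qed
  moreover have "?\<phi> ` {..<k * ?D} \<subseteq> {..<n}"
  proof
    fix x assume "x \<in> ?\<phi> ` {..<k * ?D}"
    then obtain p where p: "p < k * ?D" "x = ?\<phi> p" by auto
    then show "x \<in> {..<n}" using mem[OF p(1)] H(1)[OF div(1)[OF p(1)]] assms(2) unfolding is_subgraph_def by auto
  qed
  moreover have "links (adj G) ?D (k * ?D) ?\<phi>"
    unfolding links_def
  proof (intro allI impI)
    fix p assume p: "p < k * ?D" "Suc p mod ?D \<noteq> 0"
    have m: "Suc p mod ?D = Suc (p mod ?D)" using p(2) by (metis mod_Suc)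
    then have dv: "Suc p div ?D = p div ?D" by (metis div_Suc p(2))
    have "p mod ?D < d" using m by (metis Suc_less_eq mod_less_divisor zero_less_Suc)
    from g(2)[OF div(1)[OF p(1)] this] H(1)[OF div(1)[OF p(1)]]
    show "adj G (?\<phi> p) (?\<phi> (Suc p))" unfolding adj_def m dv is_subgraph_def by blast
  qed
  ultimately show ?thesis unfolding solvable_def solution_def by blast
qed

lemma solution_imp_matching:
  assumes "solvable n (adj G) (Suc d) k" "fst G = {..<n}" "gr n (adj G)"
  shows "has_path_matching G d k"
proof -
  let ?D = "Suc d"
  obtain \<phi> where phi: "inj_on \<phi> {..<k * ?D}" "\<phi> ` {..<k * ?D} \<subseteq> {..<n}" "links (adj G) ?D (k * ?D) \<phi>"
    using assms(1) unfolding solvable_def solution_def by blast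
  have pos: "i * ?D + j < k * ?D" if "i < k" "j \<le> d" for i j
  proof -
    have "i * ?D + j < (i + 1) * ?D" using that by simp
    also have "\<dots> \<le> k * ?D" using that by (intro mult_le_mono1) simp
    finally show ?thesis .
  qed
  let ?g = "\<lambda>i j. \<phi> (i * ?D + j)"
  let ?H = "\<lambda>i. (?g i ` {0..d}, {{?g i j, ?g i (Suc j)} | j. j < d})"
  have edge: "adj G (?g i j) (?g i (Suc j))" if "i < k" "j < d" for i j
  proof -
    have "Suc (i * ?D + j) mod ?D = Suc j" using that by (metis add_Suc_right mod_less mod_mult_self3 Suc_mono)
    then show ?thesis using phi(3) pos[of i j] that unfolding links_def by auto
  qed
  have inj: "inj_on (?g i) {0..d}" if "i < k" for i
  proof (rule inj_onI)
    fix a b assume ab: "a \<in> {0..d}" "b \<in> {0..d}" "?g i a = ?g i b"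
    from inj_onD[OF phi(1) ab(3)] pos[OF that] ab show "a = b" by auto
  qed
  have "is_subgraph (?H i) G" if i: "i < k" for i
  proof -
    have "e \<subseteq> ?g i ` {0..d} \<and> card e = 2 \<and> e \<in> snd G" if e: "e \<in> {{?g i j, ?g i (Suc j)} | j. j < d}" for e
    proof -
      obtain j where j: "j < d" "e = {?g i j, ?g i (Suc j)}" using e by blast
      have "?g i j \<noteq> ?g i (Suc j)" using edge[OF i j(1)] assms(3) unfolding gr_def by blast
      then have "card e = 2" unfolding j(2) by simp
      moreover have "e \<subseteq> ?g i ` {0..d}" unfolding j(2) using j(1)
        by (intro insert_subsetI imageI) auto
      ultimately show ?thesis using j(2) edge[OF i j(1)] unfolding adj_def by blast
    qed
    moreover have "?g i j < n" if "j \<le> d" for j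
      using subsetD[OF phi(2) imageI[of "i * ?D + j" _ \<phi>]] pos[OF i that] by simp
    then have "?g i ` {0..d} \<subseteq> fst G" unfolding assms(2) by auto
    ultimately show ?thesis unfolding is_subgraph_def simple_graph_def by auto
  qed
  moreover have "isomorphic (?H i) (path_graph d)" if i: "i < k" for i
  proof -
    let ?f = "inv_into {0..d} (?g i)"
    have b: "bij_betw (?g i) {0..d} (?g i ` {0..d})" using inj[OF i] by (rule inj_on_imp_bij_betw)
    have f: "?f (?g i j) = j" if "j \<le> d" for j using inv_into_f_f[OF inj[OF i]] that by auto
    have "{{j, Suc j} | j. j < d} = (\<lambda>e. ?f ` e) ` {{?g i j, ?g i (Suc j)} | j. j < d}"
    proof (intro equalityI subsetI)
      fix e assume "e \<in> {{j, Suc j} | j. j < d}"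
      then obtain j where j: "j < d" "e = {j, Suc j}" by blast
      then have "e = ?f ` {?g i j, ?g i (Suc j)}" using f[of j] f[of "Suc j"] by auto
      then show "e \<in> (\<lambda>e. ?f ` e) ` {{?g i j, ?g i (Suc j)} | j. j < d}" using j(1) by blast
    next
      fix e assume "e \<in> (\<lambda>e. ?f ` e) ` {{?g i j, ?g i (Suc j)} | j. j < d}"
      then obtain j where j: "j < d" "e = ?f ` {?g i j, ?g i (Suc j)}" by blast
      then have "e = {j, Suc j}" using f[of j] f[of "Suc j"] by auto
      then show "e \<in> {{j, Suc j} | j. j < d}" using j(1) by blast
    qed
    then show ?thesis unfolding isomorphic_def path_graph_def using bij_betw_inv_into[OF b] by auto
  qed
  moreover have "fst (?H i) \<inter> fst (?H j) = {}" if ij: "i < k" "j < k" "i \<noteq> j" for i j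
  proof (rule ccontr)
    assume "fst (?H i) \<inter> fst (?H j) \<noteq> {}"
    then obtain a b where ab: "a \<le> d" "b \<le> d" "?g i a = ?g j b" by auto
    from inj_onD[OF phi(1) ab(3)] pos ij ab have "i * ?D + a = j * ?D + b" by auto
    then have "(i * ?D + a) div ?D = (j * ?D + b) div ?D" by simp
    moreover have "(x * ?D + y) div ?D = x" if "y \<le> d" for x y
      using that div_mult_self3[of ?D x y] by (simp del: mult_Suc_right)
    ultimately show False using ij ab by metis
  qed
  ultimately show ?thesis unfolding has_path_matching_def by (intro exI[of _ ?H]) blast
qed

lemma yes_instance_iff:
  assumes "valid_instance (G, d, k)"
  shows "yes_instance (G, d, k) \<longleftrightarrow> solvable (card (fst G)) (adj G) (Suc d) k"
proof -
  have "fst G = {..<card (fst G)}" using assms unfolding valid_instance_def by auto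
  then show ?thesis unfolding yes_instance_def
    using matching_imp_solution[of G d k] solution_imp_matching[of "card (fst G)" G d k] gr_adj[OF assms] by auto
qed

section \<open>Logical abbreviations and tables\<close>

definition Eqt :: "tm \<Rightarrow> tm \<Rightarrow> fm" where "Eqt t u = Conj (Neg (Lt t u)) (Neg (Lt u t))"
definition Or :: "fm \<Rightarrow> fm \<Rightarrow> fm" where "Or p q = Neg (Conj (Neg p) (Neg q))"
definition Imp :: "fm \<Rightarrow> fm \<Rightarrow> fm" where "Imp p q = Neg (Conj p (Neg q))"
definition Iff :: "fm \<Rightarrow> fm \<Rightarrow> fm" where "Iff p q = Conj (Imp p q) (Imp q p)"
definition ExF :: "nat \<Rightarrow> tm \<Rightarrow> fm \<Rightarrow> fm" where "ExF x t p = Cnt x t p (Num 1)"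
definition AllF :: "nat \<Rightarrow> tm \<Rightarrow> fm \<Rightarrow> fm" where "AllF x t p = Neg (ExF x t (Neg p))"
definition FF :: fm where "FF = Lt (Num 0) (Num 0)"

lemma sat_ExF: "sat \<rho> e (ExF x t p) \<longleftrightarrow> (\<exists>a<val e t. sat \<rho> (e(x := a)) p)"
proof -
  let ?A = "{a. a < val e t \<and> sat \<rho> (e(x := a)) p}"
  have "finite ?A" by (rule finite_subset[of _ "{..<val e t}"]) auto
  then have "1 \<le> card ?A \<longleftrightarrow> ?A \<noteq> {}" by (simp add: Suc_le_eq card_gt_0_iff)
  then show ?thesis by (auto simp: ExF_def)
qed

lemma sat_macros [simp]:
  "sat \<rho> e (Eqt t u) \<longleftrightarrow> val e t = val e u"
  "sat \<rho> e (Or p q) \<longleftrightarrow> sat \<rho> e p \<or> sat \<rho> e q"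
  "sat \<rho> e (Imp p q) \<longleftrightarrow> (sat \<rho> e p \<longrightarrow> sat \<rho> e q)"
  "sat \<rho> e (Iff p q) \<longleftrightarrow> (sat \<rho> e p \<longleftrightarrow> sat \<rho> e q)"
  "sat \<rho> e (ExF x t p) \<longleftrightarrow> (\<exists>a<val e t. sat \<rho> (e(x := a)) p)"
  "sat \<rho> e (AllF x t p) \<longleftrightarrow> (\<forall>a<val e t. sat \<rho> (e(x := a)) p)"
  "sat \<rho> e FF \<longleftrightarrow> False"
  by (auto simp: Eqt_def Or_def Imp_def Iff_def AllF_def FF_def sat_ExF)

text \<open>Tables of any arity are bit lists, indexed by tuples read as digits in base
  \<open>b\<close>, which is always the budget. So a table keeps its meaning only while the budget
  stays the same.\<close>

fun idx :: "nat \<Rightarrow> nat list \<Rightarrow> nat" where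
  "idx b [] = 0"
| "idx b (a # as) = a + b * idx b as"

fun idxt :: "tm list \<Rightarrow> tm" where
  "idxt [] = Num 0"
| "idxt (t # ts) = Add t (Mul (Var 0) (idxt ts))"

lemma val_idxt: "val e (idxt ts) = idx (e 0) (map (val e) ts)"
  by (induction ts) auto

lemma idx_less: "\<forall>a\<in>set as. a < b \<Longrightarrow> idx b as < b ^ length as"
proof (induction as)
  case (Cons a as)
  then have "a < b" "idx b as + 1 \<le> b ^ length as" by (simp_all add: Suc_le_eq)
  then have "a + b * idx b as < b * (idx b as + 1)" by simp
  also have "\<dots> \<le> b * b ^ length as" using \<open>idx b as + 1 \<le> b ^ length as\<close> by (rule mult_le_mono2)
  finally show ?case by simp
qed auto

lemma idx_inj:
  "\<forall>a\<in>set as. a < b \<Longrightarrow> \<forall>a\<in>set cs. a < b \<Longrightarrow> length as = length cs \<Longrightarrow> idx b as = idx b cs \<Longrightarrow> as = cs"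
proof (induction as arbitrary: cs)
  case (Cons a as)
  then obtain c cs' where cs: "cs = c # cs'" by (cases cs) auto
  have ab: "a < b" "c < b" using Cons.prems cs by auto
  have e: "a + b * idx b as = c + b * idx b cs'" using Cons.prems(4) cs by simp
  have "a = (a + b * idx b as) mod b" using ab by simp
  also have "\<dots> = c" unfolding e using ab by simp
  finally have ac: "a = c" .
  then have "b * idx b as = b * idx b cs'" using e by simp
  then have "idx b as = idx b cs'" using ab by simp
  then have "as = cs'" using Cons.IH[of cs'] Cons.prems cs by simp
  then show ?case using ac cs by simp
qed auto

fun bnds :: "tm list \<Rightarrow> fm" where
  "bnds [] = Lt (Num 0) (Num 1)"
| "bnds (t # ts) = Conj (Lt t (Var 0)) (bnds ts)"

text \<open>The range check keeps different tuples from sharing an index. It also makes entries at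
  the budget itself false, and the budget is the value returned by an unsuccessful search.\<close>

definition Rel :: "nat \<Rightarrow> tm list \<Rightarrow> fm" where
  "Rel R ts = Conj (bnds ts) (Peek R (idxt ts) {Some True})"

definition rel :: "nat \<Rightarrow> bool list \<Rightarrow> nat list \<Rightarrow> bool" where
  "rel b l as \<longleftrightarrow> (\<forall>a\<in>set as. a < b) \<and> idx b as < length l \<and> l ! idx b as"

lemma sat_bnds: "sat \<rho> e (bnds ts) \<longleftrightarrow> (\<forall>a\<in>set (map (val e) ts). a < e 0)"
  by (induction ts) auto

lemma top_drop: "top_of (drop i l) = Some b \<longleftrightarrow> i < length l \<and> l ! i = b"
proof (cases "i < length l")
  case True
  then have "drop i l = l ! i # drop (Suc i) l" by (simp add: Cons_nth_drop_Suc)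
  then show ?thesis using True by simp
qed auto

lemma top_drop_None: "top_of (drop i l) = None \<longleftrightarrow> length l \<le> i"
proof (cases "i < length l")
  case True
  then have "drop i l = l ! i # drop (Suc i) l" by (simp add: Cons_nth_drop_Suc)
  then show ?thesis using True by simp
qed auto

lemma sat_Rel [simp]: "sat \<rho> e (Rel R ts) \<longleftrightarrow> rel (e 0) (\<rho> R) (map (val e) ts)"
  unfolding Rel_def rel_def sat.simps sat_bnds val_idxt using top_drop[of _ _ True] by auto

lemma rel_Nil [simp]: "rel b [] as \<longleftrightarrow> False"
  by (simp add: rel_def)

fun exs :: "nat list \<Rightarrow> fm \<Rightarrow> fm" where
  "exs [] p = p"
| "exs (x # xs) p = ExF x (Var 0) (exs xs p)"

fun upds :: "env \<Rightarrow> nat list \<Rightarrow> nat list \<Rightarrow> env" where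
  "upds e (x # xs) (a # as) = upds (e(x := a)) xs as"
| "upds e _ _ = e"

lemma sat_exs:
  "0 \<notin> set xs \<Longrightarrow> sat \<rho> e (exs xs p) \<longleftrightarrow>
    (\<exists>as. length as = length xs \<and> (\<forall>a\<in>set as. a < e 0) \<and> sat \<rho> (upds e xs as) p)"
proof (induction xs arbitrary: e)
  case (Cons x xs)
  have "sat \<rho> e (exs (x # xs) p) \<longleftrightarrow> (\<exists>a<e 0. \<exists>as. length as = length xs \<and> (\<forall>a\<in>set as. a < e 0) \<and>
      sat \<rho> (upds e (x # xs) (a # as)) p)"
    using Cons by auto
  also have "\<dots> \<longleftrightarrow> (\<exists>as. length as = length (x # xs) \<and> (\<forall>a\<in>set as. a < e 0) \<and> sat \<rho> (upds e (x # xs) as) p)"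
    (is "?l \<longleftrightarrow> ?r")
  proof
    assume ?l
    then obtain a as where as: "a < e 0" "length as = length xs" "\<forall>a\<in>set as. a < e 0"
      "sat \<rho> (upds e (x # xs) (a # as)) p" by blast
    show ?r by (rule exI[of _ "a # as"]) (use as in auto)
  next
    assume ?r
    then obtain bs where bs: "length bs = length (x # xs)" "\<forall>a\<in>set bs. a < e 0" "sat \<rho> (upds e (x # xs) bs) p"
      by blast
    then obtain a as where "bs = a # as" by (cases bs) auto
    then show ?l using bs by (intro exI[of _ a] exI[of _ as] conjI) auto
  qed
  finally show ?case .
qed auto

fun powt :: "tm \<Rightarrow> nat \<Rightarrow> tm" where
  "powt t 0 = Num 1"
| "powt t (Suc n) = Mul t (powt t n)"

lemma val_powt [simp]: "val e (powt t n) = val e t ^ n"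
  by (induction n) auto

text \<open>Variable 99 is reserved for the index of the entry that is being computed.\<close>

definition RDef :: "nat \<Rightarrow> nat list \<Rightarrow> fm \<Rightarrow> cmd" where
  "RDef R xs p = Def R 99 (powt (Var 0) (length xs)) (exs xs (Conj (Eqt (Var 99) (idxt (map Var xs))) p))"

definition table :: "rels \<Rightarrow> env \<Rightarrow> nat list \<Rightarrow> fm \<Rightarrow> bool list" where
  "table \<rho> e xs p = map (\<lambda>a. sat \<rho> (e(99 := a)) (exs xs (Conj (Eqt (Var 99) (idxt (map Var xs))) p))) [0..<e 0 ^ length xs]"

lemma sem_RDef [simp]: "sem (RDef R xs p) (e, \<rho>) = (e, \<rho>(R := table \<rho> e xs p))"
  by (simp add: RDef_def table_def)

lemma upds_other: "x \<notin> set xs \<Longrightarrow> upds e xs as x = e x"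
  by (induction e xs as rule: upds.induct) auto

lemma upds_vals: "distinct xs \<Longrightarrow> length as = length xs \<Longrightarrow> map (upds e xs as) xs = as"
proof (induction xs arbitrary: as e)
  case (Cons x xs)
  then obtain a as' where as: "as = a # as'" by (cases as) auto
  have "upds (e(x := a)) xs as' x = a" using upds_other[of x xs] Cons.prems by auto
  then show ?case using Cons as by auto
qed auto

text \<open>The formula for the entry with a given index guesses the tuple; by
  \<open>idx_inj\<close> only the right tuple fits.\<close>

lemma rel_table:
  assumes "length as = length xs" "distinct xs" "0 \<notin> set xs" "99 \<notin> set xs"
  shows "rel (e 0) (table \<rho> e xs p) as \<longleftrightarrow>
    (\<forall>a\<in>set as. a < e 0) \<and> sat \<rho> (upds (e(99 := idx (e 0) as)) xs as) p"
proof (cases "\<forall>a\<in>set as. a < e 0")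
  case True
  let ?i = "idx (e 0) as"
  have i: "?i < e 0 ^ length xs" using idx_less[OF True] assms(1) by simp
  let ?e = "e(99 := ?i)"
  have "rel (e 0) (table \<rho> e xs p) as \<longleftrightarrow>
    sat \<rho> ?e (exs xs (Conj (Eqt (Var 99) (idxt (map Var xs))) p))"
    using True i by (simp add: rel_def table_def)
  also have "\<dots> \<longleftrightarrow> (\<exists>cs. length cs = length xs \<and> (\<forall>a\<in>set cs. a < e 0) \<and>
      sat \<rho> (upds ?e xs cs) (Conj (Eqt (Var 99) (idxt (map Var xs))) p))"
    using sat_exs[OF assms(3), of \<rho> ?e] by simp
  also have "\<dots> \<longleftrightarrow> (\<exists>cs. length cs = length xs \<and> (\<forall>a\<in>set cs. a < e 0) \<and> ?i = idx (e 0) cs \<and>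
      sat \<rho> (upds ?e xs cs) p)"
  proof -
    have "sat \<rho> (upds ?e xs cs) (Eqt (Var 99) (idxt (map Var xs))) \<longleftrightarrow> ?i = idx (e 0) cs" if "length cs = length xs" for cs
      using upds_other[of 99 xs ?e cs] upds_other[of 0 xs ?e cs] upds_vals[OF assms(2) that, of ?e] assms(3,4)
      by (simp add: val_idxt comp_def)
    then show ?thesis by auto
  qed
  also have "\<dots> \<longleftrightarrow> sat \<rho> (upds ?e xs as) p"
    using idx_inj[of as "e 0"] True assms(1) by auto
  finally show ?thesis using True by simp
next
  case False
  then show ?thesis unfolding rel_def by blast
qed

text \<open>This turns counting into searching: an assignment of this form yields the least witness,
  or \<open>b\<close> if there is none below \<open>b\<close>.\<close>

lemma card_below_least:
  fixes P :: "nat \<Rightarrow> bool"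
  shows "card {y. y < b \<and> (\<forall>v\<le>y. \<not> P v)} = (if \<exists>v<b. P v then LEAST v. P v else b)"
proof (cases "\<exists>v<b. P v")
  case True
  then obtain w where w: "w < b" "P w" by blast
  let ?l = "LEAST v. P v"
  have l: "P ?l" "?l \<le> w" using w(2) by (rule LeastI, rule Least_le)
  have "(y < b \<and> (\<forall>v\<le>y. \<not> P v)) \<longleftrightarrow> y < ?l" for y
  proof
    assume "y < b \<and> (\<forall>v\<le>y. \<not> P v)"
    then show "y < ?l" using l(1) not_le by blast
  next
    assume y: "y < ?l"
    have "\<not> P v" if "v \<le> y" for v using not_less_Least[of v P] y that by simp
    then show "y < b \<and> (\<forall>v\<le>y. \<not> P v)" using y l(2) w(1) by simp
  qed
  then have "card {y. y < b \<and> (\<forall>v\<le>y. \<not> P v)} = card {y. y < ?l}" by simp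
  then show ?thesis using True by simp
next
  case False
  then have "(y < b \<and> (\<forall>v\<le>y. \<not> P v)) \<longleftrightarrow> y < b" for y by (meson le_less_trans)
  then have "card {y. y < b \<and> (\<forall>v\<le>y. \<not> P v)} = card {y. y < b}" by simp
  then show ?thesis unfolding if_not_P[OF False] by simp
qed

lemma card_less_min: "card {y. y < b \<and> y < c} = min b (c::nat)"
proof -
  have "{y. y < b \<and> y < c} = {..<min b c}" by auto
  then show ?thesis by simp
qed

lemma funpow_inv:
  assumes "P 0 x" "\<And>i x. i < m \<Longrightarrow> P i x \<Longrightarrow> P (Suc i) (f x)"
  shows "P m ((f ^^ m) x)"
proof -
  have "j \<le> m \<Longrightarrow> P j ((f ^^ j) x)" for j by (induction j) (use assms in auto)
  then show ?thesis by simp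
qed

definition Clr :: "nat \<Rightarrow> cmd" where "Clr R = Def R 99 (Num 0) FF"
definition Set :: "nat \<Rightarrow> tm \<Rightarrow> cmd" where "Set x t = Asg x 99 (Lt (Var 99) t)"

lemma sem_Clr [simp]: "sem (Clr R) (e, \<rho>) = (e, \<rho>(R := []))"
  by (simp add: Clr_def)

fun no99 :: "tm \<Rightarrow> bool" where
  "no99 (Var x) \<longleftrightarrow> x \<noteq> 99"
| "no99 (Num n) \<longleftrightarrow> True"
| "no99 (Add t u) \<longleftrightarrow> no99 t \<and> no99 u"
| "no99 (Mul t u) \<longleftrightarrow> no99 t \<and> no99 u"

lemma val_no99: "no99 t \<Longrightarrow> val (e(99 := a)) t = val e t"
  by (induction t) auto

lemma sem_Set: "no99 t \<Longrightarrow> sem (Set x t) (e, \<rho>) = (e(x := min (e 0) (val e t)), \<rho>)"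
  by (simp add: Set_def val_no99 card_less_min)

subsection \<open>Powers and digits\<close>

definition PowC :: cmd where
  "PowC = Sq (Clr 6) (Rep (Var 0) (RDef 6 [20, 21]
     (Or (Conj (Eqt (Var 20) (Num 0)) (Eqt (Var 21) (Num 1)))
       (ExF 22 (Var 0) (ExF 23 (Var 0) (Conj (Eqt (Var 20) (Add (Var 22) (Num 1)))
         (Conj (Eqt (Var 21) (Mul (Var 23) (Var 4))) (Rel 6 [Var 22, Var 23]))))))))"

lemma PowC:
  assumes "1 \<le> e 4"
  shows "\<exists>l. sem PowC (e, \<rho>) = (e, \<rho>(6 := l)) \<and>
    (\<forall>i z. rel (e 0) l [i, z] \<longleftrightarrow> i < e 0 \<and> z < e 0 \<and> z = e 4 ^ i)"
proof -
  define P where "P t st \<longleftrightarrow> (\<exists>l. st = (e, \<rho>(6 := l)) \<and>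
    (\<forall>i z. rel (e 0) l [i, z] \<longleftrightarrow> i < t \<and> i < e 0 \<and> z < e 0 \<and> z = e 4 ^ i))" for t and st :: "env \<times> rels"
  let ?c = "RDef 6 [20, 21]
     (Or (Conj (Eqt (Var 20) (Num 0)) (Eqt (Var 21) (Num 1)))
       (ExF 22 (Var 0) (ExF 23 (Var 0) (Conj (Eqt (Var 20) (Add (Var 22) (Num 1)))
         (Conj (Eqt (Var 21) (Mul (Var 23) (Var 4))) (Rel 6 [Var 22, Var 23]))))))"
  have "P (e 0) ((sem ?c ^^ e 0) (e, \<rho>(6 := [])))"
  proof (rule funpow_inv[where P = P])
    show "P 0 (e, \<rho>(6 := []))" unfolding P_def by (intro exI[of _ "[]"]) simp
    fix t st assume "P t st"
    then obtain l where st: "st = (e, \<rho>(6 := l))" and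
      l: "\<And>i z. rel (e 0) l [i, z] \<longleftrightarrow> i < t \<and> i < e 0 \<and> z < e 0 \<and> z = e 4 ^ i" unfolding P_def by blast
    have eq: "(i = 0 \<and> z = 1 \<or> (\<exists>a<e 0. \<exists>b<e 0. i = Suc a \<and> z = b * e 4 \<and> a < t \<and> b = e 4 ^ a)) \<longleftrightarrow>
        i < Suc t \<and> z = e 4 ^ i" if iz: "i < e 0" "z < e 0" for i z
    proof (cases i)
      case (Suc a)
      \<comment> \<open>The previous power is below the budget as well, so it is already in the
        table.\<close>
      have "e 4 ^ a \<le> e 4 ^ a * e 4" using assms by simp
      moreover have "e 4 ^ i = e 4 ^ a * e 4" using Suc by simp
      ultimately have "z = e 4 ^ i \<Longrightarrow> e 4 ^ a < e 0" using iz by linarith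
      then show ?thesis using Suc iz by (auto simp: mult.commute)
    qed simp
    show "P (Suc t) (sem ?c st)" unfolding P_def st sem_RDef
    proof (intro exI conjI allI)
      fix i z
      show "rel (e 0) (table (\<rho>(6 := l)) e [20, 21] (Or (Conj (Eqt (Var 20) (Num 0)) (Eqt (Var 21) (Num 1)))
       (ExF 22 (Var 0) (ExF 23 (Var 0) (Conj (Eqt (Var 20) (Add (Var 22) (Num 1)))
         (Conj (Eqt (Var 21) (Mul (Var 23) (Var 4))) (Rel 6 [Var 22, Var 23]))))))) [i, z] \<longleftrightarrow>
         i < Suc t \<and> i < e 0 \<and> z < e 0 \<and> z = e 4 ^ i"
        using eq[of i z] by (auto simp: rel_table l)
    qed simp
  qed
  then show ?thesis unfolding P_def PowC_def by auto
qed

definition pow_tab :: "env \<Rightarrow> rels \<Rightarrow> bool" where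
  "pow_tab e \<rho> \<longleftrightarrow> (\<forall>i z. rel (e 0) (\<rho> 6) [i, z] \<longleftrightarrow> i < e 0 \<and> z < e 0 \<and> z = e 4 ^ i)"

text \<open>\<open>Dig c i r\<close>: the digit of \<open>c\<close> with index \<open>i\<close> in the base held by variable 4 is \<open>r\<close>.
  The bound variables are 80, 81 and 82.\<close>

definition Dig :: "tm \<Rightarrow> tm \<Rightarrow> tm \<Rightarrow> fm" where
  "Dig c i r = ExF 80 (Var 0) (Conj (Rel 6 [i, Var 80]) (ExF 81 (Var 0) (ExF 82 (Var 80)
     (Conj (Eqt c (Add (Mul (Add (Mul (Var 81) (Var 4)) r) (Var 80)) (Var 82))) (Lt r (Var 4))))))"

fun vars_lt :: "nat \<Rightarrow> tm \<Rightarrow> bool" where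
  "vars_lt m (Var x) \<longleftrightarrow> x < m"
| "vars_lt m (Num n) \<longleftrightarrow> True"
| "vars_lt m (Add t u) \<longleftrightarrow> vars_lt m t \<and> vars_lt m u"
| "vars_lt m (Mul t u) \<longleftrightarrow> vars_lt m t \<and> vars_lt m u"

lemma val_vars_lt: "vars_lt m t \<Longrightarrow> m \<le> x \<Longrightarrow> val (e(x := a)) t = val e t"
  by (induction t) auto

lemma sat_Dig:
  assumes "pow_tab e \<rho>" "vars_lt 80 c" "vars_lt 80 i" "vars_lt 80 r"
    and "val e c < e 0" "val e i < e 0" "e 4 ^ val e i < e 0" "1 \<le> e 4"
  shows "sat \<rho> e (Dig c i r) \<longleftrightarrow> dg (e 4) (val e c) (val e i) = val e r"
proof -
  let ?z = "e 4 ^ val e i"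
  let ?c = "val e c"
  let ?r = "val e r"
  have "sat \<rho> e (Dig c i r) \<longleftrightarrow> (\<exists>a<e 0. \<exists>t<?z. ?c = (a * e 4 + ?r) * ?z + t \<and> ?r < e 4)"
    unfolding Dig_def using assms(1,6,7) by (simp add: val_vars_lt[OF assms(2)] val_vars_lt[OF assms(3)]
      val_vars_lt[OF assms(4)] pow_tab_def)
  also have "\<dots> \<longleftrightarrow> ?c div ?z mod e 4 = ?r"
  proof
    assume "\<exists>a<e 0. \<exists>t<?z. ?c = (a * e 4 + ?r) * ?z + t \<and> ?r < e 4"
    then obtain a t where t: "t < ?z" "?c = (a * e 4 + ?r) * ?z + t" "?r < e 4" by blast
    then have "?c div ?z = a * e 4 + ?r" by simp
    then show "?c div ?z mod e 4 = ?r" using t(3) by simp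
  next
    assume r: "?c div ?z mod e 4 = ?r"
    let ?a = "?c div ?z div e 4"
    have "?a \<le> ?c" by (meson div_le_dividend le_trans)
    then have "?a < e 0" using assms(5) by simp
    moreover have "?c mod ?z < ?z" using assms(8) by simp
    moreover have "?a * e 4 + ?r = ?c div ?z" unfolding r[symmetric] by (rule div_mult_mod_eq)
    then have "?c = (?a * e 4 + ?r) * ?z + ?c mod ?z" by (simp only: div_mult_mod_eq)
    moreover have "?r < e 4" using r assms(8) by (metis less_le_trans mod_less_divisor zero_less_one)
    ultimately show "\<exists>a<e 0. \<exists>t<?z. ?c = (a * e 4 + ?r) * ?z + t \<and> ?r < e 4" by blast
  qed
  finally show ?thesis unfolding dg_def .
qed

text \<open>Variables: 0 bound of all values, 1 number \<open>n\<close> of vertices, 2 number \<open>D = d + 1\<close> of vertices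
  of a path, 3 \<open>k\<close>, 4 base of the digits. Relations: 0 adjacency matrix, 6 powers of the base,
  7 packed vertices, 8 ancestors, 9 last chain element, 10 reachability, 11 next chain element.\<close>

definition Em :: "nat \<Rightarrow> bool list \<Rightarrow> nat \<Rightarrow> nat \<Rightarrow> bool" where
  "Em n M u v \<longleftrightarrow> u < n \<and> v < n \<and> u * n + v < length M \<and> M ! (u * n + v)"

text \<open>The matrix is indexed with the number of vertices and not with the budget, since it
  comes with the input and has to survive \<open>Grow\<close>.\<close>

definition Edg :: "tm \<Rightarrow> tm \<Rightarrow> fm" where
  "Edg t u = Conj (Lt t (Var 1)) (Conj (Lt u (Var 1)) (Peek 0 (Add (Mul t (Var 1)) u) {Some True}))"

lemma sat_Edg [simp]: "sat \<rho> e (Edg t u) \<longleftrightarrow> Em (e 1) (\<rho> 0) (val e t) (val e u)"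
  unfolding Edg_def Em_def using top_drop[of _ _ True] by auto

definition agree :: "nat set \<Rightarrow> rels \<Rightarrow> rels \<Rightarrow> bool" where
  "agree X \<rho> \<rho>' \<longleftrightarrow> (\<forall>R. R \<notin> X \<longrightarrow> \<rho>' R = \<rho> R)"

subsection \<open>Reachability\<close>

definition rchF :: fm where
  "rchF = Conj (Lt (Var 20) (Var 1)) (Conj (Lt (Var 21) (Var 1)) (Conj (Neg (Rel 7 [Var 20]))
     (Conj (Neg (Rel 7 [Var 21])) (Conj (Neg (Rel 8 [Var 20, Var 20])) (Conj (Neg (Rel 8 [Var 20, Var 21]))
     (Or (Eqt (Var 20) (Var 21)) (ExF 22 (Var 1) (Conj (Rel 10 [Var 20, Var 22]) (Edg (Var 22) (Var 21))))))))))"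

definition ReachC :: cmd where
  "ReachC = Sq (Clr 10) (Rep (Var 0) (RDef 10 [20, 21] rchF))"

lemma steps_bounded:
  assumes gr: "gr n E" and "(step E A)\<^sup>*\<^sup>* v w" shows "\<exists>i\<le>n * n. (step E A ^^ i) v w"
proof -
  let ?R = "{(x, y). step E A x y}"
  have sub: "?R \<subseteq> {..<n} \<times> {..<n}" using gr unfolding step_def gr_def by auto
  then have fin: "finite ?R" by (rule finite_subset) simp
  have "card ?R \<le> card ({..<n} \<times> {..<n})" by (rule card_mono) (use sub in auto)
  then have c: "card ?R \<le> n * n" by (simp add: card_cartesian_product)
  have "(v, w) \<in> ?R\<^sup>*" using assms(2) by (simp add: rtranclp_rtrancl_eq)
  then obtain i where "i \<le> card ?R" "(v, w) \<in> ?R ^^ i" unfolding rtrancl_finite_eq_relpow[OF fin] by blast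
  then show ?thesis using c relpowp_relpow_eq[of i ?R] by (intro exI[of _ i]) (auto simp: fun_eq_iff)
qed

text \<open>Every vertex \<open>v\<close> has its own removed set \<open>A v\<close>, the packing
  together with its chain, so reachability is computed for all of them side by side, one more step
  per round. By \<open>steps_bounded\<close> a budget above \<open>n * n\<close> gives enough
  rounds.\<close>

lemma ReachC:
  assumes gr: "gr n E" and E: "E = Em n (\<rho> 0)" "n = e 1" and B: "n * n < e 0" "n < e 0"
    and A: "\<And>v u. v < n \<Longrightarrow> u < n \<Longrightarrow> u \<in> A v \<longleftrightarrow> rel (e 0) (\<rho> 7) [u] \<or> rel (e 0) (\<rho> 8) [v, u]"
  shows "\<exists>l. sem ReachC (e, \<rho>) = (e, \<rho>(10 := l)) \<and>
    (\<forall>v w. rel (e 0) l [v, w] \<longleftrightarrow> v < n \<and> v \<notin> A v \<and> (step E (A v))\<^sup>*\<^sup>* v w)"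
proof -
  define Q where "Q j v w \<longleftrightarrow> v < n \<and> v \<notin> A v \<and> (\<exists>i<j. (step E (A v) ^^ i) v w)" for j v w
  define P where "P j st \<longleftrightarrow> (\<exists>l. st = (e, \<rho>(10 := l)) \<and> (\<forall>v w. rel (e 0) l [v, w] \<longleftrightarrow> Q j v w))"
    for j and st :: "env \<times> rels"
  have Qn: "w < n \<and> w \<notin> A v" if q: "Q j v w" for j v w
  proof -
    obtain i where i: "v < n" "v \<notin> A v" "(step E (A v) ^^ i) v w" using q unfolding Q_def by blast
    then have "(step E (A v))\<^sup>*\<^sup>* v w" by (simp add: relpowp_imp_rtranclp)
    from steps_in[OF gr this i(2,1)] show ?thesis by blast
  qed
  have QS: "Q (Suc j) v w \<longleftrightarrow> v < n \<and> w < n \<and> v \<notin> A v \<and> w \<notin> A v \<and> (v = w \<or> (\<exists>x<n. Q j v x \<and> E x w))" for j v w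
  proof
    assume q: "Q (Suc j) v w"
    then obtain i where i: "i < Suc j" "v < n" "v \<notin> A v" "(step E (A v) ^^ i) v w" unfolding Q_def by blast
    have "v = w \<or> (\<exists>x<n. Q j v x \<and> E x w)"
    proof (cases i)
      case 0
      then show ?thesis using i(4) by simp
    next
      case (Suc i')
      then obtain x where x: "(step E (A v) ^^ i') v x" "step E (A v) x w" using i(4) by (auto elim: relpowp_Suc_E)
      then have qx: "Q j v x" unfolding Q_def using i Suc by auto
      then show ?thesis using Qn[OF qx] x(2) unfolding step_def by blast
    qed
    then show "v < n \<and> w < n \<and> v \<notin> A v \<and> w \<notin> A v \<and> (v = w \<or> (\<exists>x<n. Q j v x \<and> E x w))"
      using Qn[OF q] i by blast
  next
    assume r: "v < n \<and> w < n \<and> v \<notin> A v \<and> w \<notin> A v \<and> (v = w \<or> (\<exists>x<n. Q j v x \<and> E x w))"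
    show "Q (Suc j) v w"
    proof (cases "v = w")
      case True
      then have "(step E (A v) ^^ 0) v w" by simp
      then show ?thesis unfolding Q_def using r by blast
    next
      case False
      then obtain x where x: "Q j v x" "E x w" using r by blast
      then obtain i where i: "i < j" "(step E (A v) ^^ i) v x" unfolding Q_def by blast
      have "step E (A v) x w" using x Qn[OF x(1)] r unfolding step_def by blast
      then have "(step E (A v) ^^ Suc i) v w" using i(2) by (rule relpowp_Suc_I[rotated])
      then show ?thesis unfolding Q_def using r i(1) Suc_less_eq by blast
    qed
  qed
  have "P (e 0) ((sem (RDef 10 [20, 21] rchF) ^^ e 0) (e, \<rho>(10 := [])))"
  proof (rule funpow_inv[where P = P])
    show "P 0 (e, \<rho>(10 := []))" unfolding P_def by (intro exI[of _ "[]"]) (simp add: Q_def)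
    fix j st assume "P j st"
    then obtain l where st: "st = (e, \<rho>(10 := l))" and l: "\<And>v w. rel (e 0) l [v, w] \<longleftrightarrow> Q j v w"
      unfolding P_def by blast
    have "rel (e 0) (table (\<rho>(10 := l)) e [20, 21] rchF) [v, w] \<longleftrightarrow> Q (Suc j) v w" for v w
    proof -
      have "rel (e 0) (table (\<rho>(10 := l)) e [20, 21] rchF) [v, w] \<longleftrightarrow> v < e 0 \<and> w < e 0 \<and>
        v < n \<and> w < n \<and> \<not> rel (e 0) (\<rho> 7) [v] \<and> \<not> rel (e 0) (\<rho> 7) [w] \<and> \<not> rel (e 0) (\<rho> 8) [v, v] \<and>
        \<not> rel (e 0) (\<rho> 8) [v, w] \<and> (v = w \<or> (\<exists>x<n. Q j v x \<and> E x w))"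
        by (simp add: rel_table rchF_def l E)
      then show ?thesis unfolding QS using A[of v v] A[of v w] B(2) by auto
    qed
    then show "P (Suc j) (sem (RDef 10 [20, 21] rchF) st)" unfolding P_def st sem_RDef by auto
  qed
  then obtain l where l: "sem ReachC (e, \<rho>) = (e, \<rho>(10 := l))" "\<And>v w. rel (e 0) l [v, w] \<longleftrightarrow> Q (e 0) v w"
    unfolding P_def ReachC_def by auto
  have "Q (e 0) v w \<longleftrightarrow> v < n \<and> v \<notin> A v \<and> (step E (A v))\<^sup>*\<^sup>* v w" for v w
    unfolding Q_def using steps_bounded[OF gr, of "A v" v w] B(1)
    by (meson le_less_trans relpowp_imp_rtranclp)
  then show ?thesis using l by blast
qed

subsection \<open>Chains and the packing\<close>

text \<open>The universal quantifier over the head makes the condition true for an empty chain, as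
  \<open>nexts\<close> demands.\<close>

definition adjL :: "tm \<Rightarrow> tm \<Rightarrow> fm" where
  "adjL v u = AllF 23 (Var 1) (Imp (Rel 9 [v, Var 23]) (Edg (Var 23) u))"

definition nxF :: fm where
  "nxF = Conj (Rel 10 [Var 20, Var 21]) (Conj (adjL (Var 20) (Var 21))
     (AllF 24 (Var 21) (Neg (Conj (Rel 10 [Var 20, Var 24]) (adjL (Var 20) (Var 24))))))"

definition StepC :: cmd where
  "StepC = Sq ReachC (Sq (RDef 11 [20, 21] nxF)
     (Sq (RDef 9 [20, 21] (Or (Rel 11 [Var 20, Var 21])
        (Conj (Rel 9 [Var 20, Var 21]) (Neg (ExF 22 (Var 1) (Rel 11 [Var 20, Var 22]))))))
       (RDef 8 [20, 21] (Or (Rel 8 [Var 20, Var 21]) (Rel 11 [Var 20, Var 21])))))"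

definition ChainC :: cmd where
  "ChainC = Sq (Clr 8) (Sq (Clr 9) (Rep (Var 2) StepC))"

text \<open>The chains of all vertices grow simultaneously, by at most one vertex per round. Only
  the set of chain vertices (relation 8) and the newest one (relation 9) are stored, because
  \<open>nexts\<close> depends on nothing else.\<close>

lemma ChainC:
  assumes gr: "gr n E" and E: "E = Em n (\<rho> 0)" "n = e 1" and B: "n * n < e 0" "n < e 0"
    and S: "\<And>u. rel (e 0) (\<rho> 7) [u] \<longleftrightarrow> u \<in> S"
  shows "\<exists>\<rho>'. sem ChainC (e, \<rho>) = (e, \<rho>') \<and> agree {8, 9, 10, 11} \<rho> \<rho>' \<and>
    (\<forall>v u. rel (e 0) (\<rho>' 8) [v, u] \<longleftrightarrow> u \<in> set (chain n E S (e 2) v))"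
proof -
  define P where "P t st \<longleftrightarrow> (\<exists>\<rho>'. st = (e, \<rho>') \<and> agree {8, 9, 10, 11} \<rho> \<rho>' \<and>
    (\<forall>v u. rel (e 0) (\<rho>' 8) [v, u] \<longleftrightarrow> u \<in> set (chain n E S t v)) \<and>
    (\<forall>v u. rel (e 0) (\<rho>' 9) [v, u] \<longleftrightarrow> chain n E S t v \<noteq> [] \<and> u = hd (chain n E S t v)))"
    for t and st :: "env \<times> rels"
  have en: "e (Suc 0) = n" using E(2) by simp
  have "P (e 2) ((sem StepC ^^ e 2) (e, \<rho>(8 := [], 9 := [])))"
  proof (rule funpow_inv[where P = P])
    show "P 0 (e, \<rho>(8 := [], 9 := []))" unfolding P_def by (auto simp: agree_def)
    fix t st assume "P t st"
    then obtain \<rho>1 where st: "st = (e, \<rho>1)" and ag: "agree {8, 9, 10, 11} \<rho> \<rho>1" and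
      R: "\<And>v u. rel (e 0) (\<rho>1 8) [v, u] \<longleftrightarrow> u \<in> set (chain n E S t v)" and
      L: "\<And>v u. rel (e 0) (\<rho>1 9) [v, u] \<longleftrightarrow> chain n E S t v \<noteq> [] \<and> u = hd (chain n E S t v)"
      unfolding P_def by blast
    have r0: "\<rho>1 0 = \<rho> 0" "\<rho>1 7 = \<rho> 7" using ag by (auto simp: agree_def)
    let ?N = "\<lambda>v. nexts n E S (chain n E S t v) v"
    have "\<exists>l. sem ReachC (e, \<rho>1) = (e, \<rho>1(10 := l)) \<and>
      (\<forall>v w. rel (e 0) l [v, w] \<longleftrightarrow> v < n \<and> v \<notin> S \<union> set (chain n E S t v) \<and>
        (step E (S \<union> set (chain n E S t v)))\<^sup>*\<^sup>* v w)"
      by (rule ReachC[OF gr _ E(2) B, where A = "\<lambda>v. S \<union> set (chain n E S t v)"]) (auto simp: E(1) r0 S R)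
    then obtain l where l: "sem ReachC (e, \<rho>1) = (e, \<rho>1(10 := l))" and
      Rch: "\<And>v w. rel (e 0) l [v, w] \<longleftrightarrow> v < n \<and> v \<notin> S \<union> set (chain n E S t v) \<and>
        (step E (S \<union> set (chain n E S t v)))\<^sup>*\<^sup>* v w" by blast
    have hdn: "hd (chain n E S t v) < n" if "chain n E S t v \<noteq> []" for v
    proof -
      have "hd (chain n E S t v) \<in> set (chain n E S t v)" using that by simp
      then show ?thesis using chain_props[OF gr, of S t v] by blast
    qed
    have Nn: "u < n \<and> v < n" if "u \<in> ?N v" for u v
      using nexts_in[OF gr that] that unfolding nexts_def by auto
    have N: "rel (e 0) l [v, u] \<and> (\<forall>a<n. rel (e 0) (\<rho>1 9) [v, a] \<longrightarrow> Em n (\<rho> 0) a u) \<longleftrightarrow> u \<in> ?N v" for v u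
      unfolding Rch L nexts_def E(1)[symmetric] using hdn[of v] by auto
    let ?\<rho>2 = "\<rho>1(10 := l)"
    let ?l11 = "table ?\<rho>2 e [20, 21] nxF"
    have "rel (e 0) ?l11 [v, u] \<longleftrightarrow> v < e 0 \<and> u < e 0 \<and> u \<in> ?N v \<and> (\<forall>a<u. a \<notin> ?N v)" for v u
      unfolding N[symmetric]
      by (subst rel_table) (auto simp: nxF_def adjL_def r0 en)
    then have N11: "rel (e 0) ?l11 [v, u] \<longleftrightarrow> ?N v \<noteq> {} \<and> u = (LEAST u. u \<in> ?N v)" for v u
    proof -
      assume *: "\<And>v u. rel (e 0) ?l11 [v, u] \<longleftrightarrow> v < e 0 \<and> u < e 0 \<and> u \<in> ?N v \<and> (\<forall>a<u. a \<notin> ?N v)"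
      show ?thesis
      proof
        assume "rel (e 0) ?l11 [v, u]"
        then have u: "u \<in> ?N v" "\<And>a. a < u \<Longrightarrow> a \<notin> ?N v" using * by auto
        have "(LEAST u. u \<in> ?N v) = u" by (rule Least_equality) (use u in \<open>auto simp: not_less[symmetric]\<close>)
        then show "?N v \<noteq> {} \<and> u = (LEAST u. u \<in> ?N v)" using u by auto
      next
        assume a: "?N v \<noteq> {} \<and> u = (LEAST u. u \<in> ?N v)"
        then have "u \<in> ?N v" by (metis LeastI ex_in_conv)
        then show "rel (e 0) ?l11 [v, u]" unfolding * using Nn[of u v] B a not_less_Least by auto
      qed
    qed
    let ?\<rho>3 = "?\<rho>2(11 := ?l11)"
    let ?l9 = "table ?\<rho>3 e [20, 21] (Or (Rel 11 [Var 20, Var 21])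
        (Conj (Rel 9 [Var 20, Var 21]) (Neg (ExF 22 (Var 1) (Rel 11 [Var 20, Var 22])))))"
    have r9: "rel (e 0) ?l9 [v, u] \<longleftrightarrow> v < e 0 \<and> u < e 0 \<and> (rel (e 0) ?l11 [v, u] \<or>
        rel (e 0) (\<rho>1 9) [v, u] \<and> \<not> (\<exists>a<n. rel (e 0) ?l11 [v, a]))" for v u
      by (subst rel_table) (auto simp: en)
    have bd: "rel (e 0) q [v, u] \<Longrightarrow> v < e 0 \<and> u < e 0" for q v u by (simp add: rel_def)
    have ex11: "(\<exists>a<n. rel (e 0) ?l11 [v, a]) \<longleftrightarrow> ?N v \<noteq> {}" for v
      unfolding N11 using Nn[of _ v] by (metis LeastI ex_in_conv)
    have L': "rel (e 0) ?l9 [v, u] \<longleftrightarrow> chain n E S (Suc t) v \<noteq> [] \<and> u = hd (chain n E S (Suc t) v)" for v u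
      unfolding r9 ex11 using bd[of ?l11 v u] bd[of "\<rho>1 9" v u] by (auto simp: N11 L Let_def)
    let ?\<rho>4 = "?\<rho>3(9 := ?l9)"
    let ?l8 = "table ?\<rho>4 e [20, 21] (Or (Rel 8 [Var 20, Var 21]) (Rel 11 [Var 20, Var 21]))"
    have r8: "rel (e 0) ?l8 [v, u] \<longleftrightarrow> v < e 0 \<and> u < e 0 \<and> (rel (e 0) (\<rho>1 8) [v, u] \<or> rel (e 0) ?l11 [v, u])" for v u
      by (subst rel_table) auto
    have R': "rel (e 0) ?l8 [v, u] \<longleftrightarrow> u \<in> set (chain n E S (Suc t) v)" for v u
      unfolding r8 using bd[of ?l11 v u] bd[of "\<rho>1 8" v u] by (auto simp: N11 R Let_def)
    have s: "sem StepC st = (e, ?\<rho>4(8 := ?l8))"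
      unfolding st StepC_def by (simp add: l)
    show "P (Suc t) (sem StepC st)"
      unfolding P_def s using ag R' L' by (intro exI[of _ "?\<rho>4(8 := ?l8)"]) (auto simp: agree_def simp del: chain.simps)
  qed
  then show ?thesis unfolding P_def ChainC_def by auto
qed

text \<open>If no chain is long enough, variable 5 becomes the budget. Relation 8 is false there, so
  the packing stays as it is.\<close>

definition PackC :: cmd where
  "PackC = Sq (Clr 7) (Rep (Var 3) (Sq ChainC (Sq
     (Asg 5 24 (AllF 20 (Add (Var 24) (Num 1)) (Neg (Conj (Lt (Var 20) (Var 1))
        (Cnt 21 (Var 1) (Rel 8 [Var 20, Var 21]) (Var 2))))))
     (RDef 7 [20] (Or (Rel 7 [Var 20]) (Rel 8 [Var 5, Var 20]))))))"

lemma card_rel: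
  assumes "set cs \<subseteq> {..<n}" "distinct cs" "\<And>u. Q u \<longleftrightarrow> u \<in> set cs"
  shows "card {u. u < n \<and> Q u} = length cs"
proof -
  have "{u. u < n \<and> Q u} = set cs" using assms(1,3) by auto
  then show ?thesis using distinct_card[OF assms(2)] by simp
qed

lemma PackC:
  assumes gr: "gr n E" and E: "E = Em n (\<rho> 0)" "n = e 1" and B: "n * n < e 0" "n < e 0"
    and D: "0 < e 2"
  shows "\<exists>x \<rho>'. sem PackC (e, \<rho>) = (e(5 := x), \<rho>') \<and> x \<le> max (e 0) (e 5) \<and> agree {7, 8, 9, 10, 11} \<rho> \<rho>' \<and>
    (\<forall>u. rel (e 0) (\<rho>' 7) [u] \<longleftrightarrow> u \<in> pack n E (e 2) (e 3))"
proof -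
  define P where "P i st \<longleftrightarrow> (\<exists>x \<rho>'. st = (e(5 := x), \<rho>') \<and> x \<le> max (e 0) (e 5) \<and> agree {7, 8, 9, 10, 11} \<rho> \<rho>' \<and>
    (\<forall>u. rel (e 0) (\<rho>' 7) [u] \<longleftrightarrow> u \<in> pack n E (e 2) i))" for i and st :: "env \<times> rels"
  let ?a = "AllF 20 (Add (Var 24) (Num 1)) (Neg (Conj (Lt (Var 20) (Var 1))
        (Cnt 21 (Var 1) (Rel 8 [Var 20, Var 21]) (Var 2))))"
  let ?r = "Or (Rel 7 [Var 20]) (Rel 8 [Var 5, Var 20])"
  let ?c = "Sq ChainC (Sq (Asg 5 24 ?a) (RDef 7 [20] ?r))"
  have en: "e (Suc 0) = n" using E(2) by simp
  have "P (e 3) ((sem ?c ^^ e 3) (e, \<rho>(7 := [])))"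
  proof (rule funpow_inv[where P = P])
    show "P 0 (e, \<rho>(7 := []))" unfolding P_def
      by (intro exI[of _ "e 5"] exI[of _ "\<rho>(7 := [])"]) (auto simp: agree_def)
    fix i st assume "P i st"
    then obtain x \<rho>1 where st: "st = (e(5 := x), \<rho>1)" and ag: "agree {7, 8, 9, 10, 11} \<rho> \<rho>1"
      and S: "\<And>u. rel (e 0) (\<rho>1 7) [u] \<longleftrightarrow> u \<in> pack n E (e 2) i" unfolding P_def by blast
    let ?S = "pack n E (e 2) i"
    have r0: "\<rho>1 0 = \<rho> 0" using ag by (auto simp: agree_def)
    have "\<exists>\<rho>'. sem ChainC (e(5 := x), \<rho>1) = (e(5 := x), \<rho>') \<and> agree {8, 9, 10, 11} \<rho>1 \<rho>' \<and>
      (\<forall>v u. rel ((e(5 := x)) 0) (\<rho>' 8) [v, u] \<longleftrightarrow> u \<in> set (chain n E ?S ((e(5 := x)) 2) v))"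
      by (rule ChainC[OF gr]) (use E B S r0 in auto)
    then obtain \<rho>2 where r2: "sem ChainC (e(5 := x), \<rho>1) = (e(5 := x), \<rho>2)" "agree {8, 9, 10, 11} \<rho>1 \<rho>2"
      "\<And>v u. rel (e 0) (\<rho>2 8) [v, u] \<longleftrightarrow> u \<in> set (chain n E ?S (e 2) v)" by auto
    have r27: "\<rho>2 7 = \<rho>1 7" using r2(2) by (auto simp: agree_def)
    let ?P = "\<lambda>v. v < n \<and> e 2 \<le> length (chain n E ?S (e 2) v)"
    define y where "y = (if \<exists>v<e 0. ?P v then LEAST v. ?P v else e 0)"
    have len: "card {u. u < n \<and> u \<in> set (chain n E ?S (e 2) v)} = length (chain n E ?S (e 2) v)" for v
      by (rule card_rel) (use chain_props[OF gr, of ?S "e 2" v] in auto)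
    have "card {a. a < e 0 \<and> (\<forall>v\<le>a. \<not> ?P v)} = y" unfolding y_def by (rule card_below_least)
    then have y: "sem (Asg 5 24 ?a) (e(5 := x), \<rho>2) = (e(5 := y), \<rho>2)"
      by (simp add: r2(3) en len less_Suc_eq_le)
    have ex: "(\<exists>v<e 0. ?P v) \<longleftrightarrow> (\<exists>v<n. e 2 \<le> length (chain n E ?S (e 2) v))"
      using B(2) less_trans by blast
    have "y = card {a. a < e 0 \<and> (\<forall>v\<le>a. \<not> ?P v)}" unfolding y_def by (rule card_below_least[symmetric])
    also have "\<dots> \<le> card {..<e 0}" by (rule card_mono) auto
    finally have y0: "y \<le> e 0" by simp
    let ?l = "table \<rho>2 (e(5 := y)) [20] ?r"
    have rl: "rel (e 0) ?l [u] \<longleftrightarrow> u < e 0 \<and> (u \<in> ?S \<or> y < e 0 \<and> u \<in> set (chain n E ?S (e 2) y))" for u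
    proof -
      have "rel (e 0) ?l [u] \<longleftrightarrow> u < e 0 \<and> (u \<in> ?S \<or> rel (e 0) (\<rho>2 8) [y, u])"
        using rel_table[of "[u]" "[20]" "e(5 := y)" \<rho>2 ?r] by (simp add: r27 S)
      moreover have "rel (e 0) (\<rho>2 8) [y, u] \<Longrightarrow> y < e 0" by (simp add: rel_def)
      ultimately show ?thesis using r2(3) by blast
    qed
    have sub: "pack n E (e 2) (Suc i) \<subseteq> {..<n}" using pack_props[OF gr D, of "Suc i"] by blast
    have "rel (e 0) ?l [u] \<longleftrightarrow> u \<in> pack n E (e 2) (Suc i)" for u
    proof (cases "\<exists>v<e 0. ?P v")
      case True
      then have yl: "y = (LEAST v. ?P v)" unfolding y_def by (rule if_P)
      have "\<exists>v. ?P v" using True by blast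
      then have "?P (LEAST v. ?P v)" by (rule LeastI_ex)
      then have yB: "y < e 0" using B(2) unfolding yl by linarith
      have c: "\<exists>v<n. e 2 \<le> length (chain n E ?S (e 2) v)" using True ex by blast
      have pk: "pack n E (e 2) (Suc i) = ?S \<union> set (chain n E ?S (e 2) y)"
        unfolding pack.simps Let_def yl by (rule if_P[OF c])
      have "u < e 0" if "u \<in> pack n E (e 2) (Suc i)" using sub that B(2) by auto
      then show ?thesis unfolding rl using yB pk by blast
    next
      case False
      then have "y = e 0" unfolding y_def by (rule if_not_P)
      moreover have c: "\<not> (\<exists>v<n. e 2 \<le> length (chain n E ?S (e 2) v))" using False ex by blast
      have pk: "pack n E (e 2) (Suc i) = ?S"
        unfolding pack.simps Let_def by (rule if_not_P[OF c])
      have "u < e 0" if "u \<in> pack n E (e 2) (Suc i)" using sub that B(2) by auto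
      ultimately show ?thesis unfolding rl using pk by blast
    qed
    then have l: "\<forall>u. rel (e 0) ?l [u] \<longleftrightarrow> u \<in> pack n E (e 2) (Suc i)" by blast
    have s: "sem ?c st = (e(5 := y), \<rho>2(7 := ?l))"
      unfolding st by (simp only: sem.simps(5) prod.case r2(1) y sem_RDef)
    have ag': "agree {7, 8, 9, 10, 11} \<rho> (\<rho>2(7 := ?l))"
      using ag r2(2) unfolding agree_def by simp
    have y1: "y \<le> max (e 0) (e 5)" using y0 by simp
    show "P (Suc i) (sem ?c st)" unfolding P_def s
      by (intro exI[of _ y] exI[of _ "\<rho>2(7 := ?l)"] conjI refl y1 ag') (use l in simp)
  qed
  moreover have "sem PackC (e, \<rho>) = (sem ?c ^^ e 3) (e, \<rho>(7 := []))"
    unfolding PackC_def by (simp only: sem.simps(5,7) prod.case sem_Clr val.simps)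
  ultimately show ?thesis unfolding P_def by simp
qed

text \<open>Further variables: 6 number of codes, 7 flag of a detected solution, 8 and 9 auxiliary
  numbers of vertices. Further relations: 12, 14 and 15 walks, 13 the set \<open>H\<close>.\<close>

lemma pow_tab_upd [simp]: "x \<noteq> 0 \<Longrightarrow> x \<noteq> 4 \<Longrightarrow> pow_tab (e(x := a)) \<rho> \<longleftrightarrow> pow_tab e \<rho>"
  by (simp add: pow_tab_def)

lemma pow_tab_rel [simp]: "R \<noteq> 6 \<Longrightarrow> pow_tab e (\<rho>(R := l)) \<longleftrightarrow> pow_tab e \<rho>"
  by (simp add: pow_tab_def)

text \<open>The remainder is expressed through its quotient. The residue \<open>Var 71\<close>
  ranges below the modulus \<open>Var 70\<close>, so the modulus is positive.\<close>

definition colF :: "tm \<Rightarrow> tm \<Rightarrow> tm \<Rightarrow> fm" where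
  "colF c i u = ExF 70 (Var 0) (ExF 71 (Var 70) (Conj (Dig c (Num 0) (Var 70))
     (Conj (Dig c (Add i (Num 1)) (Var 71)) (ExF 72 (Var 0) (Eqt u (Add (Mul (Var 72) (Var 70)) (Var 71)))))))"

definition okF :: "tm \<Rightarrow> tm \<Rightarrow> fm" where
  "okF c i = Conj (ExF 70 (Var 0) (Conj (Lt (Num 0) (Var 70)) (Dig c (Num 0) (Var 70))))
     (AllF 71 (Add i (Num 1)) (AllF 72 (Var 71) (AllF 73 (Var 0)
        (Imp (Dig c (Add (Var 72) (Num 1)) (Var 73)) (Neg (Dig c (Add (Var 71) (Num 1)) (Var 73)))))))"

definition adjF :: "tm \<Rightarrow> tm \<Rightarrow> fm" where
  "adjF x u = Or (Eqt x (Var 1)) (Edg x u)"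

lemma sat_adjF [simp]: "sat \<rho> e (adjF x u) \<longleftrightarrow> adjb (e 1) (Em (e 1) (\<rho> 0)) (val e x) (val e u)"
  by (auto simp: adjF_def adjb_def)

definition coded :: "env \<Rightarrow> rels \<Rightarrow> bool" where
  "coded e \<rho> \<longleftrightarrow> pow_tab e \<rho> \<and> 2 \<le> e 4 \<and> e 6 = e 4 ^ Suc (e 2) \<and> e 6 < e 0"

lemma coded_upd [simp]: "x \<notin> {0, 2, 4, 6} \<Longrightarrow> coded (e(x := a)) \<rho> \<longleftrightarrow> coded e \<rho>"
  by (simp add: coded_def)

lemma coded_rel [simp]: "R \<noteq> 6 \<Longrightarrow> coded e (\<rho>(R := l)) \<longleftrightarrow> coded e \<rho>"
  by (simp add: coded_def)

lemma vars_lt_mono: "vars_lt m t \<Longrightarrow> m \<le> m' \<Longrightarrow> vars_lt m' t"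
  by (induction t) auto

lemma sat_Dig':
  assumes "coded e \<rho>" "vars_lt 80 c" "vars_lt 80 i" "vars_lt 80 r" "val e c < e 0" "val e i \<le> e 2"
  shows "sat \<rho> e (Dig c i r) \<longleftrightarrow> dg (e 4) (val e c) (val e i) = val e r"
proof (rule sat_Dig)
  have b: "2 \<le> e 4" "e 4 ^ Suc (e 2) < e 0" using assms(1) unfolding coded_def by auto
  have "e 4 ^ val e i \<le> e 4 ^ Suc (e 2)" using b(1) assms(6) by (intro power_increasing) auto
  then show p: "e 4 ^ val e i < e 0" using b(2) by linarith
  have "(2::nat) ^ val e i \<le> e 4 ^ val e i" by (rule power_mono) (use b(1) in auto)
  then show "val e i < e 0" using p less_exp[of "val e i"] by linarith
qed (use assms in \<open>auto simp: coded_def\<close>)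


lemma coded_D:
  assumes "coded e \<rho>" shows "2 \<le> e 4" "e 6 = e 4 ^ Suc (e 2)" "e 6 < e 0" "e 4 \<le> e 6"
proof -
  show 1: "2 \<le> e 4" "e 6 = e 4 ^ Suc (e 2)" "e 6 < e 0" using assms unfolding coded_def by auto
  show "e 4 \<le> e 6" unfolding 1(2) using 1(1) by (intro self_le_power) auto
qed

lemma dg_less: "coded e \<rho> \<Longrightarrow> dg (e 4) c i < e 0"
  using coded_D[of e \<rho>] mod_less_divisor[of "e 4" "c div e 4 ^ i"] unfolding dg_def by linarith

lemma sat_colF:
  assumes e: "coded e \<rho>" and v: "vars_lt 70 c" "vars_lt 70 i" "vars_lt 70 u"
    and b: "val e c < e 0" "val e i < e 2" "val e u < e 0"
  shows "sat \<rho> e (colF c i u) \<longleftrightarrow>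
    1 \<le> dg (e 4) (val e c) 0 \<and> val e u mod dg (e 4) (val e c) 0 = dg (e 4) (val e c) (Suc (val e i))"
    (is "_ \<longleftrightarrow> 1 \<le> ?p \<and> ?u mod ?p = ?r")
proof -
  have v': "vars_lt 80 c" "vars_lt 80 i" using v by (auto elim: vars_lt_mono)
  have 1: "sat \<rho> (e(70 := a, 71 := b)) (Dig c (Num 0) (Var 70)) \<longleftrightarrow> ?p = a" for a b
    by (subst sat_Dig') (use e v v' assms(5) in \<open>auto simp: val_vars_lt[OF v(1)]\<close>)
  have 2: "sat \<rho> (e(70 := a, 71 := b)) (Dig c (Add i (Num 1)) (Var 71)) \<longleftrightarrow> ?r = b" for a b
    by (subst sat_Dig') (use e v v' assms(5,6) in \<open>auto simp: val_vars_lt[OF v(1)] val_vars_lt[OF v(2)]\<close>)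
  have "sat \<rho> e (colF c i u) \<longleftrightarrow> (\<exists>a<e 0. \<exists>b<a. ?p = a \<and> ?r = b \<and> (\<exists>q<e 0. ?u = q * a + b))"
    unfolding colF_def by (simp add: 1 2[unfolded One_nat_def] val_vars_lt[OF v(3)] del: fun_upd_apply) simp
  also have "\<dots> \<longleftrightarrow> (?r < ?p \<and> (\<exists>q<e 0. ?u = q * ?p + ?r))" using dg_less[OF e] by auto
  also have "\<dots> \<longleftrightarrow> 1 \<le> ?p \<and> ?u mod ?p = ?r"
  proof
    assume "?r < ?p \<and> (\<exists>q<e 0. ?u = q * ?p + ?r)"
    then show "1 \<le> ?p \<and> ?u mod ?p = ?r" by auto
  next
    assume a: "1 \<le> ?p \<and> ?u mod ?p = ?r"
    then have "?r < ?p" by (metis less_le_trans mod_less_divisor zero_less_one)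
    moreover have "?u div ?p < e 0" using b(3) by (meson div_le_dividend le_less_trans)
    moreover have "?u = ?u div ?p * ?p + ?r" using a div_mult_mod_eq[of ?u ?p] by simp
    ultimately show "?r < ?p \<and> (\<exists>q<e 0. ?u = q * ?p + ?r)" by blast
  qed
  finally show ?thesis .
qed

lemma sat_okF:
  assumes e: "coded e \<rho>" and v: "vars_lt 70 c" "vars_lt 70 i"
    and b: "val e c < e 0" "val e i < e 2"
  shows "sat \<rho> e (okF c i) \<longleftrightarrow> okc (dg (e 4) (val e c)) (val e i)"
proof -
  have v': "vars_lt 80 c" using v by (auto elim: vars_lt_mono)
  let ?g = "dg (e 4) (val e c)"
  have 1: "sat \<rho> (e(70 := a)) (Dig c (Num 0) (Var 70)) \<longleftrightarrow> ?g 0 = a" for a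
    by (subst sat_Dig') (use e v v' b in \<open>auto simp: val_vars_lt[OF v(1)]\<close>)
  have 2: "sat \<rho> (e(71 := x, 72 := y, 73 := z)) (Dig c (Add (Var w) (Num 1)) (Var 73)) \<longleftrightarrow> ?g (Suc (if w = 71 then x else y)) = z"
    if "w = 71 \<or> w = 72" "x < e 2" "y < e 2" for w x y z
    by (subst sat_Dig') (use e v v' b that in \<open>auto simp: val_vars_lt[OF v(1)]\<close>)
  have "sat \<rho> e (okF c i) \<longleftrightarrow> (\<exists>a<e 0. 0 < a \<and> ?g 0 = a) \<and>
      (\<forall>x<Suc (val e i). \<forall>y<x. \<forall>z<e 0. ?g (Suc y) = z \<longrightarrow> ?g (Suc x) \<noteq> z)"
  proof -
    have "(\<forall>x<Suc (val e i). \<forall>y<x. \<forall>z<e 0.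
        sat \<rho> (e(71 := x, 72 := y, 73 := z)) (Dig c (Add (Var 72) (Num 1)) (Var 73)) \<longrightarrow>
        \<not> sat \<rho> (e(71 := x, 72 := y, 73 := z)) (Dig c (Add (Var 71) (Num 1)) (Var 73))) \<longleftrightarrow>
      (\<forall>x<Suc (val e i). \<forall>y<x. \<forall>z<e 0. ?g (Suc y) = z \<longrightarrow> ?g (Suc x) \<noteq> z)"
    proof -
      have "sat \<rho> (e(71 := x, 72 := y, 73 := z)) (Dig c (Add (Var 72) (Num 1)) (Var 73)) \<longleftrightarrow> ?g (Suc y) = z"
        "sat \<rho> (e(71 := x, 72 := y, 73 := z)) (Dig c (Add (Var 71) (Num 1)) (Var 73)) \<longleftrightarrow> ?g (Suc x) = z"
        if "x < Suc (val e i)" "y < x" for x y z using 2[of 72 x y z] 2[of 71 x y z] that b(2) by auto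
      then show ?thesis by metis
    qed
    then show ?thesis unfolding okF_def by (simp add: 1 del: fun_upd_apply) simp
  qed
  also have "\<dots> \<longleftrightarrow> okc ?g (val e i)"
  proof -
    have "(\<exists>a<e 0. 0 < a \<and> ?g 0 = a) \<longleftrightarrow> 1 \<le> ?g 0" using dg_less[OF e] by auto
    moreover have "(\<forall>x<Suc (val e i). \<forall>y<x. \<forall>z<e 0. ?g (Suc y) = z \<longrightarrow> ?g (Suc x) \<noteq> z) \<longleftrightarrow>
        (\<forall>b\<le>val e i. \<forall>a<b. ?g (Suc a) \<noteq> ?g (Suc b))" (is "?l \<longleftrightarrow> ?r")
    proof
      assume l: ?l
      show ?r
      proof (intro allI impI)
        fix b a assume "b \<le> val e i" "a < b"
        then have "?g (Suc b) \<noteq> ?g (Suc a)" using l dg_less[OF e] less_Suc_eq_le by blast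
        then show "?g (Suc a) \<noteq> ?g (Suc b)" by simp
      qed
    next
      assume r: ?r
      show ?l
      proof (intro allI impI)
        fix x y z assume "x < Suc (val e i)" "y < x" "?g (Suc y) = z"
        then show "?g (Suc x) \<noteq> z" using r less_Suc_eq_le by metis
      qed
    qed
    ultimately show ?thesis unfolding okc_def by blast
  qed
  finally show ?thesis .
qed

subsection \<open>Walks with a given code\<close>

definition wlkF :: "nat \<Rightarrow> fm \<Rightarrow> fm" where
  "wlkF R reg = Conj (Lt (Var 20) (Var 6)) (Conj (Lt (Var 22) (Var 1)) (Conj (Lt (Var 24) (Var 1))
     (Conj (Lt (Var 23) (Var 2)) (Conj reg (Conj (colF (Var 20) (Var 23) (Var 24))
     (Or (Conj (Eqt (Var 23) (Num 0)) (adjF (Var 21) (Var 24)))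
       (ExF 25 (Var 2) (ExF 26 (Var 1) (Conj (Eqt (Var 23) (Add (Var 25) (Num 1)))
         (Conj (Rel R [Var 20, Var 21, Var 22, Var 25, Var 26]) (Edg (Var 26) (Var 24))))))))))))"

definition WalkC :: "nat \<Rightarrow> fm \<Rightarrow> cmd" where
  "WalkC R reg = Sq (Clr R) (Rep (Var 2) (RDef R [20, 21, 22, 23, 24] (wlkF R reg)))"

definition wk :: "nat \<Rightarrow> (nat \<Rightarrow> nat \<Rightarrow> bool) \<Rightarrow> nat set \<Rightarrow> (nat \<Rightarrow> nat) \<Rightarrow> nat \<Rightarrow> nat \<Rightarrow> nat \<Rightarrow> bool" where
  "wk n E A g x i u \<longleftrightarrow> (\<exists>w. walk E A g i w \<and> adjb n E x (w 0) \<and> w i = u)"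

lemma wk_0: "wk n E A g x 0 u \<longleftrightarrow> u \<in> A \<and> u mod g 0 = g 1 \<and> adjb n E x u"
proof
  assume "u \<in> A \<and> u mod g 0 = g 1 \<and> adjb n E x u"
  then show "wk n E A g x 0 u" unfolding wk_def walk_def by (intro exI[of _ "\<lambda>_. u"]) auto
qed (auto simp: wk_def walk_def)

lemma wk_Suc: "wk n E A g x (Suc i) u \<longleftrightarrow> u \<in> A \<and> u mod g 0 = g (Suc (Suc i)) \<and> (\<exists>b. wk n E A g x i b \<and> E b u)"
proof
  assume "wk n E A g x (Suc i) u"
  then obtain w where w: "walk E A g (Suc i) w" "adjb n E x (w 0)" "w (Suc i) = u" unfolding wk_def by blast
  then have "wk n E A g x i (w i)" unfolding wk_def walk_def by (intro exI[of _ w]) auto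
  then show "u \<in> A \<and> u mod g 0 = g (Suc (Suc i)) \<and> (\<exists>b. wk n E A g x i b \<and> E b u)"
    using w unfolding walk_def by auto
next
  assume a: "u \<in> A \<and> u mod g 0 = g (Suc (Suc i)) \<and> (\<exists>b. wk n E A g x i b \<and> E b u)"
  then obtain b w where w: "walk E A g i w" "adjb n E x (w 0)" "w i = b" "E b u" unfolding wk_def by blast
  let ?w = "w(Suc i := u)"
  have "walk E A g (Suc i) ?w" using w a unfolding walk_def by (auto simp: le_Suc_eq less_Suc_eq)
  then show "wk n E A g x (Suc i) u" unfolding wk_def using w(2) by (intro exI[of _ ?w]) auto
qed

text \<open>Only the last vertex of a walk is stored; whether the walk is a path is decided by its
  code alone. The formula \<open>reg\<close> tests whether vertex 24 belongs to the set attached to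
  vertex 22. It is instantiated with the subtrees, the regions, and the regions without
  \<open>v\<close>. The value \<open>z\<close> is that of the index variable while the table is
  built.\<close>

lemma WalkC:
  assumes e: "coded e \<rho>" and E: "E = Em n (\<rho> 0)" "n = e 1" and B: "n < e 0" "e 2 < e 0"
    and R: "R \<noteq> 0" "R \<noteq> 6"
    and A: "\<And>l c x v i u z. v < n \<Longrightarrow> u < n \<Longrightarrow>
      sat (\<rho>(R := l)) (e(99 := z, 20 := c, 21 := x, 22 := v, 23 := i, 24 := u)) reg \<longleftrightarrow> u \<in> A v"
    and An: "\<And>v. A v \<subseteq> {..<n}"
  shows "\<exists>l. sem (WalkC R reg) (e, \<rho>) = (e, \<rho>(R := l)) \<and>
    (\<forall>c x v i u. rel (e 0) l [c, x, v, i, u] \<longleftrightarrow> c < e 6 \<and> x < e 0 \<and> v < n \<and> i < e 2 \<and>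
       1 \<le> dg (e 4) c 0 \<and> wk n E (A v) (dg (e 4) c) x i u)"
proof -
  have en: "e (Suc 0) = n" using E(2) by simp
  define Q where "Q t c x v i u \<longleftrightarrow> c < e 6 \<and> x < e 0 \<and> v < n \<and> i < e 2 \<and>
       1 \<le> dg (e 4) c 0 \<and> wk n E (A v) (dg (e 4) c) x i u \<and> i < t" for t c x v i u
  define P where "P t st \<longleftrightarrow> (\<exists>l. st = (e, \<rho>(R := l)) \<and> (\<forall>c x v i u. rel (e 0) l [c, x, v, i, u] \<longleftrightarrow> Q t c x v i u))"
    for t and st :: "env \<times> rels"
  have wkn: "u < n" if "wk n E (A v) g x i u" for v g x i u
    using that An[of v] unfolding wk_def walk_def by auto
  let ?c = "RDef R [20, 21, 22, 23, 24] (wlkF R reg)"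
  have "P (e 2) ((sem ?c ^^ e 2) (e, \<rho>(R := [])))"
  proof (rule funpow_inv[where P = P])
    show "P 0 (e, \<rho>(R := []))" unfolding P_def by (intro exI[of _ "[]"]) (simp add: Q_def)
    fix t st assume "P t st"
    then obtain l where st: "st = (e, \<rho>(R := l))" and l: "\<And>c x v i u. rel (e 0) l [c, x, v, i, u] \<longleftrightarrow> Q t c x v i u"
      unfolding P_def by blast
    let ?\<rho> = "\<rho>(R := l)"
    have "rel (e 0) (table ?\<rho> e [20, 21, 22, 23, 24] (wlkF R reg)) [c, x, v, i, u] \<longleftrightarrow> Q (Suc t) c x v i u" for c x v i u
    proof -
      let ?z = "idx (e 0) [c, x, v, i, u]"
      let ?e = "e(99 := ?z, 20 := c, 21 := x, 22 := v, 23 := i, 24 := u)"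
      have ce: "coded ?e ?\<rho>" using e R by simp
      have "rel (e 0) (table ?\<rho> e [20, 21, 22, 23, 24] (wlkF R reg)) [c, x, v, i, u] \<longleftrightarrow>
        (c < e 0 \<and> x < e 0 \<and> v < e 0 \<and> i < e 0 \<and> u < e 0) \<and> sat ?\<rho> ?e (wlkF R reg)"
        by (subst rel_table) (auto simp del: fun_upd_apply)
      also have "\<dots> \<longleftrightarrow> (c < e 0 \<and> x < e 0 \<and> v < e 0 \<and> i < e 0 \<and> u < e 0) \<and> c < e 6 \<and> v < n \<and> u < n \<and> i < e 2 \<and>
        u \<in> A v \<and> 1 \<le> dg (e 4) c 0 \<and> u mod dg (e 4) c 0 = dg (e 4) c (Suc i) \<and>
        (i = 0 \<and> adjb n E x u \<or> (\<exists>a<e 2. \<exists>b<n. i = Suc a \<and> Q t c x v a b \<and> E b u))"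
      proof (cases "(c < e 0 \<and> x < e 0 \<and> v < e 0 \<and> i < e 0 \<and> u < e 0) \<and> c < e 6 \<and> v < n \<and> u < n \<and> i < e 2")
        case True
        have 1: "sat ?\<rho> ?e (colF (Var 20) (Var 23) (Var 24)) \<longleftrightarrow> 1 \<le> dg (e 4) c 0 \<and> u mod dg (e 4) c 0 = dg (e 4) c (Suc i)"
          by (subst sat_colF[OF ce]) (use True in auto)
        have 2: "sat ?\<rho> ?e reg \<longleftrightarrow> u \<in> A v" by (rule A) (use True in auto)
        have 3: "sat ?\<rho> ?e (Or (Conj (Eqt (Var 23) (Num 0)) (adjF (Var 21) (Var 24)))
           (ExF 25 (Var 2) (ExF 26 (Var 1) (Conj (Eqt (Var 23) (Add (Var 25) (Num 1)))
           (Conj (Rel R [Var 20, Var 21, Var 22, Var 25, Var 26]) (Edg (Var 26) (Var 24))))))) \<longleftrightarrow>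
           (i = 0 \<and> adjb n E x u \<or> (\<exists>a<e 2. \<exists>b<n. i = Suc a \<and> Q t c x v a b \<and> E b u))"
          using R by (simp add: l E(1) en)
        show ?thesis unfolding wlkF_def sat.simps(4) 1 2 3 using True en by simp
      next
        case False
        then show ?thesis unfolding wlkF_def using en by auto
      qed
      also have "\<dots> \<longleftrightarrow> Q (Suc t) c x v i u"
      proof (cases i)
        case 0
        then show ?thesis unfolding Q_def wk_0[of n E "A v"] using coded_D[OF e] B wkn An[of v] by (auto simp: wk_0)
      next
        case (Suc a)
        have "wk n E (A v) (dg (e 4) c) x (Suc a) u \<longleftrightarrow> u \<in> A v \<and> u mod dg (e 4) c 0 = dg (e 4) c (Suc (Suc a)) \<and>
            (\<exists>b<n. wk n E (A v) (dg (e 4) c) x a b \<and> E b u)" unfolding wk_Suc using wkn by blast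
        moreover have "(Suc a = 0 \<and> adjb n E x u \<or> (\<exists>a'<e 2. \<exists>b<n. Suc a = Suc a' \<and> Q t c x v a' b \<and> E b u)) \<longleftrightarrow>
            a < e 2 \<and> (\<exists>b<n. Q t c x v a b \<and> E b u)" by auto
        ultimately show ?thesis unfolding Suc unfolding Q_def using coded_D(3)[OF e] B An[of v] by auto
      qed
      finally show ?thesis .
    qed
    then show "P (Suc t) (sem ?c st)" unfolding P_def st sem_RDef by auto
  qed
  moreover have "sem (WalkC R reg) (e, \<rho>) = (sem ?c ^^ e 2) (e, \<rho>(R := []))"
    unfolding WalkC_def by (simp only: sem.simps(5,7) prod.case sem_Clr val.simps)
  ultimately obtain l where l: "sem (WalkC R reg) (e, \<rho>) = (e, \<rho>(R := l))"
    "\<And>c x v i u. rel (e 0) l [c, x, v, i, u] \<longleftrightarrow> Q (e 2) c x v i u" unfolding P_def by auto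
  have "Q (e 2) c x v i u \<longleftrightarrow> c < e 6 \<and> x < e 0 \<and> v < n \<and> i < e 2 \<and>
       1 \<le> dg (e 4) c 0 \<and> wk n E (A v) (dg (e 4) c) x i u" for c x v i u unfolding Q_def by auto
  then show ?thesis using l by blast
qed

section \<open>Detection of irrelevant vertices\<close>

definition segF :: "nat \<Rightarrow> tm \<Rightarrow> tm \<Rightarrow> tm \<Rightarrow> tm \<Rightarrow> tm \<Rightarrow> fm" where
  "segF R c x y i v = ExF 60 (Var 1) (Conj (Rel R [c, x, v, i, Var 60]) (adjF y (Var 60)))"

lemma sat_segF:
  assumes "\<And>c x v i u. rel (e 0) (\<rho> R) [c, x, v, i, u] \<longleftrightarrow> c < C \<and> x < e 0 \<and> v < n \<and> i < D \<and>
       1 \<le> dg \<beta> c 0 \<and> wk n E (A v) (dg \<beta> c) x i u"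
    and "E = Em n (\<rho> 0)" "n = e 1" "\<And>v. A v \<subseteq> {..<n}"
    and "vars_lt 60 c" "vars_lt 60 x" "vars_lt 60 y" "vars_lt 60 i" "vars_lt 60 v"
    and "val e c < C" "val e x < e 0" "val e v < n" "val e i < D" "1 \<le> dg \<beta> (val e c) 0"
  shows "sat \<rho> e (segF R c x y i v) \<longleftrightarrow> Seg n E (A (val e v)) (dg \<beta> (val e c)) (val e x) (val e y) (val e i)"
proof -
  have en: "e (Suc 0) = n" using assms(3) by simp
  have "sat \<rho> e (segF R c x y i v) \<longleftrightarrow>
    (\<exists>u<n. wk n E (A (val e v)) (dg \<beta> (val e c)) (val e x) (val e i) u \<and> adjb n E (val e y) u)"
    unfolding segF_def using assms(10-14)
    by (simp add: val_vars_lt[OF assms(5)] val_vars_lt[OF assms(6)] val_vars_lt[OF assms(7)]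
      val_vars_lt[OF assms(8)] val_vars_lt[OF assms(9)] en assms(1) assms(2)[symmetric])
  also have "\<dots> \<longleftrightarrow> Seg n E (A (val e v)) (dg \<beta> (val e c)) (val e x) (val e y) (val e i)"
    unfolding Seg_def wk_def walk_def using assms(4)[of "val e v"] by blast
  finally show ?thesis .
qed

definition XS :: "tm \<Rightarrow> fm" where "XS t = Or (Eqt t (Var 1)) (Rel 7 [t])"
definition XH :: "tm \<Rightarrow> fm" where "XH t = Or (XS t) (Rel 13 [t])"

definition coreH :: fm where
  "coreH = Conj (okF (Var 20) (Var 23)) (Conj (segF 12 (Var 20) (Var 21) (Var 34) (Var 23) (Var 22))
     (Neg (Cnt 35 (Var 1) (segF 12 (Var 20) (Var 21) (Var 34) (Var 23) (Var 35))
       (Mul (Var 2) (Add (Mul (Var 3) (Var 2)) (Num 1))))))"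

definition HF :: fm where
  "HF = Conj (Lt (Var 22) (Var 1)) (Conj (Neg (Rel 7 [Var 22])) (ExF 20 (Var 6) (ExF 21 (Add (Var 1) (Num 1))
     (ExF 34 (Add (Var 1) (Num 1)) (ExF 23 (Var 2) (Conj (XS (Var 21)) (Conj (XS (Var 34)) coreH)))))))"

definition regU :: fm where
  "regU = Conj (Neg (Rel 7 [Var 24])) (Conj (Neg (Rel 13 [Var 24]))
     (AllF 36 (Var 1) (Imp (Rel 13 [Var 36]) (Iff (Rel 8 [Var 24, Var 36]) (Rel 8 [Var 22, Var 36])))))"

definition coreI :: fm where
  "coreI = Imp (okF (Var 20) (Var 23)) (Imp (segF 14 (Var 20) (Var 21) (Var 34) (Var 23) (Var 22))
     (segF 15 (Var 20) (Var 21) (Var 34) (Var 23) (Var 22)))"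

definition IrrF :: fm where
  "IrrF = Conj (Lt (Var 22) (Var 1)) (Conj (Neg (Rel 7 [Var 22])) (Conj (Neg (Rel 13 [Var 22]))
     (AllF 20 (Var 6) (AllF 21 (Add (Var 1) (Num 1)) (AllF 34 (Add (Var 1) (Num 1)) (AllF 23 (Var 2)
       (Imp (XH (Var 21)) (Imp (XH (Var 34)) coreI))))))))"

definition IrrC :: cmd where
  "IrrC = Sq (WalkC 12 (Rel 8 [Var 24, Var 22])) (Sq (RDef 13 [22] HF) (Sq (WalkC 14 regU)
     (Sq (WalkC 15 (Conj regU (Neg (Eqt (Var 24) (Var 22)))))
       (Asg 5 40 (AllF 22 (Add (Var 40) (Num 1)) (Neg IrrF))))))"

text \<open>Walks inside subtrees come first because they determine \<open>H\<close>, without which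
  regions cannot be formed. Two further walk tables, for a region with and without \<open>v\<close>,
  then decide irrelevance. The search returns the budget if no vertex is irrelevant.\<close>

lemma IrrC:
  assumes F: "forest n E S anc D m \<beta> C"
    and E: "E = Em n (\<rho> 0)" "n = e 1" and D: "D = e 2" "m = e 3 * e 2" and C: "\<beta> = e 4" "C = e 6"
    and cd: "coded e \<rho>" and B: "n < e 0" "D < e 0"
    and S: "\<And>u. rel (e 0) (\<rho> 7) [u] \<longleftrightarrow> u \<in> S" and anc: "\<And>v u. rel (e 0) (\<rho> 8) [v, u] \<longleftrightarrow> u \<in> anc v"
  shows "\<exists>y \<rho>'. sem IrrC (e, \<rho>) = (e(5 := y), \<rho>') \<and> agree {12, 13, 14, 15} \<rho> \<rho>' \<and>
    y = (if \<exists>v<e 0. forest.irr n E S anc D m \<beta> C v then LEAST v. forest.irr n E S anc D m \<beta> C v else e 0)"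
proof -
  interpret F: forest n E S anc D m \<beta> C by (rule F)
  have en: "e (Suc 0) = n" using E(2) by simp
  have e2: "e 2 = D" using D by simp
  have e4: "e 4 = \<beta>" "e 6 = C" using C by auto
  have CB: "C < e 0" using coded_D(3)[OF cd] e4 by simp
  have Tn: "F.T v \<subseteq> {..<n}" for v unfolding F.T_def using F.anc_V by auto
  have Un: "F.U v \<subseteq> {..<n}" for v unfolding F.U_def by auto
  have Un': "F.U v - {v} \<subseteq> {..<n}" for v using Un by blast
  \<comment> \<open>Variables below 20 hold the data of the instance and are never bound inside
    these formulas, so all subformulas see the same data.\<close>
  define same where "same e' \<longleftrightarrow> (\<forall>x<20. e' x = e x)" for e' :: env
  have coded_same: "coded e' \<rho>'" if "same e'" "\<rho>' 6 = \<rho> 6" for e' \<rho>'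
    using cd that unfolding coded_def pow_tab_def same_def by simp
  let ?spec = "\<lambda>l A. \<forall>c x v i u. rel (e 0) l [c, x, v, i, u] \<longleftrightarrow> c < e 6 \<and> x < e 0 \<and> v < n \<and> i < e 2 \<and>
       1 \<le> dg (e 4) c 0 \<and> wk n E (A v) (dg (e 4) c) x i u"
  have seg: "sat \<rho>' e' (segF R (Var 20) (Var 21) (Var 34) (Var 23) t) \<longleftrightarrow>
      Seg n E (A (val e' t)) (dg \<beta> (e' 20)) (e' 21) (e' 34) (e' 23)"
    if "?spec l A" "\<And>v. A v \<subseteq> {..<n}" "\<rho>' R = l" "\<rho>' 0 = \<rho> 0" "same e'" "vars_lt 60 t"
      "e' 20 < C" "e' 21 \<le> n" "val e' t < n" "e' 23 < D" "okc (dg \<beta> (e' 20)) (e' 23)" for \<rho>' e' t R l A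
  proof -
    have s: "e' 0 = e 0" "e' (Suc 0) = n" using that(5) en unfolding same_def by auto
    have "sat \<rho>' e' (segF R (Var 20) (Var 21) (Var 34) (Var 23) t) \<longleftrightarrow>
      Seg n E (A (val e' t)) (dg \<beta> (val e' (Var 20))) (val e' (Var 21)) (val e' (Var 34)) (val e' (Var 23))"
      by (rule sat_segF[where C = C and D = D and A = A])
        (use that(1-4,6-11) s E(1) B(1) C e2 in \<open>auto simp: okc_def\<close>)
    then show ?thesis by simp
  qed
  have okf: "sat \<rho>' e' (okF (Var 20) (Var 23)) \<longleftrightarrow> okc (dg \<beta> (e' 20)) (e' 23)"
    if "\<rho>' 6 = \<rho> 6" "same e'" "e' 20 < C" "e' 23 < D" for \<rho>' e'
  proof -
    have s: "e' 0 = e 0" "e' 2 = D" "e' 4 = \<beta>" using that(2) e2 e4 unfolding same_def by auto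
    have "sat \<rho>' e' (okF (Var 20) (Var 23)) \<longleftrightarrow> okc (dg (e' 4) (val e' (Var 20))) (val e' (Var 23))"
      by (rule sat_okF[OF coded_same]) (use that s CB in auto)
    then show ?thesis using s by simp
  qed
  have "\<exists>l. sem (WalkC 12 (Rel 8 [Var 24, Var 22])) (e, \<rho>) = (e, \<rho>(12 := l)) \<and> ?spec l F.T"
    by (rule WalkC[OF cd E B(1)]) (use B(2) e2 anc Tn in \<open>auto simp: F.T_def\<close>)
  then obtain l12 where l12: "sem (WalkC 12 (Rel 8 [Var 24, Var 22])) (e, \<rho>) = (e, \<rho>(12 := l12))" "?spec l12 F.T"
    by blast
  let ?\<rho>1 = "\<rho>(12 := l12)"
  have cH: "sat ?\<rho>1 e' coreH \<longleftrightarrow> okc (dg \<beta> (e' 20)) (e' 23) \<and>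
      Seg n E (F.T (e' 22)) (dg \<beta> (e' 20)) (e' 21) (e' 34) (e' 23) \<and>
      \<not> F.freq (dg \<beta> (e' 20)) (e' 21) (e' 34) (e' 23)"
    if s: "same e'" "e' 20 < C" "e' 21 \<le> n" "e' 22 < n" "e' 23 < D" for e'
  proof (cases "okc (dg \<beta> (e' 20)) (e' 23)")
    case True
    have 1: "sat ?\<rho>1 e' (okF (Var 20) (Var 23))" using okf[of ?\<rho>1 e'] s True by simp
    have 2: "sat ?\<rho>1 e' (segF 12 (Var 20) (Var 21) (Var 34) (Var 23) (Var 22)) \<longleftrightarrow>
        Seg n E (F.T (e' 22)) (dg \<beta> (e' 20)) (e' 21) (e' 34) (e' 23)"
      by (subst seg[OF l12(2) Tn]) (use s True in auto)
    have 3: "sat ?\<rho>1 (e'(35 := a)) (segF 12 (Var 20) (Var 21) (Var 34) (Var 23) (Var 35)) \<longleftrightarrow>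
        Seg n E (F.T a) (dg \<beta> (e' 20)) (e' 21) (e' 34) (e' 23)" if "a < n" for a
      by (subst seg[OF l12(2) Tn]) (use s True that in \<open>auto simp: same_def\<close>)
    have v: "e' (Suc 0) = n" "e' 2 = D" "e' 3 = e 3" using s(1) en e2 unfolding same_def by auto
    have "{a. a < n \<and> sat ?\<rho>1 (e'(35 := a)) (segF 12 (Var 20) (Var 21) (Var 34) (Var 23) (Var 35))} =
        {a. a < n \<and> Seg n E (F.T a) (dg \<beta> (e' 20)) (e' 21) (e' 34) (e' 23)}" using 3 by auto
    then have 4: "sat ?\<rho>1 e' (Cnt 35 (Var 1) (segF 12 (Var 20) (Var 21) (Var 34) (Var 23) (Var 35))
       (Mul (Var 2) (Add (Mul (Var 3) (Var 2)) (Num 1)))) \<longleftrightarrow> F.freq (dg \<beta> (e' 20)) (e' 21) (e' 34) (e' 23)"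
      unfolding F.freq_def using v e2 D(2) by simp
    show ?thesis unfolding coreH_def sat.simps(3,4) using 1 2 4 True by blast
  next
    case False
    then have "\<not> sat ?\<rho>1 e' (okF (Var 20) (Var 23))" using okf[of ?\<rho>1 e'] s by simp
    then show ?thesis using False by (simp add: coreH_def)
  qed
  let ?l13 = "table ?\<rho>1 e [22] HF"
  have H: "rel (e 0) ?l13 [v] \<longleftrightarrow> v \<in> F.H" for v
  proof -
    let ?e = "e(99 := idx (e 0) [v], 22 := v)"
    have "rel (e 0) ?l13 [v] \<longleftrightarrow> v < e 0 \<and> sat ?\<rho>1 ?e HF" by (subst rel_table) (auto simp del: fun_upd_apply)
    also have "sat ?\<rho>1 ?e HF \<longleftrightarrow> v < n \<and> v \<notin> S \<and> (\<exists>c<C. \<exists>x<Suc n. \<exists>y<Suc n. \<exists>i<D. (x = n \<or> x \<in> S) \<and> (y = n \<or> y \<in> S) \<and>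
        sat ?\<rho>1 (?e(20 := c, 21 := x, 34 := y, 23 := i)) coreH)"
      unfolding HF_def XS_def by (simp add: S en e2 e4)
    also have "\<dots> \<longleftrightarrow> v < n \<and> v \<notin> S \<and> (\<exists>c<C. \<exists>x<Suc n. \<exists>y<Suc n. \<exists>i<D. (x = n \<or> x \<in> S) \<and> (y = n \<or> y \<in> S) \<and>
        okc (dg \<beta> c) i \<and> Seg n E (F.T v) (dg \<beta> c) x y i \<and> \<not> F.freq (dg \<beta> c) x y i)"
    proof (rule conj_cong[OF refl], rule conj_cong[OF refl], intro ex_cong1 conj_cong refl)
      fix c x y i assume a: "v < n" "c < C" "x < Suc n" "y < Suc n" "i < D"
      show "sat ?\<rho>1 (?e(20 := c, 21 := x, 34 := y, 23 := i)) coreH \<longleftrightarrow>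
        okc (dg \<beta> c) i \<and> Seg n E (F.T v) (dg \<beta> c) x y i \<and> \<not> F.freq (dg \<beta> c) x y i"
        using cH[of "?e(20 := c, 21 := x, 34 := y, 23 := i)"] a by (simp add: same_def)
    qed
    also have "v < e 0 \<and> \<dots> \<longleftrightarrow> v \<in> F.H"
    proof -
      have eqQ: "(\<exists>x<Suc n. \<exists>y<Suc n. \<exists>i<D. (x = n \<or> x \<in> S) \<and> (y = n \<or> y \<in> S) \<and> Q x y i) \<longleftrightarrow>
        (\<exists>x\<in>insert n S. \<exists>y\<in>insert n S. \<exists>i<D. Q x y i)" for Q :: "nat \<Rightarrow> nat \<Rightarrow> nat \<Rightarrow> bool"
      proof -
        have "x \<in> insert n S \<longleftrightarrow> x < Suc n \<and> (x = n \<or> x \<in> S)" for x using F.S_n by auto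
        then show ?thesis by (metis (no_types, lifting))
      qed
      have "v < n \<Longrightarrow> v < e 0" using B(1) by simp
      then show ?thesis unfolding eqQ F.H_def mem_Collect_eq by blast
    qed
    finally show ?thesis .
  qed
  let ?\<rho>2 = "?\<rho>1(13 := ?l13)"
  have cd2: "coded e ?\<rho>2" using cd by simp
  have regU: "sat \<rho>' e' regU \<longleftrightarrow> e' 24 \<in> F.U (e' 22)"
    if "same e'" "e' 22 < n" "e' 24 < n" "\<rho>' 7 = \<rho> 7" "\<rho>' 8 = \<rho> 8" "\<rho>' 13 = ?l13" for e' \<rho>'
  proof -
    have s: "e' 0 = e 0" "e' (Suc 0) = n" using that(1) en unfolding same_def by auto
    have Hn: "a < n" if "a \<in> F.H" for a using that unfolding F.H_def by simp
    have "sat \<rho>' e' regU \<longleftrightarrow> e' 24 \<notin> S \<and> e' 24 \<notin> F.H \<and> (\<forall>a<n. a \<in> F.H \<longrightarrow> (a \<in> anc (e' 24) \<longleftrightarrow> a \<in> anc (e' 22)))"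
      unfolding regU_def by (simp add: s that S H anc)
    then show ?thesis unfolding F.U_def using that Hn by auto
  qed
  have "\<exists>l. sem (WalkC 14 regU) (e, ?\<rho>2) = (e, ?\<rho>2(14 := l)) \<and> ?spec l F.U"
  proof (rule WalkC[OF cd2 _ E(2) B(1)])
    fix l c x v i u z assume "v < n" "u < n"
    then show "sat (?\<rho>2(14 := l)) (e(99 := z, 20 := c, 21 := x, 22 := v, 23 := i, 24 := u)) regU \<longleftrightarrow> u \<in> F.U v"
      by (subst regU) (auto simp: same_def)
  qed (use B(2) e2 Un E(1) in auto)
  then obtain l14 where l14: "sem (WalkC 14 regU) (e, ?\<rho>2) = (e, ?\<rho>2(14 := l14))" "?spec l14 F.U" by blast
  let ?\<rho>3 = "?\<rho>2(14 := l14)"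
  have cd3: "coded e ?\<rho>3" using cd by simp
  have "\<exists>l. sem (WalkC 15 (Conj regU (Neg (Eqt (Var 24) (Var 22))))) (e, ?\<rho>3) = (e, ?\<rho>3(15 := l)) \<and> ?spec l (\<lambda>v. F.U v - {v})"
  proof (rule WalkC[OF cd3 _ E(2) B(1)])
    fix l c x v i u z assume "v < n" "u < n"
    then show "sat (?\<rho>3(15 := l)) (e(99 := z, 20 := c, 21 := x, 22 := v, 23 := i, 24 := u))
        (Conj regU (Neg (Eqt (Var 24) (Var 22)))) \<longleftrightarrow> u \<in> F.U v - {v}"
      unfolding sat.simps(4) by (subst regU) (auto simp: same_def)
  qed (use B(2) e2 Un' E(1) in auto)
  then obtain l15 where l15: "sem (WalkC 15 (Conj regU (Neg (Eqt (Var 24) (Var 22))))) (e, ?\<rho>3) = (e, ?\<rho>3(15 := l15))"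
    "?spec l15 (\<lambda>v. F.U v - {v})" by blast
  let ?\<rho>4 = "?\<rho>3(15 := l15)"
  have cI: "sat ?\<rho>4 e' coreI \<longleftrightarrow> (okc (dg \<beta> (e' 20)) (e' 23) \<longrightarrow>
      Seg n E (F.U (e' 22)) (dg \<beta> (e' 20)) (e' 21) (e' 34) (e' 23) \<longrightarrow>
      Seg n E (F.U (e' 22) - {e' 22}) (dg \<beta> (e' 20)) (e' 21) (e' 34) (e' 23))"
    if s: "same e'" "e' 20 < C" "e' 21 \<le> n" "e' 22 < n" "e' 23 < D" for e'
  proof (cases "okc (dg \<beta> (e' 20)) (e' 23)")
    case True
    have 1: "sat ?\<rho>4 e' (okF (Var 20) (Var 23))" using okf[of ?\<rho>4 e'] s True by simp
    have 2: "sat ?\<rho>4 e' (segF 14 (Var 20) (Var 21) (Var 34) (Var 23) (Var 22)) \<longleftrightarrow>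
        Seg n E (F.U (e' 22)) (dg \<beta> (e' 20)) (e' 21) (e' 34) (e' 23)"
      by (subst seg[OF l14(2) Un]) (use s True in auto)
    have 3: "sat ?\<rho>4 e' (segF 15 (Var 20) (Var 21) (Var 34) (Var 23) (Var 22)) \<longleftrightarrow>
        Seg n E (F.U (e' 22) - {e' 22}) (dg \<beta> (e' 20)) (e' 21) (e' 34) (e' 23)"
      by (subst seg[OF l15(2) Un']) (use s True in auto)
    show ?thesis unfolding coreI_def sat_macros using 1 2 3 True by blast
  next
    case False
    then have "\<not> sat ?\<rho>4 e' (okF (Var 20) (Var 23))" using okf[of ?\<rho>4 e'] s by simp
    then show ?thesis using False by (simp add: coreI_def)
  qed
  have I: "sat ?\<rho>4 (e(40 := z, 22 := v)) IrrF \<longleftrightarrow> F.irr v" for z v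
  proof -
    let ?e = "e(40 := z, 22 := v)"
    let ?X = "\<lambda>x. x = n \<or> x \<in> S \<or> x \<in> F.H"
    have "sat ?\<rho>4 ?e IrrF \<longleftrightarrow> v < n \<and> v \<notin> S \<and> v \<notin> F.H \<and> (\<forall>c<C. \<forall>x<Suc n. \<forall>y<Suc n. \<forall>i<D. ?X x \<longrightarrow> ?X y \<longrightarrow>
        sat ?\<rho>4 (?e(20 := c, 21 := x, 34 := y, 23 := i)) coreI)"
      unfolding IrrF_def XH_def XS_def by (simp add: S H en e2 e4)
    also have "\<dots> \<longleftrightarrow> v < n \<and> v \<notin> S \<and> v \<notin> F.H \<and> (\<forall>c<C. \<forall>x<Suc n. \<forall>y<Suc n. \<forall>i<D. ?X x \<longrightarrow> ?X y \<longrightarrow>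
        (okc (dg \<beta> c) i \<longrightarrow> Seg n E (F.U v) (dg \<beta> c) x y i \<longrightarrow> Seg n E (F.U v - {v}) (dg \<beta> c) x y i))"
    proof (rule conj_cong[OF refl], rule conj_cong[OF refl], rule conj_cong[OF refl], intro all_cong1 imp_cong refl)
      fix c x y i assume a: "v < n" "c < C" "x < Suc n" "y < Suc n" "i < D"
      show "sat ?\<rho>4 (?e(20 := c, 21 := x, 34 := y, 23 := i)) coreI \<longleftrightarrow>
        (okc (dg \<beta> c) i \<longrightarrow> Seg n E (F.U v) (dg \<beta> c) x y i \<longrightarrow> Seg n E (F.U v - {v}) (dg \<beta> c) x y i)"
        using cI[of "?e(20 := c, 21 := x, 34 := y, 23 := i)"] a by (simp add: same_def)
    qed
    also have "\<dots> \<longleftrightarrow> F.irr v"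
    proof -
      have "x \<in> insert n (S \<union> F.H) \<longleftrightarrow> x < Suc n \<and> ?X x" for x using F.S_n unfolding F.H_def by auto
      then have eqQ: "(\<forall>x<Suc n. \<forall>y<Suc n. \<forall>i<D. ?X x \<longrightarrow> ?X y \<longrightarrow> Q x y i) \<longleftrightarrow>
        (\<forall>x\<in>insert n (S \<union> F.H). \<forall>y\<in>insert n (S \<union> F.H). \<forall>i<D. Q x y i)" for Q :: "nat \<Rightarrow> nat \<Rightarrow> nat \<Rightarrow> bool"
        by (metis (no_types, lifting))
      show ?thesis unfolding eqQ F.irr_def by (rule refl)
    qed
    finally show ?thesis .
  qed
  define y where "y = (if \<exists>v<e 0. F.irr v then LEAST v. F.irr v else e 0)"
  have "card {a. a < e 0 \<and> (\<forall>v\<le>a. \<not> F.irr v)} = y" unfolding y_def by (rule card_below_least)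
  then have A: "sem (Asg 5 40 (AllF 22 (Add (Var 40) (Num 1)) (Neg IrrF))) (e, ?\<rho>4) = (e(5 := y), ?\<rho>4)"
    by (simp add: I less_Suc_eq_le)
  have "sem IrrC (e, \<rho>) = (e(5 := y), ?\<rho>4)"
    unfolding IrrC_def by (simp only: sem.simps(5) prod.case l12(1) l14(1) l15(1) sem_RDef A)
  moreover have "agree {12, 13, 14, 15} \<rho> ?\<rho>4" by (simp add: agree_def)
  ultimately show ?thesis unfolding y_def by blast
qed

section \<open>The reduction loop\<close>

definition BaseC :: cmd where
  "BaseC = Sq (Set 4 (Num 2)) (Sq PowC (Sq
     (Asg 5 40 (ExF 21 (Var 0) (Conj (Rel 6 [Var 40, Var 21]) (Lt (Var 21) (Var 1)))))
     (Set 4 (Add (Mul (Num 2) (Mul (Mul (Var 5) (Mul (Var 2) (Var 2))) (Mul (Var 2) (Var 2)))) (Num 3)))))"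

definition CodeC :: cmd where
  "CodeC = Sq PowC (Asg 6 40 (ExF 23 (Var 0) (Conj (Rel 6 [Add (Var 2) (Num 1), Var 23]) (Lt (Var 40) (Var 23)))))"

lemma BaseC:
  assumes "e 1 < e 0" "2 \<le> e 0"
  shows "\<exists>x l. sem BaseC (e, \<rho>) = (e(5 := x, 4 := min (e 0) (modb (e 1) (e 2))), \<rho>(6 := l)) \<and> x \<le> e 0"
proof -
  let ?e = "e(4 := 2)"
  obtain l where l: "sem PowC (?e, \<rho>) = (?e, \<rho>(6 := l))"
    "\<And>i z. rel (e 0) l [i, z] \<longleftrightarrow> i < e 0 \<and> z < e 0 \<and> z = 2 ^ i"
    using PowC[of ?e \<rho>] by auto
  have 1: "sem (Set 4 (Num 2)) (e, \<rho>) = (?e, \<rho>)" using assms by (simp add: sem_Set)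
  have "a < e 0 \<and> 2 ^ a < e 0" if "2 ^ a < e (Suc 0)" for a
  proof -
    have "2 ^ a < e 0" using assms that by simp
    moreover from this have "a < e 0" using less_exp[of a] by linarith
    ultimately show ?thesis by simp
  qed
  then have "{a. a < e 0 \<and> 2 ^ a < e 0 \<and> a < e 0 \<and> 2 ^ a < e 0 \<and> 2 ^ a < e (Suc 0)} = {a. 2 ^ a < e 1}" by auto
  then have 2: "sem (Asg 5 40 (ExF 21 (Var 0) (Conj (Rel 6 [Var 40, Var 21]) (Lt (Var 21) (Var 1))))) (?e, \<rho>(6 := l)) =
      (?e(5 := Lg (e 1)), \<rho>(6 := l))"
    using Lg_card[of "e 1"] by (simp add: l(2) conj_assoc)
  have "sem BaseC (e, \<rho>) = (e(4 := 2, 5 := Lg (e 1), 4 := min (e 0) (modb (e 1) (e 2))), \<rho>(6 := l))"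
    unfolding BaseC_def by (simp only: sem.simps(5) prod.case 1 l(1) 2) (simp add: sem_Set modb_def)
  moreover have "e(4 := 2, 5 := Lg (e 1), 4 := min (e 0) (modb (e 1) (e 2))) = e(5 := Lg (e 1), 4 := min (e 0) (modb (e 1) (e 2)))"
    by (rule ext) simp
  moreover have "Lg (e 1) \<le> e 0"
  proof (cases "Lg (e 1)")
    case (Suc y)
    then have "2 ^ y < e 1" using Lg_less_iff by simp
    then show ?thesis using less_exp[of y] assms Suc by linarith
  qed simp
  ultimately show ?thesis by metis
qed

lemma CodeC:
  assumes "2 \<le> e 4" "e 4 ^ Suc (e 2) < e 0" "e 2 + 1 < e 0"
  shows "\<exists>l. sem CodeC (e, \<rho>) = (e(6 := e 4 ^ Suc (e 2)), \<rho>(6 := l)) \<and> coded (e(6 := e 4 ^ Suc (e 2))) (\<rho>(6 := l))"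
proof -
  obtain l where l: "sem PowC (e, \<rho>) = (e, \<rho>(6 := l))"
    "\<And>i z. rel (e 0) l [i, z] \<longleftrightarrow> i < e 0 \<and> z < e 0 \<and> z = e 4 ^ i"
    using PowC[of e \<rho>] assms by auto
  have "sem CodeC (e, \<rho>) = (e(6 := e 4 ^ Suc (e 2)), \<rho>(6 := l))"
    unfolding CodeC_def using assms by (simp add: l conj_assoc card_less_min del: power_Suc)
  moreover have "coded (e(6 := e 4 ^ Suc (e 2))) (\<rho>(6 := l))"
    using assms l(2) unfolding coded_def pow_tab_def by simp
  ultimately show ?thesis by blast
qed

definition shF :: "tm \<Rightarrow> tm \<Rightarrow> fm" where
  "shF x y = Or (Conj (Lt x (Var 5)) (Eqt y x)) (Conj (Neg (Lt x (Var 5))) (Eqt y (Add x (Num 1))))"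

definition delF :: fm where
  "delF = ExF 20 (Var 8) (ExF 21 (Var 8) (Conj (Eqt (Var 99) (Add (Mul (Var 20) (Var 8)) (Var 21)))
     (ExF 22 (Var 1) (ExF 23 (Var 1) (Conj (shF (Var 20) (Var 22)) (Conj (shF (Var 21) (Var 23))
       (Edg (Var 22) (Var 23))))))))"

definition DelC :: cmd where
  "DelC = If (Lt (Var 5) (Var 1)) (Sq (Asg 8 40 (Lt (Add (Var 40) (Num 1)) (Var 1)))
     (Sq (Def 0 99 (Mul (Var 8) (Var 8)) delF) (Set 1 (Var 8)))) Nop"

lemma DelC:
  assumes gr: "gr n (Em n (\<rho> 0))" and n: "n = e 1" "n < e 0" and v: "e 5 < n"
  shows "\<exists>l. sem DelC (e, \<rho>) = (e(8 := n - 1, 1 := n - 1), \<rho>(0 := l)) \<and>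
    Em (n - 1) l = del (e 5) (Em n (\<rho> 0)) \<and> length l = (n - 1) * (n - 1)"
proof -
  let ?E = "Em n (\<rho> 0)"
  have en: "e (Suc 0) = n" using n by simp
  have "{a. a < e 0 \<and> Suc a < n} = {..<n - 1}" using n by auto
  then have 1: "sem (Asg 8 40 (Lt (Add (Var 40) (Num 1)) (Var 1))) (e, \<rho>) = (e(8 := n - 1), \<rho>)"
    by (simp add: en)
  let ?e = "e(8 := n - 1)"
  let ?l = "map (\<lambda>z. sat \<rho> (?e(99 := z)) delF) [0..<(n - 1) * (n - 1)]"
  have 2: "sem (Def 0 99 (Mul (Var 8) (Var 8)) delF) (?e, \<rho>) = (?e, \<rho>(0 := ?l))" by simp
  have 3: "sem (Set 1 (Var 8)) (?e, \<rho>(0 := ?l)) = (e(8 := n - 1, 1 := n - 1), \<rho>(0 := ?l))"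
    using n by (simp add: sem_Set)
  have c: "sat \<rho> e (Lt (Var 5) (Var 1))" using v en by simp
  have "sem DelC (e, \<rho>) = (e(8 := n - 1, 1 := n - 1), \<rho>(0 := ?l))"
    unfolding DelC_def by (simp only: sem.simps(5,6) prod.case c if_True 1 2 3)
  moreover have "Em (n - 1) ?l x y \<longleftrightarrow> del (e 5) ?E x y" for x y
  proof (cases "x < n - 1 \<and> y < n - 1")
    case True
    then have xy: "x < n - 1" "y < n - 1" by auto
    have "x * (n - 1) + y < (x + 1) * (n - 1)" using xy by simp
    also have "\<dots> \<le> (n - 1) * (n - 1)" by (rule mult_le_mono1) (use xy in simp)
    finally have z: "x * (n - 1) + y < (n - 1) * (n - 1)" .
    have uniq: "x * (n - 1) + y = a * (n - 1) + b \<longleftrightarrow> a = x \<and> b = y" if "b < n - 1" for a b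
    proof
      assume e: "x * (n - 1) + y = a * (n - 1) + b"
      have "(x * (n - 1) + y) div (n - 1) = x" "(a * (n - 1) + b) div (n - 1) = a" using xy that by auto
      then show "a = x \<and> b = y" using e by auto
    qed simp
    have sh: "(x < e 5 \<and> a = x \<or> \<not> x < e 5 \<and> a = Suc x) \<longleftrightarrow> a = sh (e 5) x" for a x unfolding sh_def by auto
    have "Em (n - 1) ?l x y \<longleftrightarrow> sat \<rho> (?e(99 := x * (n - 1) + y)) delF"
      unfolding Em_def using xy z by simp
    also have "\<dots> \<longleftrightarrow> (\<exists>a<n - 1. \<exists>b<n - 1. (a = x \<and> b = y) \<and>
        (\<exists>c<n. \<exists>d<n. c = sh (e 5) a \<and> d = sh (e 5) b \<and> ?E c d))"
      unfolding delF_def shF_def using uniq by (simp add: en sh) metis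
    also have "\<dots> \<longleftrightarrow> del (e 5) ?E x y"
      unfolding del_def using xy gr unfolding gr_def by blast
    finally show ?thesis .
  next
    case False
    have "gr (n - 1) (del (e 5) ?E)" by (rule gr_del[OF gr v])
    then have "\<not> del (e 5) ?E x y" using False unfolding gr_def by blast
    moreover have "\<not> Em (n - 1) ?l x y" using False unfolding Em_def by blast
    ultimately show ?thesis by blast
  qed
  then have "Em (n - 1) ?l = del (e 5) ?E" by (simp add: fun_eq_iff)
  ultimately show ?thesis by (intro exI[of _ ?l]) simp
qed

lemma DelC_none: "\<not> e 5 < e 1 \<Longrightarrow> sem DelC (e, \<rho>) = (e, \<rho>)"
  unfolding DelC_def by simp

definition StepK :: cmd where
  "StepK = Sq PackC (Sq ChainC (If (Cnt 20 (Var 1) (Rel 7 [Var 20]) (Mul (Var 3) (Var 2))) (Set 7 (Num 1))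
     (Sq BaseC (Sq CodeC (Sq IrrC DelC)))))"

text \<open>Pairs of vertices, lengths and codes must lie below the budget to be indices or values.
  These size conditions only become weaker as \<open>n\<close> shrinks, by \<open>modb_mono\<close>,
  so one budget serves all rounds.\<close>

definition good :: "env \<Rightarrow> rels \<Rightarrow> bool" where
  "good e \<rho> \<longleftrightarrow> gr (e 1) (Em (e 1) (\<rho> 0)) \<and> length (\<rho> 0) = e 1 * e 1 \<and> e 1 * e 1 < e 0 \<and> e 1 < e 0 \<and> e 2 + 1 < e 0 \<and>
     modb (e 1) (e 2) ^ Suc (e 2) < e 0 \<and> 1 \<le> e 2 \<and> 1 \<le> e 3"

definition keeps :: "env \<Rightarrow> rels \<Rightarrow> env \<Rightarrow> rels \<Rightarrow> bool" where
  "keeps e \<rho> e' \<rho>' \<longleftrightarrow> (\<forall>x. x \<notin> {1, 4, 5, 6, 7, 8} \<longrightarrow> e' x = e x) \<and>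
     (\<forall>R. R \<in> {1..5} \<longrightarrow> \<rho>' R = \<rho> R)"

lemma Lg_mono: "a \<le> b \<Longrightarrow> Lg a \<le> Lg b"
  using Lg_less_iff[of "Lg b" a] Lg_le[of b] by (meson leD leI le_trans)

lemma modb_mono: "a \<le> b \<Longrightarrow> modb a D \<le> modb b D"
  unfolding modb_def by (intro add_mono mult_le_mono Lg_mono order_refl) auto

lemma StepK:
  assumes g: "good e \<rho>" and E: "E = Em (e 1) (\<rho> 0)" "n = e 1" "D = e 2" "k = e 3"
  shows "\<exists>e' \<rho>'. sem StepK (e, \<rho>) = (e', \<rho>') \<and> keeps e \<rho> e' \<rho>' \<and>
    (e' 7 = 1 \<and> solvable n E D k \<and> e' 1 = e 1 \<and> \<rho>' 0 = \<rho> 0 \<or>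
     e' 7 = e 7 \<and> good e' \<rho>' \<and> e' 1 = n - 1 \<and> (solvable n E D k \<longleftrightarrow> solvable (n - 1) (Em (n - 1) (\<rho>' 0)) D k) \<or>
     e' 7 = e 7 \<and> e' 1 = n \<and> \<rho>' 0 = \<rho> 0 \<and> n \<le> Gb D * k ^ 18)"
proof -
  have B: "n * n < e 0" "n < e 0" "e 2 + 1 < e 0" "modb n D ^ Suc D < e 0" "0 < D" "1 \<le> k" and gr: "gr n E"
    using g E unfolding good_def by auto
  let ?S = "pack n E D k"
  have "\<exists>x \<rho>'. sem PackC (e, \<rho>) = (e(5 := x), \<rho>') \<and> x \<le> max (e 0) (e 5) \<and> agree {7, 8, 9, 10, 11} \<rho> \<rho>' \<and>
    (\<forall>u. rel (e 0) (\<rho>' 7) [u] \<longleftrightarrow> u \<in> pack n E (e 2) (e 3))"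
    by (rule PackC[OF gr]) (use E B in auto)
  then obtain x \<rho>1 where s1: "sem PackC (e, \<rho>) = (e(5 := x), \<rho>1)" "agree {7, 8, 9, 10, 11} \<rho> \<rho>1"
    "\<And>u. rel (e 0) (\<rho>1 7) [u] \<longleftrightarrow> u \<in> ?S"
    unfolding E(3,4) by blast
  let ?e1 = "e(5 := x)"
  have r1: "\<rho>1 0 = \<rho> 0" using s1(2) by (simp add: agree_def)
  have "\<exists>\<rho>'. sem ChainC (?e1, \<rho>1) = (?e1, \<rho>') \<and> agree {8, 9, 10, 11} \<rho>1 \<rho>' \<and>
    (\<forall>v u. rel (?e1 0) (\<rho>' 8) [v, u] \<longleftrightarrow> u \<in> set (chain n E ?S (?e1 2) v))"
  proof (rule ChainC[OF gr])
    show "E = Em n (\<rho>1 0)" "n = ?e1 1" "n * n < ?e1 0" "n < ?e1 0" using E(1,2) B(1,2) r1 by simp_all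
    show "rel (?e1 0) (\<rho>1 7) [u] \<longleftrightarrow> u \<in> ?S" for u using s1(3) by simp
  qed
  then obtain \<rho>2 where s2: "sem ChainC (?e1, \<rho>1) = (?e1, \<rho>2)" "agree {8, 9, 10, 11} \<rho>1 \<rho>2"
    "\<And>v u. rel (e 0) (\<rho>2 8) [v, u] \<longleftrightarrow> u \<in> anc_of n E D k v" unfolding anc_of_def E(3) by auto
  have r2: "\<rho>2 0 = \<rho> 0" "\<rho>2 7 = \<rho>1 7" using s2(2) r1 by (auto simp: agree_def)
  have Sn: "?S \<subseteq> {..<n}" using pack_props[OF gr B(5), of k] by blast
  have cS: "{u. u < n \<and> u \<in> ?S} = ?S" using Sn by auto
  have en: "e (Suc 0) = n" using E by simp
  have test: "sat \<rho>2 ?e1 (Cnt 20 (Var 1) (Rel 7 [Var 20]) (Mul (Var 3) (Var 2))) \<longleftrightarrow> k * D \<le> card ?S"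
    unfolding E(3,4) by (simp add: en r2(2) s1(3)[unfolded E(3,4)] cS[unfolded E(3,4)])
  have ag2: "\<forall>R\<in>{1..5}. \<rho>2 R = \<rho> R" using s1(2) s2(2) unfolding agree_def by auto
  show ?thesis
  proof (cases "k * D \<le> card ?S")
    case True
    have "sem StepK (e, \<rho>) = (?e1(7 := 1), \<rho>2)"
      unfolding StepK_def by (simp only: sem.simps(5,6) prod.case s1(1) s2(1) test True if_True) (use B in \<open>simp add: sem_Set\<close>)
    moreover have "keeps e \<rho> (?e1(7 := 1)) \<rho>2" unfolding keeps_def using ag2 by auto
    moreover have "solvable n E D k" by (rule pack_yes[OF gr B(5) True])
    ultimately show ?thesis using r2 by (intro exI[of _ "?e1(7 := 1)"] exI[of _ \<rho>2]) auto
  next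
    case False
    then have small: "card ?S < k * D" by simp
    have mb: "modb n D \<le> modb n D ^ Suc D" unfolding modb_def by (rule self_le_power) auto
    obtain x2 l3 where s3: "sem BaseC (?e1, \<rho>2) = (?e1(5 := x2, 4 := min (e 0) (modb n D)), \<rho>2(6 := l3))"
      using BaseC[of ?e1 \<rho>2] B E by auto
    let ?e3 = "?e1(5 := x2, 4 := modb n D)"
    have s3': "sem BaseC (?e1, \<rho>2) = (?e3, \<rho>2(6 := l3))" using s3 mb B(4) by (simp add: min_def)
    let ?C = "modb n D ^ Suc D"
    have m2: "2 \<le> modb n D" unfolding modb_def by simp
    have "\<exists>l. sem CodeC (?e3, \<rho>2(6 := l3)) = (?e3(6 := ?e3 4 ^ Suc (?e3 2)), \<rho>2(6 := l3, 6 := l)) \<and>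
       coded (?e3(6 := ?e3 4 ^ Suc (?e3 2))) (\<rho>2(6 := l3, 6 := l))"
      by (rule CodeC) (use m2 B E in auto)
    then obtain l4 where s4: "sem CodeC (?e3, \<rho>2(6 := l3)) = (?e3(6 := ?C), \<rho>2(6 := l4))"
      "coded (?e3(6 := ?C)) (\<rho>2(6 := l4))" using E(3) by auto
    let ?e4 = "?e3(6 := ?C)"
    let ?\<rho>4 = "\<rho>2(6 := l4)"
    have F: "forest n E ?S (anc_of n E D k) D (k * D) (modb n D) ?C" by (rule forest_pack[OF gr B(5) small])
    have *: "\<exists>y \<rho>'. sem IrrC (?e4, ?\<rho>4) = (?e4(5 := y), \<rho>') \<and> agree {12, 13, 14, 15} ?\<rho>4 \<rho>' \<and>
      y = (if \<exists>v<?e4 0. forest.irr n E ?S (anc_of n E D k) D (k * D) (modb n D) ?C v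
        then LEAST v. forest.irr n E ?S (anc_of n E D k) D (k * D) (modb n D) ?C v else ?e4 0)"
    proof (rule IrrC[OF F _ _ _ _ _ _ s4(2)])
      show "E = Em n (?\<rho>4 0)" "n = ?e4 1" "D = ?e4 2" "k * D = ?e4 3 * ?e4 2" "modb n D = ?e4 4" "?C = ?e4 6" "n < ?e4 0" "D < ?e4 0"
        using E r2(1) B(2,3) by simp_all
      show "rel (?e4 0) (?\<rho>4 7) [u] \<longleftrightarrow> u \<in> ?S" for u using s1(3) r2(2) by simp
      show "rel (?e4 0) (?\<rho>4 8) [v, u] \<longleftrightarrow> u \<in> anc_of n E D k v" for v u using s2(3) by simp
    qed
    obtain y \<rho>5 where s5: "sem IrrC (?e4, ?\<rho>4) = (?e4(5 := y), \<rho>5)" "agree {12, 13, 14, 15} ?\<rho>4 \<rho>5"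
      and y: "y = (if \<exists>v<e 0. irrel n E D k v then LEAST v. irrel n E D k v else e 0)"
    proof -
      have ir: "forest.irr n E ?S (anc_of n E D k) D (k * D) (modb n D) ?C = irrel n E D k"
        by (rule ext) (simp only: irrel_def)
      have e40: "?e4 0 = e 0" by simp
      show thesis if "\<And>y \<rho>5. sem IrrC (?e4, ?\<rho>4) = (?e4(5 := y), \<rho>5) \<Longrightarrow> agree {12, 13, 14, 15} ?\<rho>4 \<rho>5 \<Longrightarrow>
          y = (if \<exists>v<e 0. irrel n E D k v then LEAST v. irrel n E D k v else e 0) \<Longrightarrow> thesis"
        using that * unfolding ir e40 by blast
    qed
    let ?e5 = "?e4(5 := y)"
    have r5: "\<rho>5 0 = \<rho> 0" "\<forall>R\<in>{1..5}. \<rho>5 R = \<rho> R" using s5(2) r2 ag2 unfolding agree_def by auto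
    have sK: "sem StepK (e, \<rho>) = sem DelC (?e5, \<rho>5)"
      unfolding StepK_def by (simp only: sem.simps(5,6) prod.case s1(1) s2(1) test False if_False s3' s4(1) s5(1))
    show ?thesis
    proof (cases "\<exists>v<e 0. irrel n E D k v")
      case True
      then have "y = (LEAST v. irrel n E D k v)" using y by simp
      moreover have "\<exists>v. irrel n E D k v" using True by blast
      ultimately have irr: "irrel n E D k y" using LeastI_ex by metis
      then have yn: "y < n" by (rule irrel_less[OF gr B(5) small])
      have "\<exists>l. sem DelC (?e5, \<rho>5) = (?e5(8 := n - 1, 1 := n - 1), \<rho>5(0 := l)) \<and>
        Em (n - 1) l = del (?e5 5) (Em n (\<rho>5 0)) \<and> length l = (n - 1) * (n - 1)"
        by (rule DelC) (use gr E r5 B yn in auto)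
      then obtain l where l: "sem DelC (?e5, \<rho>5) = (?e5(8 := n - 1, 1 := n - 1), \<rho>5(0 := l))"
        "Em (n - 1) l = del y E" "length l = (n - 1) * (n - 1)" using r5 E by auto
      let ?e6 = "?e5(8 := n - 1, 1 := n - 1)"
      have k6: "keeps e \<rho> ?e6 (\<rho>5(0 := l))" unfolding keeps_def using r5 by auto
      have "(n - 1) * (n - 1) \<le> n * n" by (rule mult_le_mono) auto
      then have nn: "(n - 1) * (n - 1) < e 0" using B(1) by linarith
      have "modb (n - 1) D ^ Suc D \<le> modb n D ^ Suc D" by (rule power_mono[OF modb_mono]) auto
      then have mm: "modb (n - 1) D ^ Suc D < e 0" using B(4) by linarith
      have g6: "good ?e6 (\<rho>5(0 := l))"
        unfolding good_def using gr_del[OF gr yn] l(2,3) B nn mm E by (simp del: power_Suc)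
      show ?thesis unfolding sK l(1) using k6 g6 irrel_sound[OF gr B(5) small irr] l(2)
        by (intro exI[of _ ?e6] exI[of _ "\<rho>5(0 := l)"]) simp
    next
      case False
      then have none: "\<not> irrel n E D k v" for v using irrel_less[OF gr B(5) small, of v] B(2) by auto
      have ye: "y = e 0" unfolding y using False by (rule if_not_P)
      have "sem DelC (?e5, \<rho>5) = (?e5, \<rho>5)" by (rule DelC_none) (use ye B E in simp)
      moreover have "n \<le> Gb D * k ^ 18" by (rule irrel_bound[OF gr B(5) small none B(6)])
      moreover have "keeps e \<rho> ?e5 \<rho>5" unfolding keeps_def using r5 by auto
      ultimately show ?thesis unfolding sK using r5 E by (intro exI[of _ ?e5] exI[of _ \<rho>5]) simp
    qed
  qed
qed

definition LoopC :: cmd where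
  "LoopC = Sq (Set 7 (Num 0)) (Sq (Set 9 (Var 1)) (Rep (Var 9) (If (Eqt (Var 7) (Num 0)) StepK Nop)))"

lemma keeps_trans: "keeps e \<rho> e1 \<rho>1 \<Longrightarrow> keeps e1 \<rho>1 e2 \<rho>2 \<Longrightarrow> keeps e \<rho> e2 \<rho>2"
  unfolding keeps_def by metis

text \<open>Every round deletes a vertex unless a solution has been flagged or the bound is reached.
  Rounds after that do no harm, so the fixed number of \<open>n\<close> rounds suffices:
  \<open>n\<close> deletions leave the empty graph, for which the bound is trivial.\<close>

lemma LoopC:
  assumes g: "good e \<rho>" and E: "E = Em (e 1) (\<rho> 0)" "n = e 1" "D = e 2" "k = e 3"
  shows "\<exists>e' \<rho>'. sem LoopC (e, \<rho>) = (e', \<rho>') \<and> keeps (e(9 := n)) \<rho> e' \<rho>' \<and>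
    (e' 7 = 1 \<and> solvable n E D k \<or>
     e' 7 = 0 \<and> good e' \<rho>' \<and> e' 1 \<le> n \<and> e' 1 \<le> Gb D * k ^ 18 \<and>
       (solvable n E D k \<longleftrightarrow> solvable (e' 1) (Em (e' 1) (\<rho>' 0)) D k))"
proof -
  let ?e0 = "e(7 := 0, 9 := n)"
  define P where "P i st \<longleftrightarrow> (\<exists>e' \<rho>'. st = (e', \<rho>') \<and> keeps (e(9 := n)) \<rho> e' \<rho>' \<and>
    (e' 7 = 1 \<and> solvable n E D k \<or>
     e' 7 = 0 \<and> good e' \<rho>' \<and> e' 1 \<le> n \<and> (e' 1 + i \<le> n \<or> e' 1 \<le> Gb D * k ^ 18) \<and>
       (solvable n E D k \<longleftrightarrow> solvable (e' 1) (Em (e' 1) (\<rho>' 0)) D k)))" for i and st :: "env \<times> rels"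
  let ?c = "If (Eqt (Var 7) (Num 0)) StepK Nop"
  have "P n ((sem ?c ^^ n) (?e0, \<rho>))"
  proof (rule funpow_inv[where P = P])
    have "keeps (e(9 := n)) \<rho> ?e0 \<rho>" unfolding keeps_def by simp
    moreover have "good ?e0 \<rho>" using g unfolding good_def by simp
    ultimately show "P 0 (?e0, \<rho>)" unfolding P_def using E by (intro exI[of _ ?e0] exI[of _ \<rho>]) simp
    fix i st assume "i < n" "P i st"
    then obtain e1 \<rho>1 where st: "st = (e1, \<rho>1)" and kp: "keeps (e(9 := n)) \<rho> e1 \<rho>1" and
      d: "e1 7 = 1 \<and> solvable n E D k \<or>
     e1 7 = 0 \<and> good e1 \<rho>1 \<and> e1 1 \<le> n \<and> (e1 1 + i \<le> n \<or> e1 1 \<le> Gb D * k ^ 18) \<and>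
       (solvable n E D k \<longleftrightarrow> solvable (e1 1) (Em (e1 1) (\<rho>1 0)) D k)" unfolding P_def by blast
    show "P (Suc i) (sem ?c st)"
    proof (cases "e1 7 = 0")
      case False
      then have "sem ?c st = st" unfolding st by simp
      then show ?thesis using kp d False unfolding P_def st by auto
    next
      case True
      then have d': "good e1 \<rho>1" "e1 1 \<le> n" "e1 1 + i \<le> n \<or> e1 1 \<le> Gb D * k ^ 18"
        "solvable n E D k \<longleftrightarrow> solvable (e1 1) (Em (e1 1) (\<rho>1 0)) D k" using d by auto
      have s: "sem ?c st = sem StepK (e1, \<rho>1)" unfolding st using True by simp
      have Dk: "e1 2 = D" "e1 3 = k" using kp E unfolding keeps_def by auto
      obtain e2 \<rho>2 where s2: "sem StepK (e1, \<rho>1) = (e2, \<rho>2)" "keeps e1 \<rho>1 e2 \<rho>2"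
        and c: "e2 7 = 1 \<and> solvable (e1 1) (Em (e1 1) (\<rho>1 0)) D k \<and> e2 1 = e1 1 \<and> \<rho>2 0 = \<rho>1 0 \<or>
          e2 7 = e1 7 \<and> good e2 \<rho>2 \<and> e2 1 = e1 1 - 1 \<and> (solvable (e1 1) (Em (e1 1) (\<rho>1 0)) D k \<longleftrightarrow> solvable (e1 1 - 1) (Em (e1 1 - 1) (\<rho>2 0)) D k) \<or>
          e2 7 = e1 7 \<and> e2 1 = e1 1 \<and> \<rho>2 0 = \<rho>1 0 \<and> e1 1 \<le> Gb D * k ^ 18"
        using StepK[OF d'(1) refl refl Dk[symmetric]] by blast
      have kp2: "keeps (e(9 := n)) \<rho> e2 \<rho>2" by (rule keeps_trans[OF kp s2(2)])
      have budget_d: "good e2 \<rho>2" if "e2 1 = e1 1" "\<rho>2 0 = \<rho>1 0"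
        using d'(1) s2(2) that unfolding good_def keeps_def by simp
      from c have "e2 7 = 1 \<and> solvable n E D k \<or>
         e2 7 = 0 \<and> good e2 \<rho>2 \<and> e2 1 \<le> n \<and> (e2 1 + Suc i \<le> n \<or> e2 1 \<le> Gb D * k ^ 18) \<and>
         (solvable n E D k \<longleftrightarrow> solvable (e2 1) (Em (e2 1) (\<rho>2 0)) D k)"
      proof (elim disjE)
        assume a: "e2 7 = e1 7 \<and> good e2 \<rho>2 \<and> e2 1 = e1 1 - 1 \<and> (solvable (e1 1) (Em (e1 1) (\<rho>1 0)) D k \<longleftrightarrow> solvable (e1 1 - 1) (Em (e1 1 - 1) (\<rho>2 0)) D k)"
        then have "e2 1 + Suc i \<le> n \<or> e2 1 \<le> Gb D * k ^ 18"
          using d'(3) by (cases "e1 1 = 0") auto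
        then show ?thesis using a d' True by auto
      qed (use d' budget_d True in auto)
      then show ?thesis unfolding P_def s s2(1) using kp2 by blast
    qed
  qed
  moreover have "sem LoopC (e, \<rho>) = (sem ?c ^^ n) (?e0, \<rho>)"
  proof -
    have "sem (Set 7 (Num 0)) (e, \<rho>) = (e(7 := 0), \<rho>)" by (simp add: sem_Set)
    moreover have "n \<le> e 0" using g E unfolding good_def by simp
    then have "sem (Set 9 (Var 1)) (e(7 := 0), \<rho>) = (?e0, \<rho>)" using E by (simp add: sem_Set)
    ultimately show ?thesis unfolding LoopC_def
      by (simp only: sem.simps(5) sem.simps(7) prod.case val.simps) simp
  qed
  ultimately obtain e' \<rho>' where s: "sem LoopC (e, \<rho>) = (e', \<rho>')" "keeps (e(9 := n)) \<rho> e' \<rho>'"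
    "e' 7 = 1 \<and> solvable n E D k \<or>
     e' 7 = 0 \<and> good e' \<rho>' \<and> e' 1 \<le> n \<and> (e' 1 + n \<le> n \<or> e' 1 \<le> Gb D * k ^ 18) \<and>
       (solvable n E D k \<longleftrightarrow> solvable (e' 1) (Em (e' 1) (\<rho>' 0)) D k)" unfolding P_def by auto
  then show ?thesis by (intro exI[of _ e'] exI[of _ \<rho>']) auto
qed

subsection \<open>Output\<close>

text \<open>The integers of the input are returned, so the bits of \<open>d\<close> and
  \<open>k\<close> are copied. The length of such a list is obtained as the number of positions at
  which \<open>Peek\<close> does not report the end.\<close>

definition OutG :: cmd where
  "OutG = Sq (Def 3 99 (Add (Add (Var 1) (Num 1)) (Mul (Var 1) (Var 1))) (Or (Lt (Var 99) (Var 1))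
       (ExF 20 (Var 1) (ExF 21 (Var 1) (Conj (Eqt (Var 99) (Add (Add (Add (Var 1) (Num 1)) (Mul (Var 20) (Var 1))) (Var 21)))
         (Edg (Var 20) (Var 21)))))))
     (Sq (Asg 10 40 (Neg (Peek 1 (Var 40) {None}))) (Sq (Def 4 99 (Var 10) (Peek 1 (Var 99) {Some True}))
     (Sq (Asg 10 40 (Neg (Peek 2 (Var 40) {None}))) (Def 5 99 (Var 10) (Peek 2 (Var 99) {Some True})))))"

text \<open>This encodes the empty graph with \<open>d = 0\<close> and \<open>k = 0\<close>. The
  negative answer is the empty graph with \<open>d = 0\<close> and \<open>k = 1\<close>.\<close>

definition OutYes :: cmd where
  "OutYes = Sq (Def 3 99 (Num 1) FF) (Sq (Clr 4) (Clr 5))"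

definition OutNo :: cmd where
  "OutNo = Sq (Def 3 99 (Num 1) FF) (Sq (Clr 4) (Def 5 99 (Num 1) (Neg FF)))"

definition outs :: "env \<times> rels \<Rightarrow> bool list list" where
  "outs st = [snd st 3, snd st 4, snd st 5]"

lemma OutYes: "outs (sem OutYes (e, \<rho>)) = [[False], [], []] \<and> fst (sem OutYes (e, \<rho>)) = e"
  by (simp add: OutYes_def outs_def)

lemma OutNo: "outs (sem OutNo (e, \<rho>)) = [[False], [], [True]] \<and> fst (sem OutNo (e, \<rho>)) = e"
  by (simp add: OutNo_def outs_def)

lemma copy_list:
  "map (\<lambda>a. top_of (drop a l) \<in> {Some True}) [0..<length l] = l"
  by (rule nth_equalityI) (use top_drop[of _ l True] in auto)

lemma card_len: "length l \<le> b \<Longrightarrow> card {a. a < b \<and> \<not> length l \<le> a} = length l"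
proof -
  assume "length l \<le> b"
  then have "{a. a < b \<and> \<not> length l \<le> a} = {..<length l}" by auto
  then show ?thesis by simp
qed

lemma enc_map:
  assumes "E = Em n M"
  shows "map (\<lambda>a. a < n \<or> (\<exists>u<n. \<exists>v<n. a = n + 1 + u * n + v \<and> E u v)) [0..<n + 1 + n * n] = enc n E"
proof (rule nth_equalityI)
  show "length (map (\<lambda>a. a < n \<or> (\<exists>u<n. \<exists>v<n. a = n + 1 + u * n + v \<and> E u v)) [0..<n + 1 + n * n]) = length (enc n E)"
    by (simp add: enc_def)
  fix a assume "a < length (map (\<lambda>a. a < n \<or> (\<exists>u<n. \<exists>v<n. a = n + 1 + u * n + v \<and> E u v)) [0..<n + 1 + n * n])"
  then have a: "a < n + 1 + n * n" by simp
  have l: "map (\<lambda>a. a < n \<or> (\<exists>u<n. \<exists>v<n. a = n + 1 + u * n + v \<and> E u v)) [0..<n + 1 + n * n] ! a \<longleftrightarrow>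
      a < n \<or> (\<exists>u<n. \<exists>v<n. a = n + 1 + u * n + v \<and> E u v)" using a by (simp del: upt_Suc)
  consider "a < n" | "a = n" | z where "a = n + 1 + z" "z < n * n"
    using a by (metis add.assoc add_less_cancel_left less_iff_Suc_add less_linear Suc_eq_plus1 add_Suc_right add_Suc)
  then show "map (\<lambda>a. a < n \<or> (\<exists>u<n. \<exists>v<n. a = n + 1 + u * n + v \<and> E u v)) [0..<n + 1 + n * n] ! a = enc n E ! a"
  proof cases
    case 1
    then show ?thesis unfolding l enc_def by (simp add: nth_append)
  next
    case 2
    then show ?thesis unfolding l enc_def by (simp add: nth_append)
  next
    case (3 z)
    have n0: "0 < n" using 3 by (cases n) auto
    have "(\<exists>u<n. \<exists>v<n. a = n + 1 + u * n + v \<and> E u v) \<longleftrightarrow> E (z div n) (z mod n)"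
    proof
      assume "\<exists>u<n. \<exists>v<n. a = n + 1 + u * n + v \<and> E u v"
      then obtain u v where uv: "v < n" "z = u * n + v" "E u v" using 3 by auto
      then show "E (z div n) (z mod n)" by simp
    next
      assume e: "E (z div n) (z mod n)"
      have "z div n < n" using 3 by (simp add: less_mult_imp_div_less)
      moreover have "z mod n < n" using n0 by simp
      moreover have "a = n + 1 + z div n * n + z mod n" using 3 by simp
      ultimately show "\<exists>u<n. \<exists>v<n. a = n + 1 + u * n + v \<and> E u v" using e by blast
    qed
    then show ?thesis unfolding l enc_def using 3 by (simp add: nth_append)
  qed
qed

lemma OutG:
  assumes "length (\<rho> 1) \<le> e 0" "length (\<rho> 2) \<le> e 0"
  shows "outs (sem OutG (e, \<rho>)) = [enc (e 1) (Em (e 1) (\<rho> 0)), \<rho> 1, \<rho> 2] \<and> fst (sem OutG (e, \<rho>)) 0 = e 0"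
proof -
  let ?E = "Em (e 1) (\<rho> 0)"
  have 1: "sem (Def 3 99 (Add (Add (Var 1) (Num 1)) (Mul (Var 1) (Var 1))) (Or (Lt (Var 99) (Var 1))
       (ExF 20 (Var 1) (ExF 21 (Var 1) (Conj (Eqt (Var 99) (Add (Add (Add (Var 1) (Num 1)) (Mul (Var 20) (Var 1))) (Var 21)))
         (Edg (Var 20) (Var 21))))))) (e, \<rho>) = (e, \<rho>(3 := enc (e 1) ?E))"
    unfolding enc_map[OF refl, of "e 1" "\<rho> 0", symmetric] by simp
  have c: "sem (Def R' 99 (Var 10) (Peek R (Var 99) {Some True})) (e'(10 := length (\<rho>' R)), \<rho>') =
      (e'(10 := length (\<rho>' R)), \<rho>'(R' := \<rho>' R))" for R R' e' \<rho>'
    using copy_list[of "\<rho>' R"] by simp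
  have a: "sem (Asg 10 40 (Neg (Peek R (Var 40) {None}))) (e', \<rho>') = (e'(10 := length (\<rho>' R)), \<rho>')"
    if "length (\<rho>' R) \<le> e' 0" for R e' \<rho>'
    using card_len[OF that] by (simp add: top_drop_None)
  let ?\<rho>1 = "\<rho>(3 := enc (e 1) ?E)"
  let ?e1 = "e(10 := length (?\<rho>1 1))"
  let ?\<rho>2 = "?\<rho>1(4 := ?\<rho>1 1)"
  let ?e2 = "?e1(10 := length (?\<rho>2 2))"
  have a1: "sem (Asg 10 40 (Neg (Peek 1 (Var 40) {None}))) (e, ?\<rho>1) = (?e1, ?\<rho>1)" by (rule a) (use assms in simp)
  have a2: "sem (Asg 10 40 (Neg (Peek 2 (Var 40) {None}))) (?e1, ?\<rho>2) = (?e2, ?\<rho>2)" by (rule a) (use assms in simp)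
  have "sem OutG (e, \<rho>) = (?e2, ?\<rho>2(5 := ?\<rho>2 2))"
    unfolding OutG_def by (simp only: sem.simps(5) prod.case 1 a1 c a2)
  then show ?thesis by (simp add: outs_def)
qed

subsection \<open>Reading binary numbers\<close>

fun bval :: "bool list \<Rightarrow> nat" where
  "bval [] = 0"
| "bval (b # bs) = (if b then 1 else 0) + 2 * bval bs"

lemma bval_bin: "bval (bin d) = d"
proof (induction d rule: bin.induct)
  case (2 n)
  have "bval (bin (Suc n)) = (if odd (Suc n) then 1 else 0) + 2 * (Suc n div 2)"
    unfolding bin.simps(2) bval.simps 2 ..
  also have "(if odd (Suc n) then 1 else 0) = Suc n mod 2" by presburger
  also have "Suc n mod 2 + 2 * (Suc n div 2) = Suc n" by (rule mod_mult_div_eq)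
  finally show ?case .
qed simp

lemma length_bin: "length (bin d) \<le> d"
proof (induction d rule: bin.induct)
  case (2 n)
  have "length (bin (Suc n)) = Suc (length (bin (Suc n div 2)))" by (simp only: bin.simps list.size add_Suc_right add_0_right)
  also have "\<dots> \<le> Suc (Suc n div 2)" using 2 by (simp only: Suc_le_mono)
  also have "Suc n div 2 \<le> n" by linarith
  then have "Suc (Suc n div 2) \<le> Suc n" by (simp only: Suc_le_mono)
  finally show ?case .
qed simp

lemma bin_less: "d < 2 ^ length (bin d)"
proof (induction d rule: bin.induct)
  case (2 n)
  have l: "length (bin (Suc n)) = Suc (length (bin (Suc n div 2)))" by (simp only: bin.simps list.size add_Suc_right add_0_right)
  have "Suc n < 2 * (Suc n div 2 + 1)" by presburger
  also have "\<dots> \<le> 2 * 2 ^ length (bin (Suc n div 2))" using 2 by (intro mult_le_mono2) (simp only: Suc_eq_plus1[symmetric] Suc_le_eq)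
  finally show ?case unfolding l by (simp only: power_Suc)
qed simp

definition ReadC :: "nat \<Rightarrow> nat \<Rightarrow> cmd" where
  "ReadC R x = Sq (Set x (Num 0)) (Sq (Set 10 (Var 0)) (Rep (Var 0)
     (Sq (Asg 10 40 (Lt (Add (Var 40) (Num 1)) (Var 10)))
       (Asg x 40 (Or (Conj (Peek R (Var 10) {Some True}) (Lt (Var 40) (Add (Add (Var x) (Var x)) (Num 1))))
          (Lt (Var 40) (Add (Var x) (Var x))))))))"

lemma min_double: "min b (min b v + min b v + t) = min b (t + 2 * v)" for b v t :: nat
  by linarith

text \<open>Horner's rule, starting from the far end of the list, where the most significant bit is;
  positions beyond the end count as zero bits. All values are capped at the budget, and by
  \<open>min_double\<close> capping commutes with doubling.\<close>

lemma ReadC: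
  assumes len: "length (\<rho> R) \<le> e 0" and x: "x \<notin> {0, 10, 40, 99}"
  shows "sem (ReadC R x) (e, \<rho>) = (e(10 := 0, x := min (e 0) (bval (\<rho> R))), \<rho>)"
proof -
  let ?B = "e 0"
  let ?a = "Asg 10 40 (Lt (Add (Var 40) (Num 1)) (Var 10))"
  let ?b = "Asg x 40 (Or (Conj (Peek R (Var 10) {Some True}) (Lt (Var 40) (Add (Add (Var x) (Var x)) (Num 1))))
          (Lt (Var 40) (Add (Var x) (Var x))))"
  let ?st = "\<lambda>j. (e(10 := ?B - j, x := min ?B (bval (drop (?B - j) (\<rho> R)))), \<rho>)"
  have "(sem (Sq ?a ?b) ^^ ?B) (e(10 := ?B, x := 0), \<rho>) = ?st ?B"
  proof (rule funpow_inv[where P = "\<lambda>j st. st = ?st j"])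
    show "(e(10 := ?B, x := 0), \<rho>) = ?st 0" using len by simp
    fix j st assume j: "j < ?B" and st: "st = ?st j"
    obtain i where i: "?B - j = Suc i" "?B - Suc j = i" using j by (metis Suc_diff_Suc)
    have iB: "i < ?B" using i by linarith
    let ?v = "bval (drop (Suc i) (\<rho> R))"
    have "card {a. a < ?B \<and> Suc a < Suc i} = i" using card_less_min[of ?B i] iB by simp
    then have 1: "sem ?a (e', \<rho>) = (e'(10 := i), \<rho>)" if "e' 0 = ?B" "e' 10 = Suc i" for e'
      using that by simp
    let ?bit = "if top_of (drop i (\<rho> R)) = Some True then 1 else (0::nat)"
    have dr: "bval (drop i (\<rho> R)) = ?bit + 2 * ?v"
    proof (cases "i < length (\<rho> R)")
      case True
      then have "drop i (\<rho> R) = \<rho> R ! i # drop (Suc i) (\<rho> R)" by (simp add: Cons_nth_drop_Suc)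
      then show ?thesis by simp
    qed simp
    have "card {a. a < ?B \<and> a < min ?B ?v + min ?B ?v + ?bit} = min ?B (min ?B ?v + min ?B ?v + ?bit)"
      by (rule card_less_min)
    also have "\<dots> = min ?B (bval (drop i (\<rho> R)))" unfolding dr by (rule min_double)
    finally have c: "card {a. a < ?B \<and> a < min ?B ?v + min ?B ?v + ?bit} = min ?B (bval (drop i (\<rho> R)))" .
    have s: "{a. a < ?B \<and> (top_of (drop i (\<rho> R)) = Some True \<and> a < Suc (w + w) \<or> a < w + w)} =
      {a. a < ?B \<and> a < w + w + ?bit}" for w by auto
    have 2: "sem ?b (e', \<rho>) = (e'(x := min ?B (bval (drop i (\<rho> R)))), \<rho>)"
      if e': "e' 0 = ?B" "e' 10 = i" "e' x = min ?B ?v" for e'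
    proof -
      have "sem ?b (e', \<rho>) = (e'(x := card {a. a < ?B \<and> (top_of (drop i (\<rho> R)) = Some True \<and> a < Suc (e' x + e' x) \<or> a < e' x + e' x)}), \<rho>)"
        using x e'(1,2) by simp
      then show ?thesis unfolding s unfolding e'(3) c .
    qed
    let ?e1 = "e(10 := ?B - j, x := min ?B (bval (drop (?B - j) (\<rho> R))))"
    have "sem (Sq ?a ?b) st = sem ?b (sem ?a (?e1, \<rho>))" unfolding st by (simp only: sem.simps(5) prod.case)
    also have "sem ?a (?e1, \<rho>) = (?e1(10 := i), \<rho>)" by (rule 1) (use x i in simp_all)
    also have "sem ?b (?e1(10 := i), \<rho>) = (?e1(10 := i, x := min ?B (bval (drop i (\<rho> R)))), \<rho>)"
      by (rule 2) (use x i in simp_all)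
    also have "?e1(10 := i, x := min ?B (bval (drop i (\<rho> R)))) = e(10 := i, x := min ?B (bval (drop i (\<rho> R))))"
      using x by (auto simp: fun_eq_iff)
    finally show "sem (Sq ?a ?b) st = ?st (Suc j)" unfolding i(2) .
  qed
  moreover have "sem (ReadC R x) (e, \<rho>) = (sem (Sq ?a ?b) ^^ ?B) (e(10 := ?B, x := 0), \<rho>)"
  proof -
    have s1: "sem (Set x (Num 0)) (e, \<rho>) = (e(x := 0), \<rho>)" by (simp add: sem_Set)
    have s2: "sem (Set 10 (Var 0)) (e(x := 0), \<rho>) = (e(x := 0, 10 := ?B), \<rho>)" using x by (simp add: sem_Set)
    have t: "e(x := 0, 10 := ?B) = e(10 := ?B, x := 0)" using x by (auto simp: fun_eq_iff)
    have v: "val (e(10 := ?B, x := 0)) (Var 0) = ?B" using x by simp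
    show ?thesis unfolding ReadC_def by (simp only: sem.simps(5,7) prod.case s1 s2 t v)
  qed
  ultimately show ?thesis by simp
qed

subsection \<open>Exhaustive search\<close>

text \<open>One number stands for a whole candidate: its digit \<open>p\<close> in base
  \<open>n\<close> is the vertex at position \<open>p\<close>. So the budget has to exceed
  \<open>n ^ (k * D)\<close>.\<close>

definition bruteF :: fm where
  "bruteF = Conj (Lt (Num 0) (Var 1)) (ExF 20 (Var 0) (AllF 21 (Mul (Var 3) (Var 2)) (ExF 22 (Var 1)
     (Conj (Dig (Var 20) (Var 21) (Var 22)) (Conj (AllF 23 (Var 21) (Neg (Dig (Var 20) (Var 23) (Var 22))))
       (Imp (AllF 25 (Var 0) (Neg (Eqt (Add (Var 21) (Num 1)) (Mul (Var 25) (Var 2)))))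
         (ExF 24 (Var 1) (Conj (Dig (Var 20) (Add (Var 21) (Num 1)) (Var 24)) (Edg (Var 22) (Var 24))))))))))"

lemma sat_bruteF:
  assumes pt: "pow_tab e \<rho>" and n: "n = e 1" "E = Em n (\<rho> 0)" "D = e 2" "k = e 3" "e 4 = n"
    and B: "n ^ (k * D) < e 0" "k * D < e 0" and D: "1 \<le> D" and k: "1 \<le> k"
  shows "sat \<rho> e bruteF \<longleftrightarrow> solvable n E D k"
proof (cases "n = 0")
  case True
  have "\<not> solvable n E D k"
  proof
    assume "solvable n E D k"
    then obtain \<phi> where "\<phi> ` {..<k * D} \<subseteq> {..<n}" unfolding solvable_def solution_def by blast
    moreover have "0 \<in> {..<k * D}" using D k by simp
    ultimately have "\<phi> 0 \<in> {..<n}" by blast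
    then show False using True by simp
  qed
  then show ?thesis using True n(1) by (simp add: bruteF_def)
next
  case False
  then have n1: "1 \<le> n" by simp
  have v: "e (Suc 0) = n" "e 2 = D" "e 3 = k" using n by auto
  define m where "m = k * D"
  have dig: "sat \<rho> e' (Dig c i r) \<longleftrightarrow> dg n (val e' c) (val e' i) = val e' r"
    if "e' 0 = e 0" "e' 4 = e 4" "vars_lt 80 c" "vars_lt 80 i" "vars_lt 80 r" "val e' c < e 0" "val e' i < m" for e' c i r
  proof -
    have "n ^ val e' i \<le> n ^ m" using n1 that(7) by (intro power_increasing) auto
    then have "n ^ val e' i < e 0" using B unfolding m_def by linarith
    then have "sat \<rho> e' (Dig c i r) \<longleftrightarrow> dg (e' 4) (val e' c) (val e' i) = val e' r"
      using that pt n(5) n1 B(2) unfolding m_def by (intro sat_Dig) (auto simp: pow_tab_def)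
    then show ?thesis using that n(5) by simp
  qed
  have lin: "(\<forall>q<e 0. Suc p \<noteq> q * D) \<longleftrightarrow> Suc p mod D \<noteq> 0" if "p < m" for p
  proof
    assume a: "\<forall>q<e 0. Suc p \<noteq> q * D"
    show "Suc p mod D \<noteq> 0"
    proof
      assume "Suc p mod D = 0"
      then have "Suc p = Suc p div D * D" by (metis add.right_neutral div_mult_mod_eq)
      moreover have "Suc p div D < e 0" using that B(2) unfolding m_def
        by (meson Suc_leI div_le_dividend le_less_trans)
      ultimately show False using a by blast
    qed
  qed auto
  have Sp: "Suc p < m" if "p < m" "Suc p mod D \<noteq> 0" for p
  proof -
    have "Suc p \<noteq> m" using that(2) unfolding m_def by auto
    then show ?thesis using that(1) by simp
  qed
  have body: "sat \<rho> (e(20 := z, 21 := p, 22 := a))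
     (Conj (Dig (Var 20) (Var 21) (Var 22)) (Conj (AllF 23 (Var 21) (Neg (Dig (Var 20) (Var 23) (Var 22))))
       (Imp (AllF 25 (Var 0) (Neg (Eqt (Add (Var 21) (Num 1)) (Mul (Var 25) (Var 2)))))
         (ExF 24 (Var 1) (Conj (Dig (Var 20) (Add (Var 21) (Num 1)) (Var 24)) (Edg (Var 22) (Var 24))))))) \<longleftrightarrow>
     dg n z p = a \<and> (\<forall>q<p. dg n z q \<noteq> a) \<and> (Suc p mod D \<noteq> 0 \<longrightarrow> (\<exists>b<n. dg n z (Suc p) = b \<and> E a b))"
    if "z < e 0" "p < m" for z p a
  proof -
    let ?e = "e(20 := z, 21 := p, 22 := a)"
    have 1: "sat \<rho> ?e (Dig (Var 20) (Var 21) (Var 22)) \<longleftrightarrow> dg n z p = a"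
      by (subst dig) (use that in auto)
    have 2: "sat \<rho> (?e(23 := q)) (Dig (Var 20) (Var 23) (Var 22)) \<longleftrightarrow> dg n z q = a" if "q < p" for q
      by (subst dig) (use that \<open>z < e 0\<close> \<open>p < m\<close> in auto)
    have 3: "sat \<rho> (?e(24 := b)) (Dig (Var 20) (Add (Var 21) (Num 1)) (Var 24)) \<longleftrightarrow> dg n z (Suc p) = b"
      if "Suc p mod D \<noteq> 0" for b
      by (subst dig) (use that \<open>z < e 0\<close> Sp[OF \<open>p < m\<close> that] in auto)
    have 4: "sat \<rho> ?e (AllF 25 (Var 0) (Neg (Eqt (Add (Var 21) (Num 1)) (Mul (Var 25) (Var 2))))) \<longleftrightarrow> Suc p mod D \<noteq> 0"
      using lin[OF that(2)] v by simp
    have 5: "sat \<rho> ?e (AllF 23 (Var 21) (Neg (Dig (Var 20) (Var 23) (Var 22)))) \<longleftrightarrow> (\<forall>q<p. dg n z q \<noteq> a)"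
      using 2 by simp
    have 6: "sat \<rho> ?e (ExF 24 (Var 1) (Conj (Dig (Var 20) (Add (Var 21) (Num 1)) (Var 24)) (Edg (Var 22) (Var 24)))) \<longleftrightarrow>
       (\<exists>b<n. dg n z (Suc p) = b \<and> E a b)" if "Suc p mod D \<noteq> 0"
      using 3[OF that, unfolded One_nat_def] v n(2) by simp
    show ?thesis unfolding sat.simps(4) sat_macros(3) 1 4 5 using 6 by blast
  qed
  have "sat \<rho> e bruteF \<longleftrightarrow> (\<exists>z<e 0. \<forall>p<m. \<exists>a<n. dg n z p = a \<and> (\<forall>q<p. dg n z q \<noteq> a) \<and>
      (Suc p mod D \<noteq> 0 \<longrightarrow> (\<exists>b<n. dg n z (Suc p) = b \<and> E a b)))"
  proof -
    have "sat \<rho> e bruteF \<longleftrightarrow> (\<exists>z<e 0. \<forall>p<m. \<exists>a<n. sat \<rho> (e(20 := z, 21 := p, 22 := a))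
     (Conj (Dig (Var 20) (Var 21) (Var 22)) (Conj (AllF 23 (Var 21) (Neg (Dig (Var 20) (Var 23) (Var 22))))
       (Imp (AllF 25 (Var 0) (Neg (Eqt (Add (Var 21) (Num 1)) (Mul (Var 25) (Var 2)))))
         (ExF 24 (Var 1) (Conj (Dig (Var 20) (Add (Var 21) (Num 1)) (Var 24)) (Edg (Var 22) (Var 24))))))))"
      unfolding bruteF_def sat.simps(4) sat_macros(5,6) using n1 v by (simp add: m_def del: sat.simps(3,4) sat_macros)
    then show ?thesis using body by (metis (no_types, lifting))
  qed
  also have "\<dots> \<longleftrightarrow> solvable n E D k"
  proof
    assume "\<exists>z<e 0. \<forall>p<m. \<exists>a<n. dg n z p = a \<and> (\<forall>q<p. dg n z q \<noteq> a) \<and>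
      (Suc p mod D \<noteq> 0 \<longrightarrow> (\<exists>b<n. dg n z (Suc p) = b \<and> E a b))"
    then obtain z where z: "\<And>p. p < m \<Longrightarrow> dg n z p < n \<and> (\<forall>q<p. dg n z q \<noteq> dg n z p) \<and>
      (Suc p mod D \<noteq> 0 \<longrightarrow> E (dg n z p) (dg n z (Suc p)))" by blast
    have "inj_on (dg n z) {..<m}"
    proof (rule inj_onI)
      fix p q assume pq: "p \<in> {..<m}" "q \<in> {..<m}" "dg n z p = dg n z q"
      show "p = q"
      proof (rule ccontr)
        assume "p \<noteq> q"
        then consider "p < q" | "q < p" by linarith
        then show False
        proof cases
          case 1
          then show False using z[of q] pq by auto
        next
          case 2
          then show False using z[of p] pq by auto
        qed
      qed
    qed
    then have "solution n E D (k * D) (dg n z)" using z unfolding solution_def links_def m_def[symmetric] by auto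
    then show "solvable n E D k" unfolding solvable_def by blast
  next
    assume "solvable n E D k"
    then obtain \<phi> where phi: "inj_on \<phi> {..<m}" "\<phi> ` {..<m} \<subseteq> {..<n}" "\<And>p. p < m \<Longrightarrow> Suc p mod D \<noteq> 0 \<Longrightarrow> E (\<phi> p) (\<phi> (Suc p))"
      unfolding solvable_def solution_def links_def m_def by blast
    have pn: "\<phi> p < n" if "p < m" for p using phi(2) that by auto
    obtain z where z: "z < n ^ m" "\<forall>p<m. dg n z p = \<phi> p" using dg_ex[of m \<phi> n] pn by blast
    have "\<exists>a<n. dg n z p = a \<and> (\<forall>q<p. dg n z q \<noteq> a) \<and>
        (Suc p mod D \<noteq> 0 \<longrightarrow> (\<exists>b<n. dg n z (Suc p) = b \<and> E a b))" if p: "p < m" for p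
    proof -
      have "dg n z q \<noteq> \<phi> p" if "q < p" for q
      proof
        assume "dg n z q = \<phi> p"
        then have "\<phi> q = \<phi> p" using z(2) that p by simp
        then have "q = p" using phi(1) that p by (auto simp: inj_on_def)
        then show False using that by simp
      qed
      moreover have "Suc p mod D \<noteq> 0 \<longrightarrow> dg n z (Suc p) < n \<and> E (\<phi> p) (dg n z (Suc p))"
        using phi(3)[OF p] Sp[OF p] z(2) pn by simp
      ultimately show ?thesis using pn[OF p] z(2) p by (intro exI[of _ "\<phi> p"]) simp
    qed
    moreover have "z < e 0" using z(1) B(1) unfolding m_def by simp
    ultimately show "\<exists>z<e 0. \<forall>p<m. \<exists>a<n. dg n z p = a \<and> (\<forall>q<p. dg n z q \<noteq> a) \<and>
      (Suc p mod D \<noteq> 0 \<longrightarrow> (\<exists>b<n. dg n z (Suc p) = b \<and> E a b))" by blast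
  qed
  finally show ?thesis .
qed

subsection \<open>The kernelization commands\<close>

definition init_e :: "nat \<Rightarrow> env" where "init_e n = (\<lambda>x. if x < 2 then n else 0)"
definition init_r :: "bool list \<Rightarrow> bool list \<Rightarrow> bool list \<Rightarrow> rels" where
  "init_r M bd bk = (\<lambda>R. if R = 0 then M else if R = 1 then bd else if R = 2 then bk else [])"

text \<open>The summand \<open>n\<close> is the initial value of variable 0, to which
  \<open>Grow\<close> adds the power. The sum exceeds \<open>n * n\<close>, is at least
  \<open>n + 3\<close>, and is at least \<open>modb n D\<close> for all
  \<open>D \<le> n\<close>.\<close>

definition base_budget :: "nat \<Rightarrow> nat" where "base_budget n = n + (n + 3) ^ 8"

text \<open>\<open>d\<close> and \<open>k\<close> may have more than \<open>n\<close> bits, and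
  reading them in full could take too long. A look at position \<open>n\<close> of each list detects
  this. Such an instance, like any with \<open>d \<ge> n\<close> or \<open>k > n\<close>, is
  negative because \<open>k = 0\<close> has been settled before. Only afterwards are the two numbers
  read.\<close>

definition MainC :: "cmd \<Rightarrow> cmd" where
  "MainC c = Sq (Grow (powt (Add (Var 1) (Num 3)) 8)) (If (Peek 2 (Num 0) {None}) OutYes
     (If (Or (Neg (Peek 1 (Var 1) {None})) (Neg (Peek 2 (Var 1) {None}))) OutNo
     (Sq (ReadC 1 11) (Sq (ReadC 2 3) (Sq (Set 2 (Add (Var 11) (Num 1)))
       (If (Or (Neg (Lt (Var 11) (Var 1))) (Lt (Var 1) (Var 3))) OutNo c))))))"

lemma bin_Nil: "bin k = [] \<longleftrightarrow> k = 0"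
  by (cases k) auto

lemma MainC_yes:
  "outs (sem (MainC c) (init_e n, init_r M bd (bin 0))) = [[False], [], []] \<and>
   fst (sem (MainC c) (init_e n, init_r M bd (bin 0))) 0 = base_budget n"
  using OutYes by (simp add: MainC_def init_r_def init_e_def base_budget_def)

lemma MainC_other:
  fixes M and n d k :: nat
  assumes k: "1 \<le> k"
  defines "st \<equiv> (init_e n, init_r M (bin d) (bin k))"
  shows "(n \<le> d \<or> n < k) \<and> outs (sem (MainC c) st) = [[False], [], [True]] \<and> fst (sem (MainC c) st) 0 = base_budget n \<or>
    d < n \<and> k \<le> n \<and> length (bin d) \<le> n \<and> length (bin k) \<le> n \<and> (\<exists>e. sem (MainC c) st = sem c (e, init_r M (bin d) (bin k)) \<and>
      e 0 = base_budget n \<and> e 1 = n \<and> e 2 = Suc d \<and> e 3 = k)"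
proof -
  let ?\<rho> = "init_r M (bin d) (bin k)"
  let ?e1 = "(init_e n)(0 := base_budget n)"
  have r: "?\<rho> 1 = bin d" "?\<rho> 2 = bin k" by (auto simp: init_r_def)
  have v1: "?e1 1 = n" "?e1 0 = base_budget n" by (auto simp: init_e_def)
  have g: "sem (Grow (powt (Add (Var 1) (Num 3)) 8)) (init_e n, ?\<rho>) = (?e1, ?\<rho>)"
    by (simp add: init_e_def base_budget_def fun_eq_iff)
  have p1: "\<not> sat ?\<rho> ?e1 (Peek 2 (Num 0) {None})"
    using k bin_Nil[of k] top_drop_None[of 0 "bin k"] by (simp add: r)
  have p2: "sat ?\<rho> ?e1 (Or (Neg (Peek 1 (Var 1) {None})) (Neg (Peek 2 (Var 1) {None}))) \<longleftrightarrow>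
      n < length (bin d) \<or> n < length (bin k)"
    using r v1 by (simp add: top_drop_None not_le)
  have nB: "n + 3 \<le> base_budget n"
  proof -
    have "n + 3 \<le> (n + 3) ^ 8" by (rule self_le_power) auto
    then show ?thesis unfolding base_budget_def by linarith
  qed
  show ?thesis
  proof (cases "n < length (bin d) \<or> n < length (bin k)")
    case True
    then have "n \<le> d \<or> n < k" using length_bin[of d] length_bin[of k] by linarith
    moreover have "sem (MainC c) st = sem OutNo (?e1, ?\<rho>)"
      unfolding MainC_def st_def
      by (simp only: sem.simps(5,6) prod.case g p1 p2 True if_True if_False)
    ultimately show ?thesis using OutNo[of ?e1 ?\<rho>] v1 by simp
  next
    case False
    let ?e2 = "?e1(10 := 0, 11 := min (base_budget n) d)"
    let ?e3 = "?e2(10 := 0, 3 := min (base_budget n) k)"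
    let ?e4 = "?e3(2 := min (base_budget n) (min (base_budget n) d + 1))"
    have s2: "sem (ReadC 1 11) (?e1, ?\<rho>) = (?e2, ?\<rho>)"
      using ReadC[of ?\<rho> 1 ?e1 11] False nB v1 r by (simp add: bval_bin)
    have s3: "sem (ReadC 2 3) (?e2, ?\<rho>) = (?e3, ?\<rho>)"
      using ReadC[of ?\<rho> 2 ?e2 3] False nB v1 r by (simp add: bval_bin)
    have s4: "sem (Set 2 (Add (Var 11) (Num 1))) (?e3, ?\<rho>) = (?e4, ?\<rho>)"
      using v1 by (simp add: sem_Set)
    have p3: "sat ?\<rho> ?e4 (Or (Neg (Lt (Var 11) (Var 1))) (Lt (Var 1) (Var 3))) \<longleftrightarrow> n \<le> d \<or> n < k"
      using v1 nB by (auto simp: init_e_def)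
    have s: "sem (MainC c) st = (if n \<le> d \<or> n < k then sem OutNo (?e4, ?\<rho>) else sem c (?e4, ?\<rho>))"
      unfolding MainC_def st_def
      by (simp only: sem.simps(5,6) prod.case g p1 p2 False if_False s2 s3 s4 p3)
    show ?thesis
    proof (cases "n \<le> d \<or> n < k")
      case True
      then show ?thesis using s OutNo[of ?e4 ?\<rho>] v1 by simp
    next
      case nd: False
      have "?e4 0 = base_budget n" "?e4 1 = n" "?e4 2 = Suc d" "?e4 3 = k" using v1 nd nB by (auto simp: init_e_def)
      then show ?thesis using s nd False by (intro disjI2) (auto simp: not_le not_less)
    qed
  qed
qed

lemma Lg_self: "Lg n \<le> n"
  unfolding Lg_def by (rule Least_le) (simp add: less_imp_le)

lemma modb_base_budget: assumes "D \<le> n" shows "modb n D \<le> base_budget n"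
proof -
  have "Lg n * (D * D) * (D * D) \<le> n * (n * n) * (n * n)"
    using assms Lg_self[of n] by (intro mult_le_mono) auto
  also have "\<dots> = n ^ 5" by (simp add: eval_nat_numeral)
  also have "\<dots> \<le> (n + 3) ^ 5" by (rule power_mono) auto
  finally have "modb n D \<le> 2 * (n + 3) ^ 5 + 3" unfolding modb_def by simp
  also have "\<dots> \<le> 3 * (n + 3) ^ 5"
  proof -
    have "n + 3 \<le> (n + 3) ^ 5" by (rule self_le_power) auto
    then show ?thesis by linarith
  qed
  also have "\<dots> \<le> (n + 3) * (n + 3) ^ 5" by (intro mult_le_mono1) simp
  also have "\<dots> = (n + 3) ^ 6" by (simp add: eval_nat_numeral)
  also have "\<dots> \<le> (n + 3) ^ 8" by (rule power_increasing) auto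
  finally show ?thesis unfolding base_budget_def by linarith
qed

lemma base_budget_sq: "n * n < base_budget n" "n + 3 \<le> base_budget n"
proof -
  have "n * n < (n + 3) ^ 2" by (simp add: power2_eq_square algebra_simps)
  also have "\<dots> \<le> (n + 3) ^ 8" by (rule power_increasing) auto
  finally show "n * n < base_budget n" unfolding base_budget_def by linarith
  have "n + 3 \<le> (n + 3) ^ 8" by (rule self_le_power) auto
  then show "n + 3 \<le> base_budget n" unfolding base_budget_def by linarith
qed

definition FinC :: cmd where "FinC = Sq LoopC (If (Eqt (Var 7) (Num 0)) OutG OutYes)"

definition Kern1 :: cmd where
  "Kern1 = Sq BaseC (Sq (Set 6 (Num 1)) (Sq (Rep (Add (Var 2) (Num 1)) (Set 6 (Mul (Var 6) (Var 4))))
     (If (Lt (Var 6) (Var 0)) FinC OutG)))"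

lemma Kern1:
  assumes e: "e 0 = base_budget n" "e 1 = n" "e 2 = D" "e 3 = k" and D: "1 \<le> D" "D \<le> n" and k: "1 \<le> k"
    and gr: "gr n (Em n (\<rho> 0))" and len: "length (\<rho> 0) = n * n" "length (\<rho> 1) \<le> n" "length (\<rho> 2) \<le> n"
  shows "fst (sem Kern1 (e, \<rho>)) 0 = base_budget n \<and>
    (outs (sem Kern1 (e, \<rho>)) = [[False], [], []] \<and> solvable n (Em n (\<rho> 0)) D k \<or>
     (\<exists>n' E'. outs (sem Kern1 (e, \<rho>)) = [enc n' E', \<rho> 1, \<rho> 2] \<and> gr n' E' \<and>
        (solvable n (Em n (\<rho> 0)) D k \<longleftrightarrow> solvable n' E' D k) \<and> n' \<le> Gb D * k ^ 18))"
proof -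
  let ?B = "base_budget n"
  let ?E = "Em n (\<rho> 0)"
  define \<beta> where "\<beta> = modb n D"
  note B = base_budget_sq[of n]
  have mB: "\<beta> \<le> ?B" unfolding \<beta>_def by (rule modb_base_budget[OF D(2)])
  obtain x l where s1: "sem BaseC (e, \<rho>) = (e(5 := x, 4 := \<beta>), \<rho>(6 := l))"
    using BaseC[of e \<rho>] e B mB unfolding \<beta>_def by (auto simp: min_def)
  let ?e1 = "e(5 := x, 4 := \<beta>)"
  let ?\<rho>1 = "\<rho>(6 := l)"
  have s2: "sem (Set 6 (Num 1)) (?e1, ?\<rho>1) = (?e1(6 := 1), ?\<rho>1)" using e B by (simp add: sem_Set)
  have b1: "1 \<le> \<beta>" unfolding \<beta>_def modb_def by simp
  \<comment> \<open>Since the base is at least 1, a power that has reached the cap stays there, so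
    repeated capped multiplication yields the capped power.\<close>
  have mm: "min ?B (min ?B (\<beta> ^ i) * \<beta>) = min ?B (\<beta> ^ Suc i)" for i
  proof (cases "?B \<le> \<beta> ^ i")
    case True
    have "?B * 1 \<le> ?B * \<beta>" using b1 by (rule mult_le_mono2)
    moreover have "\<beta> ^ i \<le> \<beta> ^ Suc i" using b1 by (intro power_increasing) auto
    ultimately have "?B \<le> ?B * \<beta>" "?B \<le> \<beta> ^ Suc i" using True by linarith+
    then show ?thesis using True by (simp add: min_absorb1 del: power_Suc)
  next
    case False
    then show ?thesis by (simp add: min_def mult.commute)
  qed
  have s3: "(sem (Set 6 (Mul (Var 6) (Var 4))) ^^ Suc D) (?e1(6 := 1), ?\<rho>1) = (?e1(6 := min ?B (\<beta> ^ Suc D)), ?\<rho>1)"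
  proof (rule funpow_inv[where P = "\<lambda>i st. st = (?e1(6 := min ?B (\<beta> ^ i)), ?\<rho>1)"])
    show "(?e1(6 := 1), ?\<rho>1) = (?e1(6 := min ?B (\<beta> ^ 0)), ?\<rho>1)" using B by simp
    fix i st assume "st = (?e1(6 := min ?B (\<beta> ^ i)), ?\<rho>1)"
    then show "sem (Set 6 (Mul (Var 6) (Var 4))) st = (?e1(6 := min ?B (\<beta> ^ Suc i)), ?\<rho>1)"
      using e(1) mm[of i] by (simp add: sem_Set del: power_Suc)
  qed
  let ?e2 = "?e1(6 := min ?B (\<beta> ^ Suc D))"
  have v: "val (?e1(6 := 1)) (Add (Var 2) (Num 1)) = Suc D" using e by simp
  have t: "sat ?\<rho>1 ?e2 (Lt (Var 6) (Var 0)) \<longleftrightarrow> \<beta> ^ Suc D < ?B" using e by (auto simp: min_def simp del: power_Suc)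
  have s: "sem Kern1 (e, \<rho>) = (if \<beta> ^ Suc D < ?B then sem FinC (?e2, ?\<rho>1) else sem OutG (?e2, ?\<rho>1))"
    unfolding Kern1_def by (simp only: sem.simps(5,6,7) prod.case s1 s2 v s3 t)
  show ?thesis
  proof (cases "\<beta> ^ Suc D < ?B")
    case False
    then have o: "sem Kern1 (e, \<rho>) = sem OutG (?e2, ?\<rho>1)" using s by simp
    have og: "outs (sem OutG (?e2, ?\<rho>1)) = [enc n ?E, \<rho> 1, \<rho> 2] \<and> fst (sem OutG (?e2, ?\<rho>1)) 0 = base_budget n"
      using OutG[of ?\<rho>1 ?e2] len e B by simp
    have "n * n < \<beta> ^ Suc D" using False B(1) by linarith
    also have "\<dots> \<le> Gb D * n" unfolding \<beta>_def by (rule modb_Gb) (use D in auto)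
    finally have "n < Gb D" using D by simp
    moreover have "Gb D * 1 \<le> Gb D * k ^ 18" by (rule mult_le_mono2) (use k in simp)
    ultimately have "n \<le> Gb D * k ^ 18" by linarith
    then show ?thesis unfolding o using og gr by blast
  next
    case True
    have g: "good ?e2 ?\<rho>1" unfolding good_def using e gr len B D k True \<beta>_def by (simp del: power_Suc)
    obtain e' \<rho>' where lp: "sem LoopC (?e2, ?\<rho>1) = (e', \<rho>')" "keeps (?e2(9 := n)) ?\<rho>1 e' \<rho>'" and
     c: "e' 7 = 1 \<and> solvable n ?E D k \<or>
     e' 7 = 0 \<and> good e' \<rho>' \<and> e' 1 \<le> n \<and> e' 1 \<le> Gb D * k ^ 18 \<and>
       (solvable n ?E D k \<longleftrightarrow> solvable (e' 1) (Em (e' 1) (\<rho>' 0)) D k)"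
      using LoopC[OF g, of ?E n D k] e by auto
    have kp: "e' 0 = base_budget n" "\<rho>' 1 = \<rho> 1" "\<rho>' 2 = \<rho> 2" using lp(2) e unfolding keeps_def by auto
    have o: "sem Kern1 (e, \<rho>) = (if e' 7 = 0 then sem OutG (e', \<rho>') else sem OutYes (e', \<rho>'))"
      using s True lp(1) by (simp add: FinC_def del: power_Suc)
    from c show ?thesis
    proof
      assume a: "e' 7 = 1 \<and> solvable n ?E D k"
      then show ?thesis using o OutYes[of e' \<rho>'] kp by simp
    next
      assume a: "e' 7 = 0 \<and> good e' \<rho>' \<and> e' 1 \<le> n \<and> e' 1 \<le> Gb D * k ^ 18 \<and>
       (solvable n ?E D k \<longleftrightarrow> solvable (e' 1) (Em (e' 1) (\<rho>' 0)) D k)"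
      then have o': "sem Kern1 (e, \<rho>) = sem OutG (e', \<rho>')" using o by simp
      have "outs (sem OutG (e', \<rho>')) = [enc (e' 1) (Em (e' 1) (\<rho>' 0)), \<rho> 1, \<rho> 2] \<and> fst (sem OutG (e', \<rho>')) 0 = base_budget n"
        using OutG[of \<rho>' e'] len B kp by simp
      moreover have "gr (e' 1) (Em (e' 1) (\<rho>' 0))" using a unfolding good_def by blast
      ultimately show ?thesis unfolding o' using a by blast
    qed
  qed
qed

definition BruteC :: cmd where
  "BruteC = Sq (Rep (Mul (Var 3) (Var 2)) (Grow (Mul (Var 0) (Var 1)))) (Sq (Set 4 (Var 1)) (Sq PowC (If bruteF OutYes OutNo)))"

text \<open>The exponent 20 exceeds the 18 of \<open>irrel_bound\<close>. If the test fails, this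
  surplus forces \<open>(k + 2) ^ 2\<close> to be at most \<open>Gb D\<close>, see
  \<open>budget2\<close>. The summand \<open>Var 2\<close> accounts for \<open>d\<close>, which is
  part of the output.\<close>

definition Kern2 :: cmd where
  "Kern2 = Sq BaseC (Sq (Rep (Add (Var 2) (Num 1)) (Grow (Mul (Var 0) (Var 4)))) (Sq LoopC
     (If (Neg (Eqt (Var 7) (Num 0))) OutYes (If (Lt (Add (Var 1) (Var 2)) (powt (Add (Var 3) (Num 2)) 20)) OutG
       (If (Eqt (Var 1) (Num 0)) OutNo BruteC)))))"

lemma rep_grow:
  assumes x: "x \<noteq> 0"
  shows "(sem (Grow (Mul (Var 0) (Var x))) ^^ m) (e, \<rho>) = (e(0 := e 0 * (1 + e x) ^ m), \<rho>)"
proof (rule funpow_inv[where P = "\<lambda>i st. st = (e(0 := e 0 * (1 + e x) ^ i), \<rho>)"])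
  fix i st assume "st = (e(0 := e 0 * (1 + e x) ^ i), \<rho>)"
  then show "sem (Grow (Mul (Var 0) (Var x))) st = (e(0 := e 0 * (1 + e x) ^ Suc i), \<rho>)"
    using x by (simp add: algebra_simps)
qed simp

text \<open>Each \<open>Grow\<close> multiplies the budget by \<open>n + 1\<close>. After
  \<open>k * D\<close> rounds it exceeds both the number of candidates and
  \<open>k * D\<close>.\<close>

lemma BruteC:
  assumes e: "e 1 = n" "e 2 = D" "e 3 = k" "E = Em n (\<rho> 0)" and n: "1 \<le> n" "1 \<le> D" "1 \<le> k" "n < e 0"
  shows "fst (sem BruteC (e, \<rho>)) 0 = e 0 * (1 + n) ^ (k * D) \<and>
    (outs (sem BruteC (e, \<rho>)) = [[False], [], []] \<and> solvable n E D k \<or>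
     outs (sem BruteC (e, \<rho>)) = [[False], [], [True]] \<and> \<not> solvable n E D k)"
proof -
  define m where "m = k * D"
  let ?B = "e 0 * (1 + n) ^ m"
  have m: "val e (Mul (Var 3) (Var 2)) = m" using e by (simp add: m_def)
  let ?e1 = "e(0 := ?B)"
  have s1: "(sem (Grow (Mul (Var 0) (Var 1))) ^^ m) (e, \<rho>) = (?e1, \<rho>)"
    using rep_grow[of 1 m e \<rho>] e by simp
  have p1: "1 \<le> (1 + n) ^ m" by simp
  have eB: "e 0 \<le> ?B" using p1 by simp
  have nB: "n < ?B" using eB n(4) by linarith
  let ?e2 = "?e1(4 := n)"
  have s2: "sem (Set 4 (Var 1)) (?e1, \<rho>) = (?e2, \<rho>)" using e nB by (simp add: sem_Set)
  obtain l where l: "sem PowC (?e2, \<rho>) = (?e2, \<rho>(6 := l))" "pow_tab ?e2 (\<rho>(6 := l))"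
    using PowC[of ?e2 \<rho>] n unfolding pow_tab_def by auto
  let ?\<rho>1 = "\<rho>(6 := l)"
  have "(1 + n) ^ m \<le> ?B" using n(4) by simp
  moreover have "n ^ m < (1 + n) ^ m" by (rule power_strict_mono) (use n in \<open>auto simp: m_def\<close>)
  ultimately have nm: "n ^ m < ?B" by linarith
  have "(2::nat) ^ m \<le> (1 + n) ^ m" by (rule power_mono) (use n in auto)
  then have mB: "m < ?B" using less_exp[of m] \<open>(1 + n) ^ m \<le> ?B\<close> by linarith
  have t: "sat ?\<rho>1 ?e2 bruteF \<longleftrightarrow> solvable n E D k"
    by (rule sat_bruteF[OF l(2)]) (use e n nm mB in \<open>auto simp: m_def\<close>)
  have "sem BruteC (e, \<rho>) = (if solvable n E D k then sem OutYes (?e2, ?\<rho>1) else sem OutNo (?e2, ?\<rho>1))"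
    unfolding BruteC_def by (simp only: sem.simps(5,6,7) prod.case m s1 s2 l(1) t)
  then show ?thesis using OutYes[of ?e2 ?\<rho>1] OutNo[of ?e2 ?\<rho>1] by (simp add: m_def)
qed

lemma Kern2:
  assumes e: "e 0 = base_budget n" "e 1 = n" "e 2 = D" "e 3 = k" and D: "1 \<le> D" "D \<le> n" and k: "1 \<le> k"
    and gr: "gr n (Em n (\<rho> 0))" and len: "length (\<rho> 0) = n * n" "length (\<rho> 1) \<le> n" "length (\<rho> 2) \<le> n"
  shows "\<exists>n' E'. gr n' E' \<and>
    (fst (sem Kern2 (e, \<rho>)) 0 = base_budget n * (1 + modb n D) ^ Suc D \<or>
     n' \<le> Gb D * k ^ 18 \<and> (k + 2) ^ 20 \<le> n' + D \<and>
     fst (sem Kern2 (e, \<rho>)) 0 = base_budget n * (1 + modb n D) ^ Suc D * (1 + n') ^ (k * D)) \<and>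
    (outs (sem Kern2 (e, \<rho>)) = [[False], [], []] \<and> solvable n (Em n (\<rho> 0)) D k \<or>
     outs (sem Kern2 (e, \<rho>)) = [[False], [], [True]] \<and> \<not> solvable n (Em n (\<rho> 0)) D k \<or>
     outs (sem Kern2 (e, \<rho>)) = [enc n' E', \<rho> 1, \<rho> 2] \<and>
        (solvable n (Em n (\<rho> 0)) D k \<longleftrightarrow> solvable n' E' D k) \<and> n' + D < (k + 2) ^ 20)"
proof -
  let ?E = "Em n (\<rho> 0)"
  define \<beta> where "\<beta> = modb n D"
  let ?B = "base_budget n * (1 + \<beta>) ^ Suc D"
  note B = base_budget_sq[of n]
  have mB: "\<beta> \<le> base_budget n" unfolding \<beta>_def by (rule modb_base_budget[OF D(2)])
  obtain x l where s1: "sem BaseC (e, \<rho>) = (e(5 := x, 4 := \<beta>), \<rho>(6 := l))"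
    using BaseC[of e \<rho>] e B mB unfolding \<beta>_def by (auto simp: min_def)
  let ?e1 = "e(5 := x, 4 := \<beta>)"
  let ?\<rho>1 = "\<rho>(6 := l)"
  have v: "val ?e1 (Add (Var 2) (Num 1)) = Suc D" using e by simp
  let ?e2 = "?e1(0 := ?B)"
  have s2: "(sem (Grow (Mul (Var 0) (Var 4))) ^^ Suc D) (?e1, ?\<rho>1) = (?e2, ?\<rho>1)"
    using rep_grow[of 4 "Suc D" ?e1 ?\<rho>1] e by simp
  have p1: "1 \<le> (1 + \<beta>) ^ Suc D" by (rule one_le_power) simp
  have BB: "base_budget n \<le> ?B" using p1 by (metis mult.right_neutral mult_le_mono2)
  have "\<beta> ^ Suc D < (1 + \<beta>) ^ Suc D" by (rule power_strict_mono) auto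
  moreover have "1 * (1 + \<beta>) ^ Suc D \<le> ?B" by (rule mult_le_mono1) (use B in simp)
  ultimately have CB: "\<beta> ^ Suc D < ?B" by linarith
  have nn: "n * n < ?B" "n < ?B" "Suc D < ?B" using B D BB by linarith+
  have g: "good ?e2 ?\<rho>1" unfolding good_def using e gr len D k CB nn \<beta>_def by (simp del: power_Suc)
  obtain e' \<rho>' where lp: "sem LoopC (?e2, ?\<rho>1) = (e', \<rho>')" "keeps (?e2(9 := n)) ?\<rho>1 e' \<rho>'" and
     c: "e' 7 = 1 \<and> solvable n ?E D k \<or>
     e' 7 = 0 \<and> good e' \<rho>' \<and> e' 1 \<le> n \<and> e' 1 \<le> Gb D * k ^ 18 \<and>
       (solvable n ?E D k \<longleftrightarrow> solvable (e' 1) (Em (e' 1) (\<rho>' 0)) D k)"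
    using LoopC[OF g, of ?E n D k] e by auto
  have kp: "e' 0 = ?B" "e' 2 = D" "e' 3 = k" "\<rho>' 1 = \<rho> 1" "\<rho>' 2 = \<rho> 2"
    using lp(2) e unfolding keeps_def by auto
  have o: "sem Kern2 (e, \<rho>) = (if e' 7 \<noteq> 0 then sem OutYes (e', \<rho>') else
      if e' 1 + D < (k + 2) ^ 20 then sem OutG (e', \<rho>') else
      if e' 1 = 0 then sem OutNo (e', \<rho>') else sem BruteC (e', \<rho>'))"
  proof -
    have t: "sat \<rho>' e' (Neg (Eqt (Var 7) (Num 0))) \<longleftrightarrow> e' 7 \<noteq> 0"
      "sat \<rho>' e' (Lt (Add (Var 1) (Var 2)) (powt (Add (Var 3) (Num 2)) 20)) \<longleftrightarrow> e' 1 + D < (k + 2) ^ 20"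
      "sat \<rho>' e' (Eqt (Var 1) (Num 0)) \<longleftrightarrow> e' 1 = 0" using kp by simp_all
    show ?thesis unfolding Kern2_def by (simp only: sem.simps(5,6,7) prod.case s1 v s2 lp(1) t)
  qed
  from c show ?thesis
  proof
    assume a: "e' 7 = 1 \<and> solvable n ?E D k"
    then show ?thesis using o OutYes[of e' \<rho>'] kp gr unfolding \<beta>_def
      by (intro exI[of _ n] exI[of _ ?E]) simp
  next
    assume a: "e' 7 = 0 \<and> good e' \<rho>' \<and> e' 1 \<le> n \<and> e' 1 \<le> Gb D * k ^ 18 \<and>
       (solvable n ?E D k \<longleftrightarrow> solvable (e' 1) (Em (e' 1) (\<rho>' 0)) D k)"
    let ?n = "e' 1"
    let ?E' = "Em ?n (\<rho>' 0)"
    have g': "gr ?n ?E'" using a unfolding good_def by blast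
    show ?thesis
    proof (cases "?n + D < (k + 2) ^ 20")
      case True
      then have o': "sem Kern2 (e, \<rho>) = sem OutG (e', \<rho>')" using o a by simp
      have "outs (sem OutG (e', \<rho>')) = [enc ?n ?E', \<rho> 1, \<rho> 2] \<and> fst (sem OutG (e', \<rho>')) 0 = ?B"
        using OutG[of \<rho>' e'] len nn kp by simp
      then show ?thesis unfolding o' using a True g' unfolding \<beta>_def
        by (intro exI[of _ ?n] exI[of _ ?E']) simp
    next
      case False
      show ?thesis
      proof (cases "?n = 0")
        case True
        then have o': "sem Kern2 (e, \<rho>) = sem OutNo (e', \<rho>')" using o a False by simp
        have "\<not> solvable ?n ?E' D k"
        proof
          assume "solvable ?n ?E' D k"
          then obtain \<phi> where "\<phi> ` {..<k * D} \<subseteq> {..<?n}" unfolding solvable_def solution_def by blast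
          moreover have "0 \<in> {..<k * D}" using D k by simp
          ultimately have "\<phi> 0 \<in> {..<?n}" by blast
          then show False using True by simp
        qed
        then show ?thesis unfolding o' using OutNo[of e' \<rho>'] kp a g' unfolding \<beta>_def
          by (intro exI[of _ ?n] exI[of _ ?E']) simp
      next
        case n0: False
        then have o': "sem Kern2 (e, \<rho>) = sem BruteC (e', \<rho>')" using o a False by simp
        have "fst (sem BruteC (e', \<rho>')) 0 = e' 0 * (1 + ?n) ^ (k * D) \<and>
          (outs (sem BruteC (e', \<rho>')) = [[False], [], []] \<and> solvable ?n ?E' D k \<or>
           outs (sem BruteC (e', \<rho>')) = [[False], [], [True]] \<and> \<not> solvable ?n ?E' D k)"
          by (rule BruteC) (use kp n0 D k a nn in auto)
        then show ?thesis unfolding o' using a g' False kp unfolding \<beta>_def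
          by (intro exI[of _ ?n] exI[of _ ?E']) (auto simp: not_less)
      qed
    qed
  qed
qed

subsection \<open>Kernelizations from commands\<close>

definition mat :: "nat \<Rightarrow> (nat \<Rightarrow> nat \<Rightarrow> bool) \<Rightarrow> bool list" where
  "mat n E = map (\<lambda>z. E (z div n) (z mod n)) [0..<n * n]"

lemma length_mat: "length (mat n E) = n * n"
  by (simp add: mat_def)

lemma Em_mat:
  assumes "gr n E" shows "Em n (mat n E) = E"
proof (intro ext)
  fix u v
  have "u * n + v < n * n" if "u < n" "v < n"
  proof -
    have "u * n + v < Suc u * n" using that by simp
    also have "\<dots> \<le> n * n" using that by (intro mult_le_mono1) simp
    finally show ?thesis .
  qed
  moreover have "E u v \<Longrightarrow> u < n \<and> v < n" using assms unfolding gr_def by blast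
  ultimately show "Em n (mat n E) u v = E u v" unfolding Em_def mat_def by auto
qed

text \<open>A prologue moves the unary prefix of the encoded graph to variables 0 and 1 and drops
  the separator. So the budget starts at \<open>n\<close> and relation 0 is the bare matrix, while
  the stacks with \<open>d\<close> and \<open>k\<close> are left untouched. This costs
  \<open>4 * n + 2\<close> steps.\<close>

lemma compile_outputs:
  assumes "wf_cmd c"
  shows "\<exists>p a. \<forall>G d k. let st = sem c (init_e (card (fst G)), init_r (mat (card (fst G)) (adj G)) (bin d) (bin k)) in
     \<exists>t. outputs_in p (encode (G, d, k)) t (outs st) \<and> t \<le> 4 * card (fst G) + 2 + (fst st 0 + 2) ^ a"
proof -
  obtain K0 where K0: "\<And>K. K0 \<le> K \<Longrightarrow> \<exists>p a. cev K c p a" using cev_cmd[OF assms] by blast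
  \<comment> \<open>At least 2, so that the matrix with its \<open>n * n\<close> entries satisfies
    the length invariant.\<close>
  define K where "K = max K0 2"
  obtain p a where p: "cev K c p a" using K0[of K] unfolding K_def by auto
  have "\<exists>t. outputs_in (mv2 0 (vst 0) (vst 1) ;; Pop 0 ;; p) (encode (G, d, k)) t (outs st) \<and>
      t \<le> 4 * card (fst G) + 2 + (fst st 0 + 2) ^ a"
    if st: "st = sem c (init_e (card (fst G)), init_r (mat (card (fst G)) (adj G)) (bin d) (bin k))" for G d k st
  proof -
    define n where "n = card (fst G)"
    define M where "M = mat n (adj G)"
    define s where "s = input_stacks (encode (G, d, k))"
    have s_simp: "s r = (if r = 0 then replicate n True @ False # M else if r = 1 then bin d else if r = 2 then bin k else [])" for r
      unfolding s_def input_stacks_def encode_def encode_graph_enc enc_def M_def mat_def n_def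
      by (auto simp: nth_Cons' less_Suc_eq)
    define s1 where "s1 = s(0 := False # M, vst 0 := replicate n True @ s (vst 0), vst 1 := replicate n True @ s (vst 1))"
    define s2 where "s2 = s1(0 := M)"
    have r1: "run (mv2 0 (vst 0) (vst 1)) s (4 * n + 1) s1" unfolding s1_def
      by (rule run_mv2) (simp_all add: vst_def s_simp)
    have r2: "run (Pop 0) s1 1 s2" by (rule run_weaken[OF run_Pop]) (auto simp: s1_def s2_def vst_def)
    have e: "env_of s2 = init_e n"
      by (auto simp: fun_eq_iff env_of_def s2_def s1_def s_simp vst_def init_e_def lead_simps(4)[of n "[]", simplified])
    have r: "rels_of s2 = init_r M (bin d) (bin k)"
      unfolding fun_eq_iff rels_of_def s2_def s1_def vst_def rst_def init_r_def
      by (auto simp: s_simp; presburger)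
    have "length M = n ^ 2" unfolding M_def mat_def by (simp add: power2_eq_square)
    also have "\<dots> \<le> (n + 2) ^ 2" by (rule power_mono) auto
    also have "\<dots> \<le> (n + 2) ^ K" by (rule power_increasing) (auto simp: K_def)
    finally have "inv_K K (env_of s2) (rels_of s2)" unfolding e r inv_K_def by (simp add: init_e_def init_r_def)
    then have i: "inv_st K s2" unfolding inv_st_def clean_def by (simp add: s2_def s1_def s_simp vst_def)
    obtain s' where s': "run p s2 ((env_of s' 0 + 2) ^ a) s'" "(env_of s', rels_of s') = sem c (env_of s2, rels_of s2)"
      using p i unfolding cev_def by blast
    have st': "st = (env_of s', rels_of s')" unfolding s'(2) e r st n_def M_def ..
    have "run (mv2 0 (vst 0) (vst 1) ;; Pop 0 ;; p) s (4 * n + 1 + (1 + (env_of s' 0 + 2) ^ a)) s'"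
      by (rule run_Seq[OF r1 run_Seq[OF r2 s'(1)]])
    then obtain t where t: "t \<le> 4 * n + 1 + (1 + (env_of s' 0 + 2) ^ a)"
      "exec (mv2 0 (vst 0) (vst 1) ;; Pop 0 ;; p) s t s'" unfolding run_def by blast
    have "s' (length (encode (G, d, k)) + i) = outs st ! i" if "i < length (outs st)" for i
    proof -
      have "i < 3" using that by (simp add: outs_def)
      moreover have "length (encode (G, d, k)) = 3" by (simp add: encode_def)
      ultimately show ?thesis unfolding outs_def st'
        by (auto simp: rels_of_def rst_def less_Suc_eq numeral_3_eq_3 eval_nat_numeral)
    qed
    then have "outputs_in (mv2 0 (vst 0) (vst 1) ;; Pop 0 ;; p) (encode (G, d, k)) t (outs st)"
      unfolding outputs_in_def using t(2) unfolding s_def by blast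
    moreover have "t \<le> 4 * n + 2 + (fst st 0 + 2) ^ a" using t(1) unfolding st' by simp
    ultimately show ?thesis unfolding n_def by blast
  qed
  then show ?thesis unfolding Let_def by blast
qed

lemma kernelization_cmd:
  assumes "wf_cmd c"
    and "\<And>G d k. valid_instance (G, d, k) \<Longrightarrow> \<exists>I. valid_instance I \<and>
      outs (sem c (init_e (card (fst G)), init_r (mat (card (fst G)) (adj G)) (bin d) (bin k))) = encode I \<and>
      (yes_instance I \<longleftrightarrow> yes_instance (G, d, k)) \<and> instance_size I \<le> S d k \<and>
      fst (sem c (init_e (card (fst G)), init_r (mat (card (fst G)) (adj G)) (bin d) (bin k))) 0 \<le> B d (card (fst G))"
  shows "\<exists>p a. kernelization p (\<lambda>d n. 4 * n + 2 + (B d n + 2) ^ a) S"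
proof -
  obtain p a where pa: "\<And>G d k. \<exists>t. outputs_in p (encode (G, d, k)) t
      (outs (sem c (init_e (card (fst G)), init_r (mat (card (fst G)) (adj G)) (bin d) (bin k)))) \<and>
      t \<le> 4 * card (fst G) + 2 + (fst (sem c (init_e (card (fst G)), init_r (mat (card (fst G)) (adj G)) (bin d) (bin k))) 0 + 2) ^ a"
    using compile_outputs[OF assms(1)] unfolding Let_def by blast
  have "kernelization p (\<lambda>d n. 4 * n + 2 + (B d n + 2) ^ a) S" unfolding kernelization_def
  proof (intro allI impI)
    fix G d k assume v: "valid_instance (G, d, k)"
    let ?st = "sem c (init_e (card (fst G)), init_r (mat (card (fst G)) (adj G)) (bin d) (bin k))"
    obtain I where I: "valid_instance I" "outs ?st = encode I" "yes_instance I \<longleftrightarrow> yes_instance (G, d, k)"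
      "instance_size I \<le> S d k" "fst ?st 0 \<le> B d (card (fst G))" using assms(2)[OF v] by blast
    obtain t where t: "outputs_in p (encode (G, d, k)) t (outs ?st)" "t \<le> 4 * card (fst G) + 2 + (fst ?st 0 + 2) ^ a"
      using pa by blast
    have "(fst ?st 0 + 2) ^ a \<le> (B d (card (fst G)) + 2) ^ a" by (rule power_mono) (use I(5) in auto)
    then have "t \<le> 4 * card (fst G) + 2 + (B d (card (fst G)) + 2) ^ a" using t(2) by linarith
    then show "\<exists>I t. valid_instance I \<and> outputs_in p (encode (G, d, k)) t (encode I) \<and>
      t \<le> 4 * card (fst G) + 2 + (B d (card (fst G)) + 2) ^ a \<and>
      (yes_instance I \<longleftrightarrow> yes_instance (G, d, k)) \<and> instance_size I \<le> S d k"
      using I(1,3,4) t(1) unfolding I(2) by blast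
  qed
  then show ?thesis by blast
qed

lemma wf_MainC: "wf_cmd (MainC Kern1)" "wf_cmd (MainC Kern2)"
  by (simp_all add: MainC_def Kern1_def Kern2_def FinC_def BruteC_def OutG_def OutYes_def OutNo_def ReadC_def
    LoopC_def StepK_def DelC_def CodeC_def BaseC_def IrrC_def WalkC_def PackC_def ChainC_def StepC_def ReachC_def
    PowC_def RDef_def Clr_def Set_def)

lemma solvable_card: "solvable n E D k \<Longrightarrow> k * D \<le> n"
proof -
  assume "solvable n E D k"
  then obtain \<phi> where "inj_on \<phi> {..<k * D}" "\<phi> ` {..<k * D} \<subseteq> {..<n}" unfolding solvable_def solution_def by blast
  then have "card {..<k * D} \<le> card {..<n}" by (rule card_inj_on_le) simp
  then show ?thesis by simp
qed

lemma solvable_0: "solvable n E D 0"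
  unfolding solvable_def solution_def links_def by simp

definition outcome :: "nat \<Rightarrow> (nat \<Rightarrow> nat \<Rightarrow> bool) \<Rightarrow> nat \<Rightarrow> nat \<Rightarrow> (nat \<Rightarrow> bool) \<Rightarrow> bool list list \<Rightarrow> bool" where
  "outcome n E d k P ys \<longleftrightarrow> ys = [[False], [], []] \<and> solvable n E (Suc d) k \<or>
     ys = [[False], [], [True]] \<and> \<not> solvable n E (Suc d) k \<or>
     (\<exists>n' E'. ys = [enc n' E', bin d, bin k] \<and> gr n' E' \<and> (solvable n E (Suc d) k \<longleftrightarrow> solvable n' E' (Suc d) k) \<and> P n')"

lemma outcome_instance:
  assumes v: "valid_instance (G, d, k)" and o: "outcome (card (fst G)) (adj G) d k P ys"
    and S: "2 \<le> S" "\<And>n'. P n' \<Longrightarrow> n' + 1 + n' * n' + d + k \<le> S"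
  shows "\<exists>I. valid_instance I \<and> ys = encode I \<and> (yes_instance I \<longleftrightarrow> yes_instance (G, d, k)) \<and> instance_size I \<le> S"
proof -
  let ?n = "card (fst G)"
  let ?E = "adj G"
  have w: "yes_instance (G, d, k) \<longleftrightarrow> solvable ?n ?E (Suc d) k" by (rule yes_instance_iff[OF v])
  have I: "valid_instance (graph_of n' E', d', k') \<and> encode (graph_of n' E', d', k') = [enc n' E', bin d', bin k'] \<and>
      (yes_instance (graph_of n' E', d', k') \<longleftrightarrow> solvable n' E' (Suc d') k') \<and>
      instance_size (graph_of n' E', d', k') \<le> n' + 1 + n' * n' + d' + k'" if g: "gr n' E'" for n' E' d' k'
  proof -
    note gp = graph_of_props[OF g]
    have e: "encode (graph_of n' E', d', k') = [enc n' E', bin d', bin k']"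
      by (simp add: encode_def encode_graph_enc gp)
    have "length (enc n' E') = n' + 1 + n' * n'" by (simp add: enc_def)
    then have "instance_size (graph_of n' E', d', k') \<le> n' + 1 + n' * n' + d' + k'"
      unfolding instance_size_def e using length_bin[of d'] length_bin[of k'] by simp
    then show ?thesis using gp(1) e yes_instance_iff[OF gp(1), of d' k'] unfolding gp(2,3) by blast
  qed
  have g0: "gr 0 (\<lambda>_ _. False)" by (simp add: gr_def)
  have e0: "enc 0 (\<lambda>_ _. False) = [False]" by (simp add: enc_def)
  consider (yes) "ys = [[False], [], []]" "solvable ?n ?E (Suc d) k" | (no) "ys = [[False], [], [True]]" "\<not> solvable ?n ?E (Suc d) k"
    | (graph) n' E' where "ys = [enc n' E', bin d, bin k]" "gr n' E'" "solvable ?n ?E (Suc d) k \<longleftrightarrow> solvable n' E' (Suc d) k" "P n'"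
    using o unfolding outcome_def by blast
  then show ?thesis
  proof cases
    case yes
    then show ?thesis using I[OF g0, of 0 0] S(1) solvable_0 unfolding w e0
      by (intro exI[of _ "(graph_of 0 (\<lambda>_ _. False), 0, 0)"]) auto
  next
    case no
    have "\<not> solvable 0 (\<lambda>_ _. False) (Suc 0) (Suc 0)" using solvable_card[of 0 "\<lambda>_ _. False" "Suc 0" "Suc 0"] by auto
    moreover have "bin (Suc 0) = [True]" by simp
    ultimately show ?thesis using no I[OF g0, of 0 "Suc 0"] S(1) unfolding w e0
      by (intro exI[of _ "(graph_of 0 (\<lambda>_ _. False), 0, Suc 0)"]) auto
  next
    case graph
    then show ?thesis using I[OF graph(2), of d k] S(2)[OF graph(4)] unfolding w
      by (intro exI[of _ "(graph_of n' E', d, k)"]) auto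
  qed
qed

lemma MainC:
  assumes gr: "gr n (Em n M)"
    and c: "\<And>e \<rho>. \<lbrakk>e 0 = base_budget n; e 1 = n; e 2 = Suc d; e 3 = k; 1 \<le> k; d < n; k \<le> n; \<rho> = init_r M (bin d) (bin k);
      length (bin d) \<le> n; length (bin k) \<le> n\<rbrakk> \<Longrightarrow>
      outcome n (Em n M) d k P (outs (sem c (e, \<rho>))) \<and> fst (sem c (e, \<rho>)) 0 \<le> X" and X: "base_budget n \<le> X"
  shows "outcome n (Em n M) d k P (outs (sem (MainC c) (init_e n, init_r M (bin d) (bin k)))) \<and>
    fst (sem (MainC c) (init_e n, init_r M (bin d) (bin k))) 0 \<le> X"
proof (cases "k = 0")
  case True
  then show ?thesis using MainC_yes[of c n M "bin d"] solvable_0 X unfolding outcome_def by auto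
next
  case False
  then have k: "1 \<le> k" by simp
  have no: "\<not> solvable n (Em n M) (Suc d) k" if "n \<le> d \<or> n < k"
  proof
    assume "solvable n (Em n M) (Suc d) k"
    then have "k * Suc d \<le> n" by (rule solvable_card)
    moreover have "k * 1 \<le> k * Suc d" by (rule mult_le_mono2) simp
    moreover have "1 * Suc d \<le> k * Suc d" using k by (rule mult_le_mono1)
    ultimately have "k * 1 \<le> n" "1 * Suc d \<le> n" by (meson le_trans)+
    then show False using that by auto
  qed
  from MainC_other[OF k, of n d c M] show ?thesis
  proof
    assume "(n \<le> d \<or> n < k) \<and> outs (sem (MainC c) (init_e n, init_r M (bin d) (bin k))) = [[False], [], [True]] \<and>
      fst (sem (MainC c) (init_e n, init_r M (bin d) (bin k))) 0 = base_budget n"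
    then show ?thesis using no X unfolding outcome_def by simp
  next
    assume a: "d < n \<and> k \<le> n \<and> length (bin d) \<le> n \<and> length (bin k) \<le> n \<and>
      (\<exists>e. sem (MainC c) (init_e n, init_r M (bin d) (bin k)) = sem c (e, init_r M (bin d) (bin k)) \<and>
      e 0 = base_budget n \<and> e 1 = n \<and> e 2 = Suc d \<and> e 3 = k)"
    then obtain e where e: "sem (MainC c) (init_e n, init_r M (bin d) (bin k)) = sem c (e, init_r M (bin d) (bin k))"
      "e 0 = base_budget n" "e 1 = n" "e 2 = Suc d" "e 3 = k" by blast
    show ?thesis unfolding e(1) by (rule c[OF e(2-5) k _ _ refl]) (use a in auto)
  qed
qed

text \<open>The part of the final budget of \<open>Kern2\<close> that depends on \<open>D\<close>:
  the first two factors come from \<open>(1 + modb n D) ^ Suc D\<close>, the last one from the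
  exhaustive search.\<close>

definition budget_d :: "nat \<Rightarrow> nat" where "budget_d D = 2 ^ Suc D * Gb D * Gb D ^ (19 * (Gb D * Gb D))"

lemma Gb_ge:
  assumes "1 \<le> D" shows "D \<le> Gb D"
proof -
  have "D \<le> D ^ 34" by (rule self_le_power) (use assms in auto)
  moreover have "1 \<le> (5 * D ^ 4) ^ (8 * Suc D)" by (rule one_le_power) (use assms in simp)
  moreover have "1 \<le> (8 * Suc D) ^ (8 * Suc D)" by (rule one_le_power) simp
  ultimately have "1 * (D * (1 * 1)) \<le> (5120 ^ 2 * 4) * (D ^ 34 * ((5 * D ^ 4) ^ (8 * Suc D) * (8 * Suc D) ^ (8 * Suc D)))"
    by (intro mult_le_mono) auto
  also have "\<dots> = Gb D" unfolding Gb_def by (simp only: mult_ac)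
  finally show ?thesis by simp
qed

lemma kernel1:
  "\<exists>p a b. kernelization p (\<lambda>d n. polybound a n) (\<lambda>d k. 5 * (Gb (Suc d) * Gb (Suc d)) * polybound b k)"
proof -
  let ?S = "\<lambda>d k. 5 * (Gb (Suc d) * Gb (Suc d)) * polybound 36 k"
  have "\<exists>p a. kernelization p (\<lambda>d n. 4 * n + 2 + (base_budget n + 2) ^ a) ?S"
  proof (rule kernelization_cmd[OF wf_MainC(1)])
    fix G d k assume v: "valid_instance (G, d, k)"
    let ?n = "card (fst G)"
    let ?M = "mat ?n (adj G)"
    let ?g = "Gb (Suc d)"
    let ?P = "\<lambda>n'. n' \<le> ?g * k ^ 18 \<and> 1 \<le> k"
    note E = Em_mat[OF gr_adj[OF v]]
    have M: "outcome ?n (Em ?n ?M) d k ?P (outs (sem (MainC Kern1) (init_e ?n, init_r ?M (bin d) (bin k)))) \<and>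
      fst (sem (MainC Kern1) (init_e ?n, init_r ?M (bin d) (bin k))) 0 \<le> base_budget ?n"
    proof (rule MainC)
      show "gr ?n (Em ?n ?M)" unfolding E by (rule gr_adj[OF v])
      fix e :: env and \<rho> :: rels assume e: "e 0 = base_budget ?n" "e 1 = ?n" "e 2 = Suc d" "e 3 = k" and k: "1 \<le> k" "d < ?n" "k \<le> ?n"
        and r: "\<rho> = init_r ?M (bin d) (bin k)" and l: "length (bin d) \<le> ?n" "length (bin k) \<le> ?n"
      have r': "\<rho> 0 = ?M" "\<rho> 1 = bin d" "\<rho> 2 = bin k" unfolding r init_r_def by auto
      have "fst (sem Kern1 (e, \<rho>)) 0 = base_budget ?n \<and>
       (outs (sem Kern1 (e, \<rho>)) = [[False], [], []] \<and> solvable ?n (Em ?n (\<rho> 0)) (Suc d) k \<or>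
       (\<exists>n' E'. outs (sem Kern1 (e, \<rho>)) = [enc n' E', \<rho> 1, \<rho> 2] \<and> gr n' E' \<and>
        (solvable ?n (Em ?n (\<rho> 0)) (Suc d) k \<longleftrightarrow> solvable n' E' (Suc d) k) \<and> n' \<le> ?g * k ^ 18))"
        by (rule Kern1[OF e]) (unfold r' E length_mat, (rule k l gr_adj[OF v] refl | use k in simp)+)
      then show "outcome ?n (Em ?n ?M) d k ?P (outs (sem Kern1 (e, \<rho>))) \<and> fst (sem Kern1 (e, \<rho>)) 0 \<le> base_budget ?n"
        unfolding outcome_def r' using k(1) by auto
    qed simp
    have "\<exists>I. valid_instance I \<and> outs (sem (MainC Kern1) (init_e ?n, init_r ?M (bin d) (bin k))) = encode I \<and>
      (yes_instance I \<longleftrightarrow> yes_instance (G, d, k)) \<and> instance_size I \<le> ?S d k"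
    proof (rule outcome_instance[OF v])
      show "outcome ?n (adj G) d k ?P (outs (sem (MainC Kern1) (init_e ?n, init_r ?M (bin d) (bin k))))"
        using M unfolding E by blast
      have g: "Suc d \<le> ?g" by (rule Gb_ge) simp
      then have "1 * 1 \<le> ?g * ?g" by (intro mult_le_mono) auto
      then have "5 * (1 * 1) * 1 \<le> ?S d k" unfolding polybound_def by (intro mult_le_mono one_le_power) auto
      then show "2 \<le> ?S d k" by linarith
      fix n' assume P: "n' \<le> ?g * k ^ 18 \<and> 1 \<le> k"
      \<comment> \<open>Each of the five summands of the size is at most \<open>x * x\<close>. This
        gives the factor 5, the square of \<open>Gb\<close> and the exponent
        \<open>36 = 2 * 18\<close>.\<close>
      define x where "x = ?g * k ^ 18"
      have "?g * 1 \<le> x" unfolding x_def by (rule mult_le_mono2) (use P in simp)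
      then have gx: "?g \<le> x" by simp
      have "k \<le> k ^ 18" by (rule self_le_power) (use P in auto)
      moreover have "1 * k ^ 18 \<le> x" unfolding x_def by (rule mult_le_mono1) (use g in simp)
      ultimately have kx: "k \<le> x" by linarith
      have "1 * x \<le> x * x" by (rule mult_le_mono1) (use gx g in simp)
      moreover have "n' * n' \<le> x * x" using P unfolding x_def by (intro mult_le_mono) auto
      ultimately have "n' + 1 + n' * n' + d + k \<le> 5 * (x * x)" using gx g kx P x_def by linarith
      also have "\<dots> = 5 * (?g * ?g) * k ^ 36"
        unfolding x_def by (simp add: power_mult_distrib flip: power_add)
      also have "\<dots> \<le> ?S d k" unfolding polybound_def by (intro mult_le_mono2 power_mono) auto
      finally show "n' + 1 + n' * n' + d + k \<le> ?S d k" .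
    qed
    then show "\<exists>I. valid_instance I \<and> outs (sem (MainC Kern1) (init_e ?n, init_r ?M (bin d) (bin k))) = encode I \<and>
      (yes_instance I \<longleftrightarrow> yes_instance (G, d, k)) \<and> instance_size I \<le> ?S d k \<and>
      fst (sem (MainC Kern1) (init_e ?n, init_r ?M (bin d) (bin k))) 0 \<le> base_budget ?n" using M by blast
  qed
  then obtain p a where p: "kernelization p (\<lambda>d n. 4 * n + 2 + (base_budget n + 2) ^ a) ?S" by blast
  have "polyb (\<lambda>n. 4 * n + 2 + (base_budget n + 2) ^ a)" unfolding base_budget_def by (intro polyb_intros)
  then obtain c where c: "\<And>n. 4 * n + 2 + (base_budget n + 2) ^ a \<le> polybound c n" unfolding polyb_def polybound_def by blast
  have "kernelization p (\<lambda>d n. polybound c n) ?S"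
    using p c unfolding kernelization_def by (meson order_trans)
  then show ?thesis by blast
qed

definition budget_n :: "nat \<Rightarrow> nat" where "budget_n n = base_budget n * Suc n"

text \<open>If exhaustive search is started, then
  \<open>(k + 2) ^ 20 \<le> n' + D \<le> Gb D * (k + 2) ^ 18\<close>, hence
  \<open>(k + 2) ^ 2 \<le> Gb D\<close>. So \<open>1 + n' \<le> Gb D ^ 19\<close> and
  \<open>k * D \<le> Gb D * Gb D\<close>, and the number of candidates is bounded in
  \<open>D\<close> alone.\<close>

lemma budget2:
  assumes D: "1 \<le> D" "D \<le> n" and k: "1 \<le> k"
    and X: "X = base_budget n * (1 + modb n D) ^ Suc D \<or>
     n' \<le> Gb D * k ^ 18 \<and> (k + 2) ^ 20 \<le> n' + D \<and> X = base_budget n * (1 + modb n D) ^ Suc D * (1 + n') ^ (k * D)"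
  shows "X \<le> budget_n n * budget_d D"
proof -
  let ?g = "Gb D"
  have g: "D \<le> ?g" by (rule Gb_ge[OF D(1)])
  have g1: "1 \<le> ?g" using g D by simp
  let ?b = "modb n D"
  have "1 + ?b \<le> 2 * ?b" unfolding modb_def by simp
  then have "(1 + ?b) ^ Suc D \<le> (2 * ?b) ^ Suc D" by (rule power_mono) simp
  also have "\<dots> = 2 ^ Suc D * ?b ^ Suc D" by (rule power_mult_distrib)
  also have "\<dots> \<le> 2 ^ Suc D * (?g * n)" by (intro mult_le_mono2 modb_Gb) (use D in auto)
  also have "\<dots> \<le> 2 ^ Suc D * (?g * Suc n)" by (intro mult_le_mono2) simp
  finally have 1: "(1 + ?b) ^ Suc D \<le> 2 ^ Suc D * (?g * Suc n)" .
  have 2: "(1 + n') ^ (k * D) \<le> ?g ^ (19 * (?g * ?g))" if n': "n' \<le> ?g * k ^ 18" "(k + 2) ^ 20 \<le> n' + D"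
  proof -
    have "k ^ 18 + 1 \<le> (k + 2) ^ 18"
    proof -
      have "k ^ 18 < (k + 2) ^ 18" by (rule power_strict_mono) auto
      then show ?thesis by simp
    qed
    then have m: "?g * (k ^ 18 + 1) \<le> ?g * (k + 2) ^ 18" by (rule mult_le_mono2)
    have a: "n' + ?g \<le> ?g * (k + 2) ^ 18" using n'(1) m by (simp add: algebra_simps)
    have "0 < (k + 2) ^ 18" by simp
    moreover have "(k + 2) ^ 18 * (k + 2) ^ 2 \<le> (k + 2) ^ 18 * ?g"
    proof -
      have "(k + 2) ^ 18 * (k + 2) ^ 2 = (k + 2) ^ 20" by (simp flip: power_add)
      also have "\<dots> \<le> ?g * (k + 2) ^ 18" using n'(2) a g by linarith
      finally show ?thesis by (simp add: mult.commute)
    qed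
    ultimately have "(k + 2) ^ 2 \<le> ?g" by (rule iffD1[OF nat_mult_le_cancel1])
    moreover have "k + 2 \<le> (k + 2) ^ 2" by (rule self_le_power) auto
    ultimately have kg: "k + 2 \<le> ?g" by linarith
    have "1 + n' \<le> ?g * (k + 2) ^ 18" using a g1 by linarith
    also have "\<dots> \<le> ?g * ?g ^ 18" by (intro mult_le_mono2 power_mono kg) simp
    also have "\<dots> = ?g ^ 19" by (simp flip: power_Suc)
    finally have "(1 + n') ^ (k * D) \<le> (?g ^ 19) ^ (k * D)" by (rule power_mono) simp
    also have "\<dots> \<le> (?g ^ 19) ^ (?g * ?g)"
      by (rule power_increasing) (use kg g g1 in \<open>auto intro: mult_le_mono\<close>)
    also have "\<dots> = ?g ^ (19 * (?g * ?g))" by (simp only: power_mult)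
    finally show ?thesis .
  qed
  have "X \<le> base_budget n * (1 + ?b) ^ Suc D * ?g ^ (19 * (?g * ?g))"
    using X
  proof
    assume X: "X = base_budget n * (1 + ?b) ^ Suc D"
    have "1 \<le> ?g ^ (19 * (?g * ?g))" using g1 by (rule one_le_power)
    then have "base_budget n * (1 + ?b) ^ Suc D * 1 \<le> base_budget n * (1 + ?b) ^ Suc D * ?g ^ (19 * (?g * ?g))" by (rule mult_le_mono2)
    then show ?thesis unfolding X by (simp only: mult_1_right)
  next
    assume a: "n' \<le> Gb D * k ^ 18 \<and> (k + 2) ^ 20 \<le> n' + D \<and> X = base_budget n * (1 + modb n D) ^ Suc D * (1 + n') ^ (k * D)"
    show ?thesis unfolding a[THEN conjunct2, THEN conjunct2] by (intro mult_le_mono2 2) (use a in blast)+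
  qed
  also have "\<dots> \<le> base_budget n * (2 ^ Suc D * (?g * Suc n)) * ?g ^ (19 * (?g * ?g))"
    by (intro mult_le_mono1 mult_le_mono2 1)
  also have "\<dots> = budget_n n * budget_d D" unfolding budget_n_def budget_d_def by (simp only: mult_ac)
  finally show ?thesis .
qed

lemma kernel2:
  "\<exists>p a b c. kernelization p (\<lambda>d n. (budget_d (Suc d) + 2) ^ c * polybound a n) (\<lambda>d k. polybound b k)"
proof -
  let ?S = "\<lambda>d k::nat. polybound 42 k"
  have "\<exists>p a. kernelization p (\<lambda>d n. 4 * n + 2 + (budget_n n * budget_d (Suc d) + 2) ^ a) ?S"
  proof (rule kernelization_cmd[OF wf_MainC(2)])
    fix G d k assume v: "valid_instance (G, d, k)"
    let ?n = "card (fst G)"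
    let ?M = "mat ?n (adj G)"
    let ?P = "\<lambda>n'. n' + Suc d < (k + 2) ^ 20"
    note E = Em_mat[OF gr_adj[OF v]]
    have g: "Suc d \<le> Gb (Suc d)" by (rule Gb_ge) simp
    have M: "outcome ?n (Em ?n ?M) d k ?P (outs (sem (MainC Kern2) (init_e ?n, init_r ?M (bin d) (bin k)))) \<and>
      fst (sem (MainC Kern2) (init_e ?n, init_r ?M (bin d) (bin k))) 0 \<le> budget_n ?n * budget_d (Suc d)"
    proof (rule MainC)
      show "gr ?n (Em ?n ?M)" unfolding E by (rule gr_adj[OF v])
      have "1 * (1 * 1) \<le> 2 ^ Suc (Suc d) * Gb (Suc d) * Gb (Suc d) ^ (19 * (Gb (Suc d) * Gb (Suc d)))"
        unfolding mult.assoc by (intro mult_le_mono one_le_power) (use g in auto)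
      then have "1 \<le> budget_d (Suc d)" unfolding budget_d_def by simp
      then have "base_budget ?n * 1 * 1 \<le> base_budget ?n * Suc ?n * budget_d (Suc d)" by (intro mult_le_mono) auto
      then show "base_budget ?n \<le> budget_n ?n * budget_d (Suc d)" unfolding budget_n_def by (simp only: mult_1_right)
      fix e :: env and \<rho> :: rels assume e: "e 0 = base_budget ?n" "e 1 = ?n" "e 2 = Suc d" "e 3 = k" and k: "1 \<le> k" "d < ?n" "k \<le> ?n"
        and r: "\<rho> = init_r ?M (bin d) (bin k)" and l: "length (bin d) \<le> ?n" "length (bin k) \<le> ?n"
      have r': "\<rho> 0 = ?M" "\<rho> 1 = bin d" "\<rho> 2 = bin k" unfolding r init_r_def by auto
      have "\<exists>n' E'. gr n' E' \<and>
       (fst (sem Kern2 (e, \<rho>)) 0 = base_budget ?n * (1 + modb ?n (Suc d)) ^ Suc (Suc d) \<or>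
        n' \<le> Gb (Suc d) * k ^ 18 \<and> (k + 2) ^ 20 \<le> n' + Suc d \<and>
        fst (sem Kern2 (e, \<rho>)) 0 = base_budget ?n * (1 + modb ?n (Suc d)) ^ Suc (Suc d) * (1 + n') ^ (k * Suc d)) \<and>
       (outs (sem Kern2 (e, \<rho>)) = [[False], [], []] \<and> solvable ?n (Em ?n (\<rho> 0)) (Suc d) k \<or>
        outs (sem Kern2 (e, \<rho>)) = [[False], [], [True]] \<and> \<not> solvable ?n (Em ?n (\<rho> 0)) (Suc d) k \<or>
        outs (sem Kern2 (e, \<rho>)) = [enc n' E', \<rho> 1, \<rho> 2] \<and>
        (solvable ?n (Em ?n (\<rho> 0)) (Suc d) k \<longleftrightarrow> solvable n' E' (Suc d) k) \<and> n' + Suc d < (k + 2) ^ 20)"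
        by (rule Kern2[OF e]) (unfold r' E length_mat, (rule k l gr_adj[OF v] refl | use k in simp)+)
      then obtain n' E' where n': "gr n' E'"
       "fst (sem Kern2 (e, \<rho>)) 0 = base_budget ?n * (1 + modb ?n (Suc d)) ^ Suc (Suc d) \<or>
        n' \<le> Gb (Suc d) * k ^ 18 \<and> (k + 2) ^ 20 \<le> n' + Suc d \<and>
        fst (sem Kern2 (e, \<rho>)) 0 = base_budget ?n * (1 + modb ?n (Suc d)) ^ Suc (Suc d) * (1 + n') ^ (k * Suc d)"
       "outs (sem Kern2 (e, \<rho>)) = [[False], [], []] \<and> solvable ?n (Em ?n (\<rho> 0)) (Suc d) k \<or>
        outs (sem Kern2 (e, \<rho>)) = [[False], [], [True]] \<and> \<not> solvable ?n (Em ?n (\<rho> 0)) (Suc d) k \<or>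
        outs (sem Kern2 (e, \<rho>)) = [enc n' E', \<rho> 1, \<rho> 2] \<and>
        (solvable ?n (Em ?n (\<rho> 0)) (Suc d) k \<longleftrightarrow> solvable n' E' (Suc d) k) \<and> n' + Suc d < (k + 2) ^ 20"
        by (elim exE conjE) (rule that)
      have "fst (sem Kern2 (e, \<rho>)) 0 \<le> budget_n ?n * budget_d (Suc d)"
        by (rule budget2[OF _ _ k(1) n'(2)]) (use k in auto)
      moreover have "outcome ?n (Em ?n ?M) d k ?P (outs (sem Kern2 (e, \<rho>)))"
        using n'(1,3) unfolding outcome_def r' by blast
      ultimately show "outcome ?n (Em ?n ?M) d k ?P (outs (sem Kern2 (e, \<rho>))) \<and>
        fst (sem Kern2 (e, \<rho>)) 0 \<le> budget_n ?n * budget_d (Suc d)" by blast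
    qed
    have "\<exists>I. valid_instance I \<and> outs (sem (MainC Kern2) (init_e ?n, init_r ?M (bin d) (bin k))) = encode I \<and>
      (yes_instance I \<longleftrightarrow> yes_instance (G, d, k)) \<and> instance_size I \<le> ?S d k"
    proof (rule outcome_instance[OF v])
      show "outcome ?n (adj G) d k ?P (outs (sem (MainC Kern2) (init_e ?n, init_r ?M (bin d) (bin k))))"
        using M unfolding E by blast
      have "k + 2 \<le> (k + 2) ^ 42" by (rule self_le_power) auto
      then show "2 \<le> ?S d k" unfolding polybound_def by linarith
      fix n' assume P: "n' + Suc d < (k + 2) ^ 20"
      \<comment> \<open>The size is at most \<open>4 * (y * y)\<close>, and
        \<open>(k + 2) ^ 2\<close> absorbs the factor 4. This gives the exponent
        \<open>42 = 2 * 20 + 2\<close>.\<close>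
      define y where "y = (k + 2) ^ 20"
      have ky: "k + 2 \<le> y" unfolding y_def by (rule self_le_power) auto
      have "1 * y \<le> y * y" by (rule mult_le_mono1) (use ky in simp)
      moreover have "n' * n' \<le> y * y" using P unfolding y_def by (intro mult_le_mono) auto
      ultimately have "n' + 1 + n' * n' + d + k \<le> 4 * (y * y)" using ky P y_def by linarith
      also have "\<dots> \<le> (k + 2) ^ 2 * (y * y)" by (intro mult_le_mono1) (simp add: power2_eq_square)
      also have "\<dots> = (k + 2) ^ 42" unfolding y_def by (simp flip: power_add)
      finally show "n' + 1 + n' * n' + d + k \<le> ?S d k" unfolding polybound_def .
    qed
    then show "\<exists>I. valid_instance I \<and> outs (sem (MainC Kern2) (init_e ?n, init_r ?M (bin d) (bin k))) = encode I \<and>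
      (yes_instance I \<longleftrightarrow> yes_instance (G, d, k)) \<and> instance_size I \<le> ?S d k \<and>
      fst (sem (MainC Kern2) (init_e ?n, init_r ?M (bin d) (bin k))) 0 \<le> budget_n ?n * budget_d (Suc d)" using M by blast
  qed
  then obtain p a where p: "kernelization p (\<lambda>d n. 4 * n + 2 + (budget_n n * budget_d (Suc d) + 2) ^ a) ?S" by blast
  have "polyb (\<lambda>n. 4 * n + 2 + (budget_n n + 1) ^ a)" unfolding budget_n_def base_budget_def by (intro polyb_intros)
  then obtain c where c: "\<And>n. 4 * n + 2 + (budget_n n + 1) ^ a \<le> polybound c n" unfolding polyb_def polybound_def by blast
  have "4 * n + 2 + (budget_n n * budget_d (Suc d) + 2) ^ a \<le> (budget_d (Suc d) + 2) ^ a * polybound c n" for d n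
  proof -
    let ?g = "budget_d (Suc d) + 2"
    have "(budget_n n * budget_d (Suc d) + 2) ^ a \<le> (?g * (budget_n n + 1)) ^ a" by (rule power_mono) (auto simp: algebra_simps)
    also have "\<dots> = ?g ^ a * (budget_n n + 1) ^ a" by (rule power_mult_distrib)
    finally have p: "(budget_n n * budget_d (Suc d) + 2) ^ a \<le> ?g ^ a * (budget_n n + 1) ^ a" .
    have "1 * (4 * n + 2) \<le> ?g ^ a * (4 * n + 2)" by (intro mult_le_mono1 one_le_power) simp
    then have "4 * n + 2 + (budget_n n * budget_d (Suc d) + 2) ^ a \<le> ?g ^ a * (4 * n + 2) + ?g ^ a * (budget_n n + 1) ^ a"
      unfolding mult_1 by (rule add_mono[OF _ p])
    also have "\<dots> = ?g ^ a * (4 * n + 2 + (budget_n n + 1) ^ a)" by (simp only: distrib_left)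
    also have "\<dots> \<le> ?g ^ a * polybound c n" by (intro mult_le_mono2 c)
    finally show ?thesis .
  qed
  then have "kernelization p (\<lambda>d n. (budget_d (Suc d) + 2) ^ a * polybound c n) ?S"
    using p unfolding kernelization_def by (meson order_trans)
  then show ?thesis by blast
qed

subsection \<open>The factor depending on \<open>d\<close>\<close>

text \<open>The factor has to be computable, and it suffices to dominate \<open>Gb\<close> and
  \<open>budget_d\<close>. The widths arise from the length of \<open>bin d\<close> by doubling and
  by adding polynomials, which \<open>Grow\<close> can do with the budget. The result is a power of
  two, so its binary form is a run of \<open>False\<close> closed by \<open>True\<close>.\<close>

definition width1 :: "nat \<Rightarrow> nat" where "width1 d = (length (bin d) + 1) * 2 ^ length (bin d)"
text \<open>\<open>7168 = 28 * 16 * 16\<close>. As \<open>8 * Suc D\<close> is at most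
  \<open>16 * width1 d\<close>, the width is at least \<open>28 * (8 * Suc D) ^ 2\<close>: three
  times the exponent of \<open>Gb_exp\<close>, and one square left for a constant factor.\<close>

definition width2 :: "nat \<Rightarrow> nat" where "width2 d = width1 d + 7168 * (width1 d * width1 d)"
definition width3 :: "nat \<Rightarrow> nat" where "width3 d = width2 d * 2 ^ width2 d"
definition d_factor :: "nat \<Rightarrow> nat \<Rightarrow> nat" where "d_factor a d = 2 ^ (width3 d + a * width3 d)"

lemma le_pow2: "x \<le> (2::nat) ^ x"
  using less_exp[of x] by simp

text \<open>With \<open>Z = 8 * Suc D\<close>, the factors of \<open>Gb D\<close> are at most powers
  of two with exponents \<open>27\<close>, \<open>34 * Z\<close>, \<open>5 * Z ^ 2\<close> and
  \<open>Z ^ 2\<close>. As \<open>Z \<ge> 16\<close>, these sum to at most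
  \<open>9 * Z ^ 2\<close>.\<close>

lemma Gb_exp:
  assumes "1 \<le> D" shows "Gb D \<le> 2 ^ (9 * (8 * Suc D) ^ 2)"
proof -
  define Z where "Z = 8 * Suc D"
  have Z: "8 \<le> Z" "D \<le> Z" unfolding Z_def by simp_all
  have D: "D \<le> 2 ^ Z" using Z(2) le_pow2[of Z] by linarith
  have 1: "D ^ 34 \<le> 2 ^ (34 * Z)"
    using power_mono[OF D, of 34] by (simp add: mult.commute flip: power_mult)
  have "5 * D ^ 4 \<le> Z * Z ^ 4" by (rule mult_le_mono) (use Z in \<open>auto intro: power_mono\<close>)
  also have "\<dots> = Z ^ 5" by (simp flip: power_Suc)
  also have "\<dots> \<le> (2 ^ Z) ^ 5" by (rule power_mono[OF le_pow2]) simp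
  finally have "(5 * D ^ 4) ^ Z \<le> ((2 ^ Z) ^ 5) ^ Z" by (rule power_mono) simp
  also have "\<dots> = 2 ^ (5 * Z ^ 2)" by (simp add: power2_eq_square mult_ac flip: power_mult)
  finally have 2: "(5 * D ^ 4) ^ Z \<le> 2 ^ (5 * Z ^ 2)" .
  have "Z ^ Z \<le> (2 ^ Z) ^ Z" by (rule power_mono[OF le_pow2]) simp
  also have "\<dots> = 2 ^ Z ^ 2" by (simp add: power2_eq_square flip: power_mult)
  finally have 3: "Z ^ Z \<le> 2 ^ Z ^ 2" .
  have "Gb D = (5120 ^ 2 * 4) * (D ^ 34 * ((5 * D ^ 4) ^ Z * Z ^ Z))"
    unfolding Gb_def Z_def by (simp only: mult_ac)
  also have "\<dots> \<le> 2 ^ 27 * (2 ^ (34 * Z) * (2 ^ (5 * Z ^ 2) * 2 ^ Z ^ 2))"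
    by (intro mult_le_mono 1 2 3) simp
  also have "\<dots> = 2 ^ (27 + (34 * Z + (5 * Z ^ 2 + Z ^ 2)))" by (simp only: power_add)
  also have "\<dots> \<le> 2 ^ (9 * Z ^ 2 + 0)"
  proof (rule power_increasing)
    show "27 + (34 * Z + (5 * Z ^ 2 + Z ^ 2)) \<le> 9 * Z ^ 2 + 0"
      using Z_def assms by (cases D) (simp_all add: power2_eq_square algebra_simps)
  qed simp
  finally show ?thesis unfolding Z_def by simp
qed

lemma dominate: "5 * (Gb (Suc d) * Gb (Suc d)) \<le> d_factor a d" "(budget_d (Suc d) + 2) ^ a \<le> d_factor a d"
proof -
  define D where "D = Suc d"
  define g where "g = Gb D"
  have D: "1 \<le> D" unfolding D_def by simp
  have Dg: "D \<le> g" unfolding g_def by (rule Gb_ge[OF D])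
  define L where "L = length (bin d)"
  have "1 * 2 ^ L \<le> width1 d" unfolding width1_def L_def by (intro mult_le_mono1) simp
  then have w1: "D \<le> width1 d" using bin_less[of d] unfolding L_def D_def by simp
  have "Suc D \<le> 2 * width1 d" using w1 D by linarith
  then have "8 * Suc D \<le> 8 * (2 * width1 d)" by (rule mult_le_mono2)
  then have "(8 * Suc D) ^ 2 \<le> (8 * (2 * width1 d)) ^ 2" by (rule power_mono) simp
  then have w2: "28 * (8 * Suc D) ^ 2 \<le> width2 d" unfolding width2_def by (simp add: power2_eq_square)
  have Z: "64 \<le> (8 * Suc D) ^ 2" using power_mono[of 8 "8 * Suc D" 2] by simp
  \<comment> \<open>The constant 23 is made for the exponent that bounds
    \<open>budget_d D + 2\<close> below: \<open>Suc (Suc D + g + g * (19 * (g * g)))\<close>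
    consists of \<open>D\<close>, \<open>g\<close>, two units and 19 times
    \<open>g * (g * g)\<close>, and \<open>D\<close>, \<open>g\<close> and 1 are at most
    \<open>g * (g * g)\<close>.\<close>
  have gg: "23 * (g * (g * g)) \<le> 2 ^ width2 d"
  proof -
    let ?m = "9 * (8 * Suc D) ^ 2"
    have g: "g \<le> 2 ^ ?m" unfolding g_def by (rule Gb_exp[OF D])
    have "23 * (g * (g * g)) \<le> 2 ^ 5 * (2 ^ ?m * (2 ^ ?m * 2 ^ ?m))" by (intro mult_le_mono g) simp
    also have "\<dots> = 2 ^ (5 + (?m + (?m + ?m)))" by (simp only: power_add)
    also have "\<dots> \<le> 2 ^ width2 d" by (rule power_increasing) (use w2 Z in linarith, simp)
    finally show ?thesis .
  qed
  have "1 \<le> width2 d" using w2 Z by linarith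
  then have "1 * 2 ^ width2 d \<le> width3 d" unfolding width3_def by (rule mult_le_mono1)
  then have w3: "23 * (g * (g * g)) \<le> width3 d" using gg by linarith
  have g1: "1 \<le> g" using Dg D by linarith
  have c1: "g \<le> g * (g * g)" using mult_le_mono[OF le_refl mult_le_mono[OF g1 g1], of g] by simp
  have "5 * (g * g) \<le> 2 ^ 3 * (2 ^ g * 2 ^ g)" by (intro mult_le_mono le_pow2) simp
  also have "\<dots> = 2 ^ (3 + (g + g))" by (simp only: power_add)
  also have "\<dots> \<le> 2 ^ (width3 d + a * width3 d)"
    by (rule power_increasing) (use w3 c1 g1 in linarith, simp)
  finally show "5 * (Gb (Suc d) * Gb (Suc d)) \<le> d_factor a d" unfolding d_factor_def g_def D_def .
  have "2 ^ Suc D * g * g ^ (19 * (g * g)) \<le> 2 ^ Suc D * 2 ^ g * (2 ^ g) ^ (19 * (g * g))"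
    by (intro mult_le_mono power_mono le_pow2) simp_all
  also have "\<dots> = 2 ^ (Suc D + g + g * (19 * (g * g)))" by (simp only: power_add power_mult)
  finally have "budget_d D \<le> 2 ^ (Suc D + g + g * (19 * (g * g)))" unfolding budget_d_def g_def .
  moreover have "(2::nat) ^ 1 \<le> 2 ^ (Suc D + g + g * (19 * (g * g)))" by (rule power_increasing) simp_all
  ultimately have "budget_d D + 2 \<le> 2 ^ Suc (Suc D + g + g * (19 * (g * g)))"
    unfolding power_Suc[of _ "Suc D + g + g * (19 * (g * g))"] power_one_right by linarith
  also have "\<dots> \<le> 2 ^ width3 d"
  proof (rule power_increasing)
    have "g * (19 * (g * g)) = 19 * (g * (g * g))" by simp
    then show "Suc (Suc D + g + g * (19 * (g * g))) \<le> width3 d" using w3 c1 g1 Dg by linarith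
  qed simp
  finally have "(budget_d D + 2) ^ a \<le> (2 ^ width3 d) ^ a" by (rule power_mono) simp
  also have "\<dots> = 2 ^ (a * width3 d)" by (simp add: mult.commute flip: power_mult)
  also have "\<dots> \<le> d_factor a d" unfolding d_factor_def by (rule power_increasing) simp_all
  finally show "(budget_d (Suc d) + 2) ^ a \<le> d_factor a d" unfolding D_def .
qed

lemma bin_double: "0 < n \<Longrightarrow> bin (2 * n) = False # bin n"
  by (cases n) simp_all

lemma bin_pow2: "bin (2 ^ B) = replicate B False @ [True]"
proof (induction B)
  case (Suc B)
  have "bin (2 ^ Suc B) = False # bin (2 ^ B)" unfolding power_Suc by (rule bin_double) simp
  then show ?case using Suc by simp
qed simp

definition FaC :: "nat \<Rightarrow> cmd" where
  "FaC a = Sq (Grow (Num 1)) (Sq (Rep (Var 1) (Grow (Var 0))) (Sq (Grow (Mul (Num 7168) (Mul (Var 0) (Var 0))))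
     (Sq (Rep (Var 0) (Grow (Var 0))) (Sq (Grow (Mul (Num a) (Var 0)))
       (Def 3 99 (Add (Var 0) (Num 1)) (Neg (Lt (Var 99) (Var 0))))))))"

lemma rep_double: "(sem (Grow (Var 0)) ^^ m) (e, \<rho>) = (e(0 := e 0 * 2 ^ m), \<rho>)"
proof (rule funpow_inv[where P = "\<lambda>i st. st = (e(0 := e 0 * 2 ^ i), \<rho>)"])
  fix i st assume "st = (e(0 := e 0 * 2 ^ i), \<rho>)"
  moreover have "e 0 * 2 ^ i + e 0 * 2 ^ i = e 0 * 2 ^ Suc i" by simp
  ultimately show "sem (Grow (Var 0)) st = (e(0 := e 0 * 2 ^ Suc i), \<rho>)" by (simp del: power_Suc)
qed simp

lemma FaC:
  "snd (sem (FaC a) (init_e (length (bin d)), \<rho>)) = \<rho>(3 := bin (d_factor a d))"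
proof -
  let ?L = "length (bin d)"
  let ?e = "\<lambda>x. (init_e ?L)(0 := x)"
  have 1: "sem (Grow (Num 1)) (init_e ?L, \<rho>) = (?e (?L + 1), \<rho>)" by (simp add: init_e_def)
  have 2: "(sem (Grow (Var 0)) ^^ val (?e (?L + 1)) (Var 1)) (?e (?L + 1), \<rho>) = (?e (width1 d), \<rho>)"
    unfolding rep_double width1_def by (simp add: init_e_def)
  have 3: "sem (Grow (Mul (Num 7168) (Mul (Var 0) (Var 0)))) (?e (width1 d), \<rho>) = (?e (width2 d), \<rho>)"
    by (simp add: width2_def)
  have 4: "(sem (Grow (Var 0)) ^^ val (?e (width2 d)) (Var 0)) (?e (width2 d), \<rho>) = (?e (width3 d), \<rho>)"
    unfolding rep_double width3_def by simp
  have 5: "sem (Grow (Mul (Num a) (Var 0))) (?e (width3 d), \<rho>) = (?e (width3 d + a * width3 d), \<rho>)" by simp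
  have m: "map (\<lambda>x. \<not> x < B) [0..<B + 1] = replicate B False @ [True]" for B
    by (rule nth_equalityI) (auto simp: nth_append simp del: upt_Suc)
  have "sem (FaC a) (init_e ?L, \<rho>) = (?e (width3 d + a * width3 d), \<rho>(3 := map (\<lambda>x. \<not> x < width3 d + a * width3 d) [0..<(width3 d + a * width3 d) + 1]))"
    unfolding FaC_def by (simp only: sem.simps(5,7) prod.case 1 2 3 4 5) (simp add: fun_eq_iff)
  then show ?thesis unfolding m d_factor_def bin_pow2 by simp
qed

text \<open>\<open>d_factor\<close> depends on its argument only through the length of the binary
  form, so the bits themselves are discarded.\<close>

definition unary :: prog where
  "unary = WhileTop 0 {Some True, Some False} (Pop 0 ;; Push (vst 0) True ;; Push (vst 1) True)"

lemma run_unary: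
  "run unary (input_stacks [xs]) (4 * length xs + 1)
    (\<lambda>r. if r = vst 0 \<or> r = vst 1 then replicate (length xs) True else [])"
proof -
  let ?m = "length xs"
  let ?\<sigma> = "\<lambda>i r. if r = 0 then drop i xs else if r = vst 0 \<or> r = vst 1 then replicate i True else []"
  have "run unary (input_stacks [xs]) (?m * (3 + 1) + 1) (?\<sigma> ?m)" unfolding unary_def
  proof (rule run_While[where \<sigma> = ?\<sigma>])
    fix i assume i: "i < ?m"
    show "top_of (?\<sigma> i 0) \<in> {Some True, Some False}" unfolding top_of_in using i by simp
    show "run (Pop 0 ;; Push (vst 0) True ;; Push (vst 1) True) (?\<sigma> i) 3 (?\<sigma> (Suc i))"
      by (rule run_weaken[OF run_Seq[OF run_Pop run_Seq[OF run_Push run_Push]]])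
        (auto simp: vst_def fun_eq_iff drop_Suc tl_drop)
  qed (auto simp: input_stacks_def vst_def)
  then show ?thesis by (rule run_weaken) (auto simp: fun_eq_iff vst_def)
qed

lemma computable_d_factor: "computable (d_factor a)"
proof -
  have "wf_cmd (FaC a)" by (simp add: FaC_def)
  then obtain K p b where p: "cev K (FaC a) p b" using cev_cmd by blast
  \<comment> \<open>The command leaves its result on stack 3, while with a single input the output
    is read from stack 1. Two moves preserve the order of the bits.\<close>
  have "\<exists>t. outputs_in (unary ;; p ;; mvb 3 9 ;; mvb 9 1) [bin d] t [bin (d_factor a d)]" for d
  proof -
    let ?L = "length (bin d)"
    define s where "s = (\<lambda>r. if r = vst 0 \<or> r = vst 1 then replicate ?L True else [])"
    have e: "env_of s = init_e ?L"
      by (auto simp: fun_eq_iff env_of_def s_def vst_def init_e_def lead_simps(4)[of ?L "[]", simplified])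
    have r: "rels_of s = (\<lambda>_. [])" by (auto simp: fun_eq_iff rels_of_def s_def)
    have "inv_st K s" unfolding inv_st_def clean_def inv_K_def e r by (simp add: s_def vst_def init_e_def)
    then obtain s' where s': "inv_st K s'" "run p s ((env_of s' 0 + 2) ^ b) s'" "(env_of s', rels_of s') = sem (FaC a) (env_of s, rels_of s)"
      using p unfolding cev_def by blast
    have "rels_of s' = (\<lambda>_. [])(3 := bin (d_factor a d))" using FaC[of a d "\<lambda>_. []"] unfolding s'(3)[unfolded e r, symmetric] by simp
    then have "rels_of s' 3 = bin (d_factor a d)" "rels_of s' 1 = []" by simp_all
    then have o: "s' 3 = bin (d_factor a d)" "s' 1 = []" unfolding rels_of_def rst_def by simp_all
    have "s' 9 = []" using s'(1) unfolding inv_st_def clean_def by simp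
    then obtain T U s1 s2 where "run (mvb 3 9) s' T s1" "run (mvb 9 1) s1 U s2" "s2 1 = bin (d_factor a d)"
      using run_mvb[of 3 9 s'] run_mvb[of 9 1 "s'(3 := [], 9 := rev (s' 3) @ s' 9)"] o by fastforce
    moreover have "run unary (input_stacks [bin d]) (4 * ?L + 1) s" unfolding s_def by (rule run_unary)
    ultimately have "run (unary ;; p ;; mvb 3 9 ;; mvb 9 1) (input_stacks [bin d])
        ((4 * ?L + 1) + ((env_of s' 0 + 2) ^ b + (T + U))) s2"
      using s'(2) by (intro run_Seq)
    then show ?thesis unfolding run_def outputs_in_def using \<open>s2 1 = bin (d_factor a d)\<close> by auto
  qed
  then show ?thesis unfolding computable_def by blast
qed

theorem theorem6:
  "\<exists>f :: nat \<Rightarrow> nat. computable f \<and>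
     (\<exists>p a b. kernelization p (\<lambda>d n. polybound a n) (\<lambda>d k. f d * polybound b k)) \<and>
     (\<exists>p a b. kernelization p (\<lambda>d n. f d * polybound a n) (\<lambda>d k. polybound b k))"
proof -
  obtain p1 a1 b1 where 1: "kernelization p1 (\<lambda>d n. polybound a1 n) (\<lambda>d k. 5 * (Gb (Suc d) * Gb (Suc d)) * polybound b1 k)"
    using kernel1 by blast
  obtain p2 a2 b2 c where 2: "kernelization p2 (\<lambda>d n. (budget_d (Suc d) + 2) ^ c * polybound a2 n) (\<lambda>d k. polybound b2 k)"
    using kernel2 by blast
  have "kernelization p1 (\<lambda>d n. polybound a1 n) (\<lambda>d k. d_factor c d * polybound b1 k)"
    using 1 mult_le_mono1[OF dominate(1)] unfolding kernelization_def by (meson order_trans)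
  moreover have "kernelization p2 (\<lambda>d n. d_factor c d * polybound a2 n) (\<lambda>d k. polybound b2 k)"
    using 2 mult_le_mono1[OF dominate(2)] unfolding kernelization_def by (meson order_trans)
  ultimately show ?thesis using computable_d_factor by blast
qed

end
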